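(* Let $X$ be a simply-connected three-dimensional metric Lie group, let $H_0(X)$ be its critical value defined in the context, and suppose that $F\subset X$ is a left translate of a normal $\mathbb{R}^2$ subgroup of $X$, where $F$ has nonnegative constant mean curvature $H_0(X)$. Then: \begin{enumerate} \item If $H_0(X)=0$, then every properly immersed minimal surface in $X$ that is disjoint from $F$ is a left translate of $F$. \item If $H_0(X)>0$ and $H\in[0,H_0(X)]$, then every properly immersed $H$-surface $\mathcal{S}$ in $X$ that lies on the mean convex side of $F$ is a left translate of $F$. In particular, the mean curvature of such an $\mathcal{S}$ is $H_0(X)$. \item If $H_0(X)>0$ and $H\in[H_0(X),\infty)$, then every properly embedded $H$-surface $\mathcal{S}$ in $X$ such that $F$ lies on the mean convex side of $\mathcal{S}$ is a left translate of $F$. In particular, the mean curvature of such an $\mathcal{S}$ is $H_0(X)$. \end{enumerate}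
   Context: A metric Lie group is a Lie group equipped with a left-invariant Riemannian metric. A normal $\mathbb{R}^2$ subgroup of $X$ is a (closed) normal Lie subgroup isomorphic to $(\mathbb{R}^2,+)$; a left translate of a subset $F$ is a set $gF=\{gf: f\in F\}$ with $g\in X$. The mean curvature of a surface is half the trace of its second fundamental form. An $H$-surface is a connected surface (without boundary) of constant mean curvature $H$, oriented so that $H\ge 0$; a minimal surface is a connected surface with mean curvature $0$. $H_0(X)$ denotes the infimum of the mean curvatures $H\ge 0$ of compact immersed constant mean curvature surfaces in $X$. (Any normal $\mathbb{R}^2$ subgroup of $X$, hence any left translate of it, is known to have constant mean curvature $H_0(X)$.) If a properly embedded connected surface $S$ in $X$ has positive constant mean curvature, it separates $X$ into two components, and its mean convex side is the component of $X-S$ into which the mean curvature vector of $S$ points. *)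

theory Defs
  imports "HOL-Analysis.Analysis" "HOL-Algebra.Coset"
begin

section \<open>Smooth functions\<close>

text \<open>Only meaningful on open sets. Continuity of all iterated directional derivatives is the usual
  notion of class \<open>C\<^sup>k\<close> in finite dimension.\<close>

primrec Ck_on ::
    "nat \<Rightarrow> 'a::euclidean_space set \<Rightarrow> ('a \<Rightarrow> 'b::euclidean_space) \<Rightarrow> bool" where
  "Ck_on 0 S = (\<lambda>f. continuous_on S f)"
| "Ck_on (Suc k) S = (\<lambda>f. (\<forall>x\<in>S. f differentiable (at x)) \<and>
      (\<forall>v. Ck_on k S (\<lambda>x. frechet_derivative f (at x) v)))"

definition smooth_on ::
    "'a::euclidean_space set \<Rightarrow> ('a \<Rightarrow> 'b::euclidean_space) \<Rightarrow> bool" where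
  "smooth_on S f \<longleftrightarrow> (\<forall>k. Ck_on k S f)"


section \<open>Smooth manifolds without boundary\<close>

text \<open>A chart is a domain together with a coordinate map; the coordinate map is only relevant on the
  domain. The atlas of a manifold need not be maximal.\<close>

type_synonym ('a, 'n) chart = "'a set \<times> ('a \<Rightarrow> real ^ 'n)"

record ('a, 'n::finite) manifold =
  pts :: "'a topology"
  charts :: "('a, 'n) chart set"

definition chart_inv :: "('a, 'n::finite) chart \<Rightarrow> real ^ 'n \<Rightarrow> 'a" where
  "chart_inv c = inv_into (fst c) (snd c)"

definition local_rep ::
    "('a, 'm::finite) chart \<Rightarrow> ('b, 'n::finite) chart \<Rightarrow> ('a \<Rightarrow> 'b) \<Rightarrow> real ^ 'm \<Rightarrow> real ^ 'n" where
  "local_rep c d f = (\<lambda>u. snd d (f (chart_inv c u)))"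

definition smooth_manifold :: "('a, 'n::finite) manifold \<Rightarrow> bool" where
  "smooth_manifold M \<longleftrightarrow>
     Hausdorff_space (pts M) \<and> second_countable (pts M) \<and>
     \<Union> (fst ` charts M) = topspace (pts M) \<and>
     (\<forall>c\<in>charts M. openin (pts M) (fst c) \<and> open (snd c ` fst c) \<and>
        homeomorphic_map (subtopology (pts M) (fst c)) (top_of_set (snd c ` fst c)) (snd c)) \<and>
     (\<forall>c\<in>charts M. \<forall>d\<in>charts M. smooth_on (snd c ` (fst c \<inter> fst d)) (local_rep c d id))"

definition smooth_map ::
    "('a, 'm::finite) manifold \<Rightarrow> ('b, 'n::finite) manifold \<Rightarrow> ('a \<Rightarrow> 'b) \<Rightarrow> bool" where
  "smooth_map M N f \<longleftrightarrow> continuous_map (pts M) (pts N) f \<and>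
     (\<forall>c\<in>charts M. \<forall>d\<in>charts N.
        smooth_on (snd c ` {p \<in> fst c. f p \<in> fst d}) (local_rep c d f))"

definition immersion ::
    "('a, 'm::finite) manifold \<Rightarrow> ('b, 'n::finite) manifold \<Rightarrow> ('a \<Rightarrow> 'b) \<Rightarrow> bool" where
  "immersion M N f \<longleftrightarrow> smooth_map M N f \<and>
     (\<forall>c\<in>charts M. \<forall>d\<in>charts N. \<forall>p\<in>fst c. f p \<in> fst d \<longrightarrow>
        inj (frechet_derivative (local_rep c d f) (at (snd c p))))"

definition euclidean_manifold :: "(real ^ 'n, 'n::finite) manifold" where
  "euclidean_manifold = \<lparr>pts = euclidean, charts = {(UNIV, id)}\<rparr>"

text \<open>As for the library's \<^const>\<open>simply_connected\<close>, any two loops are freely homotopic (constant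
  loops included), for abstract topologies.\<close>

definition simply_connected_space :: "'a topology \<Rightarrow> bool" where
  "simply_connected_space T \<longleftrightarrow>
     (\<forall>p q. pathin T p \<and> p 1 = p 0 \<and> pathin T q \<and> q 1 = q 0 \<longrightarrow>
        homotopic_with (\<lambda>r. r 1 = r 0) (top_of_set {0..1::real}) T p q)"


section \<open>Metric Lie groups\<close>

text \<open>A metric tensor is given by its components: \<open>metric X d x\<close> is the Gram matrix of the coordinate
  vector fields of the chart \<open>d\<close> at the point with coordinates \<open>x\<close>.\<close>

record ('a, 'n::finite) metric_group = "'a monoid" +
  mfd :: "('a, 'n) manifold"
  metric :: "('a, 'n) chart \<Rightarrow> real ^ 'n \<Rightarrow> real ^ 'n ^ 'n"

definition lie_group :: "('a, 'n::finite) metric_group \<Rightarrow> bool" where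
  "lie_group X \<longleftrightarrow> group X \<and> smooth_manifold (mfd X) \<and> carrier X = topspace (pts (mfd X)) \<and>
     continuous_map (prod_topology (pts (mfd X)) (pts (mfd X))) (pts (mfd X)) (\<lambda>(a, b). a \<otimes>\<^bsub>X\<^esub> b) \<and>
     (\<forall>c\<in>charts (mfd X). \<forall>d\<in>charts (mfd X). \<forall>e\<in>charts (mfd X).
        smooth_on {(snd c a, snd d b) | a b. a \<in> fst c \<and> b \<in> fst d \<and> a \<otimes>\<^bsub>X\<^esub> b \<in> fst e}
          (\<lambda>(x, y). snd e (chart_inv c x \<otimes>\<^bsub>X\<^esub> chart_inv d y))) \<and>
     smooth_map (mfd X) (mfd X) (\<lambda>a. inv\<^bsub>X\<^esub> a)"

text \<open>\<open>f\<close> pulls the metric back to itself; for \<open>f = id\<close> this is the transformation law of a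
  covariant 2-tensor.\<close>

definition preserves_metric :: "('a, 'n::finite) metric_group \<Rightarrow> ('a \<Rightarrow> 'a) \<Rightarrow> bool" where
  "preserves_metric X f \<longleftrightarrow>
     (\<forall>c\<in>charts (mfd X). \<forall>d\<in>charts (mfd X). \<forall>p\<in>fst c. f p \<in> fst d \<longrightarrow>
        (let D = frechet_derivative (local_rep c d f) (at (snd c p)) in
         \<forall>v w. D v \<bullet> (metric X d (snd d (f p)) *v D w) = v \<bullet> (metric X c (snd c p) *v w)))"

definition riemannian_metric :: "('a, 'n::finite) metric_group \<Rightarrow> bool" where
  "riemannian_metric X \<longleftrightarrow>
     (\<forall>d\<in>charts (mfd X). smooth_on (snd d ` fst d) (metric X d) \<and>
        (\<forall>x\<in>snd d ` fst d. transpose (metric X d x) = metric X d x \<and>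
           (\<forall>v. v \<noteq> 0 \<longrightarrow> 0 < v \<bullet> (metric X d x *v v)))) \<and>
     preserves_metric X id"

definition metric_lie_group :: "('a, 'n::finite) metric_group \<Rightarrow> bool" where
  "metric_lie_group X \<longleftrightarrow> lie_group X \<and> riemannian_metric X \<and>
     (\<forall>a\<in>carrier X. preserves_metric X (\<lambda>b. a \<otimes>\<^bsub>X\<^esub> b))"

text \<open>The isomorphism with \<open>(\<real>\<^sup>2, +)\<close> is one of Lie groups.\<close>

definition normal_R2_subgroup :: "('a, 3) metric_group \<Rightarrow> 'a set \<Rightarrow> bool" where
  "normal_R2_subgroup X N \<longleftrightarrow> N \<lhd> X \<and> closedin (pts (mfd X)) N \<and>
     (\<exists>\<phi> :: real ^ 2 \<Rightarrow> 'a. range \<phi> = N \<and> (\<forall>u v. \<phi> (u + v) = \<phi> u \<otimes>\<^bsub>X\<^esub> \<phi> v) \<and>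
        immersion euclidean_manifold (mfd X) \<phi> \<and> embedding_map euclidean (pts (mfd X)) \<phi>)"


section \<open>Mean curvature in coordinates\<close>

text \<open>In this section \<open>g\<close> is a metric on an open set of \<open>\<real>\<^sup>3\<close> and \<open>F\<close> a parametrized surface in it.\<close>

definition pderiv_at ::
    "'n::finite \<Rightarrow> (real ^ 'n \<Rightarrow> 'b::real_normed_vector) \<Rightarrow> real ^ 'n \<Rightarrow> 'b" where
  "pderiv_at i h x = frechet_derivative h (at x) (axis i 1)"

definition christoffel ::
    "(real ^ 'n \<Rightarrow> real ^ 'n ^ 'n) \<Rightarrow> real ^ 'n \<Rightarrow> 'n::finite \<Rightarrow> 'n \<Rightarrow> 'n \<Rightarrow> real" where
  "christoffel g x k i j = (1 / 2) * (\<Sum>l\<in>UNIV. matrix_inv (g x) $ k $ l *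
     (pderiv_at i (\<lambda>y. g y $ j $ l) x + pderiv_at j (\<lambda>y. g y $ i $ l) x
      - pderiv_at l (\<lambda>y. g y $ i $ j) x))"

text \<open>The ambient covariant derivative of the coordinate field \<open>\<partial>\<^sub>b F\<close> in the direction
  \<open>\<partial>\<^sub>a F\<close>.\<close>

definition cov_deriv ::
    "(real ^ 3 \<Rightarrow> real ^ 3 ^ 3) \<Rightarrow> (real ^ 2 \<Rightarrow> real ^ 3) \<Rightarrow> real ^ 2 \<Rightarrow> 2 \<Rightarrow> 2 \<Rightarrow> real ^ 3" where
  "cov_deriv g F u a b = pderiv_at a (pderiv_at b F) u +
     (\<chi> k. \<Sum>i\<in>UNIV. \<Sum>j\<in>UNIV.
        christoffel g (F u) k i j * (pderiv_at a F u $ i) * (pderiv_at b F u $ j))"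

definition first_form ::
    "(real ^ 3 \<Rightarrow> real ^ 3 ^ 3) \<Rightarrow> (real ^ 2 \<Rightarrow> real ^ 3) \<Rightarrow> real ^ 2 \<Rightarrow> real ^ 2 ^ 2" where
  "first_form g F u = (\<chi> a b. pderiv_at a F u \<bullet> (g (F u) *v pderiv_at b F u))"

definition second_form ::
    "(real ^ 3 \<Rightarrow> real ^ 3 ^ 3) \<Rightarrow> (real ^ 2 \<Rightarrow> real ^ 3) \<Rightarrow> real ^ 2 \<Rightarrow> real ^ 3 \<Rightarrow> real ^ 2 ^ 2"
  where
  "second_form g F u \<nu> = (\<chi> a b. cov_deriv g F u a b \<bullet> (g (F u) *v \<nu>))"

definition unit_normal ::
    "(real ^ 3 \<Rightarrow> real ^ 3 ^ 3) \<Rightarrow> (real ^ 2 \<Rightarrow> real ^ 3) \<Rightarrow> real ^ 2 \<Rightarrow> real ^ 3 \<Rightarrow> bool" where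
  "unit_normal g F u \<nu> \<longleftrightarrow>
     \<nu> \<bullet> (g (F u) *v \<nu>) = 1 \<and> (\<forall>a. pderiv_at a F u \<bullet> (g (F u) *v \<nu>) = 0)"

text \<open>The trace is taken with respect to the first fundamental form.\<close>

definition mean_curvature ::
    "(real ^ 3 \<Rightarrow> real ^ 3 ^ 3) \<Rightarrow> (real ^ 2 \<Rightarrow> real ^ 3) \<Rightarrow> real ^ 2 \<Rightarrow> real ^ 3 \<Rightarrow> real" where
  "mean_curvature g F u \<nu> = trace (matrix_inv (first_form g F u) ** second_form g F u \<nu>) / 2"


section \<open>Immersed surfaces in a metric Lie group\<close>

text \<open>A surface in \<open>X\<close> is a 2-manifold \<open>S\<close> together with an immersion \<open>f\<close> of it.\<close>

definition connected_immersed_surface ::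
    "('a, 3) metric_group \<Rightarrow> ('s, 2) manifold \<Rightarrow> ('s \<Rightarrow> 'a) \<Rightarrow> bool" where
  "connected_immersed_surface X S f \<longleftrightarrow> smooth_manifold S \<and> connected_space (pts S) \<and>
     topspace (pts S) \<noteq> {} \<and> immersion S (mfd X) f"

text \<open>\<open>\<nu>\<close> consists of the components, in the chart \<open>d\<close> of \<open>X\<close>, of a unit normal of \<open>f\<close> at \<open>p\<close>.\<close>

definition unit_normal_at ::
    "('a, 3) metric_group \<Rightarrow> ('s \<Rightarrow> 'a) \<Rightarrow> ('s, 2) chart \<Rightarrow> ('a, 3) chart \<Rightarrow> 's \<Rightarrow> real ^ 3 \<Rightarrow> bool" where
  "unit_normal_at X f c d p \<nu> \<longleftrightarrow> unit_normal (metric X d) (local_rep c d f) (snd c p) \<nu>"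

definition mean_curvature_at ::
    "('a, 3) metric_group \<Rightarrow> ('s \<Rightarrow> 'a) \<Rightarrow> ('s, 2) chart \<Rightarrow> ('a, 3) chart \<Rightarrow> 's \<Rightarrow> real ^ 3 \<Rightarrow> real" where
  "mean_curvature_at X f c d p \<nu> = mean_curvature (metric X d) (local_rep c d f) (snd c p) \<nu>"

text \<open>An orientation of the surface: a continuous unit normal field along \<open>f\<close>, where \<open>N p d\<close> are its
  components at \<open>p\<close> in the chart \<open>d\<close> of \<open>X\<close>.\<close>

definition unit_normal_field ::
    "('a, 3) metric_group \<Rightarrow> ('s, 2) manifold \<Rightarrow> ('s \<Rightarrow> 'a) \<Rightarrow> ('s \<Rightarrow> ('a, 3) chart \<Rightarrow> real ^ 3) \<Rightarrow> bool"
  where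
  "unit_normal_field X S f N \<longleftrightarrow>
     (\<forall>c\<in>charts S. \<forall>d\<in>charts (mfd X). \<forall>p\<in>fst c. f p \<in> fst d \<longrightarrow> unit_normal_at X f c d p (N p d)) \<and>
     (\<forall>d\<in>charts (mfd X). \<forall>e\<in>charts (mfd X). \<forall>p\<in>topspace (pts S). f p \<in> fst d \<inter> fst e \<longrightarrow>
        N p e = frechet_derivative (local_rep d e id) (at (snd d (f p))) (N p d)) \<and>
     (\<forall>d\<in>charts (mfd X).
        continuous_map (subtopology (pts S) {p. f p \<in> fst d}) euclidean (\<lambda>p. N p d))"

definition minimal_surface ::
    "('a, 3) metric_group \<Rightarrow> ('s, 2) manifold \<Rightarrow> ('s \<Rightarrow> 'a) \<Rightarrow> bool" where
  "minimal_surface X S f \<longleftrightarrow> connected_immersed_surface X S f \<and>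
     (\<forall>c\<in>charts S. \<forall>d\<in>charts (mfd X). \<forall>p\<in>fst c. f p \<in> fst d \<longrightarrow>
        (\<forall>\<nu>. unit_normal_at X f c d p \<nu> \<longrightarrow> mean_curvature_at X f c d p \<nu> = 0))"

text \<open>The first disjunct admits non-orientable minimal surfaces as 0-surfaces: the condition
  \<open>H = 0\<close> does not depend on an orientation.\<close>

definition H_surface ::
    "('a, 3) metric_group \<Rightarrow> ('s, 2) manifold \<Rightarrow> ('s \<Rightarrow> 'a) \<Rightarrow> real \<Rightarrow> bool" where
  "H_surface X S f H \<longleftrightarrow>
     H = 0 \<and> minimal_surface X S f \<or>
     0 \<le> H \<and> connected_immersed_surface X S f \<and>
     (\<exists>N. unit_normal_field X S f N \<and>
        (\<forall>c\<in>charts S. \<forall>d\<in>charts (mfd X). \<forall>p\<in>fst c. f p \<in> fst d \<longrightarrow>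
           mean_curvature_at X f c d p (N p d) = H))"

text \<open>Second countable Hausdorff surfaces have at most the cardinality of the continuum, so taking
  the points of the compact surfaces from \<^typ>\<open>real\<close> (with an arbitrary topology) loses nothing.\<close>

definition critical_value :: "('a, 3) metric_group \<Rightarrow> real" where
  "critical_value X = Inf {H. \<exists>(S :: (real, 2) manifold) f. compact_space (pts S) \<and> H_surface X S f H}"

definition properly_immersed ::
    "('a, 3) metric_group \<Rightarrow> ('s, 2) manifold \<Rightarrow> ('s \<Rightarrow> 'a) \<Rightarrow> bool" where
  "properly_immersed X S f \<longleftrightarrow> immersion S (mfd X) f \<and> proper_map (pts S) (pts (mfd X)) f"

definition properly_embedded ::
    "('a, 3) metric_group \<Rightarrow> ('s, 2) manifold \<Rightarrow> ('s \<Rightarrow> 'a) \<Rightarrow> bool" where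
  "properly_embedded X S f \<longleftrightarrow> properly_immersed X S f \<and> embedding_map (pts S) (pts (mfd X)) f"

text \<open>The mean curvature vector at \<open>p\<close> is the mean curvature with respect to \<open>\<nu>\<close> times \<open>\<nu>\<close>, for
  either unit normal \<open>\<nu>\<close>; it points into \<open>C\<close> if the coordinate segment from \<open>f p\<close> in its direction
  starts in \<open>C\<close>.\<close>

definition mean_convex_side ::
    "('a, 3) metric_group \<Rightarrow> ('s, 2) manifold \<Rightarrow> ('s \<Rightarrow> 'a) \<Rightarrow> 'a set \<Rightarrow> bool" where
  "mean_convex_side X S f C \<longleftrightarrow>
     C \<in> connected_components_of
           (subtopology (pts (mfd X)) (topspace (pts (mfd X)) - f ` topspace (pts S))) \<and>
     (\<forall>c\<in>charts S. \<forall>d\<in>charts (mfd X). \<forall>p\<in>fst c. f p \<in> fst d \<longrightarrow>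
        (\<forall>\<nu>. unit_normal_at X f c d p \<nu> \<longrightarrow>
           (\<forall>\<^sub>F t in at_right 0.
              chart_inv d (snd d (f p) + (t * mean_curvature_at X f c d p \<nu>) *\<^sub>R \<nu>) \<in> C)))"

text \<open>Injectivity says that the immersion does not cover the translate several times.\<close>

definition is_left_translate_of ::
    "('a, 3) metric_group \<Rightarrow> ('s, 2) manifold \<Rightarrow> ('s \<Rightarrow> 'a) \<Rightarrow> 'a set \<Rightarrow> bool" where
  "is_left_translate_of X S f F \<longleftrightarrow>
     inj_on f (topspace (pts S)) \<and> (\<exists>a\<in>carrier X. f ` topspace (pts S) = a <#\<^bsub>X\<^esub> F)"

end

theory Submission
 imports Defs
begin

text \<open>Let \<open>\<phi> : \<real>\<^sup>2 \<rightarrow> N\<close> be the isomorphism onto the normal subgroup, made orthonormal at the identity, and \<open>c\<close> a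
 one-parameter subgroup leaving \<open>N\<close> orthogonally. In the coordinates \<open>(x, z) \<mapsto> a \<phi>(x) c(z)\<close> the metric is
 \<open>|L z u|\<^sup>2 + w\<^sup>2\<close> on the vector \<open>(u, w)\<close>, where \<open>L z\<close> is conjugation by \<open>c(z)\<close>, a linear flow \<open>L' = A L\<close>; the planes \<open>z = const\<close> are
 the left translates of \<open>N\<close>, all of mean curvature \<open>|tr A| / 2\<close>.

 Half-space theorem: a surface which comes close to a plane without meeting it, and which has at most the
 mean curvature of the planes wherever it is seen from the plane, is itself a plane. Since \<open>|L z x|\<close> is
 comparable to \<open>|x|\<close> for small \<open>z\<close>, functions \<open>z - K z\<^sup>2 / 2 + h(|L z (x - x\<^sub>1)|\<^sup>2)\<close> have no minimum on the surface
 as long as \<open>h\<close> is increasing and concave enough. A logarithmic \<open>h\<close> shows that the height attains its minimum, and Hopf's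
 exponential \<open>h\<close> that the surface is a plane near each point of minimal height. A proper surface inside a plane
 is a covering of it, hence equal to it. The thickness of the slab is uniform by homogeneity, so that one can march from
 plane to plane until the surface is met. In the last part the sign of the mean curvature at the points seen from a
 plane follows because a properly embedded surface separates the simply connected group.\<close>

section \<open>Calculus of class \<open>C\<^sup>k\<close>\<close>

abbreviation "fder f x \<equiv> frechet_derivative f (at x)"

lemma frechet_derivative_eqI: "(f has_derivative f') (at x) \<Longrightarrow> fder f x = f'" by (metis frechet_derivative_at)

lemma Ck_on_imp_continuous_on: "Ck_on k S f \<Longrightarrow> continuous_on S f"
 by (cases k) (auto simp: continuous_at_imp_continuous_on differentiable_imp_continuous_within)

lemma Ck_on_Suc_imp: "Ck_on (Suc k) S f \<Longrightarrow> Ck_on k S f"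
proof (induction k arbitrary: f)
 case 0 thus ?case using Ck_on_imp_continuous_on[of "Suc 0" S f] by simp
next
 case (Suc k) thus ?case by simp
qed

lemma Ck_on_mono: "Ck_on k S f \<Longrightarrow> j \<le> k \<Longrightarrow> Ck_on j S f"
proof (induction k)
 case (Suc k)
 thus ?case using Ck_on_Suc_imp[of k S f] by (cases "j = Suc k") auto
qed simp

lemma Ck_on_subset: "Ck_on k S f \<Longrightarrow> T \<subseteq> S \<Longrightarrow> Ck_on k T f" by (induction k arbitrary: f) (auto intro: continuous_on_subset)

lemma Ck_on_cong_open:
 assumes "open S" "\<And>x. x \<in> S \<Longrightarrow> f x = g x" shows "Ck_on k S f \<longleftrightarrow> Ck_on k S g" using assms(2)
proof (induction k arbitrary: f g)
 case 0 thus ?case by (auto cong: continuous_on_cong)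
next
 case (Suc k)
 have eq: "(f has_derivative D) (at x) \<longleftrightarrow> (g has_derivative D) (at x)" if "x \<in> S" for x D
  using assms(1) that Suc.prems has_derivative_transform_within_open[of f D x UNIV S g]
   has_derivative_transform_within_open[of g D x UNIV S f] by auto
 hence "fder f x = fder g x" if "x \<in> S" for x using that by (simp add: frechet_derivative_def)
 thus ?case using eq Suc.IH[of "\<lambda>x. fder f x v" "\<lambda>x. fder g x v" for v] by (simp add: differentiable_def)
qed

lemma Ck_on_open_Union: "(\<And>x. x \<in> S \<Longrightarrow> \<exists>T. x \<in> T \<and> open T \<and> Ck_on k T f) \<Longrightarrow> Ck_on k S f"
proof (induction k arbitrary: f)
 case 0
 have "continuous (at x) f" if "x \<in> S" for x using 0[OF that] continuous_on_eq_continuous_at by auto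
 thus ?case by (simp add: continuous_at_imp_continuous_on)
next
 case (Suc k)
 have "f differentiable (at x)" if "x \<in> S" for x using Suc.prems[OF that] by auto
 moreover have "Ck_on k S (\<lambda>x. fder f x v)" for v by (rule Suc.IH) (use Suc.prems in fastforce)
 ultimately show ?case by simp
qed

lemma Ck_on_Suc_has_derivative:
 assumes "open S" "\<And>x. x \<in> S \<Longrightarrow> (f has_derivative f' x) (at x)" "\<And>v. Ck_on k S (\<lambda>x. f' x v)"
 shows "Ck_on (Suc k) S f"
proof -
 have "Ck_on k S (\<lambda>x. fder f x v)" for v using Ck_on_cong_open[OF assms(1), of "\<lambda>x. fder f x v" "\<lambda>x. f' x v" k] assms(2,3)
  by (metis frechet_derivative_eqI)
 thus ?thesis using assms by (auto simp: differentiable_def)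
qed

lemma Ck_on_SucD:
 assumes "Ck_on (Suc k) S f" "x \<in> S"
 shows "(f has_derivative fder f x) (at x)" using assms by (simp add: frechet_derivative_works)

lemma Ck_on_const [simp]: "open S \<Longrightarrow> Ck_on k S (\<lambda>x. c)"
proof (induction k arbitrary: c)
 case (Suc k) thus ?case by (intro Ck_on_Suc_has_derivative[where f' = "\<lambda>_ _. 0"]) auto
qed simp

lemma Ck_on_add:
 assumes "open S" shows "Ck_on k S f \<Longrightarrow> Ck_on k S g \<Longrightarrow> Ck_on k S (\<lambda>x. f x + g x)"
proof (induction k arbitrary: f g)
 case 0 thus ?case by (auto intro: continuous_intros)
next
 case (Suc k)
 have "\<And>x. x \<in> S \<Longrightarrow> ((\<lambda>x. f x + g x) has_derivative
   (\<lambda>v. fder f x v + fder g x v)) (at x)" using Ck_on_SucD Suc.prems by (blast intro: has_derivative_add)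
 with Suc show ?case by (intro Ck_on_Suc_has_derivative[OF assms]) auto
qed

lemma Ck_on_sum:
 assumes "open S" shows "(\<And>i. i \<in> I \<Longrightarrow> Ck_on k S (f i)) \<Longrightarrow> Ck_on k S (\<lambda>x. \<Sum>i\<in>I. f i x)"
 using assms by (induction I rule: infinite_finite_induct) (auto intro: Ck_on_add)

lemma Ck_on_bilinear:
 assumes "open S" "bounded_bilinear bil"
 shows "Ck_on k S f \<Longrightarrow> Ck_on k S g \<Longrightarrow> Ck_on k S (\<lambda>x. bil (f x) (g x))"
proof (induction k arbitrary: f g)
 case 0 thus ?case using bounded_bilinear.continuous_on[OF assms(2)] by auto
next
 case (Suc k)
 have "((\<lambda>x. bil (f x) (g x)) has_derivative
   (\<lambda>v. bil (f x) (fder g x v) + bil (fder f x v) (g x))) (at x)"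
  if "x \<in> S" for x
  using bounded_bilinear.FDERIV[OF assms(2) Ck_on_SucD[OF Suc.prems(1) that] Ck_on_SucD[OF Suc.prems(2) that]] .
 thus ?case
 proof (rule Ck_on_Suc_has_derivative[OF assms(1)])
  show "Ck_on k S (\<lambda>x. bil (f x) (fder g x v) + bil (fder f x v) (g x))" for v
   using Suc.prems Ck_on_Suc_imp[OF Suc.prems(1)] Ck_on_Suc_imp[OF Suc.prems(2)]
   by (intro Ck_on_add[OF assms(1)] Suc.IH) auto
 qed
qed

lemma Ck_on_linear_compose:
 assumes "open S" "bounded_linear l"
 shows "Ck_on k S f \<Longrightarrow> Ck_on k S (\<lambda>x. l (f x))"
proof (induction k arbitrary: f)
 case 0 thus ?case using bounded_linear.continuous_on[OF assms(2)] by auto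
next
 case (Suc k)
 have "((\<lambda>x. l (f x)) has_derivative (\<lambda>v. l (fder f x v))) (at x)"
  if "x \<in> S" for x using bounded_linear.has_derivative[OF assms(2) Ck_on_SucD[OF Suc.prems(1) that]] .
 thus ?case using Suc.IH Suc.prems by (intro Ck_on_Suc_has_derivative[OF assms(1)]) auto
qed

lemma Ck_on_ident: "open S \<Longrightarrow> Ck_on k S (\<lambda>x. x)"
proof (cases k)
 case (Suc j)
 assume "open S"
 hence "Ck_on (Suc j) S (\<lambda>x. x)" by (intro Ck_on_Suc_has_derivative[where f' = "\<lambda>_ v. v"] has_derivative_ident Ck_on_const)
 with Suc show ?thesis by simp
qed simp

lemma Ck_on_linear: "open S \<Longrightarrow> bounded_linear l \<Longrightarrow> Ck_on k S l" using Ck_on_linear_compose[OF _ _ Ck_on_ident] by blast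

lemma Ck_on_mult:
 fixes f g :: "_ \<Rightarrow> real"
 shows "open S \<Longrightarrow> Ck_on k S f \<Longrightarrow> Ck_on k S g \<Longrightarrow> Ck_on k S (\<lambda>x. f x * g x)" using Ck_on_bilinear[OF _ bounded_bilinear_mult] .

lemma Ck_on_scaleR:
 "open S \<Longrightarrow> Ck_on k S f \<Longrightarrow> Ck_on k S g \<Longrightarrow> Ck_on k S (\<lambda>x. f x *\<^sub>R g x)" using Ck_on_bilinear[OF _ bounded_bilinear_scaleR] .

lemma Ck_on_minus: "open S \<Longrightarrow> Ck_on k S f \<Longrightarrow> Ck_on k S (\<lambda>x. - f x)"
 using Ck_on_linear_compose[OF _ bounded_linear_minus[OF bounded_linear_ident]] .

lemma Ck_on_diff: "open S \<Longrightarrow> Ck_on k S f \<Longrightarrow> Ck_on k S g \<Longrightarrow> Ck_on k S (\<lambda>x. f x - g x)"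
 using Ck_on_add[of S k f "\<lambda>x. - g x"] Ck_on_minus by auto

lemma Ck_on_componentwise:
 assumes "open S" "\<And>b. b \<in> Basis \<Longrightarrow> Ck_on k S (\<lambda>x. f x \<bullet> b)"
 shows "Ck_on k S f"
proof -
 have "Ck_on k S (\<lambda>x. \<Sum>b\<in>Basis. (f x \<bullet> b) *\<^sub>R b)" using assms by (intro Ck_on_sum Ck_on_scaleR) auto
 thus ?thesis by (simp add: euclidean_representation)
qed

lemma Ck_on_compose:
 fixes f :: "'a::euclidean_space \<Rightarrow> 'b::euclidean_space" and g :: "'b \<Rightarrow> 'c::euclidean_space"
 assumes S: "open S" and T: "open T" and fST: "f ` S \<subseteq> T"
 shows "Ck_on k S f \<Longrightarrow> Ck_on k T g \<Longrightarrow> Ck_on k S (\<lambda>x. g (f x))" using fST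
proof (induction k arbitrary: g)
 case 0 thus ?case using continuous_on_compose2 by auto
next
 case (Suc k)
 have D: "((\<lambda>x. g (f x)) has_derivative (\<lambda>v. fder g (f x) (fder f x v))) (at x)"
  if "x \<in> S" for x using diff_chain_at[OF Ck_on_SucD[OF Suc.prems(1) that] Ck_on_SucD[OF Suc.prems(2)], of] that Suc.prems(3)
  by (auto simp: o_def image_subset_iff)
 have lin: "linear (fder g (f x))" if "x \<in> S" for x
  using Ck_on_SucD[OF Suc.prems(2)] Suc.prems(3) that has_derivative_linear by blast
 have "Ck_on k S (\<lambda>x. fder g (f x) (fder f x v))" for v
 proof -
  have "fder g (f x) (fder f x v) =
    (\<Sum>b\<in>Basis. (fder f x v \<bullet> b) *\<^sub>R fder g (f x) b)" if "x \<in> S" for x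
   by (subst (1) euclidean_representation[symmetric, of "fder f x v"])
    (simp only: linear_sum[OF lin[OF that]] linear_scale[OF lin[OF that]])
  note rep = this
  have "Ck_on k S (\<lambda>x. \<Sum>b\<in>Basis. (fder f x v \<bullet> b) *\<^sub>R fder g (f x) b)" using Suc.prems Ck_on_Suc_imp[OF Suc.prems(1)] S
   by (intro Ck_on_sum Ck_on_scaleR Suc.IH Ck_on_linear_compose[OF S bounded_linear_inner_left]) auto
  thus ?thesis by (subst Ck_on_cong_open[OF S rep])
 qed
 with D show ?case by (intro Ck_on_Suc_has_derivative[OF S])
qed

lemma Ck_on_Pair:
 assumes "open S" "Ck_on k S f" "Ck_on k S g" shows "Ck_on k S (\<lambda>x. (f x, g x))"
proof -
 have "Ck_on k S (\<lambda>x. (f x, 0) + (0, g x))" using assms by (intro Ck_on_add Ck_on_linear_compose[where l = "\<lambda>u. (u, 0)"]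
    Ck_on_linear_compose[where l = "\<lambda>u. (0, u)"])
   (auto intro: bounded_linear_Pair bounded_linear_ident bounded_linear_zero)
 thus ?thesis by simp
qed

lemma Ck_on_inverse: "Ck_on k (- {0}) (inverse :: real \<Rightarrow> real)"
proof (induction k)
 case 0 thus ?case by (auto intro: continuous_intros)
next
 case (Suc k)
 thus ?case by (intro Ck_on_Suc_has_derivative[where f' = "\<lambda>x v. - (inverse x * v * inverse x)"])
   (auto intro!: Ck_on_minus Ck_on_mult has_derivative_inverse' simp: open_Compl)
qed

lemma Ck_on_divide:
 fixes f g :: "'a::euclidean_space \<Rightarrow> real"
 assumes "open S" "Ck_on k S f" "Ck_on k S g" "\<And>x. x \<in> S \<Longrightarrow> g x \<noteq> 0"
 shows "Ck_on k S (\<lambda>x. f x / g x)" unfolding divide_inverse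
 using assms by (intro Ck_on_mult Ck_on_compose[OF assms(1) _ _ assms(3) Ck_on_inverse]) (auto simp: open_Compl)

lemma Ck_on_vec_nth: "open S \<Longrightarrow> Ck_on k S f \<Longrightarrow> Ck_on k S (\<lambda>x. f x $ i)"
 by (rule Ck_on_linear_compose[OF _ bounded_linear_vec_nth])

lemma Ck_on_vec:
 fixes f :: "'a::euclidean_space \<Rightarrow> real ^ 'n"
 assumes "open S" "\<And>i. Ck_on k S (\<lambda>x. f x $ i)" shows "Ck_on k S f"
proof (rule Ck_on_componentwise[OF assms(1)])
 fix b :: "real ^ 'n" assume "b \<in> Basis"
 then obtain i where "b = axis i 1" by (auto simp: Basis_vec_def)
 thus "Ck_on k S (\<lambda>x. f x \<bullet> b)" using assms(2)[of i] by (simp add: inner_axis)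
qed

lemma Ck_on_vec_lambda:
 fixes f :: "'n::finite \<Rightarrow> 'a::euclidean_space \<Rightarrow> real"
 shows "open S \<Longrightarrow> (\<And>i. Ck_on k S (f i)) \<Longrightarrow> Ck_on k S (\<lambda>x. \<chi> i. f i x)" by (rule Ck_on_vec) auto

lemma Ck_on_prod:
 fixes f :: "'i \<Rightarrow> 'a::euclidean_space \<Rightarrow> real"
 assumes "open S" shows "(\<And>i. i \<in> I \<Longrightarrow> Ck_on k S (f i)) \<Longrightarrow> Ck_on k S (\<lambda>x. \<Prod>i\<in>I. f i x)"
 using assms by (induction I rule: infinite_finite_induct) (auto intro: Ck_on_mult)

lemma Ck_on_det:
 fixes M :: "'a::euclidean_space \<Rightarrow> real ^ 'n ^ 'n"
 assumes "open S" "\<And>i j. Ck_on k S (\<lambda>x. M x $ i $ j)" shows "Ck_on k S (\<lambda>x. det (M x))"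
 unfolding det_def using assms by (intro Ck_on_sum Ck_on_mult Ck_on_prod) auto

lemma Ck_on_solve:
 fixes M :: "'a::euclidean_space \<Rightarrow> real ^ 'n ^ 'n" and b y :: "'a \<Rightarrow> real ^ 'n"
 assumes S: "open S" and M: "\<And>i j. Ck_on k S (\<lambda>x. M x $ i $ j)" and b: "Ck_on k S b"
  and y: "\<And>x. x \<in> S \<Longrightarrow> M x *v y x = b x" "\<And>x. x \<in> S \<Longrightarrow> det (M x) \<noteq> 0"
 shows "Ck_on k S y"
proof -
 define z where "z x = (\<chi> l. det (\<chi> i j. if j = l then b x $ i else M x $ i $ j) / det (M x))" for x
 have "y x = z x" if "x \<in> S" for x using iffD1[OF cramer[OF y(2)[OF that]] y(1)[OF that]] by (simp add: z_def)
 moreover have "Ck_on k S z" unfolding z_def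
 proof (intro Ck_on_vec_lambda Ck_on_divide Ck_on_det S M)
  show "Ck_on k S (\<lambda>x. (\<chi> i j. if j = l then b x $ i else M x $ i $ j) $ i $ j)" for i j l unfolding vec_lambda_beta
  proof (cases "j = l")
   case True
   thus "Ck_on k S (\<lambda>x. if j = l then b x $ i else M x $ i $ j)" using Ck_on_vec_nth[OF S b, of i] by simp
  next
   case False
   thus "Ck_on k S (\<lambda>x. if j = l then b x $ i else M x $ i $ j)" using M[of i j] by (simp only: if_False)
  qed
 qed (use y in auto)
 ultimately show ?thesis using Ck_on_cong_open[OF S, of y z k] by blast
qed

text \<open>Schwarz' theorem, by comparing the mixed second difference quotient with both iterated derivatives.\<close>

lemma second_derivative_symmetric:
 fixes f :: "'a::euclidean_space \<Rightarrow> 'b::euclidean_space"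
 assumes S: "open S" "x \<in> S" and f: "Ck_on 2 S f"
 defines "D \<equiv> \<lambda>u v y. fder (\<lambda>y. fder f y v) y u"
 shows "D u v x = D v u x"
proof -
 obtain e where e: "e > 0" "ball x e \<subseteq> S" using S openE by blast
 have f1: "Ck_on 1 S f" and f1': "\<And>v. Ck_on 1 S (\<lambda>y. fder f y v)"
  using f Ck_on_Suc_imp[of 1 S f] by (simp_all add: numeral_2_eq_2 del: Ck_on.simps(1))
 have cont: "continuous_on S (D u v)" for u v using f by (auto simp: numeral_2_eq_2 D_def)
 have approx: "\<exists>s\<in>{0<..<t}. \<exists>r\<in>{0<..<t}. 
   ((f (x + t *\<^sub>R u + t *\<^sub>R v) - f (x + t *\<^sub>R u) - f (x + t *\<^sub>R v) + f x) \<bullet> b) = t\<^sup>2 * (D v u (x + s *\<^sub>R u + r *\<^sub>R v) \<bullet> b)"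
  if t: "0 < t" "t * (norm u + norm v) < e" for t u v b
 proof -
  define P where "P s r = x + s *\<^sub>R u + r *\<^sub>R v" for s r
  have inS: "P s r \<in> S" if "0 \<le> s" "s \<le> t" "0 \<le> r" "r \<le> t" for s r
  proof -
   have "norm (s *\<^sub>R u + r *\<^sub>R v) \<le> t * norm u + t * norm v"
    using that by (intro norm_triangle_le add_mono) (auto intro: mult_right_mono)
   thus ?thesis using e t by (auto simp: P_def dist_norm algebra_simps norm_minus_commute intro!: subsetD[OF e(2)])
  qed
  define g where "g s = (f (P s t) - f (P s 0)) \<bullet> b" for s
  have dg: "(g has_real_derivative ((fder f (P s t) u - fder f (P s 0) u) \<bullet> b)) (at s)"
   if "0 \<le> s" "s \<le> t" for s
  proof -
   have 1: "((\<lambda>s. f (P s r)) has_derivative (\<lambda>h. fder f (P s r) (h *\<^sub>R u))) (at s)"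
    if "0 \<le> r" "r \<le> t" for r
   proof (rule has_derivative_compose[of "\<lambda>s. P s r" "\<lambda>h. h *\<^sub>R u"])
    show "(f has_derivative fder f (P s r)) (at (P s r))" using Ck_on_SucD f1 inS \<open>0 \<le> s\<close> \<open>s \<le> t\<close> that by (metis One_nat_def)
   qed (auto intro!: derivative_eq_intros simp: P_def)
   have "(g has_derivative (\<lambda>h. (fder f (P s t) (h *\<^sub>R u)
      - fder f (P s 0) (h *\<^sub>R u)) \<bullet> b)) (at s)"
    unfolding g_def using 1[of t] 1[of 0] t by (intro has_derivative_inner_left has_derivative_diff) auto
   moreover have "linear (fder f (P s r))" if "0 \<le> r" "r \<le> t" for r
    using Ck_on_SucD f1 inS \<open>0 \<le> s\<close> \<open>s \<le> t\<close> that has_derivative_linear by (metis One_nat_def)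
   from this[of t] this[of 0] have "(\<lambda>h. (fder f (P s t) (h *\<^sub>R u)
      - fder f (P s 0) (h *\<^sub>R u)) \<bullet> b) =
     (*) ((fder f (P s t) u - fder f (P s 0) u) \<bullet> b)"
    using t by (auto simp: fun_eq_iff linear_scale inner_diff_left algebra_simps)
   ultimately show ?thesis by (simp add: has_field_derivative_def)
  qed
  obtain s where s: "0 < s" "s < t" "g t - g 0 = t * ((fder f (P s t) u - fder f (P s 0) u) \<bullet> b)"
   using MVT2[of 0 t g, OF t(1) dg] by auto
  define h where "h r = fder f (P s r) u \<bullet> b" for r
  have dh: "(h has_real_derivative (D v u (P s r) \<bullet> b)) (at r)" if "0 \<le> r" "r \<le> t" for r
  proof -
   let ?G = "\<lambda>y. fder f y u"
   have G: "(?G has_derivative fder ?G (P s r)) (at (P s r))"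
    using Ck_on_SucD f1' inS s that by (metis One_nat_def less_eq_real_def)
   have "((\<lambda>r. ?G (P s r)) has_derivative (\<lambda>h. fder ?G (P s r) (h *\<^sub>R v))) (at r)"
    by (rule has_derivative_compose[of "\<lambda>r. P s r" "\<lambda>h. h *\<^sub>R v", OF _ G]) (auto intro!: derivative_eq_intros simp: P_def)
   hence "(h has_derivative (\<lambda>k. fder ?G (P s r) (k *\<^sub>R v) \<bullet> b)) (at r)" unfolding h_def by (intro has_derivative_inner_left)
   moreover have "(\<lambda>k. fder ?G (P s r) (k *\<^sub>R v) \<bullet> b) = (*) (D v u (P s r) \<bullet> b)"
    using has_derivative_linear[OF G] by (auto simp: D_def fun_eq_iff linear_scale)
   ultimately show ?thesis by (simp add: has_field_derivative_def)
  qed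
  obtain r where r: "0 < r" "r < t" "h t - h 0 = t * (D v u (P s r) \<bullet> b)" using MVT2[of 0 t h, OF t(1) dh] by auto
  show ?thesis
   using s r by (intro bexI[of _ s] bexI[of _ r]) (auto simp: P_def g_def h_def inner_diff_left inner_add_left power2_eq_square algebra_simps)
 qed
 have "D u v x \<bullet> b = D v u x \<bullet> b" for b
 proof (rule ccontr)
  assume ne: "D u v x \<bullet> b \<noteq> D v u x \<bullet> b"
  define \<epsilon> where "\<epsilon> = \<bar>D u v x \<bullet> b - D v u x \<bullet> b\<bar> / 2"
  have "\<epsilon> > 0" using ne by (simp add: \<epsilon>_def)
  have c: "\<exists>d>0. \<forall>y. dist y x < d \<longrightarrow> \<bar>D u v y \<bullet> b - D u v x \<bullet> b\<bar> < \<epsilon>" for u v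
  proof -
   have "isCont (\<lambda>y. D u v y \<bullet> b) x" using cont S by (auto intro!: continuous_intros simp: continuous_on_eq_continuous_at)
   thus ?thesis using \<open>\<epsilon> > 0\<close> by (auto simp: continuous_at_eps_delta dist_real_def)
  qed
  obtain d1 d2 where d: "d1 > 0" "d2 > 0" "\<And>y. dist y x < d1 \<Longrightarrow> \<bar>D u v y \<bullet> b - D u v x \<bullet> b\<bar> < \<epsilon>"
    "\<And>y. dist y x < d2 \<Longrightarrow> \<bar>D v u y \<bullet> b - D v u x \<bullet> b\<bar> < \<epsilon>" using c[of u v] c[of v u] by blast
  define t where "t = min e (min d1 d2) / (2 * (norm u + norm v + 1))"
  have t: "t > 0" using e d by (simp add: t_def add_nonneg_pos)
  have "t * (norm u + norm v) < t * (2 * (norm u + norm v + 1))" using t by (intro mult_strict_left_mono) (auto simp: add_nonneg_pos intro: add_strict_increasing)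
  also have "\<dots> = min e (min d1 d2)" by (simp add: t_def add_nonneg_eq_0_iff)
  finally have te: "t * (norm u + norm v) < min e (min d1 d2)" .
  have near: "dist (x + s *\<^sub>R p + r *\<^sub>R q) x < min e (min d1 d2)"
   if "s \<in> {0<..<t}" "r \<in> {0<..<t}" "norm p + norm q = norm u + norm v" for s r p q
  proof -
   have "norm (s *\<^sub>R p + r *\<^sub>R q) \<le> t * norm p + t * norm q"
    using that by (intro norm_triangle_le add_mono) (auto intro: mult_right_mono)
   also have "\<dots> = t * (norm u + norm v)" using that(3) by (metis distrib_left)
   finally show ?thesis using te by (simp add: dist_norm add.assoc)
  qed
  obtain s r where 1: "s \<in> {0<..<t}" "r \<in> {0<..<t}"
   "((f (x + t *\<^sub>R u + t *\<^sub>R v) - f (x + t *\<^sub>R u) - f (x + t *\<^sub>R v) + f x) \<bullet> b) = t\<^sup>2 * (D v u (x + s *\<^sub>R u + r *\<^sub>R v) \<bullet> b)"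
   using approx[of t u v b] t te by auto
  obtain s' r' where 2: "s' \<in> {0<..<t}" "r' \<in> {0<..<t}"
   "((f (x + t *\<^sub>R v + t *\<^sub>R u) - f (x + t *\<^sub>R v) - f (x + t *\<^sub>R u) + f x) \<bullet> b) = t\<^sup>2 * (D u v (x + s' *\<^sub>R v + r' *\<^sub>R u) \<bullet> b)"
   using approx[of t v u b] t te by (auto simp: add.commute)
  have comm: "x + t *\<^sub>R v + t *\<^sub>R u = x + t *\<^sub>R u + t *\<^sub>R v" by simp
  have "t\<^sup>2 * (D v u (x + s *\<^sub>R u + r *\<^sub>R v) \<bullet> b) = t\<^sup>2 * (D u v (x + s' *\<^sub>R v + r' *\<^sub>R u) \<bullet> b)"
   using 1(3) 2(3)[unfolded comm] unfolding inner_add_left inner_diff_left by linarith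
  hence "D v u (x + s *\<^sub>R u + r *\<^sub>R v) \<bullet> b = D u v (x + s' *\<^sub>R v + r' *\<^sub>R u) \<bullet> b" using t by simp
  with d(4)[of "x + s *\<^sub>R u + r *\<^sub>R v"] d(3)[of "x + s' *\<^sub>R v + r' *\<^sub>R u"] near[OF 1(1,2), of u v] near[OF 2(1,2), of v u]
  have "\<bar>D v u (x + s *\<^sub>R u + r *\<^sub>R v) \<bullet> b - D v u x \<bullet> b\<bar> < \<epsilon>" "\<bar>D v u (x + s *\<^sub>R u + r *\<^sub>R v) \<bullet> b - D u v x \<bullet> b\<bar> < \<epsilon>"
   by auto
  moreover have "2 * \<epsilon> \<le> \<bar>D v u (x + s *\<^sub>R u + r *\<^sub>R v) \<bullet> b - D v u x \<bullet> b\<bar>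
    + \<bar>D v u (x + s *\<^sub>R u + r *\<^sub>R v) \<bullet> b - D u v x \<bullet> b\<bar>" unfolding \<epsilon>_def by simp
  ultimately show False by linarith
 qed
 thus ?thesis by (meson euclidean_eqI)
qed

text \<open>A continuous map is as smooth as its composition with a local diffeomorphism: the derivative
 solves a linear system whose coefficients are as smooth as the map is known to be.\<close>

lemma local_inverse:
 fixes \<theta> :: "real ^ 'n \<Rightarrow> real ^ 'n"
 assumes V: "open V" "Ck_on 1 V \<theta>" "x \<in> V" and inj: "inj (fder \<theta> x)"
 obtains U W g g' where "open U" "U \<subseteq> V" "x \<in> U" "open W" "homeomorphism U W \<theta> g"
  "\<And>y. y \<in> W \<Longrightarrow> (g has_derivative g' y) (at y)" "\<And>y v. y \<in> W \<Longrightarrow> fder \<theta> (g y) (g' y v) = v"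
proof -
 have d\<theta>: "(\<theta> has_derivative fder \<theta> y) (at y)" if "y \<in> V" for y using Ck_on_SucD V(2) that by (metis One_nat_def)
 have bl: "bounded_linear (fder \<theta> y)" if "y \<in> V" for y using d\<theta>[OF that] has_derivative_bounded_linear by blast
 define f' where "f' y = (if y \<in> V then Blinfun (fder \<theta> y) else 0)" for y
 have f': "blinfun_apply (f' y) = fder \<theta> y" if "y \<in> V" for y
  using bl[OF that] that by (simp add: f'_def bounded_linear_Blinfun_apply)
 have cont: "continuous_on V f'"
 proof (rule continuous_on_blinfun_componentwise)
  fix i :: "real ^ 'n" assume "i \<in> Basis"
  have "continuous_on V (\<lambda>x. fder \<theta> x i)" using V(2) by auto
  thus "continuous_on V (\<lambda>x. blinfun_apply (f' x) i)" by (rule continuous_on_eq) (simp add: f')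
 qed
 obtain g0 where g0: "linear g0" "g0 \<circ> fder \<theta> x = id"
  using linear_injective_left_inverse[OF bounded_linear.linear[OF bl[OF V(3)]] inj] by blast
 have "blinfun_apply (Blinfun g0) = g0" using g0(1) by (simp add: bounded_linear_Blinfun_apply linear_conv_bounded_linear)
 hence "Blinfun g0 o\<^sub>L f' x = id_blinfun" using g0(2) by (intro blinfun_eqI) (simp add: f'[OF V(3)] fun_eq_iff)
 from inverse_function_theorem[OF V(1) _ cont V(3) this] d\<theta> f'
 obtain U W g g' where g: "open U" "U \<subseteq> V" "x \<in> U" "open W" "homeomorphism U W \<theta> g"
  "\<And>y. y \<in> W \<Longrightarrow> (g has_derivative (g' y)) (at y)" "\<And>y. y \<in> W \<Longrightarrow> g' y = inv_into UNIV (blinfun_apply (f'(g y)))"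
  "\<And>y. y \<in> W \<Longrightarrow> bij (blinfun_apply (f'(g y)))" by metis
 have "fder \<theta> (g y) (g' y v) = v" if y: "y \<in> W" for y v
 proof -
  have "g y \<in> V" using g(2,5) y by (auto simp: homeomorphism_def)
  thus ?thesis using g(7,8)[OF y] by (simp add: f' bij_is_surj surj_f_inv_f)
 qed
 thus thesis using that g(1-6) by blast
qed

lemma has_derivative_lift:
 fixes \<theta> :: "real ^ 'n \<Rightarrow> real ^ 'n" and F :: "'a::euclidean_space \<Rightarrow> real ^ 'n"
 assumes V: "open V" "Ck_on 1 V \<theta>" "F u \<in> V" and inj: "inj (fder \<theta> (F u))"
  and U: "open U" "u \<in> U" "continuous_on U F"
  and F: "((\<lambda>u. \<theta> (F u)) has_derivative F') (at u)"
 shows "\<exists>G. (F has_derivative G) (at u) \<and> (\<forall>v. fder \<theta> (F u) (G v) = F' v)"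
proof -
 obtain Q W g g' where g: "open Q" "Q \<subseteq> V" "F u \<in> Q" "open W" "homeomorphism Q W \<theta> g"
  "\<And>y. y \<in> W \<Longrightarrow> (g has_derivative (g' y)) (at y)" "\<And>y v. y \<in> W \<Longrightarrow> fder \<theta> (g y) (g' y v) = v"
  using local_inverse[OF V inj] by metis
 have gF: "\<theta> (F u) \<in> W" "g (\<theta> (F u)) = F u" using g(3,5) by (auto simp: homeomorphism_def)
 have "isCont F u" using U by (simp add: continuous_on_eq_continuous_at)
 hence ev: "\<forall>\<^sub>F w in nhds u. F w \<in> Q"
  using g(1,3) by (metis isCont_def continuous_at_imp_continuous_at_within filterlim_at_withinI tendsto_def tendsto_at_iff_tendsto_nhds topological_tendstoD)
 have D: "((\<lambda>w. g (\<theta> (F w))) has_derivative (\<lambda>v. g' (\<theta> (F u)) (F' v))) (at u)"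
  using has_derivative_compose[OF F g(6)[OF gF(1)]] by simp
 have "(F has_derivative (\<lambda>v. g' (\<theta> (F u)) (F' v))) (at u)"
 proof (rule has_derivative_transform_eventually[OF D])
  show "\<forall>\<^sub>F w in at u. g (\<theta> (F w)) = F w"
   using ev g(5) by (auto simp: eventually_at_filter homeomorphism_def elim!: eventually_mono)
 qed (use gF in auto)
 thus ?thesis using g(7)[OF gF(1)] gF(2) by auto
qed

lemma Ck_on_lift:
 fixes \<theta> :: "real ^ 'n \<Rightarrow> real ^ 'n" and F :: "'a::euclidean_space \<Rightarrow> real ^ 'n"
 assumes V: "open V" "Ck_on k V \<theta>" and inj: "\<And>y. y \<in> V \<Longrightarrow> inj (fder \<theta> y)"
  and U: "open U" "continuous_on U F" "F ` U \<subseteq> V"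
  and F: "Ck_on k U (\<lambda>u. \<theta> (F u))"
 shows "Ck_on k U F" using V(2) F
proof (induction k)
 case 0 thus ?case using U by simp
next
 case (Suc k)
 have Fk: "Ck_on k U F" using Suc.IH Ck_on_Suc_imp[OF Suc.prems(1)] Ck_on_Suc_imp[OF Suc.prems(2)] by blast
 have V1: "Ck_on 1 V \<theta>" using Suc.prems(1) Ck_on_mono[of "Suc k" V \<theta> 1] by simp
 have ex: "\<exists>G. (F has_derivative G) (at u) \<and> (\<forall>v. fder \<theta> (F u) (G v) = fder (\<lambda>u. \<theta> (F u)) u v)"
  if "u \<in> U" for u
  using has_derivative_lift[OF V(1) V1 _ inj U(1) that U(2) Ck_on_SucD[OF Suc.prems(2) that]] that U(3) by blast
 have dF: "(F has_derivative fder F u) (at u)"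
  and eq: "fder \<theta> (F u) (fder F u v) = fder (\<lambda>u. \<theta> (F u)) u v"
  if "u \<in> U" for u v using ex[OF that] frechet_derivative_eqI by fastforce+
 have d\<theta>: "(\<theta> has_derivative fder \<theta> (F u)) (at (F u))" if "u \<in> U" for u using Ck_on_SucD[OF Suc.prems(1)] that U(3) by blast
 show ?case
 proof (rule Ck_on_Suc_has_derivative[OF U(1) dF])
  fix v
  show "Ck_on k U (\<lambda>x. fder F x v)"
  proof (rule Ck_on_solve[OF U(1)])
   show "Ck_on k U (\<lambda>x. matrix (fder \<theta> (F x)) $ i $ j)" for i j unfolding matrix_def
    using Suc.prems(1) by (auto intro!: Ck_on_vec_nth U(1) Ck_on_compose[OF U(1) V(1) U(3) Fk, of "\<lambda>y. fder \<theta> y _"])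
   show "Ck_on k U (\<lambda>u. fder (\<lambda>u. \<theta> (F u)) u v)" using Suc.prems(2) by simp
  next
   fix u assume "u \<in> U"
   note lin = has_derivative_linear[OF d\<theta>[OF this]]
   show "matrix (fder \<theta> (F u)) *v fder F u v = fder (\<lambda>u. \<theta> (F u)) u v" using eq[OF \<open>u \<in> U\<close>] lin by (simp add: matrix_works)
   show "det (matrix (fder \<theta> (F u))) \<noteq> 0" using inj lin U(3) \<open>u \<in> U\<close> by (metis det_nz_iff_inj image_subset_iff)
  qed
 qed
qed

section \<open>The second fundamental form in other coordinates\<close>

lemma bounded_bilinear_matrix_vector_mult:
 "bounded_bilinear ((*v) :: real ^ 'n ^ 'm \<Rightarrow> real ^ 'n \<Rightarrow> real ^ 'm)"
 unfolding bilinear_conv_bounded_bilinear[symmetric] bilinear_def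
 by (auto intro!: linearI simp: matrix_vector_mult_add_rdistrib matrix_vector_right_distrib
   scaleR_matrix_vector_assoc[symmetric] matrix_vector_mult_scaleR)

lemma pderiv_at_nth_nth:
 fixes g :: "real ^ 'n \<Rightarrow> real ^ 'm ^ 'k"
 assumes "g differentiable (at x)"
 shows "pderiv_at i (\<lambda>y. g y $ j $ l) x = fder g x (axis i 1) $ j $ l"
proof -
 have "(g has_derivative fder g x) (at x)" using assms by (simp add: frechet_derivative_works)
 hence "((\<lambda>y. g y $ j $ l) has_derivative (\<lambda>v. fder g x v $ j $ l)) (at x)"
  by (intro bounded_linear.has_derivative[OF bounded_linear_vec_nth])
 thus ?thesis by (simp add: pderiv_at_def frechet_derivative_eqI)
qed

lemma linear_axis_expansion:
 fixes l :: "real ^ 'n \<Rightarrow> 'b::real_vector"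
 assumes "linear l" shows "l v = (\<Sum>i\<in>UNIV. v $ i *\<^sub>R l (axis i 1))"
proof -
 have "l v = l (\<Sum>i\<in>UNIV. v $ i *\<^sub>R axis i 1)" by (simp add: basis_expansion flip: scalar_mult_eq_scaleR)
 thus ?thesis by (simp add: linear_sum[OF assms] linear_scale[OF assms])
qed

lemma inner_symmetric_matrix:
 fixes M :: "real ^ 'n ^ 'n" assumes "transpose M = M" shows "v \<bullet> (M *v w) = (M *v v) \<bullet> w"
 using assms by (metis dot_lmul_matrix vector_transpose_matrix)

lemma matrix_inv_eqI:
 fixes A B :: "real ^ 'n ^ 'n" assumes "A ** B = mat 1" shows "matrix_inv A = B"
proof -
 have "B ** A = mat 1" using assms matrix_left_right_inverse by blast
 hence "A ** matrix_inv A = mat 1 \<and> matrix_inv A ** A = mat 1"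
  unfolding matrix_inv_def using assms by (intro someI[of "\<lambda>C. A ** C = mat 1 \<and> C ** A = mat 1" B]) simp
 thus ?thesis using assms by (metis matrix_mul_assoc matrix_mul_lid matrix_mul_rid)
qed

lemma koszul:
 fixes g :: "real ^ 3 \<Rightarrow> real ^ 3 ^ 3"
 assumes d: "g differentiable (at x)" and inv: "invertible (g x)" and sym: "transpose (g x) = g x"
 defines "D \<equiv> fder g x"
 shows "(\<chi> k. \<Sum>i\<in>UNIV. \<Sum>j\<in>UNIV. christoffel g x k i j * u $ i * v $ j) \<bullet> (g x *v w)
  = (1/2) * (v \<bullet> (D u *v w) + u \<bullet> (D v *v w) - u \<bullet> (D w *v v))"
proof -
 have lin: "linear D" using d unfolding D_def by (rule linear_frechet_derivative)
 define T :: "real ^ 3" where "T = (\<chi> l. \<Sum>i\<in>UNIV. \<Sum>j\<in>UNIV. u $ i * v $ j *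
   (D (axis i 1) $ j $ l + D (axis j 1) $ i $ l - D (axis l 1) $ i $ j))"
 let ?G = "\<chi> k. \<Sum>i\<in>UNIV. \<Sum>j\<in>UNIV. christoffel g x k i j * u $ i * v $ j"
 have G: "?G = (1/2) *\<^sub>R (matrix_inv (g x) *v T)"
  unfolding vec_eq_iff matrix_vector_mult_def T_def christoffel_def pderiv_at_nth_nth[OF d] D_def[symmetric]
  by (simp add: sum_3 algebra_simps)
 have "?G \<bullet> (g x *v w) = (g x *v ?G) \<bullet> w" by (simp add: inner_symmetric_matrix[OF sym])
 also have "g x *v ?G = (1/2) *\<^sub>R T"
 proof -
  obtain B where "g x ** B = mat 1" using inv invertible_right_inverse by blast
  hence "g x ** matrix_inv (g x) = mat 1" using matrix_inv_eqI by metis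
  thus ?thesis unfolding G by (simp add: matrix_vector_mul_assoc matrix_vector_mult_scaleR)
 qed
 also have "((1/2) *\<^sub>R T) \<bullet> w = (1/2) * (v \<bullet> (D u *v w) + u \<bullet> (D v *v w) - u \<bullet> (D w *v v))"
 proof -
  have D: "D z $ j $ l = (\<Sum>i\<in>UNIV. z $ i * D (axis i 1) $ j $ l)" for z j l by (subst linear_axis_expansion[OF lin]) simp
  have "T $ l = (\<Sum>j\<in>UNIV. v $ j * D u $ j $ l) + (\<Sum>i\<in>UNIV. u $ i * D v $ i $ l)
    - (\<Sum>i\<in>UNIV. \<Sum>j\<in>UNIV. u $ i * v $ j * D (axis l 1) $ i $ j)" for l
   unfolding T_def D[of u] D[of v] by (simp add: sum_3 algebra_simps)
  moreover have "(\<Sum>l\<in>UNIV. (\<Sum>j\<in>UNIV. v $ j * D u $ j $ l) * w $ l) = v \<bullet> (D u *v w)" for u v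
   by (simp add: inner_vec_def matrix_vector_mult_def sum_3 algebra_simps)
  moreover have "(\<Sum>l\<in>UNIV. (\<Sum>i\<in>UNIV. \<Sum>j\<in>UNIV. u $ i * v $ j * D (axis l 1) $ i $ j) * w $ l) = u \<bullet> (D w *v v)"
   unfolding inner_vec_def matrix_vector_mult_def D[of w] by (simp add: sum_3 algebra_simps)
  ultimately show ?thesis unfolding inner_vec_def[of "(1/2) *\<^sub>R T"]
   by (simp add: distrib_right left_diff_distrib sum.distrib sum_subtractf flip: sum_divide_distrib)
 qed
 finally show ?thesis .
qed

lemma Ck_on_frechet_derivative_works:
 assumes "Ck_on (Suc k) U F" "u \<in> U"
 shows "(F has_derivative fder F u) (at u)" "linear (fder F u)" using Ck_on_SucD[OF assms] has_derivative_linear by blast+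

lemma second_derivative_axis_expansion:
 fixes F :: "real ^ 'n \<Rightarrow> 'b::euclidean_space"
 assumes U: "open U" "u \<in> U" and F: "Ck_on 2 U F"
 shows "fder (\<lambda>x. fder F x c) u d
  = (\<Sum>a\<in>UNIV. \<Sum>b\<in>UNIV. (d $ a * c $ b) *\<^sub>R pderiv_at a (pderiv_at b F) u)"
proof -
 let ?G = "\<lambda>c x. fder F x c"
 have G: "Ck_on (Suc 0) U (?G c)" for c using F by (simp add: numeral_2_eq_2)
 have F1: "Ck_on (Suc 0) U F" using F Ck_on_Suc_imp[of 1 U F] by (simp add: numeral_2_eq_2)
 have "((\<lambda>x. \<Sum>b\<in>UNIV. c $ b *\<^sub>R ?G (axis b 1) x) has_derivative
   (\<lambda>d. \<Sum>b\<in>UNIV. c $ b *\<^sub>R fder (?G (axis b 1)) u d)) (at u)"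
  by (intro has_derivative_sum has_derivative_scaleR_right Ck_on_frechet_derivative_works(1)[OF G U(2)])
 hence "(?G c has_derivative
   (\<lambda>d. \<Sum>b\<in>UNIV. c $ b *\<^sub>R fder (?G (axis b 1)) u d)) (at u)" by (rule has_derivative_transform_within_open[OF _ U])
   (use linear_axis_expansion[OF Ck_on_frechet_derivative_works(2)[OF F1]] in auto)
 hence "fder (?G c) u d = (\<Sum>b\<in>UNIV. c $ b *\<^sub>R fder (?G (axis b 1)) u d)" by (simp add: frechet_derivative_eqI)
 also have "\<dots> = (\<Sum>b\<in>UNIV. c $ b *\<^sub>R (\<Sum>a\<in>UNIV. d $ a *\<^sub>R fder (?G (axis b 1)) u (axis a 1)))"
  by (intro sum.cong refl arg_cong2[where f = scaleR] linear_axis_expansion[OF Ck_on_frechet_derivative_works(2)[OF G U(2)]])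
 also have "\<dots> = (\<Sum>b\<in>UNIV. \<Sum>a\<in>UNIV. (d $ a * c $ b) *\<^sub>R fder (?G (axis b 1)) u (axis a 1))"
  by (simp add: scaleR_sum_right mult.commute)
 also have "\<dots> = (\<Sum>a\<in>UNIV. \<Sum>b\<in>UNIV. (d $ a * c $ b) *\<^sub>R pderiv_at a (pderiv_at b F) u)"
  by (subst sum.swap) (simp add: pderiv_at_def[abs_def])
 finally show ?thesis .
qed

lemma second_form_quadratic:
 fixes F :: "real ^ 2 \<Rightarrow> real ^ 3" and c :: "real ^ 2"
 assumes U: "open U" "u \<in> U" and F: "Ck_on 2 U F"
  and g: "g differentiable (at (F u))" "invertible (g (F u))" "transpose (g (F u)) = g (F u)"
 defines "D \<equiv> fder g (F u)" and "w \<equiv> fder F u c"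
 shows "c \<bullet> (second_form g F u \<nu> *v c) =
  fder (\<lambda>x. fder F x c) u c \<bullet> (g (F u) *v \<nu>)
  + w \<bullet> (D w *v \<nu>) - (1/2) * (w \<bullet> (D \<nu> *v w))"
proof -
 have F1: "Ck_on (Suc 0) U F" using F Ck_on_Suc_imp[of 1 U F] by (simp add: numeral_2_eq_2)
 let ?\<Gamma> = "\<lambda>p q. \<chi> k. \<Sum>i\<in>UNIV. \<Sum>j\<in>UNIV. christoffel g (F u) k i j * p $ i * q $ j"
 have w: "w = (\<Sum>a\<in>UNIV. c $ a *\<^sub>R pderiv_at a F u)"
  unfolding w_def pderiv_at_def by (rule linear_axis_expansion[OF Ck_on_frechet_derivative_works(2)[OF F1 U(2)]])
 have "c \<bullet> (second_form g F u \<nu> *v c) =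
   (\<Sum>a\<in>UNIV. \<Sum>b\<in>UNIV. (c $ a * c $ b) *\<^sub>R pderiv_at a (pderiv_at b F) u) \<bullet> (g (F u) *v \<nu>)
   + ?\<Gamma> w w \<bullet> (g (F u) *v \<nu>)"
 proof -
  have "?\<Gamma> w w = (\<Sum>a\<in>UNIV. \<Sum>b\<in>UNIV. (c $ a * c $ b) *\<^sub>R ?\<Gamma> (pderiv_at a F u) (pderiv_at b F u))"
   unfolding w by (simp add: vec_eq_iff sum_2 sum_3 algebra_simps)
  moreover have "c \<bullet> (second_form g F u \<nu> *v c) = (\<Sum>a\<in>UNIV. \<Sum>b\<in>UNIV. (c $ a * c $ b) *\<^sub>R cov_deriv g F u a b) \<bullet> (g (F u) *v \<nu>)"
   by (simp add: second_form_def inner_vec_def[of c] matrix_vector_mult_def[of "\<chi> a b. _ a b"] sum_2 inner_add_left algebra_simps)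
  ultimately show ?thesis by (simp add: cov_deriv_def scaleR_add_right sum.distrib inner_add_left)
 qed
 thus ?thesis unfolding koszul[OF g] second_derivative_axis_expansion[OF U F] D_def by simp
qed

text \<open>Here \<open>h\<close> is the metric \<open>g\<close> pulled back by the coordinate change \<open>\<theta>\<close>.\<close>

lemma second_form_pullback:
 fixes F F0 :: "real ^ 2 \<Rightarrow> real ^ 3" and \<theta> :: "real ^ 3 \<Rightarrow> real ^ 3" and c :: "real ^ 2"
 assumes U: "open U" "u \<in> U" and F0: "Ck_on 2 U F0" "F0 ` U \<subseteq> V" and V: "open V" "Ck_on 2 V \<theta>"
  and F: "\<And>x. x \<in> U \<Longrightarrow> F x = \<theta> (F0 x)"
  and g: "g differentiable (at (F u))" "invertible (g (F u))" "transpose (g (F u)) = g (F u)"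
  and h: "\<And>y v w. y \<in> V \<Longrightarrow> h y v w = fder \<theta> y v \<bullet> (g (\<theta> y) *v fder \<theta> y w)"
 defines "p \<equiv> F0 u" and "w \<equiv> fder F0 u c"
 shows "c \<bullet> (second_form g F u (fder \<theta> p \<nu>) *v c) =
   h p (fder (\<lambda>x. fder F0 x c) u c) \<nu>
   + fder (\<lambda>y. h y w \<nu>) p w - (1/2) * fder (\<lambda>y. h y w w) p \<nu>"
proof -
 let ?T = "\<lambda>v y. fder \<theta> y v"
 let ?T2 = "\<lambda>v y w. fder (?T v) y w"
 have p: "p \<in> V" using F0(2) U(2) by (auto simp: p_def)
 have Fu: "F u = \<theta> p" using F U(2) by (simp add: p_def)
 have \<theta>1: "Ck_on (Suc 0) V \<theta>" using V(2) Ck_on_Suc_imp[of 1 V \<theta>] by (simp add: numeral_2_eq_2)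
 have T1: "Ck_on (Suc 0) V (?T v)" for v using V(2) by (simp add: numeral_2_eq_2)
 have F01: "Ck_on (Suc 0) U F0" using F0(1) Ck_on_Suc_imp[of 1 U F0] by (simp add: numeral_2_eq_2)
 have F02: "Ck_on (Suc 0) U (\<lambda>x. fder F0 x v)" for v using F0(1) by (simp add: numeral_2_eq_2)
 note dT = Ck_on_frechet_derivative_works[OF T1 p] and d\<theta> = Ck_on_frechet_derivative_works[OF \<theta>1]
 define D where "D = fder g (\<theta> p)"
 have dg: "(g has_derivative D) (at (\<theta> p))" using g(1) by (simp add: D_def Fu frechet_derivative_works)
 have linD: "linear D" using dg by (rule has_derivative_linear)
 define G where "G = g (\<theta> p)"
 have sym: "transpose G = G" using g(3) by (simp add: Fu G_def)
 have sym2: "v \<bullet> (G *v w) = w \<bullet> (G *v v)" for v w using inner_symmetric_matrix[OF sym] by (simp add: inner_commute)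
 have dh: "fder (\<lambda>y. h y a b) p z = 
   ?T2 a p z \<bullet> (G *v ?T b p) + ?T a p \<bullet> (D (?T z p) *v ?T b p) + ?T a p \<bullet> (G *v ?T2 b p z)" for a b z
 proof -
  have g\<theta>: "((\<lambda>y. g (\<theta> y)) has_derivative (\<lambda>z. D (?T z p))) (at p)" using has_derivative_compose[OF d\<theta>(1)[OF p] dg] .
  have "((\<lambda>y. ?T a y \<bullet> (g (\<theta> y) *v ?T b y)) has_derivative
   (\<lambda>z. ?T a p \<bullet> (g (\<theta> p) *v ?T2 b p z + D (?T z p) *v ?T b p) + ?T2 a p z \<bullet> (g (\<theta> p) *v ?T b p))) (at p)"
   by (intro has_derivative_inner dT bounded_bilinear.FDERIV[OF bounded_bilinear_matrix_vector_mult g\<theta>])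
  hence "((\<lambda>y. h y a b) has_derivative
   (\<lambda>z. ?T a p \<bullet> (g (\<theta> p) *v ?T2 b p z + D (?T z p) *v ?T b p) + ?T2 a p z \<bullet> (g (\<theta> p) *v ?T b p))) (at p)"
   by (rule has_derivative_transform_within_open[OF _ V(1) p]) (use h in auto)
  thus ?thesis by (simp add: frechet_derivative_eqI G_def inner_add_right)
 qed
 have F2: "Ck_on 2 U F"
  using Ck_on_compose[OF U(1) V(1) F0(2) F0(1) V(2)] Ck_on_cong_open[OF U(1), of F "\<lambda>x. \<theta> (F0 x)" 2] F by blast
 have dF: "(F has_derivative (\<lambda>v. ?T (fder F0 x v) (F0 x))) (at x)" if "x \<in> U" for x
 proof -
  have "((\<lambda>x. \<theta> (F0 x)) has_derivative (\<lambda>v. ?T (fder F0 x v) (F0 x))) (at x)"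
   using has_derivative_compose[OF Ck_on_frechet_derivative_works(1)[OF F01 that] d\<theta>(1)] F0(2) that by blast
  thus ?thesis by (rule has_derivative_transform_within_open[OF _ U(1) that]) (use F in auto)
 qed
 hence dF': "fder F x v = ?T (fder F0 x v) (F0 x)" if "x \<in> U" for x v using frechet_derivative_eqI[OF dF[OF that]] by simp
 define w2 where "w2 = fder (\<lambda>x. fder F0 x c) u c"
 have "((\<lambda>x. ?T (fder F0 x c) (F0 x)) has_derivative
   (\<lambda>z. \<Sum>b\<in>Basis. (fder F0 u c \<bullet> b) *\<^sub>R ?T2 b p (fder F0 u z)
     + (fder (\<lambda>x. fder F0 x c) u z \<bullet> b) *\<^sub>R ?T b p)) (at u)"
 proof (rule has_derivative_transform_within_open[OF _ U])
  have "((\<lambda>x. ?T b (F0 x)) has_derivative (\<lambda>z. ?T2 b p (fder F0 u z))) (at u)" for b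
   using has_derivative_compose[OF Ck_on_frechet_derivative_works(1)[OF F01 U(2)] dT(1)[unfolded p_def]] by (simp add: p_def)
  thus "((\<lambda>x. \<Sum>b\<in>Basis. (fder F0 x c \<bullet> b) *\<^sub>R ?T b (F0 x)) has_derivative
   (\<lambda>z. \<Sum>b\<in>Basis. (fder F0 u c \<bullet> b) *\<^sub>R ?T2 b p (fder F0 u z)
     + (fder (\<lambda>x. fder F0 x c) u z \<bullet> b) *\<^sub>R ?T b p)) (at u)" using Ck_on_frechet_derivative_works(1)[OF F02 U(2)]
   unfolding p_def by (intro has_derivative_sum has_derivative_scaleR has_derivative_inner_left)
  fix x assume "x \<in> U"
  hence "linear (fder \<theta> (F0 x))" using d\<theta>(2) F0(2) by blast
  from linear_sum[OF this, of "\<lambda>b. (fder F0 x c \<bullet> b) *\<^sub>R b" Basis]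
  show "(\<Sum>b\<in>Basis. (fder F0 x c \<bullet> b) *\<^sub>R ?T b (F0 x)) = ?T (fder F0 x c) (F0 x)"
   by (simp add: euclidean_representation linear_scale[OF \<open>linear (fder \<theta> (F0 x))\<close>])
 qed
 hence "((\<lambda>x. fder F x c) has_derivative
   (\<lambda>z. \<Sum>b\<in>Basis. (fder F0 u c \<bullet> b) *\<^sub>R ?T2 b p (fder F0 u z)
     + (fder (\<lambda>x. fder F0 x c) u z \<bullet> b) *\<^sub>R ?T b p)) (at u)"
  by (rule has_derivative_transform_within_open[OF _ U]) (use dF' in auto)
 hence "fder (\<lambda>x. fder F x c) u c
   = (\<Sum>b\<in>Basis. (w \<bullet> b) *\<^sub>R ?T2 b p w) + (\<Sum>b\<in>Basis. (w2 \<bullet> b) *\<^sub>R ?T b p)"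
  by (simp add: frechet_derivative_eqI w_def w2_def sum.distrib)
 also have "(\<Sum>b\<in>Basis. (w2 \<bullet> b) *\<^sub>R ?T b p) = ?T w2 p" using linear_sum[OF d\<theta>(2)[OF p], of "\<lambda>b. (w2 \<bullet> b) *\<^sub>R b" Basis]
  by (simp add: euclidean_representation linear_scale[OF d\<theta>(2)[OF p]])
 also have "(\<Sum>b\<in>Basis. (w \<bullet> b) *\<^sub>R ?T2 b p w) = (\<Sum>b\<in>Basis. (w \<bullet> b) *\<^sub>R ?T2 w p b)"
  using second_derivative_symmetric[OF V(1) p V(2)] by simp
 also have "\<dots> = ?T2 w p w" using linear_sum[OF dT(2)[of w], of "\<lambda>b. (w \<bullet> b) *\<^sub>R b" Basis]
  by (simp add: euclidean_representation linear_scale[OF dT(2)])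
 finally have F2': "fder (\<lambda>x. fder F x c) u c = ?T2 w p w + ?T w2 p" .
 have sw: "?T2 \<nu> p w = ?T2 w p \<nu>" using second_derivative_symmetric[OF V(1) p V(2)] by simp
 have "c \<bullet> (second_form g F u (?T \<nu> p) *v c) =
   (?T2 w p w + ?T w2 p) \<bullet> (G *v ?T \<nu> p) + ?T w p \<bullet> (D (?T w p) *v ?T \<nu> p) - (1/2) * (?T w p \<bullet> (D (?T \<nu> p) *v ?T w p))"
  unfolding second_form_quadratic[OF U F2 g] F2' dF'[OF U(2)] by (simp add: Fu G_def D_def w_def p_def)
 moreover have "h p w2 \<nu> = ?T w2 p \<bullet> (G *v ?T \<nu> p)" using h[OF p] by (simp add: G_def)
 ultimately show ?thesis using sym2[of "?T2 w p \<nu>" "?T w p"]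
  unfolding dh w2_def[symmetric] sw by (simp add: inner_add_left field_simps)
qed

lemma first_form_inner:
 fixes F :: "real ^ 2 \<Rightarrow> real ^ 3"
 assumes "linear (fder F u)"
 shows "c \<bullet> (first_form g F u *v d) = fder F u c \<bullet> (g (F u) *v fder F u d)" by (subst (1 2) linear_axis_expansion[OF assms])
  (simp add: first_form_def pderiv_at_def inner_vec_def[of c] matrix_vector_mult_def[of "\<chi> a b. _ a b"] sum_2
    inner_add_left inner_add_right matrix_vector_right_distrib matrix_vector_mult_scaleR algebra_simps)

lemma mean_curvature_orthonormal:
 fixes c1 c2 :: "real ^ 2"
 assumes "c1 \<bullet> (first_form g F u *v c1) = 1" "c2 \<bullet> (first_form g F u *v c2) = 1"
  "c1 \<bullet> (first_form g F u *v c2) = 0" "c2 \<bullet> (first_form g F u *v c1) = 0"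
 shows "2 * mean_curvature g F u \<nu> = c1 \<bullet> (second_form g F u \<nu> *v c1) + c2 \<bullet> (second_form g F u \<nu> *v c2)"
proof -
 define I where "I = first_form g F u"
 define S where "S = second_form g F u \<nu>"
 define C :: "real ^ 2 ^ 2" where "C = (\<chi> i j. if j = 1 then c1 $ i else c2 $ i)"
 have tr: "transpose C ** M ** C = (\<chi> i j. (if i = 1 then c1 else c2) \<bullet> (M *v (if j = 1 then c1 else c2)))" for M
  by (simp add: vec_eq_iff matrix_matrix_mult_def transpose_def C_def inner_vec_def matrix_vector_mult_def sum_2 forall_2 algebra_simps)
 have "transpose C ** I ** C = mat 1" unfolding tr using assms by (simp add: vec_eq_iff forall_2 mat_def I_def)
 hence "transpose C ** (I ** C) = mat 1" by (simp add: matrix_mul_assoc)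
 hence "(I ** C) ** transpose C = mat 1" using matrix_left_right_inverse by blast
 hence inv: "I ** (C ** transpose C) = mat 1" by (simp add: matrix_mul_assoc)
 hence "matrix_inv I = C ** transpose C" by (rule matrix_inv_eqI)
 hence "2 * mean_curvature g F u \<nu> = trace (C ** transpose C ** S)" by (simp add: mean_curvature_def I_def S_def)
 also have "\<dots> = trace (transpose C ** S ** C)" by (metis matrix_mul_assoc trace_mul_sym)
 also have "\<dots> = c1 \<bullet> (S *v c1) + c2 \<bullet> (S *v c2)" unfolding tr by (simp add: trace_def sum_2)
 finally show ?thesis by (simp add: S_def)
qed

lemma mean_curvature_uminus: "mean_curvature g F u (- \<nu>) = - mean_curvature g F u \<nu>"
proof -
 have "g (F u) *v (- \<nu>) = - (g (F u) *v \<nu>)" by (simp add: vec_eq_iff matrix_vector_mult_def sum_negf)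
 hence "second_form g F u (- \<nu>) = (\<chi> a b. - (cov_deriv g F u a b \<bullet> (g (F u) *v \<nu>)))"
  unfolding second_form_def by (simp only: inner_minus_right)
 hence "second_form g F u (- \<nu>) = - second_form g F u \<nu>" by (simp add: second_form_def vec_eq_iff)
 thus ?thesis by (simp add: mean_curvature_def trace_def matrix_matrix_mult_def sum_negf)
qed

section \<open>Barriers\<close>

definition hor :: "real ^ 3 \<Rightarrow> real ^ 2" where "hor y = (\<chi> i. if i = 1 then y $ 1 else y $ 2)"

definition pt :: "real ^ 2 \<Rightarrow> real \<Rightarrow> real ^ 3" where
 "pt x z = (\<chi> i. if i = 1 then x $ 1 else if i = 2 then x $ 2 else z)"

lemma hor_nth [simp]: "hor y $ 1 = y $ 1" "hor y $ 2 = y $ 2" by (simp_all add: hor_def)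

lemma pt_nth [simp]: "pt x z $ 1 = x $ 1" "pt x z $ 2 = x $ 2" "pt x z $ 3 = z" by (simp_all add: pt_def)

lemma hor_pt [simp]: "hor (pt x z) = x" by (simp add: vec_eq_iff forall_2)

lemma pt_hor [simp]: "pt (hor y) (y $ 3) = y" by (simp add: vec_eq_iff forall_3)

lemma pt_eq_iff [simp]: "pt x z = pt x' z' \<longleftrightarrow> x = x' \<and> z = z'" by (auto simp: vec_eq_iff forall_3 forall_2)

lemma pt_add: "pt x z + pt x' z' = pt (x + x') (z + z')" and pt_scaleR: "r *\<^sub>R pt x z = pt (r *\<^sub>R x) (r * z)"
 by (simp_all add: vec_eq_iff forall_3)

lemma inner_pt: "u \<bullet> v = hor u \<bullet> hor v + u $ 3 * v $ 3" by (simp add: inner_vec_def sum_2 sum_3)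

lemma linear_hor: "linear hor" by (auto intro!: linearI simp: vec_eq_iff forall_2)

lemma hor_add [simp]: "hor (u + v) = hor u + hor v" and hor_scaleR [simp]: "hor (r *\<^sub>R u) = r *\<^sub>R hor u"
 and hor_0 [simp]: "hor 0 = 0" and hor_diff [simp]: "hor (u - v) = hor u - hor v" by (simp_all add: vec_eq_iff forall_2)

lemma bounded_linear_hor: "bounded_linear hor" using linear_hor linear_conv_bounded_linear by blast

lemma second_derivative_test:
 fixes \<phi> :: "real \<Rightarrow> real"
 assumes e: "e > 0" and d1: "\<And>t. \<bar>t\<bar> < e \<Longrightarrow> (\<phi> has_real_derivative \<phi>' t) (at t)"
  and d2: "(\<phi>' has_real_derivative d) (at 0)" and min: "\<And>t. \<bar>t\<bar> < e \<Longrightarrow> \<phi> 0 \<le> \<phi> t"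
 shows "\<phi>' 0 = 0" "0 \<le> d"
proof -
 show 0: "\<phi>' 0 = 0" using DERIV_local_min[OF d1[of 0], of e] e min by auto
 show "0 \<le> d"
 proof (rule ccontr)
  assume "\<not> 0 \<le> d"
  then obtain r where r: "r > 0" "\<And>h. 0 < h \<Longrightarrow> h < r \<Longrightarrow> \<phi>' (0 + h) < \<phi>' 0" using DERIV_neg_dec_right[OF d2] by auto
  define t where "t = min e r / 2"
  have t: "0 < t" "t < e" "t < r" using e r by (auto simp: t_def)
  obtain z where z: "0 < z" "z < t" "\<phi> t - \<phi> 0 = t * \<phi>' z" using MVT2[of 0 t \<phi> \<phi>'] d1 t by auto
  hence "\<phi> t - \<phi> 0 < 0" using r(2)[of z] t 0 by (simp add: mult_pos_neg)
  thus False using min[of t] t by simp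
 qed
qed

lemma orthonormal_trace:
 fixes r1 r2 r3 :: "real ^ 3" and B :: "real ^ 3 \<Rightarrow> real ^ 3 \<Rightarrow> real"
 assumes B: "bilinear B"
  and r: "r1 \<bullet> r1 = 1" "r2 \<bullet> r2 = 1" "r3 \<bullet> r3 = 1" "r1 \<bullet> r2 = 0" "r1 \<bullet> r3 = 0" "r2 \<bullet> r3 = 0"
 shows "B r1 r1 + B r2 r2 + B r3 r3 = (\<Sum>i\<in>UNIV. B (axis i 1) (axis i 1))"
  and "x = (x \<bullet> r1) *\<^sub>R r1 + (x \<bullet> r2) *\<^sub>R r2 + (x \<bullet> r3) *\<^sub>R r3"
proof -
 define Q :: "real ^ 3 ^ 3" where "Q = (\<chi> i. if i = 1 then r1 else if i = 2 then r2 else r3)"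
 have "Q ** transpose Q = mat 1"
  using r unfolding Q_def by (simp add: vec_eq_iff forall_3 matrix_matrix_mult_def transpose_def mat_def inner_vec_def sum_3 mult.commute)
 hence QQ: "transpose Q ** Q = mat 1" using matrix_left_right_inverse by blast
 have ij: "r1 $ i * r1 $ j + r2 $ i * r2 $ j + r3 $ i * r3 $ j = (if i = j then 1 else 0)" for i j
  using arg_cong[OF QQ, of "\<lambda>M. M $ i $ j"] by (simp add: matrix_matrix_mult_def transpose_def mat_def Q_def sum_3)
 have expand: "B r r = (\<Sum>i\<in>UNIV. \<Sum>j\<in>UNIV. (r $ i * r $ j) * B (axis i 1) (axis j 1))" for r
 proof -
  have l: "linear (\<lambda>x. B x y)" "linear (\<lambda>y. B x y)" for x y using B by (auto simp: bilinear_def)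
  have "B r r = (\<Sum>i\<in>UNIV. r $ i *\<^sub>R B (axis i 1) r)" by (rule linear_axis_expansion[OF l(1)])
  also have "\<dots> = (\<Sum>i\<in>UNIV. r $ i *\<^sub>R (\<Sum>j\<in>UNIV. r $ j *\<^sub>R B (axis i 1) (axis j 1)))"
   by (intro sum.cong refl arg_cong2[where f = scaleR] linear_axis_expansion[OF l(2)])
  finally show ?thesis by (simp add: sum_distrib_left mult.assoc)
 qed
 have "B r1 r1 + B r2 r2 + B r3 r3 =
   (\<Sum>i\<in>UNIV. \<Sum>j\<in>UNIV. (r1 $ i * r1 $ j + r2 $ i * r2 $ j + r3 $ i * r3 $ j) * B (axis i 1) (axis j 1))"
  unfolding expand by (simp add: distrib_right sum.distrib)
 thus "B r1 r1 + B r2 r2 + B r3 r3 = (\<Sum>i\<in>UNIV. B (axis i 1) (axis i 1))" unfolding ij by (simp add: sum_3)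
 have "x = transpose Q *v (Q *v x)" by (simp add: matrix_vector_mul_assoc QQ)
 also have "\<dots> = (x \<bullet> r1) *\<^sub>R r1 + (x \<bullet> r2) *\<^sub>R r2 + (x \<bullet> r3) *\<^sub>R r3"
  by (simp add: vec_eq_iff matrix_vector_mult_def transpose_def Q_def sum_3 inner_vec_def algebra_simps)
 finally show "x = (x \<bullet> r1) *\<^sub>R r1 + (x \<bullet> r2) *\<^sub>R r2 + (x \<bullet> r3) *\<^sub>R r3" .
qed

lemma orthonormal_pair_form:
 fixes q :: "real ^ 2 \<Rightarrow> real ^ 2 \<Rightarrow> real"
 assumes q: "bilinear q" and sym: "\<And>c d. q c d = q d c" and pos: "\<And>c. c \<noteq> 0 \<Longrightarrow> 0 < q c c"
 obtains c1 c2 where "q c1 c1 = 1" "q c2 c2 = 1" "q c1 c2 = 0"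
proof -
 let ?a = "axis 1 1 :: real ^ 2" and ?b = "axis 2 1 :: real ^ 2"
 note sc = bilinear_lmul[OF q] bilinear_rmul[OF q]
 define c1 where "c1 = (1 / sqrt (q ?a ?a)) *\<^sub>R ?a"
 define d where "d = ?b - q ?b c1 *\<^sub>R c1"
 define c2 where "c2 = (1 / sqrt (q d d)) *\<^sub>R d"
 have pa: "0 < q ?a ?a" by (rule pos) (simp add: vec_eq_iff forall_2 axis_def)
 have "d $ 2 = 1" by (simp add: d_def c1_def axis_def)
 hence pd: "0 < q d d" by (intro pos) (auto simp: vec_eq_iff forall_2)
 have 1: "q c1 c1 = 1" using pa by (simp add: c1_def sc)
 moreover have "q c2 c2 = 1" using pd by (simp add: c2_def sc)
 moreover have "q c1 d = 0" using 1 by (simp add: d_def bilinear_rsub[OF q] sc sym[of c1 ?b])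
 hence "q c1 c2 = 0" by (simp add: c2_def sc)
 ultimately show thesis using that by blast
qed

locale flow_frame =
 fixes L :: "real \<Rightarrow> real ^ 2 \<Rightarrow> real ^ 2" and A :: "real ^ 2 \<Rightarrow> real ^ 2" and a :: real
 assumes linL: "linear (L z)" and linA: "linear A" and injL: "inj (L z)"
  and dL: "((\<lambda>z. L z x) has_vector_derivative A (L z x)) (at z)"
  and normA: "norm (A x) \<le> a * norm x" and a0: "a \<ge> 0"
begin

definition trA :: real where "trA = A (axis 1 1) $ 1 + A (axis 2 1) $ 2"

definition frm :: "real \<Rightarrow> real ^ 3 \<Rightarrow> real ^ 3" where "frm z u = pt (L z (hor u)) (u $ 3)"

definition met :: "real ^ 3 \<Rightarrow> real ^ 3 \<Rightarrow> real ^ 3 \<Rightarrow> real" where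
 "met y u v = frm (y $ 3) u \<bullet> frm (y $ 3) v"

lemma met_eq: "met y u v = L (y $ 3) (hor u) \<bullet> L (y $ 3) (hor v) + u $ 3 * v $ 3" by (simp add: met_def frm_def inner_pt)

lemma linear_frm: "linear (frm z)"
 by (auto intro!: linearI simp: frm_def linear_add[OF linL] linear_scale[OF linL] pt_add pt_scaleR)

lemma inj_frm: "inj (frm z)" unfolding inj_def frm_def using injL[of z] by (auto simp: inj_def) (metis pt_hor)

lemma surj_frm: "surj (frm z)" using linear_frm inj_frm linear_injective_imp_surjective by blast

lemma abs_trA: "\<bar>trA\<bar> \<le> 2 * a"
proof -
 have "\<bar>A (axis i 1) $ i\<bar> \<le> a" for i using component_le_norm_cart[of "A (axis i 1)" i] normA[of "axis i 1"] by simp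
 from this[of 1] this[of 2] show ?thesis unfolding trA_def by linarith
qed

lemma has_vector_derivative_L:
 assumes "(x has_vector_derivative x') (at t)" "(z has_real_derivative z') (at t)"
 shows "((\<lambda>t. L (z t) (x t)) has_vector_derivative L (z t) x' + z' *\<^sub>R A (L (z t) (x t))) (at t)"
proof -
 have exp: "L z x = (\<Sum>i\<in>UNIV. x $ i *\<^sub>R L z (axis i 1))" for z x by (rule linear_axis_expansion[OF linL])
 have "((\<lambda>t. L (z t) v) has_vector_derivative z' *\<^sub>R A (L (z t) v)) (at t)" for v
  using vector_diff_chain_at[of z z' t "\<lambda>z. L z v"] assms(2) dL[of v "z t"]
  by (simp add: has_real_derivative_iff_has_vector_derivative o_def)
 moreover have "((\<lambda>t. x t $ i) has_real_derivative x' $ i) (at t)" for i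
  unfolding has_real_derivative_iff_has_vector_derivative
  by (rule bounded_linear.has_vector_derivative[OF bounded_linear_vec_nth assms(1)])
 ultimately have "((\<lambda>t. \<Sum>i\<in>UNIV. x t $ i *\<^sub>R L (z t) (axis i 1)) has_vector_derivative
   (\<Sum>i\<in>UNIV. x t $ i *\<^sub>R (z' *\<^sub>R A (L (z t) (axis i 1))) + x' $ i *\<^sub>R L (z t) (axis i 1))) (at t)"
  by (intro has_vector_derivative_sum has_vector_derivative_scaleR)
 moreover have "(\<Sum>i\<in>UNIV. x t $ i *\<^sub>R (z' *\<^sub>R A (L (z t) (axis i 1))) + x' $ i *\<^sub>R L (z t) (axis i 1))
   = L (z t) x' + z' *\<^sub>R A (L (z t) (x t))" unfolding exp[of "z t" x'] exp[of "z t" "x t"]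
  by (simp add: sum.distrib linear_sum[OF linA] linear_scale[OF linA] scaleR_sum_right mult.commute)
 ultimately show ?thesis by (simp only: exp[symmetric])
qed

lemma frechet_derivative_met:
 "fder (\<lambda>y. met y u v) y w =
   w $ 3 * (A (L (y $ 3) (hor u)) \<bullet> L (y $ 3) (hor v) + L (y $ 3) (hor u) \<bullet> A (L (y $ 3) (hor v)))"
proof -
 have d: "((\<lambda>y. L (y $ 3) x) has_derivative (\<lambda>w. w $ 3 *\<^sub>R A (L (y $ 3) x))) (at y)" for x
  using has_derivative_compose[OF bounded_linear_imp_has_derivative[OF bounded_linear_vec_nth[of 3]],
    of "\<lambda>z. L z x" _ y] dL[of x "y $ 3"] unfolding has_vector_derivative_def by blast
 have "((\<lambda>y. met y u v) has_derivative (\<lambda>w. L (y $ 3) (hor u) \<bullet> w $ 3 *\<^sub>R A (L (y $ 3) (hor v))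
   + w $ 3 *\<^sub>R A (L (y $ 3) (hor u)) \<bullet> L (y $ 3) (hor v) + 0)) (at y)"
  unfolding met_eq by (intro has_derivative_add has_derivative_inner d has_derivative_const)
 thus ?thesis by (simp add: frechet_derivative_eqI algebra_simps)
qed

text \<open>The leading terms are collected so that the horizontal part \<open>N\<close> of the normal controls all errors.\<close>

lemma barrier_estimate:
 fixes y N :: "real ^ 2" and s \<mu> n3 f1 f2 M \<kappa> H W1 :: real
 assumes K: "K = 1 + (4 * M + 4) * a\<^sup>2 + 4 * M + 12 * M * a + 21 * a" and M: "M \<ge> 0"
  and s_def: "s = y \<bullet> y"
  and f: "0 < f1" "f1 \<le> 1" "f1 * s \<le> 1 / (8 * (a + 1))" "\<bar>f2\<bar> * s \<le> M * f1" "f2 * s + f1 \<le> 0"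
  and y: "y \<noteq> 0" and W1: "1/2 \<le> W1" "W1 \<le> 1"
  and \<mu>: "0 < \<mu>" "\<mu> *\<^sub>R N = (2 * f1) *\<^sub>R y" "\<mu> * n3 = W1 + 2 * f1 * (y \<bullet> A y)" and N: "N \<bullet> N + n3\<^sup>2 = 1"
  and H: "2 * H \<le> - trA"
 shows "4 * (f2 * s + f1) + \<mu> * n3 * trA
   + (- K + 4 * f2 * (y \<bullet> A y)\<^sup>2 + 2 * f1 * (A y \<bullet> A y) + 2 * f1 * (y \<bullet> A (A y)))
   - (- K * n3\<^sup>2 + 4 * f2 * (y \<bullet> N + n3 * (y \<bullet> A y))\<^sup>2 + 2 * f1 * ((N + n3 *\<^sub>R A y) \<bullet> (N + n3 *\<^sub>R A y))
    + 4 * f1 * n3 * (y \<bullet> A N) + 2 * f1 * n3\<^sup>2 * (y \<bullet> A (A y)) - \<mu> * n3 * (A N \<bullet> N + N \<bullet> A N) + \<mu> * n3 * (A N \<bullet> N))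
   + 2 * \<mu> * H < 0" (is "?T < 0")
proof -
 define Q where "Q = N \<bullet> N"
 have s: "s > 0" using y by (simp add: s_def)
 have s': "norm y * norm y = s" and Q': "norm N * norm N = Q" by (simp_all add: s_def Q_def dot_square_norm power2_eq_square)
 have N0: "N \<noteq> 0" using \<mu>(2) y f(1) by auto
 hence Q: "Q > 0" by (simp add: Q_def)
 have Q1: "1 - n3\<^sup>2 = Q" using N by (simp add: Q_def)
 have \<kappa>: "f1 * s * a \<le> 1/8" "f1 * s \<le> 1/8"
 proof -
  have "f1 * s * (8 * (a + 1)) \<le> 1" using f(3) a0 by (simp add: field_simps)
  moreover have "0 \<le> f1 * s" using f(1) s by simp
  moreover have "0 \<le> f1 * s * a" using f(1) s a0 by simp
  ultimately show "f1 * s * a \<le> 1/8" "f1 * s \<le> 1/8" by (simp_all add: algebra_simps)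
 qed
 have Ay: "\<bar>y \<bullet> A y\<bar> \<le> a * s"
  using Cauchy_Schwarz_ineq2[of y "A y"] mult_left_mono[OF normA[of y] norm_ge_zero[of y]] s' by (simp add: algebra_simps)
 have AA: "A y \<bullet> A y \<le> a\<^sup>2 * s"
 proof -
  have "norm (A y) * norm (A y) \<le> (a * norm y) * (a * norm y)" by (intro mult_mono normA) (auto simp: a0)
  thus ?thesis by (simp add: dot_square_norm power2_eq_square s'[symmetric] algebra_simps)
 qed
 have yAA: "y \<bullet> A (A y) \<le> a\<^sup>2 * s"
 proof -
  have "y \<bullet> A (A y) \<le> norm y * norm (A (A y))" by (rule norm_cauchy_schwarz)
  also have "\<dots> \<le> norm y * (a * (a * norm y))"
   using normA[of "A y"] mult_left_mono[OF normA[of y] a0] by (intro mult_left_mono) auto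
  finally show ?thesis by (simp add: s'[symmetric] power2_eq_square algebra_simps)
 qed
 have yN: "f1 * (norm y * norm N) = \<mu> * Q / 2"
 proof -
  have "norm (\<mu> *\<^sub>R N) = norm ((2 * f1) *\<^sub>R y)" using \<mu>(2) by simp
  hence "\<mu> * norm N = 2 * f1 * norm y" using \<mu>(1) f(1) by simp
  thus ?thesis unfolding Q'[symmetric] by (simp add: field_simps)
 qed
 have \<mu>n3: "1/4 \<le> \<mu> * n3" "\<mu> * n3 \<le> 5/4"
 proof -
  have "\<bar>2 * f1 * (y \<bullet> A y)\<bar> \<le> 2 * (f1 * s * a)" using Ay f(1) by (simp add: abs_mult algebra_simps)
  hence "\<bar>2 * f1 * (y \<bullet> A y)\<bar> \<le> 1/4" using \<kappa>(1) by linarith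
  thus "1/4 \<le> \<mu> * n3" "\<mu> * n3 \<le> 5/4" using W1 unfolding \<mu>(3) by linarith+
 qed
 have n3: "0 < n3" using \<mu>n3(1) \<mu>(1) zero_less_mult_pos[of \<mu> n3] by linarith
 have n31: "n3 \<le> 1" using Q1 Q by (metis diff_gt_0_iff_gt less_eq_real_def one_power2 power2_le_imp_le zero_le_one)
 have \<mu>3: "\<mu> \<le> 3"
 proof -
  have "\<mu>\<^sup>2 = \<mu>\<^sup>2 * (Q + n3\<^sup>2)" using N by (simp add: Q_def)
  also have "\<dots> = (\<mu> *\<^sub>R N) \<bullet> (\<mu> *\<^sub>R N) + (\<mu> * n3)\<^sup>2" by (simp add: Q_def power2_eq_square algebra_simps)
  also have "(\<mu> *\<^sub>R N) \<bullet> (\<mu> *\<^sub>R N) = 4 * f1 * (f1 * s)" unfolding \<mu>(2) by (simp add: s_def)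
  also have "4 * f1 * (f1 * s) \<le> 4 * 1 * (1/8)" using f \<kappa>(2) s by (intro mult_mono) auto
  also have "(\<mu> * n3)\<^sup>2 \<le> (5/4)\<^sup>2" using \<mu>n3 by (intro power_mono) auto
  finally have "\<mu>\<^sup>2 \<le> 3\<^sup>2" by (simp add: power2_eq_square)
  thus ?thesis by (rule power2_le_imp_le) simp
 qed
 have t1: "4 * f2 * (y \<bullet> A y)\<^sup>2 + 2 * f1 * (A y \<bullet> A y) + 2 * f1 * (y \<bullet> A (A y)) \<le> (4 * M + 4) * a\<^sup>2"
 proof -
  have "f2 * (y \<bullet> A y)\<^sup>2 \<le> \<bar>f2\<bar> * (a * s)\<^sup>2" using Ay by (intro mult_mono) (auto simp: power2_le_iff_abs_le)
  also have "\<dots> = (\<bar>f2\<bar> * s) * (a\<^sup>2 * s)" by (simp add: power2_eq_square)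
  also have "\<dots> \<le> (M * f1) * (a\<^sup>2 * s)" using f(4) s by (intro mult_right_mono) auto
  finally have 1: "f2 * (y \<bullet> A y)\<^sup>2 \<le> M * a\<^sup>2 * (f1 * s)" by (simp add: algebra_simps)
  have 2: "M * a\<^sup>2 * (f1 * s) \<le> M * a\<^sup>2 * 1" using \<kappa>(2) M by (intro mult_left_mono) auto
  have 3: "a\<^sup>2 * (f1 * s) \<le> a\<^sup>2 * 1" using \<kappa>(2) by (intro mult_left_mono) auto
  have 4: "f1 * (A y \<bullet> A y) \<le> a\<^sup>2 * (f1 * s)" using mult_left_mono[OF AA, of f1] f(1) by (simp add: algebra_simps)
  have 5: "f1 * (y \<bullet> A (A y)) \<le> a\<^sup>2 * (f1 * s)" using mult_left_mono[OF yAA, of f1] f(1) by (simp add: algebra_simps)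
  have lin: "4 * p + 2 * q + 2 * r \<le> 4 * u + 4 * v" if "p \<le> u" "q \<le> v" "r \<le> v" for p q r u v :: real using that by linarith
  show ?thesis using lin[OF order_trans[OF 1 2] order_trans[OF 4 3] order_trans[OF 5 3]]
   by (simp only: mult_1_right distrib_right mult.assoc)
 qed
 hence t1': "Q * (4 * f2 * (y \<bullet> A y)\<^sup>2 + 2 * f1 * (A y \<bullet> A y) + 2 * f1 * (y \<bullet> A (A y))) \<le> Q * ((4 * M + 4) * a\<^sup>2)"
  using Q by (intro mult_left_mono) auto
 have yN2: "(y \<bullet> N)\<^sup>2 \<le> s * Q" using Cauchy_Schwarz_ineq[of y N] by (simp add: s_def Q_def)
 have t2: "- (4 * f2 * (y \<bullet> N)\<^sup>2) \<le> Q * (4 * M)"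
 proof -
  have "- f2 * (y \<bullet> N)\<^sup>2 \<le> \<bar>f2\<bar> * (s * Q)" using yN2 by (intro mult_mono) auto
  also have "\<dots> = (\<bar>f2\<bar> * s) * Q" by simp
  also have "\<dots> \<le> (M * f1) * Q" using f(4) Q by (intro mult_right_mono) auto
  also have "\<dots> \<le> (M * 1) * Q" using f M Q by (intro mult_right_mono mult_left_mono) auto
  finally have "4 * (- f2 * (y \<bullet> N)\<^sup>2) \<le> 4 * ((M * 1) * Q)" by (rule mult_left_mono) simp
  thus ?thesis by (simp only: mult_1_right mult_minus_left mult_minus_right mult.assoc mult.left_commute mult.commute)
 qed
 have absyN: "\<bar>y \<bullet> N\<bar> \<le> norm y * norm N" by (rule Cauchy_Schwarz_ineq2)
 have t3: "- (8 * f2 * n3 * (y \<bullet> N) * (y \<bullet> A y)) \<le> Q * (12 * M * a)"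
 proof -
  have "- (f2 * n3 * (y \<bullet> N) * (y \<bullet> A y)) \<le> \<bar>f2\<bar> * n3 * (\<bar>y \<bullet> N\<bar> * \<bar>y \<bullet> A y\<bar>)"
   using n3 abs_ge_minus_self[of "f2 * n3 * (y \<bullet> N) * (y \<bullet> A y)"] by (simp add: abs_mult mult.assoc)
  also have "\<dots> \<le> \<bar>f2\<bar> * 1 * ((norm y * norm N) * (a * s))" using n31 n3 absyN Ay by (intro mult_mono mult_left_mono) auto
  also have "\<dots> = (\<bar>f2\<bar> * s) * (a * (norm y * norm N))" by simp
  also have "\<dots> \<le> (M * f1) * (a * (norm y * norm N))" using f(4) a0 by (intro mult_right_mono) auto
  also have "\<dots> = M * a * (f1 * (norm y * norm N))" by simp
  also have "\<dots> = M * a * (\<mu> * Q / 2)" unfolding yN ..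
  also have "\<dots> \<le> M * a * (3 * Q / 2)" using M a0 \<mu>3 Q by (intro mult_left_mono divide_right_mono mult_right_mono) auto
  finally show ?thesis by (simp add: algebra_simps)
 qed
 have t4: "- (4 * f1 * n3 * (N \<bullet> A y + y \<bullet> A N)) \<le> Q * (12 * a)"
 proof -
  have "\<bar>N \<bullet> A y\<bar> \<le> norm N * (a * norm y)"
   using Cauchy_Schwarz_ineq2[of N "A y"] mult_left_mono[OF normA[of y] norm_ge_zero[of N]] by linarith
  moreover have "\<bar>y \<bullet> A N\<bar> \<le> norm y * (a * norm N)"
   using Cauchy_Schwarz_ineq2[of y "A N"] mult_left_mono[OF normA[of N] norm_ge_zero[of y]] by linarith
  ultimately have "- (N \<bullet> A y + y \<bullet> A N) \<le> 2 * a * (norm y * norm N)" by (simp add: algebra_simps)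
  hence "(f1 * n3) * - (N \<bullet> A y + y \<bullet> A N) \<le> (f1 * n3) * (2 * a * (norm y * norm N))"
   using f(1) n3 by (intro mult_left_mono) auto
  also have "\<dots> \<le> (f1 * 1) * (2 * a * (norm y * norm N))" using f(1) n31 a0 by (intro mult_right_mono mult_left_mono) auto
  also have "\<dots> = 2 * a * (\<mu> * Q / 2)" unfolding yN[symmetric] by simp
  also have "\<dots> \<le> 2 * a * (3 * Q / 2)" using a0 \<mu>3 Q by (intro mult_left_mono divide_right_mono mult_right_mono) auto
  finally show ?thesis by (simp add: algebra_simps)
 qed
 have t5: "\<mu> * n3 * (A N \<bullet> N) \<le> Q * (3 * a)"
 proof -
  have "A N \<bullet> N \<le> a * Q"
   using norm_cauchy_schwarz[of "A N" N] mult_right_mono[OF normA[of N] norm_ge_zero[of N]] by (simp add: Q'[symmetric] algebra_simps)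
  hence "(\<mu> * n3) * (A N \<bullet> N) \<le> (\<mu> * n3) * (a * Q)" using \<mu>n3 by (intro mult_left_mono) auto
  also have "\<dots> \<le> 3 * (a * Q)" using \<mu>n3 a0 Q by (intro mult_right_mono) auto
  finally show ?thesis by (simp add: algebra_simps)
 qed
 have t6: "\<mu> * n3 * trA + 2 * \<mu> * H \<le> Q * (6 * a)"
 proof -
  have "\<mu> * (n3 * trA + 2 * H) \<le> \<mu> * (n3 * trA - trA)" using H \<mu>(1) by (intro mult_left_mono) auto
  also have "n3 * trA - trA \<le> (1 - n3) * (2 * a)"
  proof -
   have "(1 - n3) * (- trA) \<le> (1 - n3) * (2 * a)" using abs_trA n31 by (intro mult_left_mono) auto
   thus ?thesis by (simp add: algebra_simps)
  qed
  also have "(1 - n3) * (2 * a) \<le> Q * (2 * a)"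
  proof (rule mult_right_mono)
   have "n3\<^sup>2 \<le> n3" using n3 n31 by (simp add: power2_eq_square)
   thus "1 - n3 \<le> Q" using Q1 by linarith
  qed (use a0 in simp)
  also have "\<mu> * (Q * (2 * a)) \<le> 3 * (Q * (2 * a))" using \<mu>3 Q a0 by (intro mult_right_mono) auto
  finally have "\<mu> * (n3 * trA + 2 * H) \<le> 3 * (Q * (2 * a))" using \<mu>(1) by (simp add: mult_left_mono)
  thus ?thesis by (simp add: algebra_simps)
 qed
 define V where "V = 4 * f2 * (y \<bullet> A y)\<^sup>2 + 2 * f1 * (A y \<bullet> A y) + 2 * f1 * (y \<bullet> A (A y))"
 define X2 where "X2 = 4 * f2 * (y \<bullet> N)\<^sup>2"
 define X3 where "X3 = 8 * f2 * n3 * (y \<bullet> N) * (y \<bullet> A y)"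
 define X4 where "X4 = 4 * f1 * n3 * (N \<bullet> A y + y \<bullet> A N)"
 define X5 where "X5 = \<mu> * n3 * (A N \<bullet> N)"
 define X6 where "X6 = \<mu> * n3 * trA + 2 * \<mu> * H"
 have "?T = 4 * (f2 * s + f1) + (1 - n3\<^sup>2) * V - (1 - n3\<^sup>2) * K - X2 - X3 - 2 * f1 * Q - X4 + X5 + X6"
  unfolding V_def X2_def X3_def X4_def X5_def X6_def Q_def s_def
   inner_add_left inner_add_right inner_scaleR_left inner_scaleR_right inner_commute[of "A y" N] inner_commute[of N "A N"]
  by (simp add: power2_eq_square algebra_simps)
 also have "\<dots> = 4 * (f2 * s + f1) + Q * V - Q * K - X2 - X3 - 2 * (f1 * Q) - X4 + X5 + X6" unfolding Q1 by simp
 also have "\<dots> \<le> Q * ((4 * M + 4) * a\<^sup>2) - Q * K + Q * (4 * M) + Q * (12 * M * a) + Q * (12 * a) + Q * (3 * a) + Q * (6 * a)"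
 proof -
  have lin: "4 * d + v - k - x2 - x3 - 2 * e - x4 + x5 + x6 \<le> v' - k + x2' + x3' + x4' + x5' + x6'"
   if "d \<le> 0" "0 < e" "v \<le> v'" "- x2 \<le> x2'" "- x3 \<le> x3'" "- x4 \<le> x4'" "x5 \<le> x5'" "x6 \<le> x6'"
   for d e k v v' x2 x2' x3 x3' x4 x4' x5 x5' x6 x6' :: real using that by linarith
  show ?thesis by (rule lin[OF f(5) mult_pos_pos[OF f(1) Q] t1'[folded V_def] t2[folded X2_def] t3[folded X3_def]
      t4[folded X4_def] t5[folded X5_def] t6[folded X6_def]])
 qed
 also have "\<dots> = - Q" unfolding K by (simp add: algebra_simps)
 finally show ?thesis using Q by linarith
qed

end

context flow_frame
begin

text \<open>\<open>F\<close> is a parametrized surface in a chart with metric \<open>g\<close>, and \<open>F0\<close> the same surface in the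
 coordinates \<open>\<theta>\<close>, in which the metric is \<^const>\<open>met\<close>.\<close>

definition adapted ::
  "(real ^ 3 \<Rightarrow> real ^ 3 ^ 3) \<Rightarrow> (real ^ 2 \<Rightarrow> real ^ 3) \<Rightarrow> (real ^ 3 \<Rightarrow> real ^ 3) \<Rightarrow> (real ^ 2 \<Rightarrow> real ^ 3) \<Rightarrow>
   (real ^ 2) set \<Rightarrow> (real ^ 3) set \<Rightarrow> bool" where
 "adapted g F \<theta> F0 U V \<longleftrightarrow> open U \<and> open V \<and> Ck_on 2 U F0 \<and> F0 ` U \<subseteq> V \<and> Ck_on 2 V \<theta> \<and> (\<forall>x\<in>U. F x = \<theta> (F0 x)) \<and>
   (\<forall>x\<in>U. g differentiable (at (F x)) \<and> invertible (g (F x)) \<and> transpose (g (F x)) = g (F x)) \<and>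
   (\<forall>y\<in>V. \<forall>v w. met y v w = fder \<theta> y v \<bullet> (g (\<theta> y) *v fder \<theta> y w)) \<and>
   (\<forall>x\<in>U. inj (fder F0 x))"

context
 fixes g F \<theta> F0 U V u
 assumes ad: "adapted g F \<theta> F0 U V" and uU: "u \<in> U"
begin

lemma adaptedD:
 shows "open U" "open V" "Ck_on 2 U F0" "F0 ` U \<subseteq> V" "Ck_on 2 V \<theta>" "\<And>x. x \<in> U \<Longrightarrow> F x = \<theta> (F0 x)"
  "g differentiable (at (F u))" "invertible (g (F u))" "transpose (g (F u)) = g (F u)"
  "\<And>y v w. y \<in> V \<Longrightarrow> met y v w = fder \<theta> y v \<bullet> (g (\<theta> y) *v fder \<theta> y w)"
  "inj (fder F0 u)" using ad uU by (auto simp: adapted_def)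

lemma F0_derivative:
 assumes "x \<in> U"
 shows "(F0 has_derivative fder F0 x) (at x)" "linear (fder F0 x)"
  "((\<lambda>x. fder F0 x c) has_derivative fder (\<lambda>x. fder F0 x c) x) (at x)"
proof -
 have 1: "Ck_on (Suc 0) U F0" using adaptedD(3) Ck_on_Suc_imp[of 1 U F0] by (simp add: numeral_2_eq_2)
 show "(F0 has_derivative fder F0 x) (at x)" "linear (fder F0 x)" using Ck_on_frechet_derivative_works[OF 1 assms] by auto
 show "((\<lambda>x. fder F0 x c) has_derivative fder (\<lambda>x. fder F0 x c) x) (at x)"
  using Ck_on_frechet_derivative_works(1)[of 0 U "\<lambda>x. fder F0 x c", OF _ assms] adaptedD(3) by (simp add: numeral_2_eq_2)
qed

lemma F0_flat:
 assumes z: "\<And>x. x \<in> U \<Longrightarrow> F0 x $ 3 = z" and x: "x \<in> U" shows "fder F0 x c $ 3 = 0"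
proof -
 have "((\<lambda>x. F0 x $ 3) has_derivative (\<lambda>c. fder F0 x c $ 3)) (at x)"
  by (rule bounded_linear.has_derivative[OF bounded_linear_vec_nth F0_derivative(1)[OF x]])
 moreover have "((\<lambda>x. F0 x $ 3) has_derivative (\<lambda>c. 0)) (at x)"
  by (rule has_derivative_transform_within_open[OF has_derivative_const[of z] adaptedD(1) x]) (simp add: z)
 ultimately show ?thesis using has_derivative_unique by metis
qed

lemma F0u: "F0 u \<in> V" using adaptedD(4) uU by blast

lemma \<theta>_derivative: "(\<theta> has_derivative fder \<theta> (F0 u)) (at (F0 u))" "linear (fder \<theta> (F0 u))"
 using Ck_on_frechet_derivative_works[OF _ F0u, of 0 \<theta>] Ck_on_Suc_imp[of 1 V \<theta>] adaptedD(5) by (simp_all add: numeral_2_eq_2)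

lemma F_derivative: "fder F u c = fder \<theta> (F0 u) (fder F0 u c)"
proof -
 have "((\<lambda>x. \<theta> (F0 x)) has_derivative (\<lambda>c. fder \<theta> (F0 u) (fder F0 u c))) (at u)"
  using has_derivative_compose[OF F0_derivative(1)[OF uU] \<theta>_derivative(1)] .
 hence "(F has_derivative (\<lambda>c. fder \<theta> (F0 u) (fder F0 u c))) (at u)"
  by (rule has_derivative_transform_within_open[OF _ adaptedD(1) uU]) (simp add: adaptedD(6))
 thus ?thesis by (simp add: frechet_derivative_eqI)
qed

abbreviation (input) "pos \<equiv> F0 u"
abbreviation (input) "tgt c \<equiv> fder F0 u c"
abbreviation (input) "acc c \<equiv> fder (\<lambda>x. fder F0 x c) u c"
abbreviation (input) "efrm \<equiv> frm (pos $ 3)"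
abbreviation (input) "etg c \<equiv> frm (pos $ 3) (tgt c)"
abbreviation (input) "sform v \<equiv> second_form g F u (fder \<theta> pos v)"
abbreviation (input) "mcurv v \<equiv> mean_curvature g F u (fder \<theta> pos v)"

lemma unit_normal_iff:
 "unit_normal g F u (fder \<theta> pos \<nu>) \<longleftrightarrow> efrm \<nu> \<bullet> efrm \<nu> = 1 \<and> (\<forall>c. etg c \<bullet> efrm \<nu> = 0)"
proof -
 have "etg c \<bullet> efrm \<nu> = (\<Sum>i\<in>UNIV. c $ i * (efrm (tgt (axis i 1)) \<bullet> efrm \<nu>))" for c
  by (subst linear_axis_expansion[OF F0_derivative(2)[OF uU], of c])
   (simp only: linear_sum[OF linear_frm] linear_scale[OF linear_frm] inner_sum_left inner_scaleR_left)
 hence "(\<forall>c. etg c \<bullet> efrm \<nu> = 0) \<longleftrightarrow> (\<forall>i. efrm (tgt (axis i 1)) \<bullet> efrm \<nu> = 0)" by (metis (no_types, lifting) mult_zero_right sum.neutral)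
 thus ?thesis unfolding unit_normal_def pderiv_at_def F_derivative
  using adaptedD(6)[OF uU] adaptedD(10)[OF F0u] by (simp add: met_def)
qed

lemma second_form_flow:
 "c \<bullet> (sform \<nu> *v c) = efrm (acc c) \<bullet> efrm \<nu>
   + tgt c $ 3 * (A (hor (etg c)) \<bullet> hor (efrm \<nu>) + hor (etg c) \<bullet> A (hor (efrm \<nu>)))
   - \<nu> $ 3 * (A (hor (etg c)) \<bullet> hor (etg c))"
 using second_form_pullback[OF adaptedD(1) uU adaptedD(3,4,2,5,6,7,8,9,10), of c \<nu>]
 unfolding frechet_derivative_met by (simp add: met_def frm_def inner_commute)

lemma mean_curvature_flow:
 assumes "etg c1 \<bullet> etg c1 = 1" "etg c2 \<bullet> etg c2 = 1" "etg c1 \<bullet> etg c2 = 0"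
 shows "2 * mean_curvature g F u \<nu> = c1 \<bullet> (second_form g F u \<nu> *v c1) + c2 \<bullet> (second_form g F u \<nu> *v c2)"
proof -
 have lin: "linear (fder F u)" unfolding F_derivative[abs_def]
  using linear_compose[OF F0_derivative(2)[OF uU] \<theta>_derivative(2)] by (simp add: o_def)
 have "c \<bullet> (first_form g F u *v d) = etg c \<bullet> etg d" for c d unfolding first_form_inner[OF lin] F_derivative
  using adaptedD(6)[OF uU] adaptedD(10)[OF F0u] by (simp add: met_def)
 thus ?thesis using assms by (intro mean_curvature_orthonormal) (simp_all add: inner_commute)
qed

lemma tangent_frame:
 obtains c1 c2 where "etg c1 \<bullet> etg c1 = 1" "etg c2 \<bullet> etg c2 = 1" "etg c1 \<bullet> etg c2 = 0"
proof -
 have lin: "linear etg" using linear_compose[OF F0_derivative(2)[OF uU] linear_frm] by (simp add: o_def)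
 have inj: "inj etg" using inj_compose[OF inj_frm adaptedD(11)] by (simp add: o_def)
 show thesis
 proof (rule orthonormal_pair_form[of "\<lambda>c d. etg c \<bullet> etg d"])
  show "bilinear (\<lambda>c d. etg c \<bullet> etg d)" unfolding bilinear_def
   by (auto intro!: linearI simp: linear_add[OF lin] linear_scale[OF lin] inner_add_left inner_add_right)
  show "0 < etg c \<bullet> etg c" if "c \<noteq> 0" for c using that inj linear_injective_0[OF lin] by auto
 qed (use that in \<open>auto simp: inner_commute\<close>)
qed

lemma line_derivatives:
 assumes "u + t *\<^sub>R c \<in> U"
 shows "((\<lambda>t. F0 (u + t *\<^sub>R c)) has_vector_derivative fder F0 (u + t *\<^sub>R c) c) (at t)"
  and "((\<lambda>t. fder F0 (u + t *\<^sub>R c) c) has_vector_derivative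
   fder (\<lambda>x. fder F0 x c) (u + t *\<^sub>R c) c) (at t)"
proof -
 have l: "((\<lambda>t. u + t *\<^sub>R c) has_vector_derivative c) (at t)"
  by (auto intro!: derivative_eq_intros simp: has_vector_derivative_def)
 show "((\<lambda>t. F0 (u + t *\<^sub>R c)) has_vector_derivative fder F0 (u + t *\<^sub>R c) c) (at t)"
  using vector_derivative_diff_chain_within[OF l has_derivative_at_withinI[OF F0_derivative(1)[OF assms]]] by (simp add: o_def)
 show "((\<lambda>t. fder F0 (u + t *\<^sub>R c) c) has_vector_derivative
   fder (\<lambda>x. fder F0 x c) (u + t *\<^sub>R c) c) (at t)"
  using vector_derivative_diff_chain_within[OF l has_derivative_at_withinI[OF F0_derivative(3)[OF assms]]] by (simp add: o_def)
qed

lemma mean_curvature_plane: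
 assumes z: "\<And>x. x \<in> U \<Longrightarrow> F0 x $ 3 = z"
  and \<nu>: "unit_normal g F u (fder \<theta> pos \<nu>)"
 shows "2 * mcurv \<nu> = - \<nu> $ 3 * trA" "\<nu> $ 3 = 1 \<or> \<nu> $ 3 = -1"
proof -
 obtain c1 c2 where c: "etg c1 \<bullet> etg c1 = 1" "etg c2 \<bullet> etg c2 = 1" "etg c1 \<bullet> etg c2 = 0" by (rule tangent_frame)
 have \<nu>': "efrm \<nu> \<bullet> efrm \<nu> = 1" "\<And>c. etg c \<bullet> efrm \<nu> = 0" using \<nu> unit_normal_iff by auto
 have d3: "x \<in> U \<Longrightarrow> fder F0 x c $ 3 = 0" for x c by (rule F0_flat) (use z in auto)
 have "((\<lambda>x. fder F0 x c $ 3) has_derivative (\<lambda>d. fder (\<lambda>x. fder F0 x c) u d $ 3)) (at u)" for c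
  by (rule bounded_linear.has_derivative[OF bounded_linear_vec_nth F0_derivative(3)[OF uU]])
 moreover have "((\<lambda>x. fder F0 x c $ 3) has_derivative (\<lambda>d. 0)) (at u)" for c
  by (rule has_derivative_transform_within_open[OF has_derivative_const[of 0] adaptedD(1) uU]) (simp add: d3)
 ultimately have w23: "acc c $ 3 = 0" for c using has_derivative_unique by metis
 have w3: "tgt c $ 3 = 0" for c using d3[OF uU] .
 define R1 R2 where "R1 = hor (etg c1)" and "R2 = hor (etg c2)"
 have R: "R1 \<bullet> R1 = 1" "R2 \<bullet> R2 = 1" "R1 \<bullet> R2 = 0"
  using c by (simp_all add: R1_def R2_def inner_pt[of "efrm _"]) (simp_all add: frm_def w3)
 define B :: "real ^ 3 \<Rightarrow> real ^ 3 \<Rightarrow> real" where "B r r' = A (hor r) \<bullet> hor r'" for r r'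
 have B: "bilinear B" unfolding bilinear_def B_def
  by (auto intro!: linearI simp: linear_add[OF linA] linear_scale[OF linA] inner_add_left inner_add_right)
 have "hor (axis 3 1 :: real ^ 3) = 0" "hor (axis 1 1 :: real ^ 3) = axis 1 1" "hor (axis 2 1 :: real ^ 3) = axis 2 1"
  by (simp_all add: vec_eq_iff forall_2 axis_def)
 hence "(\<Sum>i\<in>UNIV. B (axis i 1) (axis i 1)) = trA" unfolding sum_3 by (simp add: B_def trA_def inner_axis linear_0[OF linA])
 moreover have "(\<Sum>i\<in>UNIV. B (axis i 1) (axis i 1)) = B (pt R1 0) (pt R1 0) + B (pt R2 0) (pt R2 0) + B (axis 3 1) (axis 3 1)"
 proof (rule orthonormal_trace(1)[OF B, symmetric])
  have ax: "axis 3 1 = pt 0 (1::real)" by (simp add: vec_eq_iff forall_3 axis_def)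
  show "pt R1 0 \<bullet> pt R1 0 = 1" "pt R2 0 \<bullet> pt R2 0 = 1" "axis 3 1 \<bullet> (axis 3 1 :: real ^ 3) = 1"
   "pt R1 0 \<bullet> pt R2 0 = 0" "pt R1 0 \<bullet> axis 3 1 = 0" "pt R2 0 \<bullet> axis 3 1 = 0" unfolding ax by (simp_all add: inner_pt R)
 qed
 ultimately have tr: "A R1 \<bullet> R1 + A R2 \<bullet> R2 = trA" using \<open>hor (axis 3 1) = 0\<close> by (simp add: B_def)
 have orth: "hor (etg c) \<bullet> hor (efrm \<nu>) = 0" for c
  using \<nu>'(2)[of c] by (simp add: inner_pt[of "efrm _"]) (simp add: frm_def w3)
 have hw: "linear (\<lambda>c. hor (etg c))"
  using linear_compose[OF linear_compose[OF F0_derivative(2)[OF uU] linear_frm] linear_hor] by (simp add: o_def)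
 have "inj (\<lambda>c. hor (etg c))"
 proof (rule injI)
  fix c d assume "hor (etg c) = hor (etg d)"
  hence "etg c = etg d" using w3 by (simp add: frm_def)
  thus "c = d" using injD[OF inj_frm] injD[OF adaptedD(11)] by blast
 qed
 hence "surj (\<lambda>c. hor (etg c))" using hw linear_injective_imp_surjective by blast
 then obtain c0 where "hor (efrm \<nu>) = hor (etg c0)" by (rule surjE)
 hence N0: "hor (efrm \<nu>) = 0" using orth[of c0] by simp
 have "efrm \<nu> $ 3 = \<nu> $ 3" by (simp add: frm_def)
 hence n3: "\<nu> $ 3 * \<nu> $ 3 = 1" using \<nu>'(1) unfolding inner_pt[of "efrm \<nu>" "efrm \<nu>"] N0 by simp
 thus "\<nu> $ 3 = 1 \<or> \<nu> $ 3 = -1" by (simp only: square_eq_1_iff)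
 have "efrm (acc c) \<bullet> efrm \<nu> = 0" for c using N0 w23[of c] by (simp add: inner_pt[of "efrm _"]) (simp add: frm_def)
 thus "2 * mcurv \<nu> = - \<nu> $ 3 * trA" unfolding mean_curvature_flow[OF c] second_form_flow tr[symmetric] using w3 N0
  by (simp add: R1_def R2_def algebra_simps linear_0[OF linA])
qed

lemma barrier:
 fixes f f1 f2 :: "real \<Rightarrow> real" and x1 :: "real ^ 2"
 assumes K: "K = 1 + (4 * M + 4) * a\<^sup>2 + 4 * M + 12 * M * a + 21 * a" and M: "M \<ge> 0"
  and df: "\<And>s. s > 0 \<Longrightarrow> (f has_real_derivative f1 s) (at s)" "\<And>s. s > 0 \<Longrightarrow> (f1 has_real_derivative f2 s) (at s)"
  and y: "y = L (pos $ 3) (hor pos - x1)" "y \<noteq> 0" and s: "s = y \<bullet> y"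
  and f: "0 < f1 s" "f1 s \<le> 1" "f1 s * s \<le> 1 / (8 * (a + 1))" "\<bar>f2 s\<bar> * s \<le> M * f1 s" "f2 s * s + f1 s \<le> 0"
  and z: "0 \<le> pos $ 3" "K * pos $ 3 \<le> 1/2"
  and min: "\<forall>\<^sub>F x in nhds u.
    pos $ 3 - K / 2 * (pos $ 3)\<^sup>2 + f s
    \<le> F0 x $ 3 - K / 2 * (F0 x $ 3)\<^sup>2 + f (L (F0 x $ 3) (hor (F0 x) - x1) \<bullet> L (F0 x $ 3) (hor (F0 x) - x1))"
   (is "eventually ?min _")
  and H: "\<And>\<nu>. unit_normal g F u (fder \<theta> pos \<nu>) \<Longrightarrow> \<nu> $ 3 > 0 \<Longrightarrow>
    2 * mcurv \<nu> \<le> - trA"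
 shows False
proof -
 have a1: "a + 1 > 0" using a0 by simp
 define W1 where "W1 = 1 - K * pos $ 3"
 have K0: "K \<ge> 0" unfolding K using M a0 by simp
 have W1: "1/2 \<le> W1" "W1 \<le> 1" using z K0 by (auto simp: W1_def)
 have line: "(1 - K * pos $ 3) * tgt c $ 3 + f1 s * (2 * (y \<bullet> (L (pos $ 3) (hor (tgt c)) + tgt c $ 3 *\<^sub>R A y))) = 0 \<and>
   0 \<le> - K * (tgt c $ 3)\<^sup>2 + (1 - K * pos $ 3) * acc c $ 3
    + f2 s * (2 * (y \<bullet> (L (pos $ 3) (hor (tgt c)) + tgt c $ 3 *\<^sub>R A y)))\<^sup>2
    + f1 s * (2 * ((L (pos $ 3) (hor (tgt c)) + tgt c $ 3 *\<^sub>R A y) \<bullet> (L (pos $ 3) (hor (tgt c)) + tgt c $ 3 *\<^sub>R A y)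
     + y \<bullet> (L (pos $ 3) (hor (acc c)) + tgt c $ 3 *\<^sub>R A (L (pos $ 3) (hor (tgt c))) + (acc c $ 3 *\<^sub>R A y
      + tgt c $ 3 *\<^sub>R A (L (pos $ 3) (hor (tgt c)) + tgt c $ 3 *\<^sub>R A y)))))" for c
 proof -
  define Z where "Z t = F0 (u + t *\<^sub>R c) $ 3" for t
  define X where "X t = hor (F0 (u + t *\<^sub>R c)) - x1" for t
  define Z' where "Z' t = fder F0 (u + t *\<^sub>R c) c $ 3" for t
  define X' where "X' t = hor (fder F0 (u + t *\<^sub>R c) c)" for t
  define y' where "y' t = L (Z t) (X' t) + Z' t *\<^sub>R A (L (Z t) (X t))" for t
  define yt where "yt t = L (Z t) (X t)" for t
  have bl: "bounded_linear A" using linA linear_conv_bounded_linear by blast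
  have dX: "(X has_vector_derivative X' t) (at t)" and dZ: "(Z has_real_derivative Z' t) (at t)"
   and dX': "(X' has_vector_derivative hor (fder (\<lambda>x. fder F0 x c) (u + t *\<^sub>R c) c)) (at t)"
   and dZ': "(Z' has_real_derivative fder (\<lambda>x. fder F0 x c) (u + t *\<^sub>R c) c $ 3) (at t)"
   if "u + t *\<^sub>R c \<in> U" for t
   using line_derivatives[OF that] unfolding X_def[abs_def] X'_def[abs_def] Z_def[abs_def] Z'_def[abs_def]
    has_real_derivative_iff_has_vector_derivative
   by (auto intro!: bounded_linear.has_vector_derivative[OF bounded_linear_hor] bounded_linear.has_vector_derivative[OF bounded_linear_vec_nth]
     simp: has_vector_derivative_diff_const)
  have dy: "(yt has_vector_derivative y' t) (at t)" if "u + t *\<^sub>R c \<in> U" for t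
   unfolding yt_def[abs_def] y'_def using has_vector_derivative_L[OF dX[OF that] dZ[OF that]] .
  obtain T where T: "open T" "u \<in> T" "\<And>x. x \<in> T \<Longrightarrow> ?min x" using min unfolding eventually_nhds by blast
  have "open (U \<inter> T)" "u \<in> U \<inter> T" using T adaptedD(1) uU by auto
  hence "\<forall>\<^sub>F t in nhds (0::real). u + t *\<^sub>R c \<in> U \<inter> T"
  proof (intro topological_tendstoD[where f = "\<lambda>t. u + t *\<^sub>R c" and l = u])
   have "isCont (\<lambda>t. u + t *\<^sub>R c) 0" by (intro continuous_intros)
   thus "((\<lambda>t. u + t *\<^sub>R c) \<longlongrightarrow> u) (nhds 0)"
    using tendsto_at_iff_tendsto_nhds[of "\<lambda>t. u + t *\<^sub>R c" 0] by (simp add: isCont_def)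
  qed
  moreover have "isCont yt 0" using has_vector_derivative_continuous[OF dy[of 0]] uU by simp
  hence "(yt \<longlongrightarrow> yt 0) (nhds 0)" by (simp add: isCont_def tendsto_at_iff_tendsto_nhds)
  hence "\<forall>\<^sub>F t in nhds 0. yt t \<noteq> 0" by (rule tendsto_imp_eventually_ne) (use y in \<open>simp add: yt_def X_def Z_def\<close>)
  ultimately have "\<forall>\<^sub>F t in nhds (0::real). u + t *\<^sub>R c \<in> U \<inter> T \<and> yt t \<noteq> 0" by (rule eventually_conj)
  then obtain e where e: "e > 0" "\<And>t. \<bar>t\<bar> < e \<Longrightarrow> u + t *\<^sub>R c \<in> U \<inter> T \<and> yt t \<noteq> 0"
   unfolding eventually_nhds_metric by (auto simp: dist_real_def)
  define \<phi> where "\<phi> t = Z t - K / 2 * (Z t)\<^sup>2 + f (yt t \<bullet> yt t)" for t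
  define \<phi>' where "\<phi>' t = (1 - K * Z t) * Z' t + f1 (yt t \<bullet> yt t) * (2 * (yt t \<bullet> y' t))" for t
  have ds: "((\<lambda>t. yt t \<bullet> yt t) has_real_derivative 2 * (yt t \<bullet> y' t)) (at t)" if "u + t *\<^sub>R c \<in> U" for t
   using bounded_bilinear.has_vector_derivative[OF bounded_bilinear_inner dy[OF that] dy[OF that]]
   by (simp add: has_real_derivative_iff_has_vector_derivative inner_commute)
  have 1: "(\<phi> has_real_derivative \<phi>' t) (at t)" if "\<bar>t\<bar> < e" for t
  proof -
   have U: "u + t *\<^sub>R c \<in> U" and pos: "yt t \<bullet> yt t > 0" using e(2)[OF that] by auto
   show ?thesis unfolding \<phi>_def[abs_def] \<phi>'_def
    by (rule derivative_eq_intros DERIV_chain2[OF df(1)[OF pos] ds[OF U]] dZ[OF U] refl)+ (simp add: algebra_simps)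
  qed
  have 2: "(\<phi>' has_real_derivative - K * (Z' 0)\<^sup>2 + (1 - K * Z 0) * acc c $ 3
    + f2 (yt 0 \<bullet> yt 0) * (2 * (yt 0 \<bullet> y' 0))\<^sup>2 + f1 (yt 0 \<bullet> yt 0) * (2 * (y' 0 \<bullet> y' 0 + yt 0 \<bullet> 
     (L (Z 0) (hor (acc c)) + Z' 0 *\<^sub>R A (L (Z 0) (X' 0)) + (acc c $ 3 *\<^sub>R A (yt 0) + Z' 0 *\<^sub>R A (y' 0)))))) (at 0)"
  proof -
   have U: "u + 0 *\<^sub>R c \<in> U" and pos: "yt 0 \<bullet> yt 0 > 0" using e(1) e(2)[of 0] by auto
   have dZ'0: "(Z' has_real_derivative acc c $ 3) (at 0)" and dX'0: "(X' has_vector_derivative hor (acc c)) (at 0)"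
    using dZ'[OF U] dX'[OF U] by simp_all
   have "(y' has_vector_derivative L (Z 0) (hor (acc c)) + Z' 0 *\<^sub>R A (L (Z 0) (X' 0)) + (Z' 0 *\<^sub>R A (y' 0) + acc c $ 3 *\<^sub>R A (yt 0))) (at 0)"
    unfolding y'_def[abs_def] yt_def[symmetric]
    by (intro has_vector_derivative_add has_vector_derivative_L dX'0 dZ[OF U] has_vector_derivative_scaleR dZ'0
      bounded_linear.has_vector_derivative[OF bl] dy[OF U, unfolded y'_def yt_def[symmetric]])
   hence dyy: "((\<lambda>t. yt t \<bullet> y' t) has_real_derivative (yt 0 \<bullet> (L (Z 0) (hor (acc c)) + Z' 0 *\<^sub>R A (L (Z 0) (X' 0)) + (Z' 0 *\<^sub>R A (y' 0) + acc c $ 3 *\<^sub>R A (yt 0)))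
     + y' 0 \<bullet> y' 0)) (at 0)" unfolding has_real_derivative_iff_has_vector_derivative
    by (rule bounded_bilinear.has_vector_derivative[OF bounded_bilinear_inner dy[OF U]])
   show ?thesis unfolding \<phi>'_def[abs_def]
    by (rule derivative_eq_intros DERIV_chain2[OF df(2)[OF pos] ds[OF U]] dZ[OF U] dZ'0 dyy refl)+
     (simp add: power2_eq_square algebra_simps)
  qed
  have 3: "\<phi> 0 \<le> \<phi> t" if "\<bar>t\<bar> < e" for t
   using T(3)[of "u + t *\<^sub>R c"] e(2)[OF that] y s by (simp add: \<phi>_def Z_def yt_def X_def)
  from second_derivative_test[OF e(1) 1 2 3] y s show ?thesis by (simp add: \<phi>'_def Z_def Z'_def yt_def X_def X'_def y'_def)
 qed
 define G where "G = pt ((2 * f1 s) *\<^sub>R y) (W1 + 2 * f1 s * (y \<bullet> A y))"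
 define \<mu> where "\<mu> = norm G"
 have "G \<noteq> 0" using y(2) f(1) by (auto simp: G_def vec_eq_iff[of y] forall_2 dest: arg_cong[of _ _ hor])
 hence \<mu>: "\<mu> > 0" by (simp add: \<mu>_def)
 define r3 where "r3 = (1 / \<mu>) *\<^sub>R G"
 have r33: "r3 \<bullet> r3 = 1" using \<mu> by (simp add: r3_def \<mu>_def dot_square_norm power2_eq_square)
 obtain \<nu> where \<nu>: "efrm \<nu> = r3" using surj_frm by (metis surjD)
 define N n3 where "N = hor r3" and "n3 = r3 $ 3"
 have Gr: "\<mu> *\<^sub>R r3 = G" using \<mu> by (simp add: r3_def)
 have \<mu>N: "\<mu> *\<^sub>R N = (2 * f1 s) *\<^sub>R y" "\<mu> * n3 = W1 + 2 * f1 s * (y \<bullet> A y)"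
  using arg_cong[OF Gr, of hor] arg_cong[OF Gr, of "\<lambda>v. v $ 3"] by (simp_all add: N_def n3_def G_def)
 have Ew: "hor (etg c) = L (pos $ 3) (hor (tgt c))" "etg c $ 3 = tgt c $ 3" for c by (simp_all add: frm_def)
 have orth: "G \<bullet> etg c = 0" for c using conjunct1[OF line[of c]] unfolding inner_pt[of G "etg c"]
  by (simp add: G_def Ew inner_add_right W1_def algebra_simps)
 have un: "unit_normal g F u (fder \<theta> pos \<nu>)" unfolding unit_normal_iff \<nu> using r33 orth by (auto simp: r3_def inner_commute)
 have \<nu>3: "\<nu> $ 3 = n3" using \<nu> by (auto simp: n3_def frm_def)
 obtain c1 c2 where c: "etg c1 \<bullet> etg c1 = 1" "etg c2 \<bullet> etg c2 = 1" "etg c1 \<bullet> etg c2 = 0" by (rule tangent_frame)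
 define B where "B r r' = - K * (r $ 3 * r' $ 3) + 4 * f2 s * ((y \<bullet> hor r + r $ 3 * (y \<bullet> A y)) * (y \<bullet> hor r' + r' $ 3 * (y \<bullet> A y)))
   + 2 * f1 s * ((hor r + r $ 3 *\<^sub>R A y) \<bullet> (hor r' + r' $ 3 *\<^sub>R A y)) + 4 * f1 s * (r $ 3 * (y \<bullet> A (hor r')))
   + 2 * f1 s * (r $ 3 * r' $ 3 * (y \<bullet> A (A y))) - \<mu> * (r $ 3 * (A (hor r') \<bullet> N + hor r' \<bullet> A N)) + \<mu> * n3 * (A (hor r) \<bullet> hor r')"
  for r r' :: "real ^ 3"
 have B: "bilinear B" unfolding bilinear_def B_def by (intro conjI allI linearI)
   (simp_all add: linear_add[OF linA] linear_scale[OF linA] inner_add_left inner_add_right algebra_simps)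
 have II: "0 \<le> B (etg c) (etg c) + \<mu> * (c \<bullet> (sform \<nu> *v c))" for c
 proof -
  have "\<mu> * (efrm (acc c) \<bullet> efrm \<nu>) = efrm (acc c) \<bullet> G" unfolding \<nu> by (simp flip: Gr)
  also have "\<dots> = 2 * f1 s * (y \<bullet> L (pos $ 3) (hor (acc c))) + acc c $ 3 * (W1 + 2 * f1 s * (y \<bullet> A y))"
   by (simp add: inner_pt[of "efrm _"] G_def) (simp add: frm_def inner_commute)
  finally have a: "\<mu> * (efrm (acc c) \<bullet> efrm \<nu>) = 2 * f1 s * (y \<bullet> L (pos $ 3) (hor (acc c))) + acc c $ 3 * (W1 + 2 * f1 s * (y \<bullet> A y))" .
  have "\<mu> * (c \<bullet> (sform \<nu> *v c)) = 
    2 * f1 s * (y \<bullet> L (pos $ 3) (hor (acc c))) + acc c $ 3 * (W1 + 2 * f1 s * (y \<bullet> A y))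
   + \<mu> * (tgt c $ 3 * (A (hor (etg c)) \<bullet> N + hor (etg c) \<bullet> A N)) - \<mu> * n3 * (A (hor (etg c)) \<bullet> hor (etg c))"
   unfolding second_form_flow distrib_left right_diff_distrib a unfolding \<nu> \<nu>3 N_def[symmetric] by simp
  with conjunct2[OF line[of c]] show ?thesis
   unfolding B_def Ew W1_def[symmetric] linear_add[OF linA] linear_scale[OF linA] scaleR_add_right
    inner_add_left inner_add_right inner_scaleR_left inner_scaleR_right inner_commute[of "L _ _" "A y"]
   by (simp add: power2_eq_square algebra_simps)
 qed
 have tr: "B (etg c1) (etg c1) + B (etg c2) (etg c2) + B r3 r3 = (\<Sum>i\<in>UNIV. B (axis i 1) (axis i 1))"
  by (rule orthonormal_trace(1)[OF B c(1,2) r33 c(3)]) (use orth in \<open>simp_all add: r3_def inner_commute\<close>)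
 have axes: "hor (axis 3 1 :: real ^ 3) = 0" "hor (axis 1 1 :: real ^ 3) = axis 1 1" "hor (axis 2 1 :: real ^ 3) = axis 2 1"
  "(axis 1 1 :: real ^ 3) $ 3 = 0" "(axis 2 1 :: real ^ 3) $ 3 = 0" "(axis 3 1 :: real ^ 3) $ 3 = 1"
  by (simp_all add: vec_eq_iff forall_2 axis_def)
 have yy: "y $ 1 * y $ 1 + y $ 2 * y $ 2 = s" by (simp add: s inner_vec_def sum_2)
 have axsum: "(\<Sum>i\<in>UNIV. B (axis i 1) (axis i 1)) = 4 * (f2 s * s + f1 s) + \<mu> * n3 * trA
   + (- K + 4 * f2 s * (y \<bullet> A y)\<^sup>2 + 2 * f1 s * (A y \<bullet> A y) + 2 * f1 s * (y \<bullet> A (A y)))"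
  unfolding sum_3 B_def axes trA_def yy[symmetric]
  by (simp add: inner_axis inner_axis_axis linear_0[OF linA] power2_eq_square algebra_simps)
 have N1: "N \<bullet> N + n3\<^sup>2 = 1" using r33 by (simp add: N_def n3_def inner_pt[of r3] power2_eq_square)
 have "2 * mcurv \<nu> \<le> - trA"
 proof -
  have "\<bar>y \<bullet> A y\<bar> \<le> a * s" using Cauchy_Schwarz_ineq2[of y "A y"] mult_left_mono[OF normA[of y] norm_ge_zero[of y]]
   by (simp add: s dot_square_norm power2_eq_square algebra_simps)
  hence "f1 s * \<bar>y \<bullet> A y\<bar> \<le> (f1 s * s) * a" using mult_left_mono[of _ _ "f1 s"] f(1) by (fastforce simp: algebra_simps)
  also have "\<dots> \<le> 1 / (8 * (a + 1)) * a" using f(3) a0 by (rule mult_right_mono)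
  also have "\<dots> \<le> 1/8" using a1 by (simp add: field_simps)
  finally have "\<bar>f1 s * (y \<bullet> A y)\<bar> \<le> 1/8" using f(1) by (simp add: abs_mult)
  hence "\<mu> * n3 > 0" unfolding \<mu>N(2) using W1 by (simp add: abs_le_iff)
  hence "n3 > 0" using \<mu> zero_less_mult_pos by blast
  thus ?thesis using H[OF un] \<nu>3 by simp
 qed
 note est = barrier_estimate[OF K M s f y(2) W1 \<mu> \<mu>N N1 this]
 have Br3: "B r3 r3 = - K * n3\<^sup>2 + 4 * f2 s * (y \<bullet> N + n3 * (y \<bullet> A y))\<^sup>2 + 2 * f1 s * ((N + n3 *\<^sub>R A y) \<bullet> (N + n3 *\<^sub>R A y))
    + 4 * f1 s * n3 * (y \<bullet> A N) + 2 * f1 s * n3\<^sup>2 * (y \<bullet> A (A y)) - \<mu> * n3 * (A N \<bullet> N + N \<bullet> A N) + \<mu> * n3 * (A N \<bullet> N)"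
  unfolding B_def N_def[symmetric] n3_def[symmetric] power2_eq_square by (simp only: mult.assoc)
 have "2 * \<mu> * mcurv \<nu>
   = \<mu> * (c1 \<bullet> (sform \<nu> *v c1)) + \<mu> * (c2 \<bullet> (sform \<nu> *v c2))"
  using mean_curvature_flow[OF c, of "fder \<theta> pos \<nu>"] by (simp add: distrib_left[symmetric])
 thus False using II[of c1] II[of c2] tr est unfolding axsum Br3 by linarith
qed

end

end

section \<open>Smooth maps from Euclidean space into a manifold\<close>

lemma smooth_manifoldD:
 assumes "smooth_manifold M" "c \<in> charts M"
 shows chart_openin: "openin (pts M) (fst c)" and chart_open: "open (snd c ` fst c)"
  and chart_homeo: "homeomorphic_map (subtopology (pts M) (fst c)) (top_of_set (snd c ` fst c)) (snd c)"
  and chart_subset: "fst c \<subseteq> topspace (pts M)" using assms openin_subset by (auto simp: smooth_manifold_def)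

lemma chart_inj: "smooth_manifold M \<Longrightarrow> c \<in> charts M \<Longrightarrow> inj_on (snd c) (fst c)"
 using homeomorphic_imp_injective_map[OF chart_homeo, of M c] chart_subset[of M c] by (simp add: Int_absorb1)

lemma chart_inv_snd [simp]: "smooth_manifold M \<Longrightarrow> c \<in> charts M \<Longrightarrow> p \<in> fst c \<Longrightarrow> chart_inv c (snd c p) = p"
 by (simp add: chart_inv_def chart_inj inv_into_f_f)

lemma snd_chart_inv: "x \<in> snd c ` fst c \<Longrightarrow> snd c (chart_inv c x) = x"
 and chart_inv_in: "x \<in> snd c ` fst c \<Longrightarrow> chart_inv c x \<in> fst c" by (auto simp: chart_inv_def f_inv_into_f inv_into_into)

lemma chart_continuous:
 "smooth_manifold M \<Longrightarrow> c \<in> charts M \<Longrightarrow> continuous_map (subtopology (pts M) (fst c)) euclidean (snd c)"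
 using homeomorphic_imp_continuous_map[OF chart_homeo] continuous_map_in_subtopology by blast

lemma chart_inv_continuous:
 assumes "smooth_manifold M" "c \<in> charts M"
 shows "continuous_map (top_of_set (snd c ` fst c)) (pts M) (chart_inv c)"
proof -
 obtain g where g: "homeomorphic_maps (subtopology (pts M) (fst c)) (top_of_set (snd c ` fst c)) (snd c) g"
  using chart_homeo[OF assms] homeomorphic_map_maps by blast
 have "continuous_map (top_of_set (snd c ` fst c)) (subtopology (pts M) (fst c)) (chart_inv c)"
 proof (rule continuous_map_eq)
  show "continuous_map (top_of_set (snd c ` fst c)) (subtopology (pts M) (fst c)) g"
   using g by (simp add: homeomorphic_maps_def)
  fix x assume x: "x \<in> topspace (top_of_set (snd c ` fst c))"
  hence "g x \<in> fst c" "snd c (g x) = x"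
   using g chart_subset[OF assms] by (auto simp: homeomorphic_maps_def continuous_map_def)
  thus "g x = chart_inv c x" using chart_inv_snd[OF assms] by metis
 qed
 thus ?thesis using continuous_map_in_subtopology by blast
qed

lemma chart_cover: "smooth_manifold M \<Longrightarrow> p \<in> topspace (pts M) \<Longrightarrow> \<exists>c\<in>charts M. p \<in> fst c"
 unfolding smooth_manifold_def by (metis UN_iff)

lemma open_vimage:
 fixes U :: "'u::topological_space set"
 assumes "open U" "continuous_map (top_of_set U) T \<gamma>" "openin T W"
 shows "open {u \<in> U. \<gamma> u \<in> W}" using openin_continuous_map_preimage[OF assms(2,3)] assms(1) openin_open_eq by auto

definition smooth_into :: "('a, 'n::finite) manifold \<Rightarrow> 'u::euclidean_space set \<Rightarrow> ('u \<Rightarrow> 'a) \<Rightarrow> bool" where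
 "smooth_into M U \<gamma> \<longleftrightarrow> open U \<and> continuous_map (top_of_set U) (pts M) \<gamma> \<and>
   (\<forall>d\<in>charts M. smooth_on {u \<in> U. \<gamma> u \<in> fst d} (\<lambda>u. snd d (\<gamma> u)))"

lemma smooth_intoD:
 assumes "smooth_into M U \<gamma>"
 shows "open U" "continuous_map (top_of_set U) (pts M) \<gamma>" "u \<in> U \<Longrightarrow> \<gamma> u \<in> topspace (pts M)"
  "d \<in> charts M \<Longrightarrow> Ck_on k {u \<in> U. \<gamma> u \<in> fst d} (\<lambda>u. snd d (\<gamma> u))"
 using assms by (auto simp: smooth_into_def smooth_on_def continuous_map_def)

lemma smooth_into_open:
 assumes "smooth_manifold M" "smooth_into M U \<gamma>" "d \<in> charts M"
 shows "open {u \<in> U. \<gamma> u \<in> fst d}" using open_vimage[OF smooth_intoD(1,2)[OF assms(2)] chart_openin[OF assms(1,3)]] .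

lemma smooth_into_compose:
 assumes M: "smooth_manifold M" and "smooth_into M U \<gamma>" and V: "open V" "\<And>k. Ck_on k V h" "h ` V \<subseteq> U"
 shows "smooth_into M V (\<lambda>v. \<gamma> (h v))"
proof -
 note s = smooth_intoD[OF assms(2)]
 have h: "continuous_on V h" using V(2)[of 0] by simp
 hence "continuous_map (top_of_set V) (top_of_set U) h" using V(3) by (auto simp: continuous_map_in_subtopology)
 hence c: "continuous_map (top_of_set V) (pts M) (\<lambda>v. \<gamma> (h v))"
  using continuous_map_compose[of "top_of_set V" "top_of_set U" h "pts M" \<gamma>] s(2) by (simp add: o_def)
 have "Ck_on k {v \<in> V. \<gamma> (h v) \<in> fst d} (\<lambda>v. snd d (\<gamma> (h v)))" if d: "d \<in> charts M" for d k
 proof (rule Ck_on_compose[where f = h and g = "\<lambda>u. snd d (\<gamma> u)" and T = "{u \<in> U. \<gamma> u \<in> fst d}"])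
  show "open {v \<in> V. \<gamma> (h v) \<in> fst d}" by (rule open_vimage[OF V(1) c chart_openin[OF M d]])
  show "open {u \<in> U. \<gamma> u \<in> fst d}" by (rule smooth_into_open[OF M assms(2) d])
  show "Ck_on k {v \<in> V. \<gamma> (h v) \<in> fst d} h" by (rule Ck_on_subset[OF V(2)]) auto
  show "Ck_on k {u \<in> U. \<gamma> u \<in> fst d} (\<lambda>u. snd d (\<gamma> u))" by (rule s(4)[OF d])
 qed (use V(3) in auto)
 thus ?thesis using c V(1) by (simp add: smooth_into_def smooth_on_def)
qed

lemma smooth_into_cong:
 assumes M: "smooth_manifold M" and "smooth_into M U \<gamma>" "\<And>u. u \<in> U \<Longrightarrow> \<gamma> u = \<delta> u"
 shows "smooth_into M U \<delta>"
proof -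
 note s = smooth_intoD[OF assms(2)]
 have "continuous_map (top_of_set U) (pts M) \<delta>" by (rule continuous_map_eq[OF s(2)]) (use assms(3) in auto)
 moreover have "Ck_on k {u \<in> U. \<delta> u \<in> fst d} (\<lambda>u. snd d (\<delta> u))" if "d \<in> charts M" for d k
 proof -
  have eq: "{u \<in> U. \<delta> u \<in> fst d} = {u \<in> U. \<gamma> u \<in> fst d}" using assms(3) by auto
  show ?thesis
   unfolding eq using Ck_on_cong_open[OF smooth_into_open[OF M assms(2) that], of "\<lambda>u. snd d (\<delta> u)" "\<lambda>u. snd d (\<gamma> u)" k]
    s(4)[OF that] assms(3) by simp
 qed
 ultimately show ?thesis using s(1) by (simp add: smooth_into_def smooth_on_def)
qed

lemma smooth_into_local:
 assumes M: "smooth_manifold M" and "open U" and "\<And>u. u \<in> U \<Longrightarrow> \<exists>W. open W \<and> u \<in> W \<and> W \<subseteq> U \<and> smooth_into M W \<gamma>"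
 shows "smooth_into M U \<gamma>"
proof -
 have "openin (top_of_set U) {u \<in> U. \<gamma> u \<in> Z}" if "openin (pts M) Z" for Z
 proof -
  have "open {u \<in> U. \<gamma> u \<in> Z}"
  proof (subst open_subopen, safe)
   fix u assume u: "u \<in> U" "\<gamma> u \<in> Z"
   then obtain W where W: "open W" "u \<in> W" "W \<subseteq> U" "smooth_into M W \<gamma>" using assms(3) by blast
   thus "\<exists>T. open T \<and> u \<in> T \<and> T \<subseteq> {u \<in> U. \<gamma> u \<in> Z}"
    using open_vimage[OF W(1) smooth_intoD(2)[OF W(4)] that] u by (intro exI[of _ "{u \<in> W. \<gamma> u \<in> Z}"]) auto
  qed
  thus ?thesis using assms(2) by (simp add: openin_open_eq)
 qed
 moreover have "\<gamma> u \<in> topspace (pts M)" if "u \<in> U" for u using assms(3)[OF that] smooth_intoD(3) by blast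
 ultimately have "continuous_map (top_of_set U) (pts M) \<gamma>" by (auto simp: continuous_map_def)
 moreover have "Ck_on k {u \<in> U. \<gamma> u \<in> fst d} (\<lambda>u. snd d (\<gamma> u))" if d: "d \<in> charts M" for d k
 proof (rule Ck_on_open_Union)
  fix u assume u: "u \<in> {u \<in> U. \<gamma> u \<in> fst d}"
  then obtain W where W: "open W" "u \<in> W" "W \<subseteq> U" "smooth_into M W \<gamma>" using assms(3) by blast
  thus "\<exists>T. u \<in> T \<and> open T \<and> Ck_on k T (\<lambda>u. snd d (\<gamma> u))" using smooth_into_open[OF M W(4) d] smooth_intoD(4)[OF W(4) d] u
   by (intro exI[of _ "{u \<in> W. \<gamma> u \<in> fst d}"]) auto
 qed
 ultimately show ?thesis using assms(2) by (simp add: smooth_into_def smooth_on_def)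
qed

lemma smooth_into_chart_inv:
 assumes M: "smooth_manifold M" "c \<in> charts M" shows "smooth_into M (snd c ` fst c) (chart_inv c)"
proof -
 have "smooth_on {u \<in> snd c ` fst c. chart_inv c u \<in> fst d} (\<lambda>u. snd d (chart_inv c u))" if "d \<in> charts M" for d
 proof -
  have "{u \<in> snd c ` fst c. chart_inv c u \<in> fst d} = snd c ` (fst c \<inter> fst d)" using chart_inv_snd[OF M] by auto
  moreover have "smooth_on (snd c ` (fst c \<inter> fst d)) (local_rep c d id)" using M that by (auto simp: smooth_manifold_def)
  ultimately show ?thesis by (simp add: local_rep_def)
 qed
 thus ?thesis using chart_open[OF M] chart_inv_continuous[OF M] by (simp add: smooth_into_def)
qed

lemma smooth_into_charts:
 assumes M: "smooth_manifold M" and U: "open U" and c: "c \<in> charts M" "\<And>u. u \<in> U \<Longrightarrow> \<gamma> u \<in> fst c"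
  and k: "\<And>k. Ck_on k U (\<lambda>u. snd c (\<gamma> u))"
 shows "smooth_into M U \<gamma>"
proof (rule smooth_into_cong[OF M])
 show "smooth_into M U (\<lambda>u. chart_inv c (snd c (\<gamma> u)))"
  by (rule smooth_into_compose[OF M smooth_into_chart_inv[OF M c(1)] U k]) (use c(2) in auto)
qed (use chart_inv_snd[OF M c(1)] c(2) in auto)

lemma smooth_into_const:
 assumes M: "smooth_manifold M" and "open U" "a \<in> topspace (pts M)" shows "smooth_into M U (\<lambda>_. a)"
proof -
 obtain c where "c \<in> charts M" "a \<in> fst c" using chart_cover[OF M assms(3)] by blast
 thus ?thesis using assms by (intro smooth_into_charts[OF M]) auto
qed

lemma smooth_into_has_derivative:
 assumes "smooth_manifold M" "smooth_into M U \<gamma>" "d \<in> charts M" "u \<in> U" "\<gamma> u \<in> fst d"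
 shows "((\<lambda>u. snd d (\<gamma> u)) has_derivative fder (\<lambda>u. snd d (\<gamma> u)) u) (at u)"
 using Ck_on_SucD[OF smooth_intoD(4)[OF assms(2,3)]] assms(4,5) by blast

section \<open>Metric Lie groups\<close>

locale metric_lie =
 fixes X :: "('a, 3) metric_group" (structure)
 assumes metric_lie_group: "metric_lie_group X"
begin

abbreviation "T \<equiv> pts (mfd X)"
abbreviation "C \<equiv> charts (mfd X)"

lemma mfd: "smooth_manifold (mfd X)" and topspace_T: "topspace T = carrier X" and group_X: "Group.group X"
 and riem: "riemannian_metric X" using metric_lie_group by (auto simp: metric_lie_group_def lie_group_def)

end

sublocale metric_lie \<subseteq> Group.group X by (rule group_X)

context metric_lie
begin

lemma smooth_into_carrier: "smooth_into (mfd X) U \<gamma> \<Longrightarrow> u \<in> U \<Longrightarrow> \<gamma> u \<in> carrier X" using smooth_intoD(3) topspace_T by blast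

lemma continuous_mult:
 assumes "continuous_map S T \<alpha>" "continuous_map S T \<beta>" shows "continuous_map S T (\<lambda>u. \<alpha> u \<otimes> \<beta> u)"
proof -
 have "continuous_map (prod_topology T T) T (\<lambda>(a, b). a \<otimes> b)"
  using metric_lie_group by (simp add: metric_lie_group_def lie_group_def)
 moreover have "continuous_map S (prod_topology T T) (\<lambda>u. (\<alpha> u, \<beta> u))"
  using assms by (simp add: continuous_map_pairwise o_def)
 ultimately show ?thesis
  using continuous_map_compose[of S "prod_topology T T" "\<lambda>u. (\<alpha> u, \<beta> u)" T "\<lambda>(a, b). a \<otimes> b"] by (simp add: o_def)
qed

lemma mult_chart:
 assumes c: "c \<in> C" "d \<in> C" "e \<in> C"
 defines "S \<equiv> {(x, y). x \<in> snd c ` fst c \<and> y \<in> snd d ` fst d \<and> chart_inv c x \<otimes> chart_inv d y \<in> fst e}"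
 shows "open S" "Ck_on k S (\<lambda>(x, y). snd e (chart_inv c x \<otimes> chart_inv d y))"
proof -
 let ?D = "(snd c ` fst c) \<times> (snd d ` fst d)"
 have "continuous_map (top_of_set ?D) (top_of_set (snd c ` fst c)) fst"
  "continuous_map (top_of_set ?D) (top_of_set (snd d ` fst d)) snd"
  by (auto simp: continuous_map_in_subtopology continuous_on_fst continuous_on_snd intro!: continuous_intros)
 hence "continuous_map (top_of_set ?D) T (\<lambda>p. chart_inv c (fst p) \<otimes> chart_inv d (snd p))"
  using continuous_map_compose[OF _ chart_inv_continuous[OF mfd c(1)], of "top_of_set ?D" fst]
   continuous_map_compose[OF _ chart_inv_continuous[OF mfd c(2)], of "top_of_set ?D" snd]
  by (intro continuous_mult) (simp_all add: o_def)
 from open_vimage[OF _ this chart_openin[OF mfd c(3)]] chart_open[OF mfd] c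
 have "open {p \<in> ?D. chart_inv c (fst p) \<otimes> chart_inv d (snd p) \<in> fst e}" by (simp add: open_Times)
 moreover have "{p \<in> ?D. chart_inv c (fst p) \<otimes> chart_inv d (snd p) \<in> fst e} = S" by (auto simp: S_def)
 ultimately show "open S" by simp
 have "S = {(snd c a, snd d b) | a b. a \<in> fst c \<and> b \<in> fst d \<and> a \<otimes> b \<in> fst e}"
  using chart_inv_snd[OF mfd c(1)] chart_inv_snd[OF mfd c(2)] by (auto simp: S_def) blast
 thus "Ck_on k S (\<lambda>(x, y). snd e (chart_inv c x \<otimes> chart_inv d y))"
  using metric_lie_group c by (simp add: metric_lie_group_def lie_group_def smooth_on_def)
qed

lemma smooth_into_mult:
 assumes \<alpha>: "smooth_into (mfd X) U \<alpha>" and \<beta>: "smooth_into (mfd X) U \<beta>"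
 shows "smooth_into (mfd X) U (\<lambda>u. \<alpha> u \<otimes> \<beta> u)"
proof (rule smooth_into_local[OF mfd smooth_intoD(1)[OF \<alpha>]])
 fix u assume u: "u \<in> U"
 obtain c d where c: "c \<in> C" "\<alpha> u \<in> fst c" and d: "d \<in> C" "\<beta> u \<in> fst d"
  using chart_cover[OF mfd smooth_intoD(3)[OF \<alpha> u]] chart_cover[OF mfd smooth_intoD(3)[OF \<beta> u]] by blast
 obtain e where e: "e \<in> C" "\<alpha> u \<otimes> \<beta> u \<in> fst e"
  using chart_cover[OF mfd] smooth_into_carrier[OF \<alpha> u] smooth_into_carrier[OF \<beta> u] topspace_T by (metis m_closed)
 have cont: "continuous_map (top_of_set U) T (\<lambda>u. \<alpha> u \<otimes> \<beta> u)" using smooth_intoD(2) \<alpha> \<beta> continuous_mult by blast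
 let ?W = "{u \<in> U. \<alpha> u \<in> fst c} \<inter> {u \<in> U. \<beta> u \<in> fst d} \<inter> {u \<in> U. \<alpha> u \<otimes> \<beta> u \<in> fst e}"
 have W: "open ?W" using smooth_into_open[OF mfd \<alpha> c(1)] smooth_into_open[OF mfd \<beta> d(1)]
   open_vimage[OF smooth_intoD(1)[OF \<alpha>] cont chart_openin[OF mfd e(1)]] by auto
 note inv = chart_inv_snd[OF mfd c(1)] chart_inv_snd[OF mfd d(1)]
 have "smooth_into (mfd X) ?W (\<lambda>u. \<alpha> u \<otimes> \<beta> u)"
 proof (rule smooth_into_charts[OF mfd W e(1)])
  fix k
  have "Ck_on k ?W (\<lambda>u. (snd c (\<alpha> u), snd d (\<beta> u)))"
   by (intro Ck_on_Pair[OF W] Ck_on_subset[OF smooth_intoD(4)[OF \<alpha> c(1)]] Ck_on_subset[OF smooth_intoD(4)[OF \<beta> d(1)]]) auto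
  moreover have "(\<lambda>u. (snd c (\<alpha> u), snd d (\<beta> u))) ` ?W \<subseteq> {(x, y). x \<in> snd c ` fst c \<and> y \<in> snd d ` fst d \<and> chart_inv c x \<otimes> chart_inv d y \<in> fst e}"
   using inv by auto
  ultimately have "Ck_on k ?W (\<lambda>u. snd e (chart_inv c (snd c (\<alpha> u)) \<otimes> chart_inv d (snd d (\<beta> u))))"
   using Ck_on_compose[OF W mult_chart(1)[OF c(1) d(1) e(1)] _ _ mult_chart(2)[OF c(1) d(1) e(1)]] by fastforce
  thus "Ck_on k ?W (\<lambda>u. snd e (\<alpha> u \<otimes> \<beta> u))"
   using Ck_on_cong_open[OF W, of "\<lambda>u. snd e (chart_inv c (snd c (\<alpha> u)) \<otimes> chart_inv d (snd d (\<beta> u)))" "\<lambda>u. snd e (\<alpha> u \<otimes> \<beta> u)" k]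
    inv by simp
 qed auto
 thus "\<exists>W. open W \<and> u \<in> W \<and> W \<subseteq> U \<and> smooth_into (mfd X) W (\<lambda>u. \<alpha> u \<otimes> \<beta> u)" using W u c d e by (intro exI[of _ ?W]) auto
qed

lemma metric_symmetric: "d \<in> C \<Longrightarrow> p \<in> fst d \<Longrightarrow> transpose (metric X d (snd d p)) = metric X d (snd d p)"
 and metric_pos: "d \<in> C \<Longrightarrow> p \<in> fst d \<Longrightarrow> v \<noteq> 0 \<Longrightarrow> 0 < v \<bullet> (metric X d (snd d p) *v v)"
 using riem by (auto simp: riemannian_metric_def)

lemma metric_differentiable: "d \<in> C \<Longrightarrow> p \<in> fst d \<Longrightarrow> metric X d differentiable (at (snd d p))"
proof -
 assume d: "d \<in> C" "p \<in> fst d"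
 hence "smooth_on (snd d ` fst d) (metric X d)" using riem by (auto simp: riemannian_metric_def)
 hence "Ck_on (Suc 0) (snd d ` fst d) (metric X d)" unfolding smooth_on_def by blast
 thus ?thesis using d by simp
qed

lemma metric_invertible:
 assumes "d \<in> C" "p \<in> fst d" shows "invertible (metric X d (snd d p))"
proof -
 have "x = 0" if "metric X d (snd d p) *v x = 0" for x using metric_pos[OF assms, of x] that by auto
 hence "\<exists>B. B ** metric X d (snd d p) = mat 1" using matrix_left_invertible_ker by blast
 thus ?thesis using invertible_left_inverse by blast
qed

lemma left_mult_isometry:
 assumes "a \<in> carrier X" "c \<in> C" "d \<in> C" "p \<in> fst c" "a \<otimes> p \<in> fst d"
 defines "D \<equiv> fder (\<lambda>u. snd d (a \<otimes> chart_inv c u)) (snd c p)"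
 shows "D v \<bullet> (metric X d (snd d (a \<otimes> p)) *v D w) = v \<bullet> (metric X c (snd c p) *v w)"
proof -
 have "preserves_metric X (\<lambda>b. a \<otimes> b)" using metric_lie_group assms(1) by (simp add: metric_lie_group_def)
 thus ?thesis using assms unfolding preserves_metric_def local_rep_def Let_def by blast
qed

end

section \<open>One-parameter subgroups\<close>

lemma C1_lipschitz_cball:
 fixes E :: "'a::euclidean_space \<Rightarrow> 'b::euclidean_space"
 assumes "open V" "Ck_on 1 V E" "cball x0 r \<subseteq> V"
 shows "\<exists>B>0. \<forall>x\<in>cball x0 r. \<forall>y\<in>cball x0 r. norm (E x - E y) \<le> B * norm (x - y)"
proof -
 have d: "(E has_derivative fder E x) (at x)" if "x \<in> V" for x using Ck_on_SucD assms(2) that by (metis One_nat_def)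
 have cont: "continuous_on (cball x0 r) (\<lambda>x. \<Sum>b\<in>Basis. norm (fder E x b))"
  using assms(2) by (intro continuous_intros continuous_on_subset[OF _ assms(3)]) simp
 from compact_imp_bounded[OF compact_continuous_image[OF this compact_cball]]
 obtain B where B: "\<And>x. x \<in> cball x0 r \<Longrightarrow> norm (\<Sum>b\<in>Basis. norm (fder E x b)) \<le> B" unfolding bounded_iff by blast
 have on: "onorm (fder E x) \<le> max B 1" if x: "x \<in> cball x0 r" for x
 proof (rule onorm_bound)
  fix v
  have lin: "linear (fder E x)" using d x assms(3) has_derivative_linear by blast
  have "fder E x v = (\<Sum>b\<in>Basis. (v \<bullet> b) *\<^sub>R fder E x b)"
   using linear_sum[OF lin, of "\<lambda>b. (v \<bullet> b) *\<^sub>R b" Basis] by (simp add: euclidean_representation linear_scale[OF lin])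
  also have "norm \<dots> \<le> (\<Sum>b\<in>Basis. norm v * norm (fder E x b))"
   by (intro norm_sum[THEN order_trans] sum_mono) (auto intro!: mult_right_mono simp: Basis_le_norm)
  also have "\<dots> = (\<Sum>b\<in>Basis. norm (fder E x b)) * norm v" by (simp add: sum_distrib_left mult.commute)
  also have "\<dots> \<le> max B 1 * norm v" using B[OF x] by (intro mult_right_mono) (auto simp: sum_nonneg)
  finally show "norm (fder E x v) \<le> max B 1 * norm v" .
 qed auto
 have "norm (E x - E y) \<le> max B 1 * norm (x - y)" if "x \<in> cball x0 r" "y \<in> cball x0 r" for x y
 proof (rule differentiable_bound[OF convex_cball _ on that])
  show "(E has_derivative fder E x) (at x within cball x0 r)" if "x \<in> cball x0 r" for x
   using d that assms(3) by (blast intro: has_derivative_at_withinI)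
 qed
 thus ?thesis by (intro exI[of _ "max B 1"]) auto
qed

lemma ode_global_solution:
 fixes P :: "'a::euclidean_space \<Rightarrow> 'a" and x0 :: 'a
 assumes lip: "\<And>x y. norm (P x - P y) \<le> B * norm (x - y)" and bd: "\<And>x. norm (P x) \<le> m"
  and B: "B > 0" and e: "e > 0" "B * e < 1"
 shows "\<exists>y. y 0 = x0 \<and> (\<forall>t\<in>{0..e}. (y has_vector_derivative P (y t)) (at t within {0..e}))"
proof -
 have contP: "continuous_on UNIV P"
 proof (rule continuous_at_imp_continuous_on, rule ballI)
  fix x :: 'a
  have "((\<lambda>y. B * norm (y - x)) \<longlongrightarrow> 0) (at x)" by (auto intro!: tendsto_eq_intros)
  hence "((\<lambda>y. P y - P x) \<longlongrightarrow> 0) (at x)" by (rule Lim_null_comparison[rotated]) (use lip in auto)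
  thus "isCont P x" by (simp add: isCont_def LIM_zero_iff)
 qed
 define cl where "cl t = max 0 (min t e)" for t :: real
 have cl: "cl t \<in> {0..e}" for t using e by (auto simp: cl_def)
 have contcl: "continuous_on UNIV cl" unfolding cl_def by (intro continuous_intros)
 have m0: "0 \<le> m" using bd[of 0] norm_ge_zero order_trans by blast
 define Op where "Op f t = x0 + integral {0..cl t} (\<lambda>s. P (apply_bcontfun f s))" for f :: "real \<Rightarrow>\<^sub>C 'a" and t
 have contPf: "continuous_on S (\<lambda>s. P (apply_bcontfun f s))" for f :: "real \<Rightarrow>\<^sub>C 'a" and S
  by (rule continuous_on_compose2[OF contP]) (auto intro!: continuous_on_apply_bcontfun continuous_on_subset[OF _ subset_UNIV])
 have int: "(\<lambda>s. P (apply_bcontfun f s)) integrable_on {a..b}" for f :: "real \<Rightarrow>\<^sub>C 'a" and a b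
  by (rule integrable_continuous_real[OF contPf])
 have Op_bc: "Op f \<in> bcontfun" for f
 proof (rule bcontfun_normI)
  have "continuous_on {0..e} (\<lambda>t. integral {0..t} (\<lambda>s. P (apply_bcontfun f s)))"
   by (rule indefinite_integral_continuous_1[OF int])
  hence "continuous_on UNIV (\<lambda>t. integral {0..cl t} (\<lambda>s. P (apply_bcontfun f s)))"
   by (rule continuous_on_compose2[OF _ contcl]) (use cl in auto)
  thus "continuous_on UNIV (Op f)" unfolding Op_def by (intro continuous_intros)
  fix t
  have "norm (integral {0..cl t} (\<lambda>s. P (apply_bcontfun f s))) \<le> m * (cl t - 0)"
   using cl[of t] contPf bd by (intro integral_bound) auto
  also have "\<dots> \<le> m * e" using cl[of t] m0 by (intro mult_left_mono) auto
  finally show "norm (Op f t) \<le> norm x0 + m * e" unfolding Op_def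
   using norm_triangle_ineq[of x0 "integral {0..cl t} (\<lambda>s. P (apply_bcontfun f s))"] by linarith
 qed
 define S where "S f = Bcontfun (Op f)" for f
 have S: "apply_bcontfun (S f) t = Op f t" for f t unfolding S_def using Bcontfun_inverse[OF Op_bc] by metis
 have "dist (S f) (S g) \<le> (B * e) * dist f g" for f g
 proof (rule dist_bound)
  fix t
  have "dist (apply_bcontfun (S f) t) (apply_bcontfun (S g) t)
    = norm (integral {0..cl t} (\<lambda>s. P (apply_bcontfun f s) - P (apply_bcontfun g s)))"
   unfolding S Op_def by (simp add: dist_norm integral_diff[OF int int])
  also have "\<dots> \<le> (B * dist f g) * (cl t - 0)"
  proof (rule integral_bound)
   fix s
   have "norm (P (apply_bcontfun f s) - P (apply_bcontfun g s)) \<le> B * norm (apply_bcontfun f s - apply_bcontfun g s)" by (rule lip)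
   also have "\<dots> \<le> B * dist f g" using dist_bounded[of f s g] B by (intro mult_left_mono) (auto simp: dist_norm)
   finally show "norm (P (apply_bcontfun f s) - P (apply_bcontfun g s)) \<le> B * dist f g" .
  qed (use cl[of t] contPf in \<open>auto intro!: continuous_intros\<close>)
  also have "\<dots> \<le> (B * dist f g) * e" using cl[of t] B by (intro mult_left_mono) auto
  finally show "dist (apply_bcontfun (S f) t) (apply_bcontfun (S g) t) \<le> (B * e) * dist f g" by (simp add: ac_simps)
 qed
 hence "\<exists>!f. S f = f" using banach_fix_type[of "B * e" S] B e by auto
 then obtain f where f: "S f = f" by blast
 define y where "y = apply_bcontfun f"
 have y: "y t = x0 + integral {0..t} (\<lambda>s. P (y s))" if "t \<in> {0..e}" for t
 proof -
  have "cl t = t" using that by (auto simp: cl_def)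
  thus ?thesis using S[of f t] f by (simp add: y_def Op_def)
 qed
 have "(y has_vector_derivative P (y t)) (at t within {0..e})" if t: "t \<in> {0..e}" for t
 proof -
  have "((\<lambda>u. integral {0..u} (\<lambda>s. P (y s))) has_vector_derivative P (y t)) (at t within {0..e})"
   unfolding y_def by (rule integral_has_vector_derivative[OF contPf t])
  hence "((\<lambda>u. x0 + integral {0..u} (\<lambda>s. P (y s))) has_vector_derivative 0 + P (y t)) (at t within {0..e})"
   by (intro has_vector_derivative_add has_vector_derivative_const)
  thus ?thesis using has_vector_derivative_transform[OF t] y by (metis (no_types, lifting) add_0)
 qed
 moreover have "y 0 = x0" using y[of 0] e by simp
 ultimately show ?thesis by blast
qed

lemma ode_local_solution:
 fixes E :: "'a::euclidean_space \<Rightarrow> 'a"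
 assumes "open V" "Ck_on 1 V E" "x0 \<in> V"
 obtains r B e y where "r > 0" "B > 0" "e > 0" "cball x0 r \<subseteq> V" "B * e < 1"
  "\<And>x y. x \<in> cball x0 r \<Longrightarrow> y \<in> cball x0 r \<Longrightarrow> norm (E x - E y) \<le> B * norm (x - y)"
  "y 0 = x0" "\<And>t. t \<in> {0..e} \<Longrightarrow> y t \<in> cball x0 r"
  "\<And>t. t \<in> {0..e} \<Longrightarrow> (y has_vector_derivative E (y t)) (at t within {0..e})"
proof -
 obtain r where r: "r > 0" "cball x0 r \<subseteq> V" using assms(1,3) open_contains_cball by blast
 obtain B where B: "B > 0" "\<And>x y. x \<in> cball x0 r \<Longrightarrow> y \<in> cball x0 r \<Longrightarrow> norm (E x - E y) \<le> B * norm (x - y)"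
  using C1_lipschitz_cball[OF assms(1,2) r(2)] by blast
 define P where "P x = E (closest_point (cball x0 r) x)" for x
 have cp: "closest_point (cball x0 r) x \<in> cball x0 r" for x using r by (intro closest_point_in_set) auto
 have "dist (closest_point (cball x0 r) x) (closest_point (cball x0 r) y) \<le> dist x y" for x y
  using r by (intro closest_point_lipschitz) auto
 hence lip: "norm (P x - P y) \<le> B * norm (x - y)" for x y
  unfolding P_def using order_trans[OF B(2)[OF cp cp, of x y] mult_left_mono[of _ _ B]] B(1) by (simp add: dist_norm)
 define m where "m = norm (E x0) + B * r + 1"
 have bd: "norm (P x) \<le> m" for x
 proof -
  have "norm (P x - E x0) \<le> B * norm (closest_point (cball x0 r) x - x0)" unfolding P_def using r cp by (intro B(2)) auto
  also have "\<dots> \<le> B * r" using cp[of x] B by (intro mult_left_mono) (auto simp: dist_norm norm_minus_commute)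
  finally show ?thesis unfolding m_def using norm_triangle_ineq2[of "P x" "E x0"] by linarith
 qed
 have m: "m > 0" using B r by (simp add: m_def add_nonneg_pos)
 define e where "e = min (1 / (2 * B)) (r / m)"
 have e: "e > 0" "B * e < 1" "m * e \<le> r" using B r m by (auto simp: e_def min_def field_simps)
 obtain y where y: "y 0 = x0" "\<And>t. t \<in> {0..e} \<Longrightarrow> (y has_vector_derivative P (y t)) (at t within {0..e})"
  using ode_global_solution[OF lip bd B(1) e(1,2)] by blast
 have in_ball: "y t \<in> cball x0 r" if t: "t \<in> {0..e}" for t
 proof -
  have "norm (y t - y 0) \<le> m * norm (t - 0)"
  proof (rule differentiable_bound[of "{0..e}" y "\<lambda>t h. h *\<^sub>R P (y t)"])
   show "onorm (\<lambda>h. h *\<^sub>R P (y s)) \<le> m" if "s \<in> {0..e}" for s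
    using bd[of "y s"] by (intro onorm_bound) (auto simp: mult.commute[of m] intro!: mult_left_mono intro: order_trans[OF norm_ge_zero])
  qed (use t e y in \<open>auto simp: has_vector_derivative_def\<close>)
  also have "\<dots> \<le> m * e" using t m by (intro mult_left_mono) auto
  finally show ?thesis using e y(1) by (simp add: dist_norm norm_minus_commute)
 qed
 have "(y has_vector_derivative E (y t)) (at t within {0..e})" if "t \<in> {0..e}" for t
  using y(2)[OF that] closest_point_self[OF in_ball[OF that]] by (simp add: P_def)
 thus thesis by (intro that[of r B e y] r B e y(1) in_ball)
qed

lemma ode_unique:
 fixes E :: "'a::euclidean_space \<Rightarrow> 'a"
 assumes lip: "\<And>x y. x \<in> W \<Longrightarrow> y \<in> W \<Longrightarrow> norm (E x - E y) \<le> B * norm (x - y)" and B: "B > 0" "B * e < 1" "e \<ge> 0"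
  and y1: "\<And>t. t \<in> {0..e} \<Longrightarrow> y1 t \<in> W" "\<And>t. t \<in> {0..e} \<Longrightarrow> (y1 has_vector_derivative E (y1 t)) (at t within {0..e})"
  and y2: "\<And>t. t \<in> {0..e} \<Longrightarrow> y2 t \<in> W" "\<And>t. t \<in> {0..e} \<Longrightarrow> (y2 has_vector_derivative E (y2 t)) (at t within {0..e})"
  and 0: "y1 0 = y2 0" and t: "t \<in> {0..e}"
 shows "y1 t = y2 t"
proof -
 define d where "d t = y1 t - y2 t" for t
 have dd: "(d has_vector_derivative E (y1 t) - E (y2 t)) (at t within {0..e})" if "t \<in> {0..e}" for t
  unfolding d_def using y1(2)[OF that] y2(2)[OF that] by (intro has_vector_derivative_diff)
 hence "continuous_on {0..e} d" unfolding continuous_on_eq_continuous_within using has_vector_derivative_continuous by blast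
 hence "continuous_on {0..e} (\<lambda>t. norm (d t))" by (intro continuous_intros)
 then obtain s where s: "s \<in> {0..e}" "\<And>t. t \<in> {0..e} \<Longrightarrow> norm (d t) \<le> norm (d s)"
  using continuous_attains_sup[of "{0..e}" "\<lambda>t. norm (d t)"] B(3) by auto
 have "norm (d s - d 0) \<le> (B * norm (d s)) * norm (s - 0)"
 proof (rule differentiable_bound[of "{0..e}" d "\<lambda>t h. h *\<^sub>R (E (y1 t) - E (y2 t))"])
  fix t assume t: "t \<in> {0..e}"
  have "norm (E (y1 t) - E (y2 t)) \<le> B * norm (d t)" using lip[OF y1(1)[OF t] y2(1)[OF t]] by (simp add: d_def)
  also have "\<dots> \<le> B * norm (d s)" using s(2)[OF t] B by simp
  finally have le: "norm (E (y1 t) - E (y2 t)) \<le> B * norm (d s)" .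
  show "onorm (\<lambda>h. h *\<^sub>R (E (y1 t) - E (y2 t))) \<le> B * norm (d s)"
  proof (rule onorm_bound)
   show "norm (h *\<^sub>R (E (y1 t) - E (y2 t))) \<le> B * norm (d s) * norm h" for h
    using mult_left_mono[OF le abs_ge_zero[of h]] by (simp add: mult.commute)
  qed (use B in auto)
 qed (use s dd B(3) in \<open>auto simp: has_vector_derivative_def\<close>)
 also have "\<dots> \<le> (B * norm (d s)) * e" using s(1) B by (intro mult_left_mono) auto
 finally have "norm (d s) * (1 - B * e) \<le> 0" using 0 by (simp add: d_def algebra_simps)
 hence "norm (d s) = 0" using B(2) mult_le_0_iff[of "norm (d s)" "1 - B * e"] by auto
 thus ?thesis using s(2)[OF t] by (simp add: d_def)
qed

lemma ode_solution_smooth: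
 fixes E :: "'a::euclidean_space \<Rightarrow> 'a" and y :: "real \<Rightarrow> 'a"
 assumes V: "open V" "\<And>k. Ck_on k V E" and I: "open I" "\<And>t. t \<in> I \<Longrightarrow> y t \<in> V"
  "\<And>t. t \<in> I \<Longrightarrow> (y has_vector_derivative E (y t)) (at t)"
 shows "Ck_on k I y"
proof (induction k)
 case 0
 thus ?case using I(3) by (auto intro!: continuous_at_imp_continuous_on has_vector_derivative_continuous)
next
 case (Suc k)
 show ?case
 proof (rule Ck_on_Suc_has_derivative[OF I(1)])
  show "(y has_derivative (\<lambda>h. h *\<^sub>R E (y t))) (at t)" if "t \<in> I" for t
   using I(3)[OF that] by (simp add: has_vector_derivative_def)
  show "Ck_on k I (\<lambda>t. h *\<^sub>R E (y t))" for h
   using I(2) by (intro Ck_on_scaleR[OF I(1)] Ck_on_const[OF I(1)] Ck_on_compose[OF I(1) V(1) _ Suc V(2)]) auto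
 qed
qed

context Group.group
begin

lemma local_hom_extends:
 fixes \<kappa> :: "real \<Rightarrow> 'a"
 assumes e: "e > 0" and car: "\<And>t. t \<in> {0..e} \<Longrightarrow> \<kappa> t \<in> carrier G"
  and hom: "\<And>s t. 0 \<le> s \<Longrightarrow> 0 \<le> t \<Longrightarrow> s + t \<le> e \<Longrightarrow> \<kappa> (s + t) = \<kappa> s \<otimes> \<kappa> t"
 shows "\<exists>\<gamma>. (\<forall>t. \<gamma> t \<in> carrier G) \<and> (\<forall>s t. \<gamma> (s + t) = \<gamma> s \<otimes> \<gamma> t) \<and> (\<forall>t\<in>{0..<e}. \<gamma> t = \<kappa> t)"
proof -
 have comm0: "\<kappa> s \<otimes> \<kappa> t = \<kappa> t \<otimes> \<kappa> s" if "0 \<le> s" "0 \<le> t" "s + t \<le> e" for s t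
  using hom[OF that] hom[of t s] that by (simp add: add.commute)
 have half: "\<kappa> s = \<kappa> (s/2) \<otimes> \<kappa> (s/2)" if "s \<in> {0..e}" for s using hom[of "s/2" "s/2"] that by simp
 have sq: "(x \<otimes> x) \<otimes> y = y \<otimes> (x \<otimes> x)" if "x \<in> carrier G" "y \<in> carrier G" "x \<otimes> y = y \<otimes> x" for x y
  using that by (metis m_assoc m_closed)
 have swap: "(x \<otimes> x) \<otimes> (y \<otimes> y) = (y \<otimes> y) \<otimes> (x \<otimes> x)" if "x \<in> carrier G" "y \<in> carrier G" "x \<otimes> y = y \<otimes> x" for x y
  using that sq[of y x] by (intro sq) auto
 have comm: "\<kappa> s \<otimes> \<kappa> t = \<kappa> t \<otimes> \<kappa> s" if "s \<in> {0..e}" "t \<in> {0..e}" for s t unfolding half[OF that(1)] half[OF that(2)]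
  by (rule swap) (use that in \<open>auto intro!: car comm0\<close>)
 define n where "n t = \<lfloor>t / e\<rfloor>" for t :: real
 define fr where "fr t = t - of_int (n t) * e" for t
 have fr: "0 \<le> fr t" "fr t < e" for t
  using floor_divide_lower[OF e, of t] floor_divide_upper[OF e, of t] by (auto simp: fr_def n_def algebra_simps)
 have \<kappa>e: "\<kappa> e \<in> carrier G" using car e by auto
 define \<gamma> where "\<gamma> t = \<kappa> e [^] n t \<otimes> \<kappa> (fr t)" for t
 have car\<gamma>: "\<gamma> t \<in> carrier G" for t using car[of "fr t"] fr[of t] \<kappa>e by (auto simp: \<gamma>_def int_pow_closed)
 have cpow: "\<kappa> s \<otimes> (\<kappa> e [^] (k::int)) = \<kappa> e [^] k \<otimes> \<kappa> s" if "s \<in> {0..e}" for s k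
 proof -
  have c: "\<kappa> s \<otimes> \<kappa> e = \<kappa> e \<otimes> \<kappa> s" using comm[OF that, of e] e by simp
  have nat: "\<kappa> e [^] (j::nat) \<otimes> \<kappa> s = \<kappa> s \<otimes> \<kappa> e [^] j" for j
   using group_commutes_pow[of "\<kappa> e" "\<kappa> s" j] c car[OF that] \<kappa>e by simp
  have "inv x \<otimes> y = y \<otimes> inv x" if "x \<in> carrier G" "y \<in> carrier G" "x \<otimes> y = y \<otimes> x" for x y
  proof -
   have "inv x \<otimes> y = inv x \<otimes> (y \<otimes> x) \<otimes> inv x" using that(1,2) by (simp add: m_assoc)
   also have "\<dots> = (inv x \<otimes> x) \<otimes> (y \<otimes> inv x)" unfolding that(3)[symmetric] using that(1,2) by (simp only: m_assoc m_closed inv_closed)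
   finally show ?thesis using that(1,2) by (simp only: l_inv l_one m_closed inv_closed)
  qed
  hence invc: "inv (\<kappa> e [^] j) \<otimes> \<kappa> s = \<kappa> s \<otimes> inv (\<kappa> e [^] j)" for j :: nat using nat[of j] \<kappa>e car[OF that] by simp
  show ?thesis unfolding int_pow_def2 using nat[of "nat k"] invc[of "nat (- k)"] by presburger
 qed
 have "\<gamma> (s + t) = \<gamma> s \<otimes> \<gamma> t" for s t
 proof -
  have f: "fr s \<in> {0..e}" "fr t \<in> {0..e}" using fr less_imp_le by auto
  have "\<gamma> s \<otimes> \<gamma> t = \<kappa> e [^] n s \<otimes> (\<kappa> (fr s) \<otimes> \<kappa> e [^] n t) \<otimes> \<kappa> (fr t)"
   using car[OF f(1)] car[OF f(2)] \<kappa>e by (simp add: \<gamma>_def m_assoc int_pow_closed)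
  also have "\<dots> = (\<kappa> e [^] n s \<otimes> \<kappa> e [^] n t) \<otimes> (\<kappa> (fr s) \<otimes> \<kappa> (fr t))"
   using car[OF f(1)] car[OF f(2)] \<kappa>e by (simp add: cpow[OF f(1)] m_assoc int_pow_closed)
  also have "\<dots> = \<kappa> e [^] (n s + n t) \<otimes> (\<kappa> (fr s) \<otimes> \<kappa> (fr t))" using \<kappa>e by (simp add: int_pow_mult)
  finally have *: "\<gamma> s \<otimes> \<gamma> t = \<kappa> e [^] (n s + n t) \<otimes> (\<kappa> (fr s) \<otimes> \<kappa> (fr t))" .
  have st: "s + t = of_int (n s + n t) * e + (fr s + fr t)" by (simp add: fr_def algebra_simps)
  have fl: "n x = k \<and> fr x = r" if "x = of_int k * e + r" "0 \<le> r" "r < e" for x r k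
  proof -
   have "n x = k" unfolding n_def using that e by (intro floor_unique) (auto simp: field_simps)
   thus ?thesis using that(1) by (simp add: fr_def)
  qed
  show ?thesis
  proof (cases "fr s + fr t < e")
   case True
   hence "n (s + t) = n s + n t \<and> fr (s + t) = fr s + fr t" using st fr[of s] fr[of t] by (intro fl) auto
   thus ?thesis unfolding * using hom[of "fr s" "fr t"] fr[of s] fr[of t] True by (simp add: \<gamma>_def)
  next
   case False
   have "s + t = of_int (n s + n t + 1) * e + (fr s + fr t - e)" unfolding st by (simp add: algebra_simps)
   hence nf: "n (s + t) = n s + n t + 1 \<and> fr (s + t) = fr s + fr t - e" using False fr[of s] fr[of t] by (intro fl) auto
   have cl: "\<kappa> (fr s + fr t - e) \<in> carrier G" "\<kappa> (e - fr s) \<in> carrier G" "\<kappa> (fr s) \<in> carrier G"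
    using False fr[of s] fr[of t] by (auto intro: car)
   have "\<kappa> (fr t) = \<kappa> (e - fr s) \<otimes> \<kappa> (fr s + fr t - e)"
    using hom[of "e - fr s" "fr s + fr t - e"] False fr[of s] fr[of t] by simp
   moreover have "\<kappa> e = \<kappa> (fr s) \<otimes> \<kappa> (e - fr s)" using hom[of "fr s" "e - fr s"] fr[of s] by simp
   ultimately have "\<kappa> (fr s) \<otimes> \<kappa> (fr t) = \<kappa> e \<otimes> \<kappa> (fr s + fr t - e)" using cl by (simp add: m_assoc)
   moreover have "\<kappa> e [^] (n s + n t + 1) = \<kappa> e [^] (n s + n t) \<otimes> \<kappa> e" using int_pow_mult[OF \<kappa>e, of "n s + n t" 1] \<kappa>e by simp
   ultimately show ?thesis unfolding * \<gamma>_def[of "s + t"] using nf \<kappa>e cl by (simp add: m_assoc int_pow_closed)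
  qed
 qed
 moreover have "\<gamma> t = \<kappa> t" if "t \<in> {0..<e}" for t
 proof -
  have "n t = 0" unfolding n_def using that e by (intro floor_unique) auto
  thus ?thesis using that car[of t] by (simp add: \<gamma>_def fr_def)
 qed
 ultimately show ?thesis using car\<gamma> by blast
qed

end

context metric_lie
begin

definition d0 where "d0 = (SOME d. d \<in> C \<and> \<one> \<in> fst d)"
definition e0 where "e0 = snd d0 \<one>"
definition Lam where "Lam d a = fder (\<lambda>y. snd d (a \<otimes> chart_inv d0 y)) e0"
definition g0 where "g0 v w = v \<bullet> (metric X d0 e0 *v w)"

lemma d0: "d0 \<in> C" "\<one> \<in> fst d0"
proof -
 have "\<exists>d. d \<in> C \<and> \<one> \<in> fst d" using chart_cover[OF mfd, of \<one>] topspace_T by auto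
 from someI_ex[OF this] show "d0 \<in> C" "\<one> \<in> fst d0" by (simp_all add: d0_def)
qed

lemma e0: "e0 \<in> snd d0 ` fst d0" "chart_inv d0 e0 = \<one>" using d0 chart_inv_snd[OF mfd d0] by (auto simp: e0_def)

lemma chart_carrier: "d \<in> C \<Longrightarrow> p \<in> fst d \<Longrightarrow> p \<in> carrier X" using chart_subset[OF mfd] topspace_T by blast

lemma smooth_left_mult_chart:
 "a \<in> carrier X \<Longrightarrow> e \<in> C \<Longrightarrow> smooth_into (mfd X) (snd e ` fst e) (\<lambda>y. a \<otimes> chart_inv e y)"
 by (intro smooth_into_mult smooth_into_const[OF mfd] smooth_into_chart_inv[OF mfd] chart_open[OF mfd])
  (auto simp: topspace_T)

lemma left_mult_has_derivative:
 assumes "a \<in> carrier X" "d \<in> C" "e \<in> C" "b \<in> fst e" "a \<otimes> b \<in> fst d"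
 shows "((\<lambda>y. snd d (a \<otimes> chart_inv e y)) has_derivative fder (\<lambda>y. snd d (a \<otimes> chart_inv e y)) (snd e b)) (at (snd e b))"
 by (rule smooth_into_has_derivative[OF mfd smooth_left_mult_chart[OF assms(1,3)] assms(2)])
  (use assms chart_inv_snd[OF mfd] in auto)

lemma Lam_has_derivative:
 assumes "d \<in> C" "a \<in> fst d"
 shows "((\<lambda>y. snd d (a \<otimes> chart_inv d0 y)) has_derivative Lam d a) (at e0)" unfolding Lam_def e0_def
 by (rule left_mult_has_derivative) (use assms d0 chart_carrier in auto)

lemma linear_Lam: "d \<in> C \<Longrightarrow> a \<in> fst d \<Longrightarrow> linear (Lam d a)" using Lam_has_derivative has_derivative_linear by blast

lemma Lam_isometry:
 assumes "d \<in> C" "a \<in> fst d"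
 shows "Lam d a v \<bullet> (metric X d (snd d a) *v Lam d a w) = g0 v w"
proof -
 have a: "a \<in> carrier X" using assms chart_carrier by blast
 thus ?thesis using left_mult_isometry[OF a d0(1) assms(1) d0(2), of v w] assms by (simp add: Lam_def e0_def g0_def)
qed

lemma derivative_mult_curve:
 assumes d: "d \<in> C" "a \<in> fst d" and \<kappa>: "((\<lambda>u. snd d0 (\<kappa> u)) has_derivative D) (at u0)" "\<kappa> u0 = \<one>"
  and near: "\<forall>\<^sub>F u in nhds u0. \<kappa> u \<in> fst d0"
 shows "((\<lambda>u. snd d (a \<otimes> \<kappa> u)) has_derivative (\<lambda>v. Lam d a (D v))) (at u0)"
proof -
 have "((\<lambda>u. snd d (a \<otimes> chart_inv d0 (snd d0 (\<kappa> u)))) has_derivative (\<lambda>v. Lam d a (D v))) (at u0)"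
  by (rule has_derivative_compose[OF \<kappa>(1)]) (use Lam_has_derivative[OF d] \<kappa>(2) in \<open>simp add: e0_def\<close>)
 thus ?thesis
 proof (rule has_derivative_transform_eventually)
  show "\<forall>\<^sub>F u in at u0. snd d (a \<otimes> chart_inv d0 (snd d0 (\<kappa> u))) = snd d (a \<otimes> \<kappa> u)"
   using eventually_nhds_x_imp_x[OF near] near chart_inv_snd[OF mfd d0(1)]
   by (auto simp: eventually_at_filter elim!: eventually_mono)
 qed (use \<kappa>(2) d0 chart_inv_snd[OF mfd d0(1)] in auto)
qed

lemma continuous_chart_nbhd:
 assumes "e \<in> C" "b \<in> fst e" "a \<in> carrier X" "d \<in> C" "a \<otimes> b \<in> fst d"
 shows "\<forall>\<^sub>F y in nhds (snd e b). y \<in> snd e ` fst e \<and> a \<otimes> chart_inv e y \<in> fst d"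
proof -
 have "open {y \<in> snd e ` fst e. a \<otimes> chart_inv e y \<in> fst d}"
  by (rule smooth_into_open[OF mfd smooth_left_mult_chart[OF assms(3,1)] assms(4)])
 thus ?thesis using eventually_nhds_in_open[of _ "snd e b"] assms chart_inv_snd[OF mfd assms(1)] by fastforce
qed

lemma Lam_mult:
 assumes a: "a \<in> carrier X" and b: "e \<in> C" "b \<in> fst e" and d: "d \<in> C" "a \<otimes> b \<in> fst d"
 shows "Lam d (a \<otimes> b) v = fder (\<lambda>y. snd d (a \<otimes> chart_inv e y)) (snd e b) (Lam e b v)"
proof -
 have bc: "b \<in> carrier X" using b chart_carrier by blast
 have "((\<lambda>y. snd d (a \<otimes> chart_inv e (snd e (b \<otimes> chart_inv d0 y)))) has_derivative
   (\<lambda>v. fder (\<lambda>y. snd d (a \<otimes> chart_inv e y)) (snd e b) (Lam e b v))) (at e0)"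
  by (rule has_derivative_compose[OF Lam_has_derivative[OF b]])
   (use left_mult_has_derivative[OF a d(1) b d(2)] e0 bc in simp)
 hence "((\<lambda>y. snd d (a \<otimes> b \<otimes> chart_inv d0 y)) has_derivative
   (\<lambda>v. fder (\<lambda>y. snd d (a \<otimes> chart_inv e y)) (snd e b) (Lam e b v))) (at e0)"
 proof (rule has_derivative_transform_eventually)
  have "\<forall>\<^sub>F y in nhds e0. y \<in> snd d0 ` fst d0 \<and> b \<otimes> chart_inv d0 y \<in> fst e"
   using continuous_chart_nbhd[OF d0 bc b(1)] b bc by (simp add: e0_def)
  thus "\<forall>\<^sub>F y in at e0. snd d (a \<otimes> chart_inv e (snd e (b \<otimes> chart_inv d0 y))) = snd d (a \<otimes> b \<otimes> chart_inv d0 y)"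
   unfolding eventually_at_filter
   by (rule eventually_mono) (use a bc chart_inv_snd[OF mfd b(1)] chart_inv_snd[OF mfd d0(1)] chart_carrier[OF d0(1)] in \<open>auto simp: m_assoc\<close>)
 qed (use e0 a bc b chart_inv_snd[OF mfd b(1)] in \<open>auto simp: m_assoc\<close>)
 thus ?thesis by (simp add: Lam_def frechet_derivative_eqI)
qed

lemma Lam_one: "Lam d0 \<one> v = v"
proof -
 have "((\<lambda>y. y) has_derivative (\<lambda>v. v)) (at e0)" by (rule has_derivative_ident)
 hence "((\<lambda>y. snd d0 (\<one> \<otimes> chart_inv d0 y)) has_derivative (\<lambda>v. v)) (at e0)"
  by (rule has_derivative_transform_within_open[OF _ chart_open[OF mfd d0(1)] e0(1)])
   (simp add: chart_carrier[OF d0(1) chart_inv_in] snd_chart_inv)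
 thus ?thesis by (simp add: Lam_def frechet_derivative_eqI)
qed

lemma Lam_smooth: "Ck_on k (snd d0 ` fst d0) (\<lambda>x. Lam d0 (chart_inv d0 x) v)"
proof -
 let ?S = "{(x, y). x \<in> snd d0 ` fst d0 \<and> y \<in> snd d0 ` fst d0 \<and> chart_inv d0 x \<otimes> chart_inv d0 y \<in> fst d0}"
 let ?M = "\<lambda>(x, y). snd d0 (chart_inv d0 x \<otimes> chart_inv d0 y)"
 let ?V = "snd d0 ` fst d0"
 note M = mult_chart[OF d0(1) d0(1) d0(1)]
 have V: "open ?V" by (rule chart_open[OF mfd d0(1)])
 have inS: "(x, e0) \<in> ?S" if "x \<in> ?V" for x using that e0 chart_inv_in[OF that] chart_carrier[OF d0(1)] by simp
 have "Lam d0 (chart_inv d0 x) v = fder ?M (x, e0) (0, v)" if "x \<in> ?V" for x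
 proof -
  have "(?M has_derivative fder ?M (x, e0)) (at (x, e0))" by (rule Ck_on_SucD[OF M(2) inS[OF that]])
  moreover have "((\<lambda>y. (x, y)) has_derivative (\<lambda>v. (0, v))) (at e0)"
   by (intro has_derivative_Pair has_derivative_const has_derivative_ident)
  ultimately have "((\<lambda>y. ?M (x, y)) has_derivative (\<lambda>v. fder ?M (x, e0) (0, v))) (at e0)"
   by (rule has_derivative_compose[rotated])
  thus ?thesis by (simp add: Lam_def frechet_derivative_eqI)
 qed
 moreover have "Ck_on k ?V (\<lambda>x. fder ?M (x, e0) (0, v))"
 proof (rule Ck_on_compose[OF V M(1)])
  show "Ck_on k ?V (\<lambda>x. (x, e0))" by (intro Ck_on_Pair V Ck_on_ident Ck_on_const)
  show "Ck_on k ?S (\<lambda>p. fder ?M p (0, v))" using M(2)[of "Suc k"] by (simp only: Ck_on.simps)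
 qed (use inS in auto)
 ultimately show ?thesis using Ck_on_cong_open[OF V, of "\<lambda>x. Lam d0 (chart_inv d0 x) v" _ k] by simp
qed

theorem one_parameter_subgroup:
 fixes v :: "real ^ 3"
 obtains \<gamma> :: "real \<Rightarrow> 'a" where "\<And>s t. \<gamma> (s + t) = \<gamma> s \<otimes> \<gamma> t" "smooth_into (mfd X) UNIV \<gamma>"
  "((\<lambda>t. snd d0 (\<gamma> t)) has_vector_derivative v) (at 0)"
proof -
 let ?V = "snd d0 ` fst d0"
 define E where "E x = Lam d0 (chart_inv d0 x) v" for x
 have V: "open ?V" by (rule chart_open[OF mfd d0(1)])
 have Es: "Ck_on k ?V E" for k using Lam_smooth[of k v] by (simp add: E_def[abs_def])
 obtain r B e y where r: "r > 0" "cball e0 r \<subseteq> ?V" and B: "B > 0" and e: "e > 0" "B * e < 1"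
  and lip: "\<And>x y. x \<in> cball e0 r \<Longrightarrow> y \<in> cball e0 r \<Longrightarrow> norm (E x - E y) \<le> B * norm (x - y)"
  and y0: "y 0 = e0" and yr: "\<And>t. t \<in> {0..e} \<Longrightarrow> y t \<in> cball e0 r"
  and dy: "\<And>t. t \<in> {0..e} \<Longrightarrow> (y has_vector_derivative E (y t)) (at t within {0..e})"
  using ode_local_solution[OF V Es[of 1] e0(1)] by metis
 define c where "c t = chart_inv d0 (y t)" for t
 have yV: "y t \<in> ?V" if "t \<in> {0..e}" for t using yr[OF that] r by blast
 have cd0: "c t \<in> fst d0" "snd d0 (c t) = y t" if "t \<in> {0..e}" for t
  using chart_inv_in[OF yV[OF that]] snd_chart_inv[OF yV[OF that]] by (simp_all add: c_def)
 have cc: "c t \<in> carrier X" if "t \<in> {0..e}" for t using cd0[OF that] chart_carrier[OF d0(1)] by blast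
 let ?S = "{(x, y). x \<in> ?V \<and> y \<in> ?V \<and> chart_inv d0 x \<otimes> chart_inv d0 y \<in> fst d0}"
 let ?M = "\<lambda>(x, y). snd d0 (chart_inv d0 x \<otimes> chart_inv d0 y)"
 note M = mult_chart[OF d0(1) d0(1) d0(1)]
 have 00: "(e0, e0) \<in> ?S" using e0 d0 by simp
 have "isCont ?M (e0, e0)"
  using iffD1[OF continuous_on_eq_continuous_at[OF M(1)] Ck_on_imp_continuous_on[OF M(2)[of 0]]] 00 by (rule bspec)
 moreover have "?M (e0, e0) = e0" using e0 d0 by (simp add: e0_def)
 ultimately have "\<forall>\<^sub>F p in nhds (e0, e0). ?M p \<in> ball e0 r"
  using r(1) tendsto_at_iff_tendsto_nhds[of ?M "(e0, e0)"] by (intro topological_tendstoD[where l = e0]) (auto simp: isCont_def)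
 hence "\<forall>\<^sub>F p in nhds (e0, e0). p \<in> ?S \<and> ?M p \<in> ball e0 r"
  using eventually_nhds_in_open[OF M(1) 00] by (auto elim: eventually_elim2)
 then obtain \<rho> where \<rho>: "\<rho> > 0" "\<And>p. dist p (e0, e0) < \<rho> \<Longrightarrow> p \<in> ?S \<and> ?M p \<in> ball e0 r"
  unfolding eventually_nhds_metric by blast
 have "continuous (at 0 within {0..e}) y" using has_vector_derivative_continuous[OF dy[of 0]] e by simp
 then obtain \<delta> where \<delta>: "\<delta> > 0" "\<And>t. t \<in> {0..e} \<Longrightarrow> dist t 0 < \<delta> \<Longrightarrow> dist (y t) (y 0) < \<rho> / 2"
  using \<rho>(1) unfolding continuous_within_eps_delta by (metis half_gt_zero)
 define \<epsilon> where "\<epsilon> = min (\<delta> / 2) (e / 2)"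
 have \<epsilon>: "\<epsilon> > 0" "\<epsilon> < \<delta>" "2 * \<epsilon> \<le> e" using \<delta> e by (auto simp: \<epsilon>_def min_def)
 have near: "(y s, y t) \<in> ?S \<and> ?M (y s, y t) \<in> ball e0 r" if "s \<in> {0..\<epsilon>}" "t \<in> {0..\<epsilon>}" for s t
 proof (rule \<rho>(2))
  have "dist (y s) e0 < \<rho> / 2" "dist (y t) e0 < \<rho> / 2" using \<delta>(2)[of s] \<delta>(2)[of t] that \<epsilon> e y0 by auto
  moreover have "dist (y s, y t) (e0, e0) \<le> dist (y s) e0 + dist (y t) e0"
   unfolding dist_Pair_Pair by (rule sqrt_sum_squares_le_sum) auto
  ultimately show "dist (y s, y t) (e0, e0) < \<rho>" by linarith
 qed
 have hom: "c (s + t) = c s \<otimes> c t" if s: "s \<in> {0..\<epsilon>}" and t: "t \<in> {0..\<epsilon>}" for s t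
 proof -
  have se: "s \<in> {0..e}" using s \<epsilon> by auto
  have "?M (y s, y t) = y (s + t)"
  proof (rule ode_unique[where W = "cball e0 r" and B = B and e = \<epsilon> and t = t and E = E
     and ?y1.0 = "\<lambda>t. ?M (y s, y t)" and ?y2.0 = "\<lambda>t. y (s + t)"])
   show "B * \<epsilon> < 1" using \<epsilon> e mult_left_mono[of \<epsilon> e B] B by linarith
   fix t assume t: "t \<in> {0..\<epsilon>}"
   hence te: "t \<in> {0..e}" "s + t \<in> {0..e}" using s \<epsilon> by auto
   show "?M (y s, y t) \<in> cball e0 r" using near[OF s t] by auto
   show "y (s + t) \<in> cball e0 r" using yr[OF te(2)] .
   have prod: "c s \<otimes> c t \<in> fst d0" using near[OF s t] by (simp add: c_def)
   have "((\<lambda>z. snd d0 (c s \<otimes> chart_inv d0 z)) has_derivative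
     fder (\<lambda>z. snd d0 (c s \<otimes> chart_inv d0 z)) (y t)) (at (y t))"
    using left_mult_has_derivative[OF cc[OF se] d0(1) d0(1) cd0(1)[OF te(1)] prod] by (simp add: cd0(2)[OF te(1)])
   from vector_derivative_diff_chain_within[OF has_vector_derivative_within_subset[OF dy[OF te(1)], of "{0..\<epsilon>}"] has_derivative_at_withinI[OF this]]
   have "((\<lambda>t. snd d0 (c s \<otimes> chart_inv d0 (y t))) has_vector_derivative
     fder (\<lambda>z. snd d0 (c s \<otimes> chart_inv d0 z)) (y t) (E (y t))) (at t within {0..\<epsilon>})" using \<epsilon> by (auto simp: o_def)
   moreover have "fder (\<lambda>z. snd d0 (c s \<otimes> chart_inv d0 z)) (y t) (E (y t)) = Lam d0 (c s \<otimes> c t) v"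
    using Lam_mult[OF cc[OF se] d0(1) cd0(1)[OF te(1)] d0(1) prod, of v] cd0(2)[OF te(1)] by (simp add: E_def c_def)
   moreover have "Lam d0 (c s \<otimes> c t) v = E (?M (y s, y t))"
    using prod chart_inv_snd[OF mfd d0(1) prod] by (simp add: E_def c_def)
   ultimately show "((\<lambda>t. ?M (y s, y t)) has_vector_derivative E (?M (y s, y t))) (at t within {0..\<epsilon>})" by (simp add: c_def)
   have "((+) s has_vector_derivative 1) (at t within {0..\<epsilon>})"
    by (auto intro!: derivative_eq_intros simp: has_vector_derivative_def)
   moreover have "(y has_vector_derivative E (y (s + t))) (at (s + t) within (+) s ` {0..\<epsilon>})"
    by (rule has_vector_derivative_within_subset[OF dy[OF te(2)]]) (use s \<epsilon> in auto)
   ultimately show "((\<lambda>t. y (s + t)) has_vector_derivative E (y (s + t))) (at t within {0..\<epsilon>})"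
    using vector_diff_chain_within[of "(+) s" 1 t "{0..\<epsilon>}" y "E (y (s + t))"] by (simp add: o_def)
  next
   show "?M (y s, y 0) = y (s + 0)" using y0 e0 cc[OF se] cd0(2)[OF se] by (simp add: c_def)
  qed (use lip B \<epsilon> t in auto)
  thus ?thesis using near[OF s t] chart_inv_snd[OF mfd d0(1), of "c s \<otimes> c t"] by (simp add: c_def)
 qed
 obtain \<gamma> where \<gamma>: "\<And>t. \<gamma> t \<in> carrier X" "\<And>s t. \<gamma> (s + t) = \<gamma> s \<otimes> \<gamma> t" "\<And>t. t \<in> {0..<\<epsilon>} \<Longrightarrow> \<gamma> t = c t"
  using local_hom_extends[OF \<epsilon>(1), of c] cc \<epsilon> hom by fastforce
 have I: "smooth_into (mfd X) {0<..<\<epsilon>} \<gamma>"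
 proof (rule smooth_into_charts[OF mfd _ d0(1)])
  fix k
  have "Ck_on k {0<..<\<epsilon>} y"
  proof (rule ode_solution_smooth[OF V Es])
   fix t assume t: "t \<in> {0<..<\<epsilon>}"
   hence "t \<in> interior {0..e}" using \<epsilon> by auto
   thus "(y has_vector_derivative E (y t)) (at t)"
    using dy[of t] t \<epsilon> unfolding at_within_interior[OF \<open>t \<in> interior {0..e}\<close>] by auto
   show "y t \<in> ?V" using yV[of t] t \<epsilon> by auto
  qed simp
  thus "Ck_on k {0<..<\<epsilon>} (\<lambda>t. snd d0 (\<gamma> t))"
   using Ck_on_cong_open[of "{0<..<\<epsilon>}" y "\<lambda>t. snd d0 (\<gamma> t)" k] \<gamma>(3) cd0(2) \<epsilon> by auto
 qed (use \<gamma>(3) cd0(1) \<epsilon> in auto)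
 have smooth: "smooth_into (mfd X) UNIV \<gamma>"
 proof (rule smooth_into_local[OF mfd])
  fix t0 :: real
  let ?W = "{t0 - \<epsilon>/2<..<t0 + \<epsilon>/2}"
  have "smooth_into (mfd X) ?W (\<lambda>t. \<gamma> (t0 - \<epsilon>/2) \<otimes> \<gamma> (t - t0 + \<epsilon>/2))"
  proof (intro smooth_into_mult smooth_into_const[OF mfd])
   show "smooth_into (mfd X) ?W (\<lambda>t. \<gamma> (t - t0 + \<epsilon>/2))"
   proof (rule smooth_into_compose[OF mfd I])
    show "Ck_on k ?W (\<lambda>t. t - t0 + \<epsilon>/2)" for k by (intro Ck_on_add Ck_on_diff Ck_on_ident Ck_on_const) auto
   qed auto
  qed (use \<gamma>(1) in \<open>auto simp: topspace_T\<close>)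
  moreover have "\<gamma> (t0 - \<epsilon>/2) \<otimes> \<gamma> (t - t0 + \<epsilon>/2) = \<gamma> t" for t by (simp flip: \<gamma>(2))
  ultimately show "\<exists>W. open W \<and> t0 \<in> W \<and> W \<subseteq> UNIV \<and> smooth_into (mfd X) W \<gamma>" using \<epsilon> by (intro exI[of _ ?W]) auto
 qed simp
 have \<gamma>0: "\<gamma> 0 = \<one>" using \<gamma>(3)[of 0] \<epsilon> y0 e0 by (simp add: c_def)
 have D: "((\<lambda>t. snd d0 (\<gamma> t)) has_derivative fder (\<lambda>t. snd d0 (\<gamma> t)) 0) (at 0)"
  by (rule smooth_into_has_derivative[OF mfd smooth d0(1)]) (use \<gamma>0 d0 in auto)
 have "(\<lambda>h. h *\<^sub>R fder (\<lambda>t. snd d0 (\<gamma> t)) 0 1) = fder (\<lambda>t. snd d0 (\<gamma> t)) 0"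
 proof (rule ext)
  show "h *\<^sub>R fder (\<lambda>t. snd d0 (\<gamma> t)) 0 1 = fder (\<lambda>t. snd d0 (\<gamma> t)) 0 h" for h
   using linear_scale[OF has_derivative_linear[OF D], of h 1] by simp
 qed
 hence D': "((\<lambda>t. snd d0 (\<gamma> t)) has_vector_derivative fder (\<lambda>t. snd d0 (\<gamma> t)) 0 1) (at 0)"
  unfolding has_vector_derivative_def using D by simp
 have "((\<lambda>t. snd d0 (\<gamma> t)) has_vector_derivative v) (at 0 within {0..\<epsilon>/2})"
 proof (rule has_vector_derivative_transform)
  show "(y has_vector_derivative v) (at 0 within {0..\<epsilon>/2})"
   using has_vector_derivative_within_subset[OF dy[of 0], of "{0..\<epsilon>/2}"] e \<epsilon> y0 e0 Lam_one by (simp add: E_def)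
 qed (use \<gamma>(3) cd0(2) \<epsilon> in auto)
 hence "fder (\<lambda>t. snd d0 (\<gamma> t)) 0 1 = v"
  using vector_derivative_unique_within_closed_interval[of 0 "\<epsilon>/2" 0, OF _ _ has_vector_derivative_at_within[OF D']] \<epsilon> by auto
 thus thesis using that \<gamma>(2) smooth D' by metis
qed

lemma g0_bilinear: "bilinear g0" unfolding bilinear_def g0_def
 by (auto intro!: linearI simp: inner_add_left inner_add_right matrix_vector_right_distrib matrix_vector_mult_scaleR)

lemma g0_sym: "g0 v w = g0 w v"
 using inner_symmetric_matrix[OF metric_symmetric[OF d0], of v w] by (simp add: g0_def e0_def inner_commute)

lemma g0_pos: "v \<noteq> 0 \<Longrightarrow> 0 < g0 v v" using metric_pos[OF d0] by (simp add: g0_def e0_def)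

lemma g0_unit_normal:
 fixes J :: "real ^ 2 \<Rightarrow> real ^ 3" assumes J: "linear J" "inj J"
 obtains v where "g0 v v = 1" "\<And>x. g0 v (J x) = 0"
proof -
 let ?G = "metric X d0 e0"
 define n where "n = cross3 (J (axis 1 1)) (J (axis 2 1))"
 have "n \<noteq> 0"
 proof
  assume "n = 0"
  hence "collinear {0, J (axis 1 1), J (axis 2 1)}" by (simp add: n_def cross_eq_0)
  hence "J (axis 1 1) = 0 \<or> J (axis 2 1) = 0 *\<^sub>R J (axis 1 1) \<or> (\<exists>k. J (axis 2 1) = k *\<^sub>R J (axis 1 1))"
   unfolding collinear_lemma by simp
  then obtain k where k: "J (axis 1 1) = 0 \<or> J (axis 2 1) = k *\<^sub>R J (axis 1 1)" by blast
  have nz: "J c \<noteq> 0" if "c \<noteq> 0" for c using J that linear_injective_0 by metis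
  have "axis 1 1 \<noteq> (0 :: real ^ 2)" "axis 2 1 - k *\<^sub>R axis 1 1 \<noteq> (0 :: real ^ 2)"
   by (auto simp: vec_eq_iff forall_2 axis_def)
  from nz[OF this(1)] nz[OF this(2)] k show False by (simp add: linear_diff[OF J(1)] linear_scale[OF J(1)])
 qed
 have "invertible ?G" using metric_invertible[OF d0] by (simp add: e0_def)
 then obtain B where "?G ** B = mat 1" unfolding invertible_def by blast
 hence Gv: "?G *v (B *v n) = n" by (simp add: matrix_vector_mul_assoc)
 define v0 where "v0 = B *v n"
 have v0: "v0 \<noteq> 0" using Gv \<open>n \<noteq> 0\<close> by (auto simp: v0_def)
 have orth: "g0 v0 (J x) = 0" for x
 proof -
  have "g0 v0 (J x) = J x \<bullet> n" unfolding g0_sym[of v0] by (simp add: g0_def v0_def Gv)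
  also have "\<dots> = (\<Sum>i\<in>UNIV. x $ i *\<^sub>R J (axis i 1)) \<bullet> n" using linear_axis_expansion[OF J(1), of x] by simp
  also have "\<dots> = 0" by (simp add: sum_2 inner_add_left n_def dot_cross_self)
  finally show ?thesis .
 qed
 define v where "v = (1 / sqrt (g0 v0 v0)) *\<^sub>R v0"
 show thesis
 proof (rule that[of v])
  show "g0 v v = 1" using g0_pos[OF v0] by (simp add: v_def bilinear_lmul[OF g0_bilinear] bilinear_rmul[OF g0_bilinear])
  show "g0 v (J x) = 0" for x using orth by (simp add: v_def bilinear_lmul[OF g0_bilinear])
 qed
qed

end

section \<open>Flow coordinates\<close>

lemma chart_preimage_open:
 assumes M: "smooth_manifold M" "d \<in> charts M" and "open W"
 shows "openin (pts M) {p \<in> fst d. snd d p \<in> W}"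
proof -
 have "openin (subtopology (pts M) (fst d)) {p \<in> topspace (subtopology (pts M) (fst d)). snd d p \<in> W}"
  by (rule openin_continuous_map_preimage[OF chart_continuous[OF M]]) (use assms(3) in auto)
 moreover have "{p \<in> topspace (subtopology (pts M) (fst d)). snd d p \<in> W} = {p \<in> fst d. snd d p \<in> W}"
  using chart_subset[OF M] by auto
 ultimately show ?thesis using openin_trans_full[OF _ chart_openin[OF M]] by simp
qed

lemma additive_differentiable_linear:
 fixes f :: "'a::real_normed_vector \<Rightarrow> 'b::real_normed_vector"
 assumes add: "\<And>x y. f (x + y) = f x + f y" and D: "(f has_derivative D) (at 0)"
 shows "f = D"
proof
 fix x
 have f0: "f 0 = 0" using add[of 0 0] by simp
 have nat: "f (of_nat n *\<^sub>R y) = of_nat n *\<^sub>R f y" for n y by (induction n) (auto simp: f0 add scaleR_add_left)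
 have lin: "linear D" using D by (rule has_derivative_linear)
 have le: "norm (f x - D x) \<le> e * norm x" if e: "e > 0" for e
 proof -
  obtain d where d: "d > 0" "\<And>y. norm y < d \<Longrightarrow> norm (f y - D y) \<le> e * norm y"
   using D e unfolding has_derivative_at_alt f0 by auto
  obtain n :: nat where n: "norm x / d < of_nat n" using reals_Archimedean2 by blast
  hence "0 < real n" using d(1) by (metis divide_nonneg_pos norm_ge_zero order_le_less_trans)
  define y where "y = (1 / real n) *\<^sub>R x"
  have x: "x = of_nat n *\<^sub>R y" using \<open>0 < real n\<close> by (simp add: y_def)
  have "norm y < d" using n d(1) \<open>0 < real n\<close> by (simp add: y_def field_simps)
  hence "real n * norm (f y - D y) \<le> real n * (e * norm y)" using d(2) \<open>0 < real n\<close> by (intro mult_left_mono) auto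
  moreover have "f x - D x = real n *\<^sub>R (f y - D y)" unfolding x nat linear_scale[OF lin] by (simp add: scaleR_diff_right)
  ultimately show ?thesis using x by (simp add: ac_simps)
 qed
 have "norm (f x - D x) \<le> 0"
 proof (rule field_le_epsilon)
  fix e :: real assume "e > 0"
  have "norm (f x - D x) \<le> (e / (norm x + 1)) * norm x" using \<open>e > 0\<close> by (intro le) (simp add: add_nonneg_pos)
  also have "\<dots> = e * (norm x / (norm x + 1))" by simp
  also have "\<dots> \<le> e * 1" using \<open>e > 0\<close> by (intro mult_left_mono) (auto simp: divide_le_eq_1 add_nonneg_pos)
  finally show "norm (f x - D x) \<le> 0 + e" by simp
 qed
 thus "f x = D x" by simp
qed

locale lie_frame = metric_lie +
 fixes \<phi> :: "real ^ 2 \<Rightarrow> 'a" and c :: "real \<Rightarrow> 'a" and N :: "'a set"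
 assumes \<phi>_add: "\<phi> (x + x') = \<phi> x \<otimes> \<phi> x'" and range_\<phi>: "range \<phi> = N" and normal_N: "N \<lhd> X" and closed_N: "closedin T N"
  and \<phi>_smooth: "smooth_into (mfd X) UNIV \<phi>" and \<phi>_emb: "embedding_map euclidean T \<phi>"
  and c_add: "c (s + t) = c s \<otimes> c t" and c_smooth: "smooth_into (mfd X) UNIV c"
  and orth: "g0 (fder (\<lambda>y. snd d0 (\<phi> (hor y) \<otimes> c (y $ 3))) 0 v)
    (fder (\<lambda>y. snd d0 (\<phi> (hor y) \<otimes> c (y $ 3))) 0 w) = v \<bullet> w"
begin

lemma \<phi>_carrier [simp]: "\<phi> x \<in> carrier X" and c_carrier [simp]: "c t \<in> carrier X"
 using smooth_into_carrier[OF \<phi>_smooth] smooth_into_carrier[OF c_smooth] by auto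

lemma \<phi>_0 [simp]: "\<phi> 0 = \<one>" and c_0 [simp]: "c 0 = \<one>"
 using \<phi>_add[of 0 0] c_add[of 0 0] \<phi>_carrier[of 0] c_carrier[of 0] by (simp_all add: r_cancel_one)

lemma c_uminus: "c (- t) = inv (c t)" using c_add[of t "- t"] by (intro inv_equality[symmetric]) (simp_all flip: c_add)

lemma \<phi>_uminus: "\<phi> (- x) = inv (\<phi> x)" by (intro inv_equality[symmetric]) (simp_all flip: \<phi>_add)

lemma inj_\<phi>: "inj \<phi>" using \<phi>_emb homeomorphic_imp_injective_map[of euclidean _ \<phi>] by (simp add: embedding_map_def)

lemma \<phi>_in: "\<phi> x \<in> N" using range_\<phi> by auto

definition Th :: "'a \<Rightarrow> real ^ 3 \<Rightarrow> 'a" where "Th a y = a \<otimes> (\<phi> (hor y) \<otimes> c (y $ 3))"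

abbreviation "J0 \<equiv> fder (\<lambda>y. snd d0 (Th \<one> y)) 0"
abbreviation "Thc a d \<equiv> \<lambda>y. snd d (Th a y)"
abbreviation "vert d p \<equiv> Lam d p (J0 (axis 3 1))"

lemma Th_one: "Th \<one> y = \<phi> (hor y) \<otimes> c (y $ 3)" by (simp add: Th_def)

lemma Th_0 [simp]: "a \<in> carrier X \<Longrightarrow> Th a 0 = a" by (simp add: Th_def)

lemma Th_carrier [simp]: "a \<in> carrier X \<Longrightarrow> Th a y \<in> carrier X" by (simp add: Th_def)

lemma orth': "g0 (J0 v) (J0 w) = v \<bullet> w" using orth by (simp add: Th_one)

lemma Th_smooth: "a \<in> carrier X \<Longrightarrow> smooth_into (mfd X) UNIV (Th a)" unfolding Th_def
 by (intro smooth_into_mult smooth_into_const[OF mfd] smooth_into_compose[OF mfd \<phi>_smooth]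
   smooth_into_compose[OF mfd c_smooth] Ck_on_linear bounded_linear_hor bounded_linear_vec_nth)
  (auto simp: topspace_T)

lemma Th_continuous: "a \<in> carrier X \<Longrightarrow> continuous_map euclidean T (Th a)" using smooth_intoD(2)[OF Th_smooth] by simp

lemma Th_one_has_derivative: "((\<lambda>y. snd d0 (Th \<one> y)) has_derivative J0) (at 0)"
 by (rule smooth_into_has_derivative[OF mfd Th_smooth d0(1)]) (use d0 in auto)

lemma Th_one_near: "\<forall>\<^sub>F y in nhds 0. Th \<one> y \<in> fst d0"
 using eventually_nhds_in_open[OF smooth_into_open[OF mfd Th_smooth d0(1), of \<one>], of 0] d0 by simp

lemma Th_has_derivative_0:
 assumes a: "a \<in> carrier X" and d: "d \<in> C" "Th a y \<in> fst d" and \<kappa>: "linear \<kappa>" "\<And>s. Th a (y + s) = Th a y \<otimes> Th \<one> (\<kappa> s)"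
 shows "((Thc a d) has_derivative (\<lambda>v. Lam d (Th a y) (J0 (\<kappa> v)))) (at y)"
proof -
 have bl: "bounded_linear \<kappa>" using \<kappa>(1) linear_conv_bounded_linear by blast
 have "((\<lambda>u. u - y) has_derivative (\<lambda>v. v)) (at y)" by (auto intro!: derivative_eq_intros)
 from has_derivative_compose[OF this bounded_linear_imp_has_derivative[OF bl]]
 have k: "((\<lambda>u. \<kappa> (u - y)) has_derivative \<kappa>) (at y)" .
 have k0: "\<kappa> (y - y) = 0" using linear_0[OF \<kappa>(1)] by simp
 have "((\<lambda>u. snd d0 (Th \<one> (\<kappa> (u - y)))) has_derivative (\<lambda>v. J0 (\<kappa> v))) (at y)"
  by (rule has_derivative_compose[OF k]) (use Th_one_has_derivative k0 in simp)
 moreover have "\<forall>\<^sub>F u in nhds y. Th \<one> (\<kappa> (u - y)) \<in> fst d0"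
 proof (rule eventually_compose_filterlim[OF Th_one_near])
  show "filterlim (\<lambda>u. \<kappa> (u - y)) (nhds 0) (nhds y)"
   using has_derivative_continuous[OF k] k0 tendsto_at_iff_tendsto_nhds[of "\<lambda>u. \<kappa> (u - y)" y] by (simp add: isCont_def)
 qed
 ultimately have "((\<lambda>u. snd d (Th a y \<otimes> Th \<one> (\<kappa> (u - y)))) has_derivative (\<lambda>v. Lam d (Th a y) (J0 (\<kappa> v)))) (at y)"
  using derivative_mult_curve[OF d, of "\<lambda>u. Th \<one> (\<kappa> (u - y))" "\<lambda>v. J0 (\<kappa> v)" y] k0 by simp
 thus ?thesis by (simp flip: \<kappa>(2))
qed

lemma inj_Lam_J0:
 assumes "d \<in> C" "p \<in> fst d" "inj \<kappa>" "linear \<kappa>" shows "inj (\<lambda>v. Lam d p (J0 (\<kappa> v)))"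
proof -
 have lin: "linear (\<lambda>v. Lam d p (J0 (\<kappa> v)))"
  using linear_compose[OF linear_compose[OF assms(4) has_derivative_linear[OF Th_one_has_derivative]] linear_Lam[OF assms(1,2)]]
  by (simp add: o_def)
 have "v = 0" if "Lam d p (J0 (\<kappa> v)) = 0" for v
 proof -
  have "\<kappa> v \<bullet> \<kappa> v = 0" using Lam_isometry[OF assms(1,2), of "J0 (\<kappa> v)" "J0 (\<kappa> v)"] that orth' by simp
  thus ?thesis using assms(3,4) linear_injective_0 by (metis inner_eq_zero_iff)
 qed
 thus ?thesis using linear_injective_0[OF lin] by blast
qed

subsection \<open>The action on the normal subgroup\<close>

definition L :: "real \<Rightarrow> real ^ 2 \<Rightarrow> real ^ 2" where "L z x = inv_into UNIV \<phi> (inv (c z) \<otimes> \<phi> x \<otimes> c z)"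

lemma \<phi>_L: "\<phi> (L z x) = inv (c z) \<otimes> \<phi> x \<otimes> c z"
proof -
 have "inv (c z) \<otimes> \<phi> x \<otimes> c z \<in> range \<phi>" unfolding range_\<phi> by (rule normal.inv_op_closed1[OF normal_N c_carrier \<phi>_in])
 thus ?thesis unfolding L_def by (rule f_inv_into_f)
qed

lemma L_eqI: "\<phi> y = inv (c z) \<otimes> \<phi> x \<otimes> c z \<Longrightarrow> L z x = y" using \<phi>_L inj_\<phi> by (metis injD)

lemma L_additive: "L z (x + y) = L z x + L z y"
proof (rule L_eqI)
 have "c z \<otimes> (inv (c z) \<otimes> (\<phi> y \<otimes> c z)) = \<phi> y \<otimes> c z" using m_assoc[of "c z" "inv (c z)" "\<phi> y \<otimes> c z"] by simp
 thus "\<phi> (L z x + L z y) = inv (c z) \<otimes> \<phi> (x + y) \<otimes> c z" by (simp add: \<phi>_add \<phi>_L m_assoc)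
qed

lemma L_add: "L (s + t) x = L t (L s x)" by (rule L_eqI) (simp add: \<phi>_L c_add inv_mult_group m_assoc)

lemma L_0: "L 0 x = x" by (rule L_eqI) simp

lemma L_continuous: "continuous_on UNIV (\<lambda>(z, x). L z x)"
proof -
 obtain g where g: "homeomorphic_maps euclidean (subtopology T (range \<phi>)) \<phi> g"
  using \<phi>_emb by (auto simp: embedding_map_def homeomorphic_map_maps)
 have gL: "L z x = g (inv (c z) \<otimes> \<phi> x \<otimes> c z)" for z x
  using g \<phi>_L[of z x] by (metis UNIV_I homeomorphic_maps_def topspace_euclidean)
 have c1: "continuous_map euclidean T (\<lambda>p. c (l p))" if "continuous_on UNIV l" for l :: "real \<times> (real ^ 2) \<Rightarrow> real"
  using continuous_map_compose[of euclidean euclidean l T c] smooth_intoD(2)[OF c_smooth] that by (simp add: o_def)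
 have c2: "continuous_map euclidean T (\<lambda>p::real \<times> (real ^ 2). \<phi> (snd p))"
  using continuous_map_compose[of euclidean euclidean "snd :: real \<times> (real ^ 2) \<Rightarrow> real ^ 2" T \<phi>] smooth_intoD(2)[OF \<phi>_smooth]
  by (simp add: o_def continuous_on_snd)
 have "continuous_map euclidean T (\<lambda>p::real \<times> (real ^ 2). inv (c (fst p)) \<otimes> \<phi> (snd p) \<otimes> c (fst p))"
  unfolding c_uminus[symmetric] by (intro continuous_mult c1 c2 continuous_intros)
 hence "continuous_map euclidean (subtopology T (range \<phi>)) (\<lambda>p::real \<times> (real ^ 2). inv (c (fst p)) \<otimes> \<phi> (snd p) \<otimes> c (fst p))"
  using \<phi>_L by (auto simp: continuous_map_in_subtopology) (metis rangeI)
 hence "continuous_map euclidean euclidean (g \<circ> (\<lambda>p::real \<times> (real ^ 2). inv (c (fst p)) \<otimes> \<phi> (snd p) \<otimes> c (fst p)))"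
  using g by (intro continuous_map_compose) (auto simp: homeomorphic_maps_def)
 thus ?thesis by (simp add: o_def gL case_prod_beta)
qed

text \<open>Since \<open>Th \<one>\<close> is a local diffeomorphism along the normal subgroup, the action inherits the smoothness of conjugation.\<close>

lemma L_differentiable: "(\<lambda>(z, x). L z x) differentiable (at p)"
proof -
 let ?F = "\<lambda>p. pt (L (fst p) (snd p)) 0 :: real ^ 3"
 let ?y = "?F p"
 obtain d where d: "d \<in> C" "Th \<one> ?y \<in> fst d" using chart_cover[OF mfd, of "Th \<one> ?y"] topspace_T by auto
 let ?V = "{y. Th \<one> y \<in> fst d}"
 have V: "open ?V" "Ck_on k ?V (\<lambda>y. snd d (Th \<one> y))" for k
  using smooth_into_open[OF mfd Th_smooth d(1), of \<one>] smooth_intoD(4)[OF Th_smooth d(1), of \<one>] by auto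
 have "Th \<one> (?y + s) = Th \<one> ?y \<otimes> Th \<one> s" for s by (simp add: Th_def \<phi>_add m_assoc)
 hence D: "((\<lambda>y. snd d (Th \<one> y)) has_derivative (\<lambda>v. Lam d (Th \<one> ?y) (J0 v))) (at ?y)"
  using Th_has_derivative_0[OF _ d, of "\<lambda>v. v"] by (auto simp: linear_id[unfolded id_def])
 have inj: "inj (fder (\<lambda>y. snd d (Th \<one> y)) ?y)"
  unfolding frechet_derivative_eqI[OF D] using inj_Lam_J0[OF d, of "\<lambda>v. v"] by (simp add: linear_id[unfolded id_def] inj_on_id2)
 have sm: "smooth_into (mfd X) UNIV (\<lambda>p::real \<times> (real ^ 2). c (- fst p) \<otimes> \<phi> (snd p) \<otimes> c (fst p))"
  by (intro smooth_into_mult smooth_into_compose[OF mfd \<phi>_smooth] smooth_into_compose[OF mfd c_smooth]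
    Ck_on_linear bounded_linear_minus bounded_linear_fst bounded_linear_snd) auto
 have eq: "c (- fst p) \<otimes> \<phi> (snd p) \<otimes> c (fst p) = Th \<one> (?F p)" for p by (simp add: Th_one \<phi>_L c_uminus)
 have "((\<lambda>p. snd d (c (- fst p) \<otimes> \<phi> (snd p) \<otimes> c (fst p))) has_derivative
   fder (\<lambda>p. snd d (c (- fst p) \<otimes> \<phi> (snd p) \<otimes> c (fst p))) p) (at p)"
  by (rule smooth_into_has_derivative[OF mfd sm d(1)]) (use d(2) eq in auto)
 hence "((\<lambda>p. snd d (Th \<one> (?F p))) has_derivative
   fder (\<lambda>p. snd d (c (- fst p) \<otimes> \<phi> (snd p) \<otimes> c (fst p))) p) (at p)" by (simp only: eq)
 moreover have "continuous_on UNIV ?F"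
 proof -
  have "linear (\<lambda>x. pt x 0)" by (auto intro!: linearI simp: pt_add pt_scaleR)
  hence "continuous_on UNIV (\<lambda>x. pt x 0)" using linear_continuous_on linear_conv_bounded_linear by blast
  moreover have "continuous_on UNIV (\<lambda>p. L (fst p) (snd p))" using L_continuous by (simp add: case_prod_unfold)
  ultimately show ?thesis by (rule continuous_on_compose2) simp
 qed
 ultimately obtain G where "(?F has_derivative G) (at p)"
  using has_derivative_lift[OF V(1) V(2)[of 1], of ?F p UNIV] inj d(2) by blast
 from bounded_linear.has_derivative[OF bounded_linear_hor this]
 show ?thesis unfolding differentiable_def by (auto simp: case_prod_unfold)
qed

definition A :: "real ^ 2 \<Rightarrow> real ^ 2" where "A x = vector_derivative (\<lambda>z. L z x) (at 0)"

lemma linear_L: "linear (L z)"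
proof -
 obtain G where "((\<lambda>(z, x). L z x) has_derivative G) (at (z, 0))" using L_differentiable by (auto simp: differentiable_def)
 moreover have "((\<lambda>x. (z, x)) has_derivative (\<lambda>v. (0, v))) (at 0)"
  by (intro has_derivative_Pair has_derivative_const has_derivative_ident)
 ultimately have "(L z has_derivative (\<lambda>v. G (0, v))) (at 0)"
  using has_derivative_compose[of "\<lambda>x. (z, x)" "\<lambda>v. (0, v)" 0 UNIV "\<lambda>(z, x). L z x" G] by simp
 with additive_differentiable_linear[OF L_additive this] show ?thesis using has_derivative_linear by metis
qed

lemma L_has_vector_derivative: "((\<lambda>z. L z x) has_vector_derivative A (L z x)) (at z)"
proof -
 have d0: "((\<lambda>z. L z x) has_vector_derivative A x) (at 0)" for x
 proof -
  obtain G where "((\<lambda>(z, x). L z x) has_derivative G) (at (0, x))" using L_differentiable by (auto simp: differentiable_def)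
  moreover have "((\<lambda>z. (z, x)) has_derivative (\<lambda>v. (v, 0))) (at 0)"
   by (intro has_derivative_Pair has_derivative_const has_derivative_ident)
  ultimately have "((\<lambda>z. L z x) has_derivative (\<lambda>v. G (v, 0))) (at 0)"
   using has_derivative_compose[of "\<lambda>z. (z, x)" "\<lambda>v. (v, 0)" 0 UNIV "\<lambda>(z, x). L z x" G] by simp
  hence "(\<lambda>z. L z x) differentiable (at 0)" by (auto simp: differentiable_def)
  thus ?thesis unfolding A_def by (simp add: vector_derivative_works)
 qed
 have "((\<lambda>u. u - z) has_vector_derivative 1) (at z)" by (auto intro!: derivative_eq_intros simp: has_vector_derivative_def)
 from vector_diff_chain_at[OF this, of "\<lambda>s. L s (L z x)" "A (L z x)"] d0[of "L z x"]
 have "((\<lambda>u. L (u - z) (L z x)) has_vector_derivative A (L z x)) (at z)" by (simp add: o_def)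
 thus ?thesis by (simp flip: L_add)
qed

lemma linear_A: "linear A"
proof (rule linearI)
 have d0: "((\<lambda>z. L z x) has_vector_derivative A x) (at 0)" for x using L_has_vector_derivative[of x 0] by (simp add: L_0)
 fix x y and r :: real
 have "((\<lambda>z. L z (x + y)) has_vector_derivative A x + A y) (at 0)"
  unfolding L_additive by (intro has_vector_derivative_add d0)
 thus "A (x + y) = A x + A y" using d0 vector_derivative_unique_at by blast
 have "((\<lambda>z. L z (r *\<^sub>R x)) has_vector_derivative r *\<^sub>R A x) (at 0)"
  unfolding linear_scale[OF linear_L] using d0[of x] bounded_linear.has_vector_derivative[OF bounded_linear_scaleR_right] by blast
 thus "A (r *\<^sub>R x) = r *\<^sub>R A x" using d0 vector_derivative_unique_at by blast
qed

lemma flow_frame_L: "flow_frame L A (onorm A)"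
proof (rule flow_frame.intro)
 show "linear (L z)" for z by (rule linear_L)
 show "linear A" by (rule linear_A)
 show "inj (L z)" for z by (rule inj_on_inverseI[of _ "L (- z)"]) (simp flip: L_add add: L_0)
 show "((\<lambda>z. L z x) has_vector_derivative A (L z x)) (at z)" for z x by (rule L_has_vector_derivative)
 have "bounded_linear A" using linear_A linear_conv_bounded_linear by blast
 thus "norm (A x) \<le> onorm A * norm x" for x by (rule onorm)
 show "0 \<le> onorm A" using \<open>bounded_linear A\<close> by (rule onorm_pos_le)
qed

end

sublocale lie_frame \<subseteq> flow_frame L A "onorm A" by (rule flow_frame_L)

context lie_frame
begin

lemma Th_add:
 assumes "a \<in> carrier X" shows "Th a (y + s) = Th a y \<otimes> Th \<one> (frm (y $ 3) s)"
proof -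
 have "c (y $ 3) \<otimes> (\<phi> (L (y $ 3) (hor s)) \<otimes> c (s $ 3)) = \<phi> (hor s) \<otimes> c (y $ 3) \<otimes> c (s $ 3)"
  by (simp add: \<phi>_L m_assoc[symmetric])
 thus ?thesis using assms by (simp add: Th_def frm_def \<phi>_add c_add m_assoc)
qed

lemma Th_has_derivative:
 assumes "a \<in> carrier X" "d \<in> C" "Th a y \<in> fst d"
 shows "((Thc a d) has_derivative (\<lambda>v. Lam d (Th a y) (J0 (frm (y $ 3) v)))) (at y)"
 by (rule Th_has_derivative_0[OF assms linear_frm]) (rule Th_add[OF assms(1)])

lemma Th_derivative_inj:
 assumes "a \<in> carrier X" "d \<in> C" "Th a y \<in> fst d"
 shows "inj (fder (Thc a d) y)" unfolding frechet_derivative_eqI[OF Th_has_derivative[OF assms]]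
 by (rule inj_Lam_J0[OF assms(2,3) inj_frm linear_frm])

lemma met_pullback:
 assumes "a \<in> carrier X" "d \<in> C" "Th a y \<in> fst d"
 shows "met y v w = fder (Thc a d) y v \<bullet>
   (metric X d (snd d (Th a y)) *v fder (Thc a d) y w)"
 unfolding frechet_derivative_eqI[OF Th_has_derivative[OF assms]] Lam_isometry[OF assms(2,3)] orth' met_def ..

lemma Th_local_homeo:
 assumes a: "a \<in> carrier X" and d: "d \<in> C" "Th a y \<in> fst d" and U: "open U" "y \<in> U"
 obtains U' W g where "open U'" "U' \<subseteq> U" "y \<in> U'" "\<And>u. u \<in> U' \<Longrightarrow> Th a u \<in> fst d" "open W" "homeomorphism U' W (Thc a d) g"
proof -
 let ?V = "{u \<in> UNIV. Th a u \<in> fst d} \<inter> U"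
 have "open ?V" using smooth_into_open[OF mfd Th_smooth[OF a] d(1)] U(1) by (rule open_Int)
 moreover have "Ck_on 1 ?V (Thc a d)" by (rule Ck_on_subset[OF smooth_intoD(4)[OF Th_smooth[OF a] d(1)]]) auto
 moreover have "y \<in> ?V" using d U by simp
 ultimately show thesis by (rule local_inverse[OF _ _ _ Th_derivative_inj[OF a d]]) (rule that, auto)
qed

lemma Th_open_map:
 assumes a: "a \<in> carrier X" and U: "open U" shows "openin T (Th a ` U)"
proof (subst openin_subopen, safe)
 fix y assume y: "y \<in> U"
 obtain d where d: "d \<in> C" "Th a y \<in> fst d" using chart_cover[OF mfd, of "Th a y"] topspace_T a by auto
 obtain U' W g where U': "open U'" "U' \<subseteq> U" "y \<in> U'" "\<And>u. u \<in> U' \<Longrightarrow> Th a u \<in> fst d" "open W"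
  and h: "homeomorphism U' W (Thc a d) g" using Th_local_homeo[OF a d U y] by metis
 have "Th a ` U' = {p \<in> fst d. snd d p \<in> W}"
 proof
  show "Th a ` U' \<subseteq> {p \<in> fst d. snd d p \<in> W}" using U' h by (auto simp: homeomorphism_def)
  show "{p \<in> fst d. snd d p \<in> W} \<subseteq> Th a ` U'"
  proof
   fix p assume p: "p \<in> {p \<in> fst d. snd d p \<in> W}"
   then obtain u where "u \<in> U'" "snd d p = snd d (Th a u)" using h by (auto simp: homeomorphism_def)
   thus "p \<in> Th a ` U'" using chart_inj[OF mfd d(1)] p U'(4) by (auto simp: inj_on_def)
  qed
 qed
 thus "\<exists>S. openin T S \<and> Th a y \<in> S \<and> S \<subseteq> Th a ` U"
  using chart_preimage_open[OF mfd d(1) U'(5)] U'(2,3) by (intro exI[of _ "Th a ` U'"]) auto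
qed

lemma c_in_N_small: "\<exists>e>0. \<forall>t. \<bar>t\<bar> < e \<and> c t \<in> N \<longrightarrow> t = 0"
proof -
 have "Th \<one> 0 \<in> fst d0" using d0 by simp
 from Th_local_homeo[OF one_closed d0(1) this open_UNIV UNIV_I]
 obtain U' W g where U': "open U'" "U' \<subseteq> UNIV" "0 \<in> U'" "\<And>u. u \<in> U' \<Longrightarrow> Th \<one> u \<in> fst d0" "open W"
  "homeomorphism U' W (\<lambda>y. snd d0 (Th \<one> y)) g" by metis
 then obtain r where r: "r > 0" "ball 0 r \<subseteq> U'" using openE by blast
 have "inj_on (\<lambda>y. snd d0 (Th \<one> y)) U'" using U'(6) by (auto simp: homeomorphism_def intro!: inj_on_inverseI[of _ g])
 hence inj: "y = y'" if "Th \<one> y = Th \<one> y'" "norm y < r" "norm y' < r" for y y'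
  using that r by (auto simp: inj_on_def subset_iff)
 have "openin (subtopology T N) (\<phi> ` ball 0 r)"
  using \<phi>_emb homeomorphic_imp_open_map[of euclidean "subtopology T (range \<phi>)" \<phi>] range_\<phi>
  by (auto simp: embedding_map_def open_map_def)
 then obtain Z where Z: "openin T Z" "\<phi> ` ball 0 r = Z \<inter> N" by (auto simp: openin_subtopology)
 have "\<phi> 0 \<in> Z" using Z(2) r(1) by (metis Int_iff centre_in_ball image_eqI)
 moreover have "open {t \<in> UNIV. c t \<in> Z}" by (rule open_vimage[OF open_UNIV smooth_intoD(2)[OF c_smooth] Z(1)])
 ultimately have "\<forall>\<^sub>F t in nhds 0. c t \<in> Z" using eventually_nhds_in_open[of "{t \<in> UNIV. c t \<in> Z}" 0] by simp
 then obtain e where e: "e > 0" "\<And>t. dist t 0 < e \<Longrightarrow> c t \<in> Z" unfolding eventually_nhds_metric by blast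
 have "t = 0" if "\<bar>t\<bar> < min e r" "c t \<in> N" for t
 proof -
  have "c t \<in> \<phi> ` ball 0 r" using e(2)[of t] that Z(2) by auto
  then obtain v where v: "norm v < r" "c t = \<phi> v" by auto
  have n: "norm (pt v 0) = norm v" "norm (pt 0 t) = \<bar>t\<bar>" by (simp_all add: norm_eq_sqrt_inner inner_pt)
  have "pt v 0 = pt 0 t" by (rule inj) (use v that n in \<open>simp_all add: Th_one\<close>)
  thus ?thesis by simp
 qed
 thus ?thesis using e(1) r(1) by (intro exI[of _ "min e r"]) auto
qed

end

lemma (in metric_lie) exists_lie_frame:
 assumes "normal_R2_subgroup X N"
 shows "\<exists>\<phi> c. lie_frame X \<phi> c N \<and> lie_frame X \<phi> (\<lambda>t. c (- t)) N"
proof -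
 obtain \<psi> :: "real ^ 2 \<Rightarrow> 'a" where N: "N \<lhd> X" "closedin T N" and \<psi>: "range \<psi> = N" "\<And>u v. \<psi> (u + v) = \<psi> u \<otimes> \<psi> v"
  "immersion euclidean_manifold (mfd X) \<psi>" "embedding_map euclidean T \<psi>" using assms by (auto simp: normal_R2_subgroup_def)
 have inv: "inv_into UNIV id = (id :: real ^ 2 \<Rightarrow> _)" by (simp add: inv_id)
 have rep: "local_rep (UNIV, id) d \<psi> = (\<lambda>u. snd d (\<psi> u))" for d by (simp add: local_rep_def chart_inv_def inv)
 have sm\<psi>: "smooth_into (mfd X) UNIV \<psi>"
  using \<psi>(3) by (simp add: smooth_into_def immersion_def smooth_map_def euclidean_manifold_def rep)
 have \<psi>c: "\<psi> u \<in> carrier X" for u using smooth_into_carrier[OF sm\<psi>] by simp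
 have \<psi>0: "\<psi> 0 = \<one>" using \<psi>(2)[of 0 0] \<psi>c[of 0] by (simp add: r_cancel_one)
 define J where "J = fder (\<lambda>u. snd d0 (\<psi> u)) 0"
 have dJ: "((\<lambda>u. snd d0 (\<psi> u)) has_derivative J) (at 0)"
  unfolding J_def by (rule smooth_into_has_derivative[OF mfd sm\<psi> d0(1)]) (use \<psi>0 d0 in auto)
 have linJ: "linear J" using dJ by (rule has_derivative_linear)
 have injJ: "inj J" using \<psi>(3) d0 \<psi>0 by (simp add: immersion_def euclidean_manifold_def rep J_def)
 obtain v where v: "g0 v v = 1" "\<And>x. g0 v (J x) = 0" using g0_unit_normal[OF linJ injJ] by blast
 obtain c where c: "\<And>s t. c (s + t) = c s \<otimes> c t" "smooth_into (mfd X) UNIV c"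
  "((\<lambda>t. snd d0 (c t)) has_vector_derivative v) (at 0)" using one_parameter_subgroup[of v] by metis
 have cc: "c t \<in> carrier X" for t using smooth_into_carrier[OF c(2)] by simp
 have c0: "c 0 = \<one>" using c(1)[of 0 0] cc[of 0] by (simp add: r_cancel_one)
 have "bilinear (\<lambda>a b. g0 (J a) (J b))"
  using g0_bilinear linJ unfolding bilinear_def by (auto intro: linear_compose[unfolded o_def])
 then obtain c1 c2 where cs: "g0 (J c1) (J c1) = 1" "g0 (J c2) (J c2) = 1" "g0 (J c1) (J c2) = 0"
  by (rule orthonormal_pair_form) (use g0_sym g0_pos injJ linJ linear_injective_0 in blast)+
 define Q where "Q x = x $ 1 *\<^sub>R c1 + x $ 2 *\<^sub>R c2" for x :: "real ^ 2"
 have linQ: "linear Q" by (auto intro!: linearI simp: Q_def algebra_simps)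
 have gQ: "g0 (J (Q x)) (J (Q y)) = x \<bullet> y" for x y using cs g0_sym[of "J c2" "J c1"]
  by (simp add: Q_def linear_add[OF linJ] linear_scale[OF linJ] bilinear_ladd[OF g0_bilinear] bilinear_radd[OF g0_bilinear]
    bilinear_lmul[OF g0_bilinear] bilinear_rmul[OF g0_bilinear] inner_vec_def sum_2)
 have injQ: "inj Q"
 proof -
  have "x = 0" if "Q x = 0" for x using gQ[of x x] that linear_0[OF linJ] bilinear_lzero[OF g0_bilinear] by simp
  thus ?thesis using linear_injective_0[OF linQ] by blast
 qed
 hence surjQ: "surj Q" using linQ linear_injective_imp_surjective by blast
 have blQ: "bounded_linear Q" using linQ linear_conv_bounded_linear by blast
 obtain Q' where Q': "linear Q'" "Q' \<circ> Q = id" "Q \<circ> Q' = id"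
  using linear_injective_isomorphism[OF linQ injQ] by (auto simp: fun_eq_iff)
 define \<phi> where "\<phi> x = \<psi> (Q x)" for x
 have emb: "embedding_map euclidean T \<phi>"
 proof -
  have "homeomorphic_maps euclidean euclidean Q Q'"
   using Q' linQ linear_continuous_on linear_conv_bounded_linear by (auto simp: homeomorphic_maps_def pointfree_idE)
  hence "homeomorphic_map euclidean euclidean Q" using homeomorphic_map_maps by blast
  moreover have "homeomorphic_map euclidean (subtopology T (range \<psi>)) \<psi>" using \<psi>(4) by (simp add: embedding_map_def)
  ultimately have "homeomorphic_map euclidean (subtopology T (range \<psi>)) (\<psi> \<circ> Q)" by (rule homeomorphic_map_compose)
  moreover have "range \<psi> = range (\<psi> \<circ> Q)" using surjQ by (metis image_comp)
  ultimately show ?thesis by (simp add: embedding_map_def \<phi>_def[abs_def] o_def)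
 qed
 have sm\<phi>: "smooth_into (mfd X) UNIV \<phi>"
  unfolding \<phi>_def[abs_def] by (rule smooth_into_compose[OF mfd sm\<psi>]) (auto intro: Ck_on_linear blQ)
 have frame: "lie_frame X \<phi> (\<lambda>t. c (\<sigma> * t)) N" if \<sigma>: "\<sigma> = 1 \<or> \<sigma> = -1" for \<sigma>
 proof -
  let ?T = "\<lambda>y::real ^ 3. \<phi> (hor y) \<otimes> c (\<sigma> * y $ 3)"
  have smc: "smooth_into (mfd X) UNIV (\<lambda>t. c (\<sigma> * t))"
   by (rule smooth_into_compose[OF mfd c(2)]) (auto intro: Ck_on_linear bounded_linear_mult_right)
  have smT: "smooth_into (mfd X) UNIV ?T"
   by (intro smooth_into_mult smooth_into_compose[OF mfd sm\<phi>] smooth_into_compose[OF mfd smc] Ck_on_linear bounded_linear_hor bounded_linear_vec_nth) auto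
  define D where "D = fder (\<lambda>y. snd d0 (?T y)) 0"
  have dD: "((\<lambda>y. snd d0 (?T y)) has_derivative D) (at 0)"
   unfolding D_def by (rule smooth_into_has_derivative[OF mfd smT d0(1)]) (use \<psi>0 c0 d0 linear_0[OF linQ] in \<open>auto simp: \<phi>_def\<close>)
  have linD: "linear D" using dD by (rule has_derivative_linear)
  have pt0: "pt 0 0 = 0" by (simp add: vec_eq_iff forall_3)
  have "D (pt x 0) = J (Q x)" for x
  proof -
   have "((\<lambda>x. pt x 0) has_derivative (\<lambda>x. pt x 0)) (at 0)"
    by (intro bounded_linear_imp_has_derivative, subst linear_conv_bounded_linear[symmetric])
     (auto intro!: linearI simp: pt_add pt_scaleR)
   from has_derivative_compose[OF this, of "\<lambda>y. snd d0 (?T y)" D] dD pt0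
   have "((\<lambda>x. snd d0 (\<psi> (Q x))) has_derivative (\<lambda>x. D (pt x 0))) (at 0)" using \<psi>c c0 by (simp add: \<phi>_def)
   moreover have "((\<lambda>x. snd d0 (\<psi> (Q x))) has_derivative (\<lambda>x. J (Q x))) (at 0)"
    using has_derivative_compose[OF bounded_linear_imp_has_derivative[OF blQ], of "\<lambda>u. snd d0 (\<psi> u)" J 0] dJ linear_0[OF linQ] by simp
   ultimately show ?thesis using has_derivative_unique by metis
  qed
  moreover have "D (pt 0 t) = (\<sigma> * t) *\<^sub>R v" for t
  proof -
   have "((\<lambda>t. pt 0 t) has_derivative (\<lambda>t. pt 0 t)) (at 0)"
    by (intro bounded_linear_imp_has_derivative, subst linear_conv_bounded_linear[symmetric])
     (auto intro!: linearI simp: vec_eq_iff forall_3)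
   from has_derivative_compose[OF this, of "\<lambda>y. snd d0 (?T y)" D] dD pt0
   have "((\<lambda>t. snd d0 (c (\<sigma> * t))) has_derivative (\<lambda>t. D (pt 0 t))) (at 0)"
    using cc \<psi>0 linear_0[OF linQ] by (simp add: \<phi>_def)
   moreover have "((\<lambda>t. snd d0 (c (\<sigma> * t))) has_derivative (\<lambda>t. (\<sigma> * t) *\<^sub>R v)) (at 0)"
    using has_derivative_compose[OF bounded_linear_imp_has_derivative[OF bounded_linear_mult_right[of \<sigma>]], of "\<lambda>t. snd d0 (c t)" "\<lambda>t. t *\<^sub>R v" 0]
     c(3) by (simp add: has_vector_derivative_def)
   ultimately show ?thesis using has_derivative_unique by metis
  qed
  ultimately have Dy: "D y = J (Q (hor y)) + (\<sigma> * y $ 3) *\<^sub>R v" for y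
  proof -
   assume *: "\<And>x. D (pt x 0) = J (Q x)" "\<And>t. D (pt 0 t) = (\<sigma> * t) *\<^sub>R v"
   have "D y = D (pt (hor y) 0 + pt 0 (y $ 3))" by (simp add: pt_add)
   thus ?thesis by (simp only: linear_add[OF linD] *)
  qed
  have v2: "g0 (J x) v = 0" for x using v(2) g0_sym by metis
  have "\<sigma> * \<sigma> = 1" using \<sigma> by auto
  hence orth: "g0 (D y) (D y') = y \<bullet> y'" for y y' unfolding Dy inner_pt[of y y'] using v v2
   by (simp add: bilinear_ladd[OF g0_bilinear] bilinear_radd[OF g0_bilinear]
    bilinear_lmul[OF g0_bilinear] bilinear_rmul[OF g0_bilinear] gQ)
  show ?thesis
  proof (intro lie_frame.intro lie_frame_axioms.intro)
   show "metric_lie X" by unfold_locales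
   show "\<phi> (x + x') = \<phi> x \<otimes> \<phi> x'" for x x' by (simp add: \<phi>_def linear_add[OF linQ] \<psi>(2))
   show "range \<phi> = N" using surjQ \<psi>(1) by (auto simp: \<phi>_def) (metis rangeI surjD)
   show "c (\<sigma> * (s + t)) = c (\<sigma> * s) \<otimes> c (\<sigma> * t)" for s t by (simp add: distrib_left c(1))
   show "g0 (fder (\<lambda>y. snd d0 (\<phi> (hor y) \<otimes> c (\<sigma> * y $ 3))) 0 v)
     (fder (\<lambda>y. snd d0 (\<phi> (hor y) \<otimes> c (\<sigma> * y $ 3))) 0 w) = v \<bullet> w" for v w using orth[of v w] by (simp add: D_def)
  qed (use N emb sm\<phi> smc in auto)
 qed
 from frame[of 1] frame[of "-1"] show ?thesis by auto
qed

section \<open>Slabs and surfaces\<close>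

context lie_frame
begin

text \<open>The constant of the lemma \<open>barrier\<close> for \<open>M = 200\<close>, which covers both kinds of barriers.\<close>

definition K0 :: real where
 "K0 = 1 + (4 * 200 + 4) * (onorm A)\<^sup>2 + 4 * 200 + 12 * 200 * onorm A + 21 * onorm A"

definition dsq :: "real ^ 2 \<Rightarrow> real ^ 3 \<Rightarrow> real" where
 "dsq x1 y = L (y $ 3) (hor y - x1) \<bullet> L (y $ 3) (hor y - x1)"

definition Phi :: "(real \<Rightarrow> real) \<Rightarrow> real ^ 2 \<Rightarrow> real ^ 3 \<Rightarrow> real" where
 "Phi h x1 y = y $ 3 - K0 / 2 * (y $ 3)\<^sup>2 + h (dsq x1 y)"

lemma K0_pos: "K0 > 0" unfolding K0_def using a0 by (intro add_pos_nonneg mult_nonneg_nonneg) auto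

lemma L_near_id: "\<exists>e>0. \<forall>z x. \<bar>z\<bar> < e \<longrightarrow> norm (L z x - x) \<le> norm x / 2"
proof -
 have "\<exists>e>0. \<forall>z. \<bar>z\<bar> < e \<longrightarrow> norm (L z (axis i 1) - axis i 1) < 1/4" for i :: 2
 proof -
  have "isCont (\<lambda>z. L z (axis i 1)) 0" using has_vector_derivative_continuous[OF dL] .
  thus ?thesis
   unfolding continuous_at_eps_delta by (auto simp: dist_norm L_0) (metis less_divide_eq_numeral1(1) mult_1 zero_less_one zero_less_divide_iff zero_less_numeral)
 qed
 then obtain e1 e2 where e: "e1 > 0" "\<And>z. \<bar>z\<bar> < e1 \<Longrightarrow> norm (L z (axis 1 1) - axis 1 1) < 1/4"
  "e2 > 0" "\<And>z. \<bar>z\<bar> < e2 \<Longrightarrow> norm (L z (axis 2 1) - axis 2 1) < 1/4" by metis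
 have "norm (L z x - x) \<le> norm x / 2" if z: "\<bar>z\<bar> < min e1 e2" for z x
 proof -
  have "L z x - x = x $ 1 *\<^sub>R (L z (axis 1 1) - axis 1 1) + x $ 2 *\<^sub>R (L z (axis 2 1) - axis 2 1)"
   using linear_axis_expansion[OF linL, of z x] linear_axis_expansion[OF linear_id, of x] by (simp add: sum_2 algebra_simps)
  also have "norm \<dots> \<le> \<bar>x $ 1\<bar> * norm (L z (axis 1 1) - axis 1 1) + \<bar>x $ 2\<bar> * norm (L z (axis 2 1) - axis 2 1)"
   by (rule norm_triangle_le) simp
  also have "\<dots> \<le> norm x * (1/4) + norm x * (1/4)"
   using e(2,4)[of z] z by (intro add_mono mult_mono component_le_norm_cart) (auto intro: less_imp_le)
  finally show ?thesis by simp
 qed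
 thus ?thesis using e by (intro exI[of _ "min e1 e2"]) auto
qed

definition eps :: real where
 "eps = (SOME e. e > 0 \<and> (\<forall>t. \<bar>t\<bar> < 2 * e \<and> c t \<in> N \<longrightarrow> t = 0) \<and>
   (\<forall>z x. \<bar>z\<bar> < e \<longrightarrow> norm (L z x - x) \<le> norm x / 2) \<and> K0 * e \<le> 1/2)"

lemma eps: "eps > 0" "\<bar>t\<bar> < 2 * eps \<Longrightarrow> c t \<in> N \<Longrightarrow> t = 0" "\<bar>z\<bar> < eps \<Longrightarrow> norm (L z x - x) \<le> norm x / 2" "K0 * eps \<le> 1/2"
proof -
 obtain e1 e2 where e: "e1 > 0" "\<And>t. \<bar>t\<bar> < e1 \<Longrightarrow> c t \<in> N \<Longrightarrow> t = 0"
  "e2 > 0" "\<And>z x. \<bar>z\<bar> < e2 \<Longrightarrow> norm (L z x - x) \<le> norm x / 2" using c_in_N_small L_near_id by blast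
 define e where "e = min (e1 / 2) (min e2 (1 / (2 * K0)))"
 have "e \<le> 1 / (2 * K0)" by (simp add: e_def)
 hence "K0 * e \<le> 1/2" using K0_pos by (simp add: field_simps)
 moreover have "e > 0" "2 * e \<le> e1" "e \<le> e2" using e K0_pos by (auto simp: e_def min_def)
 ultimately have "e > 0 \<and> (\<forall>t. \<bar>t\<bar> < 2 * e \<and> c t \<in> N \<longrightarrow> t = 0) \<and>
   (\<forall>z x. \<bar>z\<bar> < e \<longrightarrow> norm (L z x - x) \<le> norm x / 2) \<and> K0 * e \<le> 1/2" using e by auto
 from someI[of "\<lambda>e. e > 0 \<and> (\<forall>t. \<bar>t\<bar> < 2 * e \<and> c t \<in> N \<longrightarrow> t = 0) \<and>
   (\<forall>z x. \<bar>z\<bar> < e \<longrightarrow> norm (L z x - x) \<le> norm x / 2) \<and> K0 * e \<le> 1/2", OF this, folded eps_def]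
 show "eps > 0" "\<bar>t\<bar> < 2 * eps \<Longrightarrow> c t \<in> N \<Longrightarrow> t = 0" "\<bar>z\<bar> < eps \<Longrightarrow> norm (L z x - x) \<le> norm x / 2" "K0 * eps \<le> 1/2" by blast+
qed

lemma L_norm_bounds:
 assumes "\<bar>z\<bar> < eps" shows "norm x / 2 \<le> norm (L z x)" "norm (L z x) \<le> 3/2 * norm x"
 using eps(3)[OF assms, of x] norm_triangle_ineq2[of x "L z x"] norm_triangle_ineq2[of "L z x" x]
 by (auto simp: norm_minus_commute)

definition Slab :: "(real ^ 3) set" where "Slab = {y. \<bar>y $ 3\<bar> < eps}"

lemma open_Slab: "open Slab" unfolding Slab_def by (intro open_Collect_less continuous_intros)

lemma c_diff: "c s \<otimes> inv (c t) = c (s - t)" by (simp flip: c_uminus c_add)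

lemma Th_eq_plane:
 assumes a: "a \<in> carrier X" and eq: "Th a y = Th a y'" shows "c (y' $ 3 - y $ 3) \<in> N" "y $ 3 = y' $ 3 \<Longrightarrow> y = y'"
proof -
 have e: "\<phi> (hor y) \<otimes> c (y $ 3) = \<phi> (hor y') \<otimes> c (y' $ 3)" using eq a by (simp add: Th_def)
 hence "\<phi> (- hor y') \<otimes> \<phi> (hor y) = c (y' $ 3) \<otimes> inv (c (y $ 3))"
  by (simp add: \<phi>_uminus inv_solve_right inv_solve_left m_assoc) 
 hence "c (y' $ 3 - y $ 3) = \<phi> (- hor y' + hor y)" by (simp only: c_diff \<phi>_add)
 thus "c (y' $ 3 - y $ 3) \<in> N" using \<phi>_in by simp
 assume "y $ 3 = y' $ 3"
 hence "\<phi> (hor y) = \<phi> (hor y')" using e by simp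
 hence "hor y = hor y'" using inj_\<phi> by (metis injD)
 thus "y = y'" using \<open>y $ 3 = y' $ 3\<close> by (metis pt_hor)
qed

lemma Th_inj_Slab: "a \<in> carrier X \<Longrightarrow> inj_on (Th a) Slab"
proof (rule inj_onI)
 fix y y' assume a: "a \<in> carrier X" "y \<in> Slab" "y' \<in> Slab" "Th a y = Th a y'"
 hence "y' $ 3 - y $ 3 = 0" by (intro eps(2) Th_eq_plane(1)) (auto simp: Slab_def)
 thus "y = y'" using Th_eq_plane(2)[OF a(1,4)] by simp
qed

definition co :: "'a \<Rightarrow> 'a \<Rightarrow> real ^ 3" where "co a = inv_into Slab (Th a)"

lemma co_Th [simp]: "a \<in> carrier X \<Longrightarrow> y \<in> Slab \<Longrightarrow> co a (Th a y) = y" by (simp add: co_def Th_inj_Slab)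

lemma Th_co: "p \<in> Th a ` Slab \<Longrightarrow> Th a (co a p) = p" and co_in: "p \<in> Th a ` Slab \<Longrightarrow> co a p \<in> Slab"
 by (auto simp: co_def f_inv_into_f inv_into_into)

lemma openin_slab: "a \<in> carrier X \<Longrightarrow> openin T (Th a ` Slab)" by (rule Th_open_map[OF _ open_Slab])

lemma co_continuous:
 assumes a: "a \<in> carrier X" shows "continuous_map (subtopology T (Th a ` Slab)) euclidean (co a)"
 unfolding continuous_map_def
proof (intro conjI allI impI)
 fix W :: "(real ^ 3) set" assume "openin euclidean W"
 hence "open (Slab \<inter> W)" using open_Slab by auto
 moreover have "{p \<in> topspace (subtopology T (Th a ` Slab)). co a p \<in> W} = Th a ` (Slab \<inter> W)"
 proof (intro equalityI subsetI)
  fix p assume p: "p \<in> {p \<in> topspace (subtopology T (Th a ` Slab)). co a p \<in> W}"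
  hence "p \<in> Th a ` Slab" by simp
  hence "p = Th a (co a p)" "co a p \<in> Slab" using Th_co co_in by metis+
  thus "p \<in> Th a ` (Slab \<inter> W)" using p by blast
 next
  fix p assume "p \<in> Th a ` (Slab \<inter> W)"
  then obtain y where "p = Th a y" "y \<in> Slab" "y \<in> W" by blast
  thus "p \<in> {p \<in> topspace (subtopology T (Th a ` Slab)). co a p \<in> W}" using a topspace_T by simp
 qed
 ultimately show "openin (subtopology T (Th a ` Slab)) {p \<in> topspace (subtopology T (Th a ` Slab)). co a p \<in> W}"
  using Th_open_map[OF a, of "Slab \<inter> W"] by (auto simp: openin_subtopology)
qed auto

lemma plane_eq: "a \<in> carrier X \<Longrightarrow> a <# N = Th a ` {y. y $ 3 = 0}"
proof -
 assume a: "a \<in> carrier X"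
 have "a \<otimes> \<phi> x = Th a (pt x 0)" for x by (simp add: Th_def)
 hence "a <# N \<subseteq> Th a ` {y. y $ 3 = 0}" unfolding l_coset_def range_\<phi>[symmetric] by auto
 moreover have "Th a y \<in> a <# N" if "y $ 3 = 0" for y using that \<phi>_in unfolding l_coset_def by (auto simp: Th_def)
 ultimately show ?thesis by blast
qed

end

locale frame_surface = lie_frame +
 fixes S :: "('s, 2) manifold" and f :: "'s \<Rightarrow> 'a"
 assumes surface: "connected_immersed_surface X S f"
begin

abbreviation "SS \<equiv> topspace (pts S)"

lemma S_mfd: "smooth_manifold S" and S_connected: "connected_space (pts S)" and S_nonempty: "SS \<noteq> {}"
 and f_immersion: "immersion S (mfd X) f" and f_smooth: "smooth_map S (mfd X) f" and f_continuous: "continuous_map (pts S) T f"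
 using surface by (auto simp: connected_immersed_surface_def immersion_def smooth_map_def)

lemma f_carrier: "q \<in> SS \<Longrightarrow> f q \<in> carrier X" using f_continuous topspace_T by (auto simp: continuous_map_def)

lemma charts_at:
 assumes "q \<in> SS" obtains cs d where "cs \<in> charts S" "q \<in> fst cs" "d \<in> C" "f q \<in> fst d"
 using chart_cover[OF S_mfd assms] chart_cover[OF mfd, of "f q"] f_carrier[OF assms] topspace_T that by auto

definition param :: "'a \<Rightarrow> ('s, 2) chart \<Rightarrow> real ^ 2 \<Rightarrow> real ^ 3" where
 "param a cs = (\<lambda>x. co a (f (chart_inv cs x)))"

definition pdom :: "'a \<Rightarrow> ('s, 2) chart \<Rightarrow> ('a, 3) chart \<Rightarrow> (real ^ 2) set" where
 "pdom a cs d = {x \<in> snd cs ` fst cs. f (chart_inv cs x) \<in> fst d \<inter> Th a ` Slab}"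

lemma param_in:
 assumes "cs \<in> charts S" "x \<in> pdom a cs d"
 shows "param a cs x \<in> Slab" "f (chart_inv cs x) = Th a (param a cs x)" "chart_inv cs x \<in> SS"
 using assms Th_co co_in chart_inv_in[of x cs] chart_subset[OF S_mfd assms(1)] by (auto simp: pdom_def param_def)

lemma param_at:
 assumes "a \<in> carrier X" "cs \<in> charts S" "q \<in> fst cs" "f q \<in> fst d" "f q = Th a y" "y \<in> Slab"
 shows "snd cs q \<in> pdom a cs d" "param a cs (snd cs q) = y" "chart_inv cs (snd cs q) = q"
 using assms chart_inv_snd[OF S_mfd assms(2,3)] by (auto simp: pdom_def param_def)

lemma f_chart_continuous:
 assumes "cs \<in> charts S" shows "continuous_map (top_of_set (snd cs ` fst cs)) T (\<lambda>x. f (chart_inv cs x))"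
 using continuous_map_compose[OF chart_inv_continuous[OF S_mfd assms] f_continuous] by (simp add: o_def)

lemma open_dom:
 assumes "a \<in> carrier X" "cs \<in> charts S" "d \<in> C" shows "open (pdom a cs d)" unfolding pdom_def
 by (rule open_vimage[OF chart_open[OF S_mfd assms(2)] f_chart_continuous[OF assms(2)]])
  (intro openin_Int chart_openin[OF mfd assms(3)] openin_slab[OF assms(1)])

lemma surface_adapted:
 assumes a: "a \<in> carrier X" and cs: "cs \<in> charts S" and d: "d \<in> C"
 shows "adapted (metric X d) (local_rep cs d f) (Thc a d) (param a cs) (pdom a cs d) {y \<in> Slab. Th a y \<in> fst d}"
proof -
 let ?U = "pdom a cs d" and ?V = "{y \<in> Slab. Th a y \<in> fst d}" and ?\<theta> = "Thc a d" and ?F = "local_rep cs d f"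
 have U: "open ?U" by (rule open_dom[OF assms])
 have "open ({u \<in> UNIV. Th a u \<in> fst d} \<inter> Slab)"
  using smooth_into_open[OF mfd Th_smooth[OF a] d] open_Slab by (rule open_Int)
 hence V: "open ?V" by (simp add: Collect_conj_eq Int_commute)
 have Vs: "Ck_on 2 ?V ?\<theta>" by (rule Ck_on_subset[OF smooth_intoD(4)[OF Th_smooth[OF a] d]]) auto
 have domD: "f (chart_inv cs x) \<in> fst d" "f (chart_inv cs x) \<in> Th a ` Slab" if "x \<in> ?U" for x
  using that by (simp_all add: pdom_def)
 have FV: "param a cs ` ?U \<subseteq> ?V"
 proof (rule image_subsetI)
  fix x assume x: "x \<in> ?U"
  show "param a cs x \<in> ?V" using Th_co[OF domD(2)[OF x]] co_in[OF domD(2)[OF x]] domD(1)[OF x] by (simp add: param_def)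
 qed
 have eq: "?F x = ?\<theta> (param a cs x)" if "x \<in> ?U" for x
  using Th_co[OF domD(2)[OF that]] by (simp add: param_def local_rep_def)
 have "Ck_on 2 (snd cs ` {p \<in> fst cs. f p \<in> fst d}) ?F" using f_smooth cs d by (simp add: smooth_map_def smooth_on_def)
 moreover have "?U \<subseteq> snd cs ` {p \<in> fst cs. f p \<in> fst d}" using chart_inv_snd[OF S_mfd cs] by (auto simp: pdom_def)
 ultimately have Fs: "Ck_on 2 ?U ?F" by (rule Ck_on_subset)
 hence \<theta>F: "Ck_on 2 ?U (\<lambda>x. ?\<theta> (param a cs x))" using Ck_on_cong_open[OF U, of ?F "\<lambda>x. ?\<theta> (param a cs x)" 2] eq by blast
 have cont: "continuous_on ?U (param a cs)"
 proof -
  have "continuous_map (top_of_set ?U) T (\<lambda>x. f (chart_inv cs x))"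
   using continuous_map_from_subtopology_mono[OF f_chart_continuous[OF cs]] by (auto simp: pdom_def)
  hence "continuous_map (top_of_set ?U) (subtopology T (Th a ` Slab)) (\<lambda>x. f (chart_inv cs x))"
   by (auto simp: continuous_map_in_subtopology pdom_def)
  from continuous_map_compose[OF this co_continuous[OF a]] show ?thesis by (simp add: param_def[abs_def] o_def)
 qed
 have inj\<theta>: "inj (fder ?\<theta> y)" if "y \<in> ?V" for y using Th_derivative_inj[OF a d] that by blast
 have F0s: "Ck_on 2 ?U (param a cs)" by (rule Ck_on_lift[OF V Vs inj\<theta> U cont FV \<theta>F])
 have injF0: "inj (fder (param a cs) x)" if x: "x \<in> ?U" for x
 proof -
  have p: "chart_inv cs x \<in> fst cs" "snd cs (chart_inv cs x) = x" "f (chart_inv cs x) \<in> fst d"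
   using x by (auto simp: pdom_def chart_inv_in snd_chart_inv)
  have 1: "Ck_on (Suc 0) ?U (param a cs)" "Ck_on (Suc 0) ?V ?\<theta>" by (rule Ck_on_mono[OF F0s], simp) (rule Ck_on_mono[OF Vs], simp)
  have "((\<lambda>x. ?\<theta> (param a cs x)) has_derivative (\<lambda>v. fder ?\<theta> (param a cs x) (fder (param a cs) x v))) (at x)"
   by (rule has_derivative_compose[OF Ck_on_SucD[OF 1(1) x] Ck_on_SucD[OF 1(2)]]) (use FV x in blast)
  hence "(?F has_derivative (\<lambda>v. fder ?\<theta> (param a cs x) (fder (param a cs) x v))) (at x)"
   by (rule has_derivative_transform_within_open[OF _ U x]) (simp add: eq)
  moreover have "inj (fder ?F x)" using f_immersion cs d p unfolding immersion_def by metis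
  ultimately have "inj (\<lambda>v. fder ?\<theta> (param a cs x) (fder (param a cs) x v))" by (simp add: frechet_derivative_eqI)
  thus ?thesis by (auto simp: inj_def) 
 qed
 have g: "metric X d differentiable (at (?F x)) \<and> invertible (metric X d (?F x)) \<and> transpose (metric X d (?F x)) = metric X d (?F x)"
  if "x \<in> ?U" for x
  using that metric_differentiable[OF d] metric_invertible[OF d] metric_symmetric[OF d] by (auto simp: pdom_def local_rep_def)
 show ?thesis unfolding adapted_def using U V Vs FV F0s eq g injF0 met_pullback[OF a d] by auto
qed

text \<open>The planes have mean curvature \<open>- trA / 2\<close> with respect to the upward normal.\<close>

definition good :: "'s \<Rightarrow> bool" where
 "good q \<longleftrightarrow> (\<forall>cs\<in>charts S. \<forall>d\<in>C. q \<in> fst cs \<and> f q \<in> fst d \<longrightarrow>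
   (\<forall>e. unit_normal_at X f cs d q (Lam d (f q) (J0 e)) \<and> e $ 3 > 0 \<longrightarrow>
    2 * mean_curvature_at X f cs d q (Lam d (f q) (J0 e)) \<le> - trA))"

lemma frechet_Th: "a \<in> carrier X \<Longrightarrow> d \<in> C \<Longrightarrow> Th a y \<in> fst d \<Longrightarrow>
  fder (Thc a d) y v = Lam d (Th a y) (J0 (frm (y $ 3) v))" using frechet_derivative_eqI[OF Th_has_derivative] by metis

lemma no_contact:
 fixes h h1 h2 :: "real \<Rightarrow> real" and x1 :: "real ^ 2"
 assumes a: "a \<in> carrier X" and q: "q \<in> SS" "f q = Th a y" "y \<in> Slab" "good q"
  and dh: "\<And>s. s > 0 \<Longrightarrow> (h has_real_derivative h1 s) (at s)" "\<And>s. s > 0 \<Longrightarrow> (h1 has_real_derivative h2 s) (at s)"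
  and s: "s = dsq x1 y" "s \<noteq> 0"
  and h: "0 < h1 s" "h1 s \<le> 1" "h1 s * s \<le> 1 / (8 * (onorm A + 1))" "\<bar>h2 s\<bar> * s \<le> 200 * h1 s" "h2 s * s + h1 s \<le> 0"
  and z: "0 \<le> y $ 3"
  and Q: "openin (pts S) Q" "q \<in> Q"
  and min: "\<And>q' y'. q' \<in> Q \<Longrightarrow> y' \<in> Slab \<Longrightarrow> f q' = Th a y' \<Longrightarrow> Phi h x1 y \<le> Phi h x1 y'"
 shows False
proof -
 obtain cs d where cs: "cs \<in> charts S" "q \<in> fst cs" and d: "d \<in> C" "f q \<in> fst d" by (rule charts_at[OF q(1)])
 define u where "u = snd cs q"
 note uU = param_at(1)[OF a cs d(2) q(2,3), folded u_def] and pu = param_at(2)[OF a cs d(2) q(2,3), folded u_def]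
  and qu = param_at(3)[OF a cs d(2) q(2,3), folded u_def]
 have ev: "\<forall>\<^sub>F x in nhds u. x \<in> pdom a cs d \<and> chart_inv cs x \<in> Q"
 proof -
  have "open {x \<in> snd cs ` fst cs. chart_inv cs x \<in> Q}"
   by (rule open_vimage[OF chart_open[OF S_mfd cs(1)] chart_inv_continuous[OF S_mfd cs(1)] Q(1)])
  hence "open (pdom a cs d \<inter> {x \<in> snd cs ` fst cs. chart_inv cs x \<in> Q})" using open_dom[OF a cs(1) d(1)] by (rule open_Int[rotated])
  moreover have "u \<in> pdom a cs d \<inter> {x \<in> snd cs ` fst cs. chart_inv cs x \<in> Q}" using uU Q(2) qu by (auto simp: pdom_def)
  ultimately show ?thesis using eventually_nhds_in_open by (fastforce elim: eventually_mono)
 qed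
 have "\<forall>\<^sub>F x in nhds u. Phi h x1 y \<le> Phi h x1 (param a cs x)"
  using ev by (rule eventually_mono) (use param_in[OF cs(1)] in \<open>blast intro: min\<close>)
 hence min': "\<forall>\<^sub>F x in nhds u. y $ 3 - K0 / 2 * (y $ 3)\<^sup>2 + h s \<le> Phi h x1 (param a cs x)"
  by (simp add: Phi_def s(1))
 show False
 proof (rule barrier[OF surface_adapted[OF a cs(1) d(1)] uU K0_def _ dh _ _ s(1)[unfolded dsq_def], where ?x1.0 = x1])
  fix \<nu> assume \<nu>: "unit_normal (metric X d) (local_rep cs d f) u (fder (Thc a d) (param a cs u) \<nu>)" "\<nu> $ 3 > 0"
  have fr: "fder (Thc a d) (param a cs u) \<nu> = Lam d (f q) (J0 (frm (y $ 3) \<nu>))"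
   unfolding pu using frechet_Th[OF a d(1), of y] d(2) q(2) by simp
  have "unit_normal_at X f cs d q (Lam d (f q) (J0 (frm (y $ 3) \<nu>)))" "frm (y $ 3) \<nu> $ 3 > 0"
   using \<nu> unfolding fr by (simp_all add: unit_normal_at_def u_def frm_def)
  with q(4) cs d have "2 * mean_curvature_at X f cs d q (Lam d (f q) (J0 (frm (y $ 3) \<nu>))) \<le> - trA"
   unfolding good_def by blast
  thus "2 * mean_curvature (metric X d) (local_rep cs d f) u (fder (Thc a d) (param a cs u) \<nu>) \<le> - trA"
   unfolding fr by (simp add: mean_curvature_at_def u_def)
 next
  show "L (y $ 3) (hor y - x1) = L (param a cs u $ 3) (hor (param a cs u) - x1)" by (simp add: pu)
  show "K0 * param a cs u $ 3 \<le> 1/2"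
  proof -
   have "K0 * y $ 3 \<le> K0 * eps" using q(3) z K0_pos by (intro mult_left_mono) (auto simp: Slab_def)
   thus ?thesis using eps(4) by (simp add: pu)
  qed
 qed (use s h z pu min' in \<open>auto simp: Phi_def dsq_def\<close>)
qed

end

section \<open>The half-space theorem\<close>

context lie_frame
begin

lemma continuous_dsq: "continuous_on W (dsq x1)"
proof -
 have "continuous_on UNIV (\<lambda>p. L (fst p) (snd p))" using L_continuous by (simp add: case_prod_unfold)
 moreover have "continuous_on W (\<lambda>y::real ^ 3. (y $ 3, hor y - x1))"
  using linear_continuous_on[OF bounded_linear_hor] by (intro continuous_intros)
 ultimately have "continuous_on W (\<lambda>y. L (y $ 3) (hor y - x1))"
  using continuous_on_compose2[of UNIV "\<lambda>p. L (fst p) (snd p)" W "\<lambda>y. (y $ 3, hor y - x1)"] by simp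
 thus ?thesis unfolding dsq_def by (intro continuous_intros)
qed

lemma dsq_nonneg: "0 \<le> dsq x1 y" and dsq_eq_0: "dsq x1 y = 0 \<longleftrightarrow> hor y = x1"
 using injL linear_0[OF linL] by (auto simp: dsq_def) (metis injD right_minus_eq)

lemma dsq_bounds:
 assumes "y \<in> Slab" shows "(norm (hor y - x1) / 2)\<^sup>2 \<le> dsq x1 y" "dsq x1 y \<le> (3/2 * norm (hor y - x1))\<^sup>2"
 using L_norm_bounds[of "y $ 3" "hor y - x1"] assms unfolding dsq_def dot_square_norm Slab_def by (auto intro!: power_mono)

lemma height_strict_mono:
 assumes "0 \<le> s" "s < t" "t < eps" shows "s - K0 / 2 * s\<^sup>2 < t - K0 / 2 * t\<^sup>2"
proof -
 have "K0 * t < K0 * eps" using assms K0_pos by simp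
 moreover have "K0 * s < K0 * t" using assms K0_pos by simp
 ultimately have "0 < 1 - K0 / 2 * (s + t)" using eps(4) by (simp add: algebra_simps)
 hence "0 < (t - s) * (1 - K0 / 2 * (s + t))" using assms by simp
 also have "\<dots> = (t - K0 / 2 * t\<^sup>2) - (s - K0 / 2 * s\<^sup>2)" by (simp add: power2_eq_square field_simps)
 finally show ?thesis by simp
qed

lemma height_bounds: "0 \<le> t \<Longrightarrow> t < eps \<Longrightarrow> t / 2 \<le> t - K0 / 2 * t\<^sup>2"
proof -
 assume t: "0 \<le> t" "t < eps"
 have "K0 * t \<le> K0 * eps" using t K0_pos by simp
 hence "t * (K0 * t) \<le> t * (1/2)" using eps(4) t by (intro mult_left_mono) auto
 hence "K0 / 2 * t\<^sup>2 \<le> t / 4" by (simp add: power2_eq_square ac_simps)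
 thus ?thesis using t by linarith
qed

lemma height_le: "t - K0 / 2 * t\<^sup>2 \<le> t" using K0_pos by simp

lemma Phi_vertical_mono:
 assumes dh: "\<And>s. s > 0 \<Longrightarrow> (h has_real_derivative h1 s) (at s)"
  and x: "x \<noteq> x1" and t: "0 \<le> t1" "t1 < t2" "t2 < eps"
  and h: "\<And>s. s > 0 \<Longrightarrow> 0 \<le> h1 s" "\<And>s. s > 0 \<Longrightarrow> h1 s * s \<le> 1 / (8 * (onorm A + 1))"
 shows "Phi h x1 (pt x t1) < Phi h x1 (pt x t2)"
proof (rule DERIV_pos_imp_increasing[OF t(2)])
 fix t assume tt: "t1 \<le> t" "t \<le> t2"
 define y where "y = L t (x - x1)"
 have y: "y \<noteq> 0" using x injL linear_0[OF linL] unfolding y_def by (metis injD right_minus_eq)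
 have "((\<lambda>t. L t (x - x1)) has_vector_derivative A y) (at t)" using dL[of "x - x1" t] by (simp add: y_def)
 from bounded_bilinear.has_vector_derivative[OF bounded_bilinear_inner this this]
 have ds: "((\<lambda>t. dsq x1 (pt x t)) has_real_derivative 2 * (y \<bullet> A y)) (at t)"
  by (simp add: dsq_def has_real_derivative_iff_has_vector_derivative y_def inner_commute)
 have sy: "dsq x1 (pt x t) = y \<bullet> y" by (simp add: dsq_def y_def)
 have pos: "dsq x1 (pt x t) > 0" using y by (simp add: sy)
 have D: "((\<lambda>t. Phi h x1 (pt x t)) has_real_derivative (1 - K0 * t + h1 (y \<bullet> y) * (2 * (y \<bullet> A y)))) (at t)"
 proof -
  have "((\<lambda>t. t - K0 / 2 * t\<^sup>2) has_real_derivative (1 - K0 * t)) (at t)" by (auto intro!: derivative_eq_intros)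
  from DERIV_add[OF this DERIV_chain2[OF dh[OF pos] ds]] show ?thesis by (simp add: Phi_def sy)
 qed
 have a1: "onorm A + 1 > 0" using a0 by simp
 have Ay: "\<bar>y \<bullet> A y\<bar> \<le> onorm A * (y \<bullet> y)"
  using Cauchy_Schwarz_ineq2[of y "A y"] mult_left_mono[OF normA[of y] norm_ge_zero[of y]]
  by (simp add: dot_square_norm power2_eq_square algebra_simps)
 have yy: "y \<bullet> y > 0" using y by simp
 have "h1 (y \<bullet> y) * \<bar>y \<bullet> A y\<bar> \<le> h1 (y \<bullet> y) * (onorm A * (y \<bullet> y))" using Ay h(1)[OF yy] by (rule mult_left_mono)
 also have "\<dots> = (h1 (y \<bullet> y) * (y \<bullet> y)) * onorm A" by simp
 also have "\<dots> \<le> 1 / (8 * (onorm A + 1)) * onorm A" using h(2)[OF yy] a0 by (rule mult_right_mono)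
 also have "\<dots> \<le> 1/8" using a1 by (simp add: field_simps)
 finally have "\<bar>h1 (y \<bullet> y) * (y \<bullet> A y)\<bar> \<le> 1/8" using h(1)[OF yy] by (simp add: abs_mult)
 moreover have "K0 * t \<le> 1/2"
 proof -
  have "K0 * t \<le> K0 * eps" using tt t K0_pos by simp
  thus ?thesis using eps(4) by linarith
 qed
 ultimately have "0 < 1 - K0 * t + h1 (y \<bullet> y) * (2 * (y \<bullet> A y))" by (simp add: abs_le_iff)
 thus "\<exists>d. ((\<lambda>t. Phi h x1 (pt x t)) has_real_derivative d) (at t) \<and> 0 < d" using D by blast
qed

end

context frame_surface
begin

lemma compact_attains_inf_surface:
 assumes proper: "proper_map (pts S) T f" and a: "a \<in> carrier X" and Kc: "compact Kc" "Kc \<subseteq> Slab"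
  and ne: "q1 \<in> SS" "f q1 = Th a y1" "y1 \<in> Kc" and cont: "continuous_on Kc \<Psi>"
 obtains q y where "q \<in> SS" "f q = Th a y" "y \<in> Kc"
  "\<And>q' y'. q' \<in> SS \<Longrightarrow> f q' = Th a y' \<Longrightarrow> y' \<in> Kc \<Longrightarrow> \<Psi> y \<le> (\<Psi> y' :: real)"
proof -
 let ?M = "{q \<in> SS. f q \<in> Th a ` Kc}"
 have "compactin T (Th a ` Kc)" using image_compactin[of euclidean Kc T "Th a"] Kc(1) Th_continuous[OF a] by simp
 hence M: "compactin (pts S) ?M" using compactin_proper_map_preimage[OF proper] by simp
 let ?E = "(\<lambda>q. co a (f q)) ` ?M"
 have coM: "co a (f q) = y" if "f q = Th a y" "y \<in> Kc" for q y using that Kc(2) a by auto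
 have EK: "?E \<subseteq> Kc"
 proof (rule image_subsetI)
  fix q assume "q \<in> ?M"
  then obtain y where "f q = Th a y" "y \<in> Kc" by blast
  thus "co a (f q) \<in> Kc" using coM by simp
 qed
 have "continuous_map (subtopology (pts S) ?M) (subtopology T (Th a ` Slab)) f"
  using f_continuous Kc(2) by (auto simp: continuous_map_in_subtopology continuous_map_from_subtopology)
 from continuous_map_compose[OF this co_continuous[OF a]]
 have "continuous_map (subtopology (pts S) ?M) euclidean (\<lambda>q. co a (f q))" by (simp add: o_def)
 moreover have "compactin (subtopology (pts S) ?M) ?M" using M by (simp add: compactin_subtopology)
 ultimately have "compactin euclidean ?E" by (intro image_compactin)
 hence "compact ?E" by simp
 moreover have "?E \<noteq> {}" using ne by auto
 moreover have "continuous_on ?E \<Psi>" using cont EK continuous_on_subset by blast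
 ultimately have "\<exists>e\<in>?E. \<forall>e'\<in>?E. \<Psi> e \<le> \<Psi> e'" by (rule continuous_attains_inf)
 then obtain e where e: "e \<in> ?E" "\<And>e'. e' \<in> ?E \<Longrightarrow> \<Psi> e \<le> \<Psi> e'" by blast
 then obtain q where q: "q \<in> ?M" "e = co a (f q)" by blast
 then obtain y where y: "f q = Th a y" "y \<in> Kc" by blast
 show thesis
 proof (rule that[of q y])
  fix q' y' assume "q' \<in> SS" "f q' = Th a y'" "y' \<in> Kc"
  hence "co a (f q') = y'" "q' \<in> ?M" using coM by auto
  hence "y' \<in> ?E" by blast
  thus "\<Psi> y \<le> \<Psi> y'" using e(2)[of y'] q y coM[of q y] by simp
 qed (use q y in auto)
qed

lemma slab_open_preimage:
 assumes "a \<in> carrier X" "open W" "W \<subseteq> Slab"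
 shows "openin (pts S) {q \<in> SS. f q \<in> Th a ` W}"
 using openin_continuous_map_preimage[OF f_continuous Th_open_map[OF assms(1,2)]] .

text \<open>Logarithmic barriers rule out that the surface approaches the plane only at infinity.\<close>

lemma minimal_height_attained:
 assumes proper: "proper_map (pts S) T f" and a: "a \<in> carrier X"
  and disj: "\<And>q x. q \<in> SS \<Longrightarrow> f q \<noteq> Th a (pt x 0)"
  and p1: "p1 \<in> SS" "f p1 = Th a y1" "0 < y1 $ 3" "y1 $ 3 < eps"
  and sgn: "\<And>q y. q \<in> SS \<Longrightarrow> f q = Th a y \<Longrightarrow> y \<in> Slab \<Longrightarrow> 0 < y $ 3 \<Longrightarrow>
    (\<And>t. 0 \<le> t \<Longrightarrow> t < y $ 3 \<Longrightarrow> Th a (pt (hor y) t) \<notin> f ` SS) \<Longrightarrow> good q"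
 obtains q0 y0 where "q0 \<in> SS" "f q0 = Th a y0" "0 < y0 $ 3" "y0 $ 3 < eps"
  "\<And>q y. q \<in> SS \<Longrightarrow> f q = Th a y \<Longrightarrow> 0 \<le> y $ 3 \<Longrightarrow> y $ 3 < y0 $ 3 \<Longrightarrow> False"
proof -
 define R2 where "R2 = max 1 (dsq 0 y1)"
 have R2: "R2 \<ge> 1" "dsq 0 y1 \<le> R2" by (auto simp: R2_def)
 have norm_le: "norm y \<le> 2 * sqrt B + eps" if "0 \<le> y $ 3" "y $ 3 < eps" "dsq 0 y \<le> B" for y B
 proof -
  have "y \<in> Slab" using that by (simp add: Slab_def)
  from dsq_bounds(1)[OF this, of 0] that(3) have "(norm (hor y) / 2)\<^sup>2 \<le> B" by simp
  hence "norm (hor y) / 2 \<le> sqrt B" by (rule real_le_rsqrt)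
  moreover have "norm y \<le> norm (hor y) + \<bar>y $ 3\<bar>"
  proof -
   have "norm y = sqrt ((norm (hor y))\<^sup>2 + (y $ 3)\<^sup>2)" by (simp add: norm_eq_sqrt_inner inner_pt[of y] power2_eq_square)
   thus ?thesis using sqrt_sum_squares_le_sum_abs[of "norm (hor y)" "y $ 3"] by simp
  qed
  ultimately show ?thesis using that by linarith
 qed
 have cl3: "closed {y::real ^ 3. 0 \<le> y $ 3}" "closed {y::real ^ 3. y $ 3 \<le> d}" for d
  by (intro closed_Collect_le continuous_intros)+
 define K1 where "K1 = {y. 0 \<le> y $ 3} \<inter> {y. y $ 3 \<le> y1 $ 3} \<inter> {y. dsq 0 y \<le> R2}"
 have K1: "compact K1" "K1 \<subseteq> Slab"
 proof -
  have "closed K1" unfolding K1_def by (intro closed_Int cl3 closed_Collect_le continuous_dsq continuous_intros)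
  moreover have "bounded K1"
   unfolding bounded_iff using norm_le p1(4) by (intro exI[of _ "2 * sqrt R2 + eps"]) (auto simp: K1_def)
  ultimately show "compact K1" using compact_eq_bounded_closed by blast
  show "K1 \<subseteq> Slab" using p1(4) by (auto simp: K1_def Slab_def)
 qed
 have "y1 \<in> K1" using p1 R2 by (simp add: K1_def)
 obtain q0 y0 where q0: "q0 \<in> SS" "f q0 = Th a y0" "y0 \<in> K1"
  "\<And>q' y'. q' \<in> SS \<Longrightarrow> f q' = Th a y' \<Longrightarrow> y' \<in> K1 \<Longrightarrow> y0 $ 3 \<le> y' $ 3"
  using compact_attains_inf_surface[OF proper a K1 p1(1,2) \<open>y1 \<in> K1\<close>, of "\<lambda>y. y $ 3"]
  using continuous_on_subset[OF linear_continuous_on[OF bounded_linear_vec_nth[of 3]] subset_UNIV] by metis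
 define \<delta> where "\<delta> = y0 $ 3"
 have off: "y $ 3 \<noteq> 0" if "q \<in> SS" "f q = Th a y" for q y using disj[OF that(1), of "hor y"] that(2) by (metis pt_hor)
 have \<delta>: "0 < \<delta>" "\<delta> \<le> y1 $ 3" "\<delta> < eps" using q0(3) off[OF q0(1,2)] p1(4) by (auto simp: K1_def \<delta>_def)
 have far: "R2 < dsq 0 y" if "q \<in> SS" "f q = Th a y" "0 \<le> y $ 3" "y $ 3 < \<delta>" for q y
 proof (rule ccontr)
  assume "\<not> R2 < dsq 0 y"
  hence "y \<in> K1" using that \<delta> by (simp add: K1_def)
  from q0(4)[OF that(1,2) this] that(4) show False by (simp add: \<delta>_def)
 qed
 show thesis
 proof (rule that[OF q0(1,2)])
  show "0 < y0 $ 3" "y0 $ 3 < eps" using \<delta> by (simp_all add: \<delta>_def)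
  fix q2 y2 assume q2: "q2 \<in> SS" "f q2 = Th a y2" "0 \<le> y2 $ 3" "y2 $ 3 < y0 $ 3"
  have far2: "R2 < dsq 0 y2" using far q2 by (simp add: \<delta>_def)
  define gap where "gap = (\<delta> - K0 / 2 * \<delta>\<^sup>2) - (y2 $ 3 - K0 / 2 * (y2 $ 3)\<^sup>2)"
  have gap: "gap > 0" using height_strict_mono[of "y2 $ 3" \<delta>] q2 \<delta> by (simp add: gap_def \<delta>_def)
  have a1: "onorm A + 1 > 0" using a0 by simp
  define \<eta> where "\<eta> = min (min 1 (1 / (4 * (onorm A + 1)))) (gap / (ln (dsq 0 y2) - ln R2 + 1))"
  have lnp: "ln (dsq 0 y2) - ln R2 > 0" using far2 R2 by simp
  have \<eta>: "\<eta> > 0" "\<eta> \<le> 1" "\<eta> \<le> 1 / (4 * (onorm A + 1))" "\<eta> \<le> gap / (ln (dsq 0 y2) - ln R2 + 1)"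
   using gap a1 lnp by (auto simp: \<eta>_def)
  define h where "h s = \<eta> / 2 * (ln s - ln R2)" for s
  define h1 where "h1 s = \<eta> / (2 * s)" for s
  define h2 where "h2 s = - \<eta> / (2 * s\<^sup>2)" for s
  have dh: "(h has_real_derivative h1 s) (at s)" "(h1 has_real_derivative h2 s) (at s)" if "s > 0" for s
  proof -
   show "(h has_real_derivative h1 s) (at s)"
    unfolding h_def[abs_def] h1_def using that by (auto intro!: derivative_eq_intros)
   show "(h1 has_real_derivative h2 s) (at s)"
    unfolding h1_def[abs_def] h2_def using that by (auto intro!: derivative_eq_intros simp: power2_eq_square)
  qed
  have h1s: "h1 s * s \<le> 1 / (8 * (onorm A + 1))" "0 < h1 s" if "s > 0" for s
  proof -
   have "h1 s * s = \<eta> / 2" using that by (simp add: h1_def)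
   moreover have "(1 / (4 * x)) / 2 = 1 / (8 * x)" for x :: real by simp
   ultimately show "h1 s * s \<le> 1 / (8 * (onorm A + 1))" using divide_right_mono[OF \<eta>(3), of 2] by simp
   show "0 < h1 s" using that \<eta>(1) by (simp add: h1_def)
  qed
  have small: "Phi h 0 y2 < \<delta> - K0 / 2 * \<delta>\<^sup>2"
  proof -
   have "\<eta> * (ln (dsq 0 y2) - ln R2 + 1) \<le> gap" using \<eta>(4) lnp by (simp add: pos_le_divide_eq)
   hence "\<eta> * (ln (dsq 0 y2) - ln R2) + \<eta> \<le> gap" by (simp add: algebra_simps)
   moreover have "h (dsq 0 y2) \<le> \<eta> * (ln (dsq 0 y2) - ln R2)" using \<eta>(1) lnp by (simp add: h_def)
   ultimately have "h (dsq 0 y2) < gap" using \<eta>(1) by linarith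
   thus ?thesis by (simp add: Phi_def gap_def)
  qed
  define C1 where "C1 = {y. 0 \<le> y $ 3} \<inter> {y. y $ 3 \<le> \<delta>} \<inter> {y. R2 \<le> dsq 0 y}"
  have C1: "closed C1" unfolding C1_def by (intro closed_Int cl3 closed_Collect_le continuous_dsq continuous_intros)
  have contP: "continuous_on C1 (Phi h 0)"
   unfolding Phi_def[abs_def] h_def using R2 by (intro continuous_intros continuous_dsq) (auto simp: C1_def)
  define D where "D = C1 \<inter> Phi h 0 -` {..Phi h 0 y2}"
  have "closed D" unfolding D_def by (rule continuous_closed_preimage[OF contP C1]) simp
  moreover have "bounded D"
  proof -
   have "dsq 0 y \<le> exp (ln R2 + 2 * \<delta> / \<eta>)" if "y \<in> D" for y
   proof -
    have y: "0 \<le> y $ 3" "y $ 3 \<le> \<delta>" "R2 \<le> dsq 0 y" "Phi h 0 y \<le> Phi h 0 y2" using that by (auto simp: D_def C1_def)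
    have "0 \<le> y $ 3 - K0 / 2 * (y $ 3)\<^sup>2" using height_bounds[of "y $ 3"] y \<delta> by simp
    hence "h (dsq 0 y) \<le> \<delta>" using y(4) small height_le[of \<delta>] by (simp add: Phi_def)
    hence "ln (dsq 0 y) \<le> ln R2 + 2 * \<delta> / \<eta>" using \<eta>(1) by (simp add: h_def field_simps)
    moreover have "dsq 0 y > 0" using y R2 by linarith
    ultimately show ?thesis by (metis exp_le_cancel_iff exp_ln)
   qed
   thus ?thesis unfolding bounded_iff using norm_le \<delta>
    by (intro exI[of _ "2 * sqrt (exp (ln R2 + 2 * \<delta> / \<eta>)) + eps"]) (auto simp: D_def C1_def)
  qed
  ultimately have cD: "compact D" using compact_eq_bounded_closed by blast
  have DS: "D \<subseteq> Slab" using \<delta> by (auto simp: D_def C1_def Slab_def)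
  have "y2 \<in> D" using q2 far2 by (simp add: D_def C1_def \<delta>_def)
  have "continuous_on D (Phi h 0)" by (rule continuous_on_subset[OF contP]) (simp add: D_def)
  then obtain q y where q: "q \<in> SS" "f q = Th a y" "y \<in> D"
   "\<And>q' y'. q' \<in> SS \<Longrightarrow> f q' = Th a y' \<Longrightarrow> y' \<in> D \<Longrightarrow> Phi h 0 y \<le> Phi h 0 y'"
   using compact_attains_inf_surface[OF proper a cD DS q2(1,2) \<open>y2 \<in> D\<close>, of "Phi h 0"] by metis
  have y: "0 < y $ 3" "y $ 3 \<le> \<delta>" "R2 \<le> dsq 0 y" "Phi h 0 y \<le> Phi h 0 y2"
   using q(3) off[OF q(1,2)] by (auto simp: D_def C1_def)
  have h0: "0 \<le> h (dsq 0 y)" using y(3) R2 \<eta>(1) by (simp add: h_def)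
  have "y $ 3 \<noteq> \<delta>" using y(4) small h0 by (auto simp: Phi_def)
  hence y3: "y $ 3 < \<delta>" using y by simp
  have ys: "R2 < dsq 0 y" using far[OF q(1,2)] y y3 by simp
  have yS: "y \<in> Slab" using q(3) DS by blast
  have s0: "dsq 0 y > 0" using y(3) R2 by linarith
  have min: "Phi h 0 y \<le> Phi h 0 y'" if "q' \<in> SS" "f q' = Th a y'" "0 \<le> y' $ 3" "y' $ 3 < \<delta>" for q' y'
  proof (cases "Phi h 0 y' \<le> Phi h 0 y2")
   case True
   hence "y' \<in> D" using far[OF that] that by (simp add: D_def C1_def)
   thus ?thesis using q(4) that by blast
  next
   case False thus ?thesis using y(4) by simp
  qed
  have "hor y \<noteq> 0" using s0 dsq_eq_0[of 0 y] by auto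
  have "good q"
  proof (rule sgn[OF q(1,2) yS y(1)], rule notI)
   fix t assume t: "0 \<le> t" "t < y $ 3" "Th a (pt (hor y) t) \<in> f ` SS"
   then obtain q' where q': "q' \<in> SS" "f q' = Th a (pt (hor y) t)" by auto
   have "Phi h 0 (pt (hor y) t) < Phi h 0 (pt (hor y) (y $ 3))"
    by (rule Phi_vertical_mono[OF dh(1) \<open>hor y \<noteq> 0\<close> t(1,2)]) (use y3 \<delta> h1s in \<open>auto intro: less_imp_le\<close>)
   thus False using min[OF q'] t y3 by simp
  qed
  let ?W = "Slab \<inter> {y. 0 < y $ 3} \<inter> {y. y $ 3 < \<delta>}"
  have oW: "open ?W" by (intro open_Int open_Slab open_Collect_less continuous_intros)
  let ?Q = "{q \<in> SS. f q \<in> Th a ` ?W}"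
  show False
  proof (rule no_contact[OF a q(1,2) yS \<open>good q\<close> dh, of "dsq 0 y" 0 ?Q])
   show "openin (pts S) ?Q" by (rule slab_open_preimage[OF a oW]) auto
   show "q \<in> ?Q" using q y y3 yS by auto
   show "\<bar>h2 (dsq 0 y)\<bar> * dsq 0 y \<le> 200 * h1 (dsq 0 y)"
    using s0 \<eta>(1) by (simp add: h1_def h2_def power2_eq_square field_simps)
   show "h2 (dsq 0 y) * dsq 0 y + h1 (dsq 0 y) \<le> 0" using s0 by (simp add: h1_def h2_def power2_eq_square field_simps)
   have "1 \<le> dsq 0 y" using R2 y by linarith
   thus "h1 (dsq 0 y) \<le> 1" using \<eta> by (simp add: h1_def)
   fix q' y' assume q': "q' \<in> ?Q" "y' \<in> Slab" "f q' = Th a y'"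
   then obtain y'' where "f q' = Th a y''" "y'' \<in> ?W" by auto
   hence "y' \<in> ?W" using q' Th_inj_Slab[OF a] by (auto simp: inj_on_def)
   thus "Phi h 0 y \<le> Phi h 0 y'" using min[of q' y'] q' by auto
  qed (use s0 h1s y in auto)
 qed
qed

end

lemma mult_exp_neg_le_1: "t * exp (- t) \<le> (1::real)"
proof -
 have "t \<le> exp t" using exp_ge_add_one_self[of t] by linarith
 hence "t * exp (- t) \<le> exp t * exp (- t)" by (intro mult_right_mono) auto
 thus ?thesis by (simp flip: exp_add)
qed

lemma internally_tangent_ball:
 fixes x y0 y1 x' :: "'a::real_inner"
 assumes y1: "y1 = (1/2) *\<^sub>R (x' + y0)" and x: "dist y1 x \<le> dist x' y0 / 2" "x \<noteq> y0"
 shows "dist x' x < dist x' y0"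
proof -
 define v where "v = (1/2) *\<^sub>R (y0 - x')"
 define e where "e = x - y1"
 have ev: "x - x' = e + v" "x - y0 = e - v" by (simp_all add: e_def v_def y1 algebra_simps) (simp_all flip: scaleR_add_left)
 have nv: "norm v = dist x' y0 / 2" by (simp add: v_def dist_norm norm_minus_commute)
 have ne: "norm e \<le> dist x' y0 / 2" using x(1) by (simp add: e_def dist_norm norm_minus_commute)
 have "(norm (e + v))\<^sup>2 + (norm (e - v))\<^sup>2 = 2 * (norm e)\<^sup>2 + 2 * (norm v)\<^sup>2"
  by (simp add: power2_norm_eq_inner inner_add_left inner_add_right inner_diff_left inner_diff_right inner_commute)
 moreover have "(norm e)\<^sup>2 \<le> (dist x' y0 / 2)\<^sup>2" using ne by (intro power_mono) auto
 moreover have "0 < (norm (e - v))\<^sup>2" using x(2) ev(2) by auto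
 moreover have "(norm v)\<^sup>2 = (dist x' y0 / 2)\<^sup>2" by (simp add: nv)
 moreover have "4 * (dist x' y0 / 2)\<^sup>2 = (dist x' y0)\<^sup>2" by (simp add: power_divide)
 ultimately have "(norm (e + v))\<^sup>2 < (dist x' y0)\<^sup>2" by linarith
 hence "norm (e + v) < dist x' y0" by (rule power2_less_imp_less) simp
 thus ?thesis using ev(1) by (simp add: dist_norm norm_minus_commute)
qed

lemma bounded_linear_pt0: "bounded_linear (\<lambda>x. pt x 0)"
 by (subst linear_conv_bounded_linear[symmetric]) (auto intro!: linearI simp: pt_add pt_scaleR)

lemma pt_add_axis: "pt x t = pt x 0 + t *\<^sub>R pt 0 1" by (simp add: vec_eq_iff forall_3)

context lie_frame
begin

lemma frm_axis_3: "frm z (axis 3 1) = axis 3 1"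
proof -
 have "hor (axis 3 1) = 0" by (simp add: vec_eq_iff forall_2 axis_def)
 hence "frm z (axis 3 1) = pt 0 1" using linear_0[OF linL] by (simp add: frm_def axis_def)
 thus ?thesis by (simp add: vec_eq_iff forall_3 axis_def)
qed

lemma Th_rebase:
 assumes "a \<in> carrier X" shows "Th (a \<otimes> c \<delta>) (pt x t) = Th a (pt (L (- \<delta>) x) (\<delta> + t))"
proof -
 have "\<phi> (L (- \<delta>) x) \<otimes> (c \<delta> \<otimes> c t) = c \<delta> \<otimes> (\<phi> x \<otimes> c t)"
  using m_assoc[of "inv (c \<delta>)" "c \<delta>" "c t"] by (simp add: \<phi>_L c_uminus m_assoc)
 thus ?thesis using assms by (simp add: Th_def c_add m_assoc)
qed

lemma Th_rebase_inverse: "a \<in> carrier X \<Longrightarrow> Th a y = Th (a \<otimes> c \<delta>) (pt (L \<delta> (hor y)) (y $ 3 - \<delta>))"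
 by (simp add: Th_rebase flip: L_add) (simp add: L_0)

end

context frame_surface
begin

lemma height_minimum_flat:
 assumes a: "a \<in> carrier X" "cs \<in> charts S" "d \<in> C" and U: "open U" "u \<in> U" "U \<subseteq> pdom a cs d"
  and min: "\<And>x. x \<in> U \<Longrightarrow> param a cs u $ 3 \<le> param a cs x $ 3"
 shows "fder (param a cs) u v $ 3 = 0"
proof -
 have u: "u \<in> pdom a cs d" using U by blast
 have "(\<lambda>v. fder (param a cs) u v $ 3) = (\<lambda>v. 0)"
  by (rule differential_zero_maxmin[OF U(2,1) bounded_linear.has_derivative[OF bounded_linear_vec_nth
     F0_derivative(1)[OF surface_adapted[OF a] u u]]]) (use min in blast)
 thus ?thesis by meson
qed

lemma height_derivative_injective:
 assumes a: "a \<in> carrier X" "cs \<in> charts S" "d \<in> C" and u: "u \<in> pdom a cs d"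
  and z: "\<And>v. fder (param a cs) u v $ 3 = 0"
  and U: "open U" "u \<in> U" "U \<subseteq> pdom a cs d"
 obtains U' W k where "open U'" "U' \<subseteq> U" "u \<in> U'" "open W" "homeomorphism U' W (\<lambda>x. hor (param a cs x)) k"
proof -
 note ad = surface_adapted[OF a]
 have F0: "(param a cs has_derivative fder (param a cs) u) (at u)" "linear (fder (param a cs) u)"
  using F0_derivative(1,2)[OF ad u u] by auto
 have D: "((\<lambda>x. hor (param a cs x)) has_derivative (\<lambda>v. hor (fder (param a cs) u v))) (at u)"
  by (rule bounded_linear.has_derivative[OF bounded_linear_hor F0(1)])
 have "inj (\<lambda>v. hor (fder (param a cs) u v))"
 proof (rule injI)
  fix v v' assume "hor (fder (param a cs) u v) = hor (fder (param a cs) u v')"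
  hence "fder (param a cs) u v = fder (param a cs) u v'" using z by (metis pt_hor)
  thus "v = v'" using adaptedD(11)[OF ad u] by (metis injD)
 qed
 hence inj: "inj (fder (\<lambda>x. hor (param a cs x)) u)" by (simp add: frechet_derivative_eqI[OF D])
 have "Ck_on 1 (pdom a cs d) (param a cs)" by (rule Ck_on_mono[OF adaptedD(3)[OF ad u]]) simp
 hence "Ck_on 1 U (\<lambda>x. hor (param a cs x))"
  by (intro Ck_on_linear_compose[OF U(1) bounded_linear_hor] Ck_on_subset[OF _ U(3)])
 from local_inverse[OF U(1) this U(2) inj] that show thesis by metis
qed

text \<open>Hopf's argument: if the contact set were not open, a ball in its complement would touch it, and
 an exponential barrier on that ball would be tangent to the surface.\<close>

lemma hopf_contact_open:
 assumes b: "b \<in> carrier X" and q: "q \<in> SS" "f q = Th b y" "y $ 3 = 0"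
  and Q0: "openin (pts S) Q0" "q \<in> Q0" "\<And>q'. q' \<in> Q0 \<Longrightarrow> good q'"
   "\<And>q' y'. q' \<in> Q0 \<Longrightarrow> y' \<in> Slab \<Longrightarrow> f q' = Th b y' \<Longrightarrow> 0 \<le> y' $ 3"
 shows "\<exists>Q. openin (pts S) Q \<and> q \<in> Q \<and> (\<forall>q'\<in>Q. \<exists>y'. f q' = Th b y' \<and> y' $ 3 = 0)"
proof -
 obtain cs d where cs: "cs \<in> charts S" "q \<in> fst cs" and d: "d \<in> C" "f q \<in> fst d" by (rule charts_at[OF q(1)])
 define u where "u = snd cs q"
 have qu: "chart_inv cs u = q" using chart_inv_snd[OF S_mfd cs] by (simp add: u_def)
 have yS: "y \<in> Slab" using q(3) eps(1) by (simp add: Slab_def)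
 let ?F0 = "param b cs"
 define U0 where "U0 = pdom b cs d \<inter> {x \<in> snd cs ` fst cs. chart_inv cs x \<in> Q0}"
 have U0: "open U0" unfolding U0_def
  by (intro open_Int open_dom[OF b cs(1) d(1)] open_vimage[OF chart_open[OF S_mfd cs(1)] chart_inv_continuous[OF S_mfd cs(1)] Q0(1)])
 have uD: "u \<in> pdom b cs d" using cs d q qu yS by (auto simp: pdom_def u_def)
 hence uU0: "u \<in> U0" using Q0(2) qu by (auto simp: U0_def pdom_def)
 note F0S = param_in[OF cs(1), of _ b d]
 have F0_nonneg: "0 \<le> ?F0 x $ 3" if "x \<in> U0" for x using Q0(4)[of "chart_inv cs x" "?F0 x"] F0S that by (auto simp: U0_def)
 have F0u: "?F0 u = y" using b q yS by (simp add: param_def qu)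
 have z3: "fder ?F0 u v $ 3 = 0" for v
  by (rule height_minimum_flat[OF b cs(1) d(1) U0 uU0]) (use F0_nonneg F0u q(3) in \<open>auto simp: U0_def\<close>)
 obtain U' W k where U': "open U'" "U' \<subseteq> U0" "u \<in> U'" and W: "open W" and hk: "homeomorphism U' W (\<lambda>x. hor (?F0 x)) k"
 proof (rule height_derivative_injective[OF b cs(1) d(1) uD z3 U0 uU0])
  show "U0 \<subseteq> pdom b cs d" by (simp add: U0_def)
 qed
 have kU': "k x \<in> U'" "hor (?F0 (k x)) = x" if "x \<in> W" for x using hk that by (auto simp: homeomorphism_def)
 have kF: "hor (?F0 x) \<in> W" "k (hor (?F0 x)) = x" if "x \<in> U'" for x using hk that by (auto simp: homeomorphism_def)
 have oU': "open {x \<in> U'. hor (?F0 x) \<in> ball p e}" for p e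
 proof -
  have "continuous_on U' (\<lambda>x. hor (?F0 x))" using hk by (simp add: homeomorphism_def)
  from continuous_open_preimage[OF this U'(1) open_ball] show ?thesis by (simp only: vimage_def Int_def mem_Collect_eq)
 qed
 define z where "z x = ?F0 (k x) $ 3" for x
 have F0k: "?F0 (k x) = pt x (z x)" if "x \<in> W" for x using kU'(2)[OF that] by (metis pt_hor z_def)
 have z: "0 \<le> z x" "z x < eps" "pt x (z x) \<in> Slab" if "x \<in> W" for x
 proof -
  have "k x \<in> U0" using kU'(1)[OF that] U'(2) by blast
  thus "0 \<le> z x" "pt x (z x) \<in> Slab" using F0_nonneg F0S(1) F0k[OF that] by (auto simp: z_def U0_def)
  thus "z x < eps" by (simp add: Slab_def)
 qed
 have contz: "continuous_on W z"
 proof -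
  have "continuous_on U' ?F0"
   by (rule continuous_on_subset[OF Ck_on_imp_continuous_on[OF adaptedD(3)[OF surface_adapted[OF b cs(1) d(1)] uD]]])
    (use U'(2) in \<open>auto simp: U0_def\<close>)
  hence "continuous_on W (\<lambda>x. ?F0 (k x))" by (rule continuous_on_compose2) (use hk in \<open>auto simp: homeomorphism_def\<close>)
  thus ?thesis unfolding z_def by (intro continuous_intros)
 qed
 define x0 where "x0 = hor y"
 have x0: "x0 \<in> W" "z x0 = 0" using kF[OF U'(3)] q(3) by (auto simp: F0u x0_def z_def)
 obtain r0 where r0: "r0 > 0" "cball x0 r0 \<subseteq> W" using W x0(1) open_contains_cball by blast
 have flat: "z x' = 0" if x': "dist x0 x' < r0 / 4" for x'
 proof (rule ccontr)
  assume zx': "z x' \<noteq> 0"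
  define Zs where "Zs = {x \<in> cball x0 (r0 / 2). z x = 0}"
  have sub: "cball x0 (r0 / 2) \<subseteq> W" using r0 by (auto intro: subsetD[OF r0(2)])
  have "closed Zs" unfolding Zs_def by (rule continuous_closed_preimage_constant[OF continuous_on_subset[OF contz sub]]) simp
  moreover have "x0 \<in> Zs" using x0 r0 by (simp add: Zs_def)
  ultimately obtain y0 where y0: "y0 \<in> Zs" "\<And>x. x \<in> Zs \<Longrightarrow> dist x' y0 \<le> dist x' x"
   using distance_attains_inf[of Zs x'] by blast
  define \<rho> where "\<rho> = dist x' y0"
  have \<rho>: "\<rho> > 0" "\<rho> < r0 / 4"
  proof -
   show "\<rho> > 0" using y0(1) zx' by (auto simp: \<rho>_def Zs_def)
   show "\<rho> < r0 / 4" using y0(2)[OF \<open>x0 \<in> Zs\<close>] x' by (simp add: \<rho>_def dist_commute)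
  qed
  have y0': "dist x0 y0 \<le> r0 / 2" "z y0 = 0" using y0(1) by (auto simp: Zs_def)
  have pos: "0 < z x" if "dist x' x < \<rho>" for x
  proof -
   have "dist x0 x \<le> dist x0 x' + dist x' x" by (rule dist_triangle)
   hence xc: "x \<in> cball x0 (r0 / 2)" using that x' \<rho> by simp
   have "x \<notin> Zs" using y0(2) that by (force simp: \<rho>_def)
   thus ?thesis using xc z(1) sub by (force simp: Zs_def less_le)
  qed
  define y1 where "y1 = (1/2) *\<^sub>R (x' + y0)"
  define r where "r = \<rho> / 2"
  have r: "r > 0" using \<rho> by (simp add: r_def)
  have y10: "dist y1 y0 = r"
  proof -
   have "y1 - y0 = (1/2) *\<^sub>R (x' - y0)" by (simp add: y1_def vec_eq_iff)
   thus ?thesis by (simp add: dist_norm r_def \<rho>_def)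
  qed
  have posB: "0 < z x" if "dist y1 x \<le> r" "x \<noteq> y0" for x
   using internally_tangent_ball[OF y1_def] that by (intro pos) (auto simp: r_def \<rho>_def)
  have BW: "cball y0 (r/2) \<subseteq> W"
  proof
   fix x assume "x \<in> cball y0 (r/2)"
   hence "dist x0 x \<le> r0" using dist_triangle[of x0 x y0] y0'(1) \<rho> r0 by (simp add: r_def)
   thus "x \<in> W" using r0(2) by auto
  qed
  obtain \<kappa> where \<kappa>: "\<kappa> > 0" "\<And>x. dist y0 x = r/2 \<Longrightarrow> dist y1 x \<le> r \<Longrightarrow> \<kappa> \<le> z x"
  proof (cases "sphere y0 (r/2) \<inter> cball y1 r = {}")
   case True thus thesis using that[of 1] by force
  next
   case False
   have "continuous_on (sphere y0 (r/2) \<inter> cball y1 r) z" by (rule continuous_on_subset[OF contz]) (use BW in force)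
   then obtain xk where xk: "xk \<in> sphere y0 (r/2) \<inter> cball y1 r" "\<And>x. x \<in> sphere y0 (r/2) \<inter> cball y1 r \<Longrightarrow> z xk \<le> z x"
    using continuous_attains_inf[of "sphere y0 (r/2) \<inter> cball y1 r" z] False
    by (metis compact_Int compact_cball compact_sphere)
   have "xk \<noteq> y0" using xk(1) r by auto
   hence "0 < z xk" using posB xk(1) by auto
   thus thesis using that[of "z xk"] xk(2) by simp
  qed
  have a1: "onorm A + 1 > 0" using a0 by simp
  define \<alpha> where "\<alpha> = 16 / r\<^sup>2"
  have \<alpha>: "\<alpha> > 0" using r by (simp add: \<alpha>_def)
  define \<eta> where "\<eta> = min (min (1 / \<alpha>) (\<kappa> / 4)) (1 / (8 * (onorm A + 1)))"
  have \<eta>: "\<eta> > 0" "\<eta> \<le> 1 / \<alpha>" "\<eta> \<le> \<kappa> / 4" "\<eta> \<le> 1 / (8 * (onorm A + 1))" using \<alpha> \<kappa> a1 by (auto simp: \<eta>_def)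
  define h where "h s = - \<eta> * exp (- (\<alpha> * s))" for s
  define h1 where "h1 s = \<eta> * \<alpha> * exp (- (\<alpha> * s))" for s
  define h2 where "h2 s = - \<eta> * \<alpha>\<^sup>2 * exp (- (\<alpha> * s))" for s
  have dh: "(h has_real_derivative h1 s) (at s)" "(h1 has_real_derivative h2 s) (at s)" for s
  proof -
   show "(h has_real_derivative h1 s) (at s)" unfolding h_def[abs_def] h1_def by (auto intro!: derivative_eq_intros)
   show "(h1 has_real_derivative h2 s) (at s)"
    unfolding h1_def[abs_def] h2_def by (auto intro!: derivative_eq_intros simp: power2_eq_square)
  qed
  have h1p: "0 < h1 s" for s using \<eta> \<alpha> by (simp add: h1_def)
  have h1s: "h1 s * s \<le> 1 / (8 * (onorm A + 1))" for s
  proof -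
   have "h1 s * s = \<eta> * ((\<alpha> * s) * exp (- (\<alpha> * s)))" by (simp add: h1_def)
   also have "\<dots> \<le> \<eta> * 1" using mult_exp_neg_le_1[of "\<alpha> * s"] \<eta>(1) by (intro mult_left_mono) auto
   finally show ?thesis using \<eta>(4) by simp
  qed
  have h1le: "h1 s \<le> 1" if "0 \<le> s" for s
  proof -
   have "\<eta> * \<alpha> \<le> 1" using \<eta>(2) \<alpha> by (simp add: field_simps)
   moreover have "exp (- (\<alpha> * s)) \<le> 1" using that \<alpha> by simp
   ultimately have "(\<eta> * \<alpha>) * exp (- (\<alpha> * s)) \<le> 1 * 1" by (intro mult_mono) auto
   thus ?thesis by (simp add: h1_def)
  qed
  have h_mono: "h s \<le> h t" if "s \<le> t" for s t using that \<eta>(1) \<alpha> by (simp add: h_def)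
  have h_bounds: "- \<eta> \<le> h s" "h s \<le> 0" if "0 \<le> s" for s
  proof -
   have "\<eta> * exp (- (\<alpha> * s)) \<le> \<eta> * 1" using that \<eta>(1) \<alpha> by (intro mult_left_mono) auto
   thus "- \<eta> \<le> h s" by (simp add: h_def)
   show "h s \<le> 0" using \<eta>(1) by (simp add: h_def)
  qed
  define \<Psi> where "\<Psi> x = Phi h y1 (pt x (z x))" for x
  have cont\<Psi>: "continuous_on (cball y0 (r/2)) \<Psi>"
  proof -
   have "continuous_on W (\<lambda>x. pt x (z x))"
    by (subst pt_add_axis) (intro continuous_intros contz linear_continuous_on bounded_linear_pt0)
   hence c1: "continuous_on (cball y0 (r/2)) (\<lambda>x. pt x (z x))" using BW continuous_on_subset by blast
   have "continuous_on UNIV (Phi h y1)" unfolding Phi_def[abs_def] h_def by (intro continuous_intros continuous_dsq)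
   from continuous_on_compose2[OF this c1] show ?thesis by (simp add: \<Psi>_def[abs_def])
  qed
  have no_min: False if xm: "dist y0 xm < r/2" "\<And>x. dist y0 x \<le> r/2 \<Longrightarrow> \<Psi> xm \<le> \<Psi> x" for xm
  proof -
   have xW: "xm \<in> W" using xm(1) BW by auto
   define s where "s = dsq y1 (pt xm (z xm))"
   have d1: "r/2 \<le> norm (xm - y1)" "norm (xm - y1) \<le> 3/2 * r"
    using dist_triangle[of y1 y0 xm] dist_triangle[of y1 xm y0] xm(1) y10 by (auto simp: dist_norm norm_minus_commute)
   have "(r/4)\<^sup>2 \<le> (norm (xm - y1) / 2)\<^sup>2" using d1 r by (intro power_mono) auto
   hence s1: "(r/4)\<^sup>2 \<le> s" using dsq_bounds(1)[OF z(3)[OF xW], of y1] by (simp add: s_def)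
   have "(3/2 * norm (xm - y1))\<^sup>2 \<le> (9/4 * r)\<^sup>2" using d1 by (intro power_mono) auto
   hence s2: "s \<le> (9/4 * r)\<^sup>2" using dsq_bounds(2)[OF z(3)[OF xW], of y1] by (simp add: s_def)
   have \<alpha>s: "1 \<le> \<alpha> * s" "\<alpha> * s \<le> 81"
   proof -
    have "\<alpha> * (r/4)\<^sup>2 = 1" "\<alpha> * (9/4 * r)\<^sup>2 = 81" using r by (simp_all add: \<alpha>_def power2_eq_square)
    thus "1 \<le> \<alpha> * s" "\<alpha> * s \<le> 81" using s1 s2 \<alpha> by (metis mult_left_mono less_imp_le)+
   qed
   have s0: "s > 0" using s1 r by (metis less_le_trans zero_less_divide_iff zero_less_numeral zero_less_power)
   define q' where "q' = chart_inv cs (k xm)"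
   have kx: "k xm \<in> U0" using kU'(1)[OF xW] U'(2) by blast
   hence kx1: "k xm \<in> pdom b cs d" "k xm \<in> snd cs ` fst cs" and q'Q: "q' \<in> Q0" by (auto simp: U0_def q'_def)
   have q'c: "q' \<in> fst cs" "snd cs q' = k xm" "f q' = Th b (pt xm (z xm))"
    using F0S(2)[OF kx1(1)] F0k[OF xW] chart_inv_in[OF kx1(2)] snd_chart_inv[OF kx1(2)] by (simp_all add: q'_def)
   let ?U2 = "{x \<in> U'. hor (?F0 x) \<in> ball y0 (r/2)}"
   let ?Q = "{p \<in> fst cs. snd cs p \<in> ?U2}"
   show False
   proof (rule no_contact[OF b _ q'c(3) z(3)[OF xW] Q0(3)[OF q'Q] dh, of s y1 ?Q])
    show "q' \<in> SS" using q'c(1) chart_subset[OF S_mfd cs(1)] by blast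
    show "openin (pts S) ?Q" by (rule chart_preimage_open[OF S_mfd cs(1) oU'])
    show "q' \<in> ?Q" using q'c kU'[OF xW] xm(1) by simp
    show "\<bar>h2 s\<bar> * s \<le> 200 * h1 s"
    proof -
     have "\<bar>h2 s\<bar> * s = (\<alpha> * s) * h1 s" using \<eta>(1) by (simp add: h2_def h1_def abs_mult power2_eq_square)
     also have "\<dots> \<le> 200 * h1 s" using \<alpha>s h1p[of s] by (intro mult_right_mono) auto
     finally show ?thesis .
    qed
    have "h2 s * s + h1 s = (1 - \<alpha> * s) * h1 s" by (simp add: h2_def h1_def power2_eq_square algebra_simps)
    thus "h2 s * s + h1 s \<le> 0" using \<alpha>s(1) h1p[of s] by (simp add: mult_nonpos_nonneg)
    show "h1 s \<le> 1" using h1le s0 by simp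
    fix q2 y2 assume q2: "q2 \<in> ?Q" "y2 \<in> Slab" "f q2 = Th b y2"
    hence x2: "snd cs q2 \<in> U'" "dist y0 (hor (?F0 (snd cs q2))) < r/2" "q2 \<in> fst cs" by auto
    have "snd cs q2 \<in> pdom b cs d" using x2(1) U'(2) by (auto simp: U0_def)
    hence "f q2 = Th b (?F0 (snd cs q2))" "?F0 (snd cs q2) \<in> Slab"
     using F0S[of "snd cs q2"] chart_inv_snd[OF S_mfd cs(1) x2(3)] by auto
    hence y2F: "y2 = ?F0 (snd cs q2)" using q2 b by (metis co_Th)
    hence y2: "y2 = pt (hor y2) (z (hor y2))" using kF[OF x2(1)] by (simp add: z_def)
    have "\<Psi> xm \<le> \<Psi> (hor y2)" using x2(2) y2F by (intro xm(2)) auto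
    thus "Phi h y1 (pt xm (z xm)) \<le> Phi h y1 y2" unfolding \<Psi>_def y2[symmetric] .
   qed (use s0 h1p h1s z(1)[OF xW] in \<open>auto simp: s_def\<close>)
  qed
  obtain xm where xm: "dist y0 xm \<le> r/2" "\<And>x. dist y0 x \<le> r/2 \<Longrightarrow> \<Psi> xm \<le> \<Psi> x"
   using continuous_attains_inf[OF compact_cball _ cont\<Psi>] r by auto
  have sph: "dist y0 xm = r/2" using no_min[of xm] xm by force
  have "\<Psi> xm \<noteq> \<Psi> y0" using no_min[of y0] xm(2) r by force
  hence lt: "\<Psi> xm < \<Psi> y0" using xm(2)[of y0] r by force
  have dsq0: "dsq y1 (pt x 0) = (dist y1 x)\<^sup>2" for x by (simp add: dsq_def L_0 dist_norm norm_minus_commute dot_square_norm)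
  have \<Psi>y0: "\<Psi> y0 = h (r\<^sup>2)" by (simp add: \<Psi>_def y0'(2) Phi_def dsq0 y10)
  have xW: "xm \<in> W" using xm(1) BW by auto
  show False
  proof (cases "dist y1 xm \<le> r")
   case True
   hence "\<kappa> \<le> z xm" using \<kappa>(2) sph by simp
   hence "\<kappa> / 2 \<le> z xm - K0 / 2 * (z xm)\<^sup>2" using height_bounds[OF z(1,2)[OF xW]] by simp
   moreover have "- \<eta> \<le> h (dsq y1 (pt xm (z xm)))" using h_bounds dsq_nonneg by blast
   moreover have "h (r\<^sup>2) \<le> 0" using h_bounds by simp
   moreover have "z xm - K0 / 2 * (z xm)\<^sup>2 + h (dsq y1 (pt xm (z xm))) < h (r\<^sup>2)"
    using lt unfolding \<Psi>y0 by (simp add: \<Psi>_def Phi_def)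
   ultimately show False using \<eta>(3) \<kappa>(1) by linarith
  next
   case False
   hence "xm \<noteq> y1" using r by auto
   have "Phi h y1 (pt xm 0) \<le> \<Psi> xm"
   proof (cases "z xm = 0")
    case False
    hence "0 < z xm" using z(1)[OF xW] by simp
    from Phi_vertical_mono[OF dh(1) \<open>xm \<noteq> y1\<close> _ this z(2)[OF xW]] h1p h1s
    show ?thesis unfolding \<Psi>_def by (auto intro: less_imp_le)
   qed (simp add: \<Psi>_def)
   moreover have "h (r\<^sup>2) \<le> h ((dist y1 xm)\<^sup>2)" using False r by (intro h_mono power_mono) auto
   ultimately show False using lt unfolding \<Psi>y0 by (simp add: Phi_def dsq0)
  qed
 qed
 let ?U3 = "{x \<in> U'. hor (?F0 x) \<in> ball x0 (r0/4)}"
 show ?thesis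
 proof (intro exI[of _ "{p \<in> fst cs. snd cs p \<in> ?U3}"] conjI ballI)
  show "openin (pts S) {p \<in> fst cs. snd cs p \<in> ?U3}" by (rule chart_preimage_open[OF S_mfd cs(1) oU'])
  show "q \<in> {p \<in> fst cs. snd cs p \<in> ?U3}" using cs U'(3) F0u r0 by (simp add: x0_def flip: u_def)
  fix q' assume q': "q' \<in> {p \<in> fst cs. snd cs p \<in> ?U3}"
  hence x: "snd cs q' \<in> U'" "dist x0 (hor (?F0 (snd cs q'))) < r0/4" "q' \<in> fst cs" by auto
  hence "?F0 (snd cs q') $ 3 = 0" using flat[OF x(2)] kF[OF x(1)] by (simp add: z_def)
  moreover have "f q' = Th b (?F0 (snd cs q'))"
   using F0S(2)[of "snd cs q'"] x U'(2) chart_inv_snd[OF S_mfd cs(1) x(3)] by (auto simp: U0_def)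
  ultimately show "\<exists>y'. f q' = Th b y' \<and> y' $ 3 = 0" by blast
 qed
qed

lemma vertical_unit_normal:
 assumes a: "a \<in> carrier X" "cs \<in> charts S" "d \<in> C" and q: "q \<in> fst cs" "f q \<in> fst d" "f q = Th a y" "y \<in> Slab"
  and flat: "\<And>v. fder (param a cs) (snd cs q) v $ 3 = 0"
 shows "unit_normal_at X f cs d q (vert d (f q))"
proof -
 note uD = param_at(1)[OF a(1,2) q] and pq = param_at(2)[OF a(1,2) q]
 note ax = frm_axis_3
 have "unit_normal (metric X d) (local_rep cs d f) (snd cs q)
   (fder (Thc a d) (param a cs (snd cs q)) (axis 3 1))" unfolding unit_normal_iff[OF surface_adapted[OF a] uD] ax
  using flat by (simp add: inner_axis frm_def)
 thus ?thesis using frechet_Th[OF a(1,3), of y "axis 3 1"] q by (simp add: unit_normal_at_def pq ax)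
qed

theorem halfspace:
 assumes proper: "proper_map (pts S) T f" and a: "a \<in> carrier X"
  and disj: "\<And>q x. q \<in> SS \<Longrightarrow> f q \<noteq> Th a (pt x 0)"
  and p1: "p1 \<in> SS" "f p1 = Th a y1" "0 < y1 $ 3" "y1 $ 3 < eps"
  and sgn: "\<And>q y. q \<in> SS \<Longrightarrow> f q = Th a y \<Longrightarrow> y \<in> Slab \<Longrightarrow> 0 < y $ 3 \<Longrightarrow>
    (\<And>t. 0 \<le> t \<Longrightarrow> t < y $ 3 \<Longrightarrow> Th a (pt (hor y) t) \<notin> f ` SS) \<Longrightarrow> good q"
  and sgn_near: "\<And>q y. q \<in> SS \<Longrightarrow> f q = Th a y \<Longrightarrow> y \<in> Slab \<Longrightarrow> 0 < y $ 3 \<Longrightarrow>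
    (\<And>t. 0 \<le> t \<Longrightarrow> t < y $ 3 \<Longrightarrow> Th a (pt (hor y) t) \<notin> f ` SS) \<Longrightarrow>
    (\<And>cs d. cs \<in> charts S \<Longrightarrow> d \<in> C \<Longrightarrow> q \<in> fst cs \<Longrightarrow> f q \<in> fst d \<Longrightarrow>
      unit_normal_at X f cs d q (vert d (f q))) \<Longrightarrow>
    \<exists>Q. openin (pts S) Q \<and> q \<in> Q \<and> (\<forall>q'\<in>Q. good q')"
 obtains \<delta> where "0 < \<delta>" "\<delta> < eps" "\<And>q. q \<in> SS \<Longrightarrow> \<exists>x. f q = Th a (pt x \<delta>)"
proof -
 obtain q0 y0 where q0: "q0 \<in> SS" "f q0 = Th a y0" "0 < y0 $ 3" "y0 $ 3 < eps"
  and low: "\<And>q y. q \<in> SS \<Longrightarrow> f q = Th a y \<Longrightarrow> 0 \<le> y $ 3 \<Longrightarrow> y $ 3 < y0 $ 3 \<Longrightarrow> False"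
 proof (rule minimal_height_attained[OF proper a _ p1])
  show "f q \<noteq> Th a (pt x 0)" if "q \<in> SS" for q x by (rule disj[OF that])
  show "good q" if "q \<in> SS" "f q = Th a y" "y \<in> Slab" "0 < y $ 3"
   "\<And>t. 0 \<le> t \<Longrightarrow> t < y $ 3 \<Longrightarrow> Th a (pt (hor y) t) \<notin> f ` SS" for q y by (rule sgn[OF that])
 qed (rule that)
 define \<delta> where "\<delta> = y0 $ 3"
 define Z where "Z = {q \<in> SS. \<exists>x. f q = Th a (pt x \<delta>)}"
 have goodZ: "\<exists>Q. openin (pts S) Q \<and> q \<in> Q \<and> (\<forall>q'\<in>Q. good q')" if "q \<in> Z" for q
 proof -
  obtain x where x: "q \<in> SS" "f q = Th a (pt x \<delta>)" using \<open>q \<in> Z\<close> by (auto simp: Z_def)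
  have "Th a (pt (hor (pt x \<delta>)) t) \<notin> f ` SS" if "0 \<le> t" "t < pt x \<delta> $ 3" for t
  proof
   assume "Th a (pt (hor (pt x \<delta>)) t) \<in> f ` SS"
   then obtain q' where "q' \<in> SS" "f q' = Th a (pt x t)" by auto
   from low[OF this] that show False by (simp add: \<delta>_def)
  qed
  moreover have "unit_normal_at X f cs d q (vert d (f q))"
   if ch: "cs \<in> charts S" "d \<in> C" "q \<in> fst cs" "f q \<in> fst d" for cs d
  proof (rule vertical_unit_normal[OF a ch x(2)])
   show xS: "pt x \<delta> \<in> Slab" using q0 by (simp add: Slab_def \<delta>_def)
   note uD = param_at(1)[OF a ch(1,3,4) x(2) xS] and pq = param_at(2)[OF a ch(1,3,4) x(2) xS]
   have "continuous_on (pdom a cs d) (param a cs)"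
    by (rule Ck_on_imp_continuous_on[OF adaptedD(3)[OF surface_adapted[OF a ch(1,2)] uD]])
   hence "continuous_on (pdom a cs d) (\<lambda>v. param a cs v $ 3)" by (intro continuous_intros)
   from continuous_open_preimage[OF this open_dom[OF a ch(1,2)], of "{0<..}"]
   have op: "open {v \<in> pdom a cs d. 0 < param a cs v $ 3}" by (simp add: vimage_def Int_def)
   have ge: "\<delta> \<le> param a cs v $ 3" if v: "v \<in> pdom a cs d" "0 < param a cs v $ 3" for v
    using param_in(2,3)[OF ch(1) v(1)] low[of "chart_inv cs v" "param a cs v"] v(2) by (force simp: \<delta>_def)
   show "fder (param a cs) (snd cs q) v $ 3 = 0" for v
    by (rule height_minimum_flat[OF a ch(1,2) op]) (use uD q0(3) ge in \<open>auto simp: pq \<delta>_def\<close>)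
  qed
  ultimately show ?thesis using sgn_near[OF x] q0 by (simp add: Slab_def \<delta>_def)
 qed
 have closedZ: "closedin (pts S) Z"
 proof -
  have "continuous_map (pts S) T (\<lambda>q. inv a \<otimes> f q \<otimes> c (- \<delta>))" using a topspace_T by (intro continuous_mult f_continuous) auto
  from closedin_continuous_map_preimage[OF this closed_N]
  have "closedin (pts S) {q \<in> SS. inv a \<otimes> f q \<otimes> c (- \<delta>) \<in> N}" .
  moreover have "inv a \<otimes> f q \<otimes> c (- \<delta>) \<in> N \<longleftrightarrow> (\<exists>x. f q = Th a (pt x \<delta>))" if "q \<in> SS" for q
  proof -
   have fq: "f q \<in> carrier X" using f_carrier[OF that] .
   have "inv a \<otimes> f q \<otimes> c (- \<delta>) = \<phi> x \<longleftrightarrow> f q = Th a (pt x \<delta>)" for x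
   proof
    assume *: "inv a \<otimes> f q \<otimes> c (- \<delta>) = \<phi> x"
    show "f q = Th a (pt x \<delta>)" using a fq m_assoc[of a "inv a" "f q"] by (simp add: Th_def *[symmetric] c_uminus m_assoc)
   next
    assume "f q = Th a (pt x \<delta>)"
    thus "inv a \<otimes> f q \<otimes> c (- \<delta>) = \<phi> x" using a m_assoc[of "inv a" a "\<phi> x"] by (simp add: Th_def c_uminus m_assoc)
   qed
   thus ?thesis unfolding range_\<phi>[symmetric] by auto
  qed
  ultimately show ?thesis by (simp add: Z_def cong: conj_cong)
 qed
 have openZ: "openin (pts S) Z"
 proof (subst openin_subopen, safe)
  fix q assume qZ: "q \<in> Z"
  then obtain x where x: "q \<in> SS" "f q = Th a (pt x \<delta>)" by (auto simp: Z_def)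
  obtain Q1 where Q1: "openin (pts S) Q1" "q \<in> Q1" "\<And>q'. q' \<in> Q1 \<Longrightarrow> good q'" using goodZ[OF qZ] by blast
  define b where "b = a \<otimes> c \<delta>"
  have b: "b \<in> carrier X" using a by (simp add: b_def)
  have fqb: "f q = Th b (pt (L \<delta> x) 0)" using Th_rebase_inverse[OF a, of "pt x \<delta>" \<delta>] x(2) by (simp add: b_def)
  let ?V = "Slab \<inter> {y. - \<delta> < y $ 3}"
  define Q0 where "Q0 = Q1 \<inter> {q' \<in> SS. f q' \<in> Th b ` ?V}"
  have oV: "open ?V" by (intro open_Int open_Slab open_Collect_less continuous_intros)
  have Q0: "openin (pts S) Q0" unfolding Q0_def by (intro openin_Int Q1(1) slab_open_preimage[OF b oV]) auto
  have "q \<in> Q0" using Q1(2) x(1) fqb q0 eps(1) by (auto simp: Q0_def Slab_def \<delta>_def)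
  have "0 \<le> y' $ 3" if q': "q' \<in> Q0" "y' \<in> Slab" "f q' = Th b y'" for q' y'
  proof (rule ccontr)
   assume neg: "\<not> 0 \<le> y' $ 3"
   obtain y'' where "f q' = Th b y''" "y'' \<in> ?V" using q'(1) by (auto simp: Q0_def)
   hence "y' \<in> ?V" using q' Th_inj_Slab[OF b] by (auto simp: inj_on_def)
   moreover have "f q' = Th a (pt (L (- \<delta>) (hor y')) (\<delta> + y' $ 3))"
    using q'(3) Th_rebase[OF a, of \<delta> "hor y'" "y' $ 3"] by (simp add: b_def)
   moreover have "q' \<in> SS" using q'(1) by (auto simp: Q0_def)
   ultimately show False using low[of q' "pt (L (- \<delta>) (hor y')) (\<delta> + y' $ 3)"] neg by (auto simp: \<delta>_def)
  qed
  moreover have "good q'" if "q' \<in> Q0" for q' using that Q1(3) by (simp add: Q0_def)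
  moreover have "pt (L \<delta> x) 0 $ 3 = 0" by simp
  ultimately have "\<exists>Q. openin (pts S) Q \<and> q \<in> Q \<and> (\<forall>q'\<in>Q. \<exists>y'. f q' = Th b y' \<and> y' $ 3 = 0)"
   using hopf_contact_open[OF b x(1) fqb _ Q0 \<open>q \<in> Q0\<close>] by blast
  then obtain Q where Q: "openin (pts S) Q" "q \<in> Q" "\<And>q'. q' \<in> Q \<Longrightarrow> \<exists>y'. f q' = Th b y' \<and> y' $ 3 = 0" by blast
  have "Q \<subseteq> Z"
  proof
   fix q' assume q': "q' \<in> Q"
   then obtain y' where y': "f q' = Th b y'" "y' $ 3 = 0" using Q(3) by blast
   have "f q' = Th a (pt (L (- \<delta>) (hor y')) \<delta>)" using y' Th_rebase[OF a, of \<delta> "hor y'" 0] pt_hor[of y'] by (simp add: b_def)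
   moreover have "q' \<in> SS" using q' openin_subset[OF Q(1)] by blast
   ultimately show "q' \<in> Z" by (auto simp: Z_def)
  qed
  thus "\<exists>W. openin (pts S) W \<and> q \<in> W \<and> W \<subseteq> Z" using Q by blast
 qed
 have "q0 \<in> Z" using q0(1,2) by (auto simp: Z_def \<delta>_def) (metis pt_hor)
 hence "Z = SS" using S_connected openZ closedZ by (auto simp: connected_space_clopen_in)
 thus thesis using that[of \<delta>] q0 by (auto simp: \<delta>_def[symmetric] Z_def)
qed

end

section \<open>Proper surfaces inside a plane\<close>

lemma transport_section:
 fixes Q :: "'v::real_normed_vector set" and T :: "'v \<Rightarrow> 'v \<Rightarrow> 'f \<Rightarrow> 'f"
 assumes Q: "convex Q" "bounded Q" and e: "e > 0"
  and into: "\<And>a b p. a \<in> Q \<Longrightarrow> b \<in> Q \<Longrightarrow> dist a b < e \<Longrightarrow> p \<in> Fb a \<Longrightarrow> T a b p \<in> Fb b"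
  and id: "\<And>a p. a \<in> Q \<Longrightarrow> p \<in> Fb a \<Longrightarrow> T a a p = p"
  and comp: "\<And>a b c p. a \<in> Q \<Longrightarrow> b \<in> Q \<Longrightarrow> c \<in> Q \<Longrightarrow> dist a b < e \<Longrightarrow> dist b c < e \<Longrightarrow> dist a c < e \<Longrightarrow>
    p \<in> Fb a \<Longrightarrow> T b c (T a b p) = T a c p"
  and x0: "x0 \<in> Q" "p0 \<in> Fb x0"
 shows "\<exists>s. s x0 = p0 \<and> (\<forall>y\<in>Q. s y \<in> Fb y) \<and> (\<forall>y\<in>Q. \<forall>y'\<in>Q. dist y y' < e / 2 \<longrightarrow> s y' = T y y' (s y))"
proof -
 obtain B where B: "\<And>y. y \<in> Q \<Longrightarrow> dist x0 y \<le> B" using Q(2) by (meson bounded_any_center)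
 have B0: "B \<ge> 0" using B[OF x0(1)] by simp
 obtain n :: nat where n: "2 * B / e < real n" using reals_Archimedean2 by blast
 have "0 \<le> 2 * B / e" using B0 e by simp
 hence n0: "0 < real n" using n by linarith
 have Bn: "B / n < e / 2" using n n0 e by (simp add: field_simps)
 define P where "P y k = x0 + (real k / n) *\<^sub>R (y - x0)" for y and k :: nat
 have PQ: "P y k \<in> Q" if "y \<in> Q" "k \<le> n" for y k
 proof -
  have "P y k = (1 - real k / n) *\<^sub>R x0 + (real k / n) *\<^sub>R y" by (simp add: P_def algebra_simps)
  moreover have "real k / n \<le> 1" using that(2) n0 by simp
  ultimately show ?thesis using Q(1) x0(1) that(1) by (simp add: convexD_alt)
 qed
 have d1: "dist (P y k) (P y (Suc k)) < e / 2" if "y \<in> Q" for y k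
 proof -
  have "P y (Suc k) - P y k = (1 / n) *\<^sub>R (y - x0)" by (simp add: P_def add_divide_distrib scaleR_add_left)
  moreover have "dist (P y k) (P y (Suc k)) = norm (P y (Suc k) - P y k)" by (simp add: dist_norm norm_minus_commute)
  ultimately have "dist (P y k) (P y (Suc k)) = dist x0 y / n"
   using n0 by (simp add: dist_norm norm_minus_commute divide_inverse)
  also have "\<dots> \<le> B / n" using B[OF that] n0 by (intro divide_right_mono) auto
  finally show ?thesis using Bn by linarith
 qed
 have d2: "dist (P y k) (P y' k) < e / 2" if "k \<le> n" "dist y y' < e / 2" for y y' k
 proof -
  have "P y k - P y' k = (real k / n) *\<^sub>R (y - y')" by (simp add: P_def flip: scaleR_diff_right)
  hence "dist (P y k) (P y' k) = (real k / n) * dist y y'" by (simp add: dist_norm)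
  also have "\<dots> \<le> 1 * dist y y'" using that(1) n0 by (intro mult_right_mono) auto
  finally show ?thesis using that(2) by simp
 qed
 define st where "st y = rec_nat p0 (\<lambda>k. T (P y k) (P y (Suc k)))" for y
 have st: "st y 0 = p0" "st y (Suc k) = T (P y k) (P y (Suc k)) (st y k)" for y k by (simp_all add: st_def)
 have P0: "P y 0 = x0" "P y n = y" "P x0 k = x0" for y k using n0 by (simp_all add: P_def)
 have stF: "k \<le> n \<Longrightarrow> st y k \<in> Fb (P y k)" if "y \<in> Q" for y k
 proof (induction k)
  case (Suc k)
  thus ?case using that d1[OF that, of k] e by (auto simp: st intro!: into PQ)
 qed (simp add: st P0 x0)
 have st0: "st x0 k = p0" for k by (induction k) (simp_all add: st P0 id[OF x0])
 have key: "k \<le> n \<Longrightarrow> st y' k = T (P y k) (P y' k) (st y k)" if y: "y \<in> Q" "y' \<in> Q" "dist y y' < e / 2" for y y' k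
 proof (induction k)
  case (Suc k)
  let ?a = "P y k" and ?b = "P y (Suc k)" and ?a' = "P y' k" and ?b' = "P y' (Suc k)" and ?p = "st y k"
  have k: "k \<le> n" "Suc k \<le> n" using Suc.prems by auto
  have d: "dist ?a ?b < e / 2" "dist ?a' ?b' < e / 2" "dist ?a ?a' < e / 2" "dist ?b ?b' < e / 2"
   using d1 d2[OF _ y(3)] y k by auto
  have dd: "dist ?a ?b' < e" using dist_triangle_half_l[of ?a ?a' e ?b'] d(2,3) by (simp add: dist_commute dist_triangle_half_r)
  have p: "?p \<in> Fb ?a" using stF[OF y(1) k(1)] .
  have "st y' (Suc k) = T ?a' ?b' (T ?a ?a' ?p)" using Suc.IH k by (simp add: st)
  also have "\<dots> = T ?a ?b' ?p" using d dd e p y k by (intro comp PQ) auto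
  also have "\<dots> = T ?b ?b' (T ?a ?b ?p)" using d dd e p y k by (intro comp[symmetric] PQ) auto
  finally show ?case by (simp add: st)
 qed (simp add: st P0 id[OF x0])
 show ?thesis
 proof (intro exI[of _ "\<lambda>y. st y n"] conjI ballI impI)
  show "st y n \<in> Fb y" if "y \<in> Q" for y using stF[OF that, of n] by (simp add: P0)
  show "st y' n = T y y' (st y n)" if "y \<in> Q" "y' \<in> Q" "dist y y' < e / 2" for y y'
   using key[OF that, of n] by (simp add: P0)
 qed (rule st0)
qed

locale proper_local_homeo =
 fixes S :: "'s topology" and g :: "'s \<Rightarrow> 'v::euclidean_space"
 assumes hausdorff: "Hausdorff_space S" and conn: "connected_space S" and ne: "topspace S \<noteq> {}"
  and cont: "continuous_map S euclidean g" and proper: "proper_map S euclidean g"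
  and locally: "\<And>q. q \<in> topspace S \<Longrightarrow> \<exists>Q W t. openin S Q \<and> q \<in> Q \<and> open W \<and> g ` Q \<subseteq> W \<and>
   (\<forall>q'\<in>Q. t (g q') = q') \<and> (\<forall>w\<in>W. g (t w) = w) \<and> continuous_map (top_of_set W) S t"
begin

definition section_on :: "'v set \<Rightarrow> ('v \<Rightarrow> 's) \<Rightarrow> bool" where
 "section_on U s \<longleftrightarrow> continuous_map (top_of_set U) S s \<and> (\<forall>x\<in>U. g (s x) = x)"

lemma section_on_subset: "section_on U s \<Longrightarrow> V \<subseteq> U \<Longrightarrow> section_on V s"
 using continuous_map_from_subtopology[of "top_of_set U" S s V] by (auto simp: section_on_def subtopology_subtopology Int_absorb1)

lemma section_on_in: "section_on U s \<Longrightarrow> x \<in> U \<Longrightarrow> s x \<in> topspace S" by (auto simp: section_on_def continuous_map_def)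

lemma section_unique:
 assumes s: "section_on U s" and t: "section_on U t" and U: "connected U" and x: "x \<in> U" "s x = t x" and y: "y \<in> U"
 shows "s y = t y"
proof -
 let ?E = "{x \<in> topspace (top_of_set U). s x = t x}"
 have cs: "continuous_map (top_of_set U) S s" and ct: "continuous_map (top_of_set U) S t"
  using s t by (auto simp: section_on_def)
 have "closedin (top_of_set U) ?E" by (rule closedin_continuous_maps_eq[OF hausdorff cs ct])
 moreover have "openin (top_of_set U) ?E"
 proof (subst openin_subopen, safe)
  fix z assume z: "z \<in> topspace (top_of_set U)" "s z = t z"
  obtain Q W r where Q: "openin S Q" "s z \<in> Q" "\<And>q'. q' \<in> Q \<Longrightarrow> r (g q') = q'"
   using locally[OF section_on_in[OF s, of z]] z by auto
  let ?O = "{x \<in> U. s x \<in> Q} \<inter> {x \<in> U. t x \<in> Q}"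
  have "openin (top_of_set U) ?O"
  proof (rule openin_Int)
   show "openin (top_of_set U) {x \<in> U. s x \<in> Q}" "openin (top_of_set U) {x \<in> U. t x \<in> Q}"
    using openin_continuous_map_preimage[OF cs Q(1)] openin_continuous_map_preimage[OF ct Q(1)] by simp_all
  qed
  have "s x = t x" if "x \<in> ?O" for x using that Q(3)[of "s x"] Q(3)[of "t x"] s t by (auto simp: section_on_def)
  hence "?O \<subseteq> ?E" by auto
  moreover have "z \<in> ?O" using z Q(2) by simp
  ultimately show "\<exists>V. openin (top_of_set U) V \<and> z \<in> V \<and> V \<subseteq> ?E" using \<open>openin (top_of_set U) ?O\<close> by blast
 qed
 ultimately have "?E = {} \<or> ?E = U" using U by (metis (no_types, lifting) connected_clopen)
 thus ?thesis using x y by auto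
qed

lemma evenly_covered:
 "\<exists>r>0. \<forall>p\<in>topspace S. g p \<in> ball x r \<longrightarrow> (\<exists>s. section_on (ball x r) s \<and> s (g p) = p)"
proof -
 let ?fib = "{q \<in> topspace S. g q = x}"
 have "compactin S ?fib" using proper by (simp add: proper_map_def)
 define nice where "nice Q W t \<longleftrightarrow> openin S Q \<and> open W \<and> x \<in> W \<and> (\<forall>q'\<in>Q. t (g q') = q') \<and> section_on W t" for Q W t
 define \<Q> where "\<Q> = {Q. \<exists>W t. nice Q W t}"
 have "\<exists>Q. Q \<in> \<Q> \<and> q \<in> Q" if "q \<in> ?fib" for q
 proof -
  obtain Q W t where "openin S Q" "q \<in> Q" "open W" "g ` Q \<subseteq> W"
   "\<forall>q'\<in>Q. t (g q') = q'" "\<forall>w\<in>W. g (t w) = w" "continuous_map (top_of_set W) S t" using locally[of q] \<open>q \<in> ?fib\<close> by auto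
  hence "nice Q W t" using that by (auto simp: nice_def section_on_def)
  thus ?thesis using \<open>q \<in> Q\<close> by (auto simp: \<Q>_def)
 qed
 hence "?fib \<subseteq> \<Union>\<Q>" by blast
 moreover have "\<forall>Q\<in>\<Q>. openin S Q" by (auto simp: \<Q>_def nice_def)
 ultimately obtain \<F> where \<F>: "finite \<F>" "\<F> \<subseteq> \<Q>" "?fib \<subseteq> \<Union>\<F>" using \<open>compactin S ?fib\<close> unfolding compactin_def by meson
 have "\<forall>Q\<in>\<F>. \<exists>W. \<exists>t. nice Q W t" using \<F>(2) by (auto simp: \<Q>_def)
 then obtain W where W: "\<And>Q. Q \<in> \<F> \<Longrightarrow> \<exists>t. nice Q (W Q) t" by metis
 have op: "openin S (\<Union>\<F>)" using \<F>(2) by (intro openin_Union) (auto simp: \<Q>_def nice_def)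
 hence "closedin S (topspace S - \<Union>\<F>)" by blast
 hence "closed (g ` (topspace S - \<Union>\<F>))" using proper by (simp add: proper_map_def closed_map_def)
 moreover have "open (\<Inter>Q\<in>\<F>. W Q)" using \<F>(1) W by (intro open_INT) (auto simp: nice_def)
 ultimately have "open ((\<Inter>Q\<in>\<F>. W Q) - g ` (topspace S - \<Union>\<F>))" by blast
 moreover have "x \<in> (\<Inter>Q\<in>\<F>. W Q) - g ` (topspace S - \<Union>\<F>)" using \<F>(3) W by (auto simp: nice_def)
 ultimately obtain r where r: "r > 0" "ball x r \<subseteq> (\<Inter>Q\<in>\<F>. W Q) - g ` (topspace S - \<Union>\<F>)" by (meson open_contains_ball)
 have "\<exists>s. section_on (ball x r) s \<and> s (g p) = p" if p: "p \<in> topspace S" "g p \<in> ball x r" for p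
 proof -
  have "p \<in> \<Union>\<F>" using p r(2) by blast
  then obtain Q where Q: "Q \<in> \<F>" "p \<in> Q" by blast
  obtain t where t: "nice Q (W Q) t" using W[OF Q(1)] by blast
  have "ball x r \<subseteq> W Q" using r(2) Q(1) by blast
  hence "section_on (ball x r) t" using t section_on_subset by (auto simp: nice_def)
  thus ?thesis using t Q(2) by (auto simp: nice_def)
 qed
 thus ?thesis using r(1) by blast
qed

lemma section_cball:
 assumes p: "p \<in> topspace S" "g p \<in> cball 0 R"
 shows "\<exists>s. section_on (ball 0 R) s \<and> (g p \<in> ball 0 R \<longrightarrow> s (g p) = p)"
proof -
 define ev where "ev U \<longleftrightarrow> open U \<and> (\<forall>p\<in>topspace S. g p \<in> U \<longrightarrow> (\<exists>s. section_on U s \<and> s (g p) = p))" for U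
 have "\<exists>U. ev U \<and> x \<in> U" for x
 proof -
  obtain r where "r > 0" "\<forall>p\<in>topspace S. g p \<in> ball x r \<longrightarrow> (\<exists>s. section_on (ball x r) s \<and> s (g p) = p)"
   using evenly_covered by blast
  thus ?thesis by (intro exI[of _ "ball x r"]) (simp add: ev_def)
 qed
 hence cov: "cball 0 R \<subseteq> \<Union>{U. ev U}" by blast
 have op: "open U" if "U \<in> {U. ev U}" for U using that by (simp add: ev_def)
 obtain e where e: "e > 0" "\<And>x. x \<in> cball 0 R \<Longrightarrow> \<exists>U. ev U \<and> ball x e \<subseteq> U"
  using Heine_Borel_lemma[OF compact_cball cov op] by (metis mem_Collect_eq)
 have "\<exists>s. section_on (ball (g q) e) s \<and> s (g q) = q" if q: "q \<in> topspace S" "g q \<in> cball 0 R" for q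
 proof -
  obtain U where U: "ev U" "ball (g q) e \<subseteq> U" using e(2)[OF q(2)] by blast
  hence "g q \<in> U" using e(1) by auto
  then obtain s where "section_on U s" "s (g q) = q" using U(1) q(1) by (auto simp: ev_def)
  thus ?thesis using section_on_subset U(2) by blast
 qed
 then obtain sec where sec: "\<And>q. q \<in> topspace S \<Longrightarrow> g q \<in> cball 0 R \<Longrightarrow> section_on (ball (g q) e) (sec q)"
  "\<And>q. q \<in> topspace S \<Longrightarrow> g q \<in> cball 0 R \<Longrightarrow> sec q (g q) = q" by metis
 let ?Fb = "\<lambda>a. {q \<in> topspace S. g q = a}"
 have into: "sec q b \<in> ?Fb b" if "a \<in> cball 0 R" "b \<in> cball 0 R" "dist a b < e" "q \<in> ?Fb a" for a b q
 proof -
  have s: "section_on (ball (g q) e) (sec q)" using sec(1) that by auto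
  have b: "b \<in> ball (g q) e" using that by simp
  show ?thesis using section_on_in[OF s b] s b by (auto simp: section_on_def)
 qed
 have comp: "sec (sec q b) c = sec q c" if abc: "a \<in> cball 0 R" "b \<in> cball 0 R" "c \<in> cball 0 R" "dist a b < e" "dist b c < e" "dist a c < e"
  "q \<in> ?Fb a" for a b c q
 proof -
  have q': "sec q b \<in> ?Fb b" using into abc by blast
  have s1: "section_on (ball a e) (sec q)" using sec(1)[of q] abc by simp
  have s2: "section_on (ball b e) (sec (sec q b))" using sec(1)[of "sec q b"] q' abc by simp
  have "sec (sec q b) b = sec q b" using sec(2)[of "sec q b"] q' abc by simp
  thus ?thesis
   using section_unique[OF section_on_subset[OF s2] section_on_subset[OF s1], of "ball a e \<inter> ball b e" b c] abc e(1)
   by (auto simp: convex_Int convex_connected dist_commute)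
 qed
 have "\<exists>s. s (g p) = p \<and> (\<forall>y\<in>cball 0 R. s y \<in> ?Fb y) \<and>
   (\<forall>y\<in>cball 0 R. \<forall>y'\<in>cball 0 R. dist y y' < e / 2 \<longrightarrow> s y' = sec (s y) y')"
 proof (rule transport_section[of "cball 0 R" e ?Fb "\<lambda>a b q. sec q b"])
  show "sec q a = q" if "a \<in> cball 0 R" "q \<in> ?Fb a" for a q using sec(2)[of q] that by simp
  show "sec q b \<in> ?Fb b" if "a \<in> cball 0 R" "b \<in> cball 0 R" "dist a b < e" "q \<in> ?Fb a" for a b q using into[OF that] .
  show "sec (sec q b) c = sec q c" if "a \<in> cball 0 R" "b \<in> cball 0 R" "c \<in> cball 0 R" "dist a b < e" "dist b c < e" "dist a c < e"
   "q \<in> ?Fb a" for a b c q using comp[OF that] .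
 qed (use p e(1) in auto)
 then obtain s where s: "s (g p) = p" "\<And>y. y \<in> cball 0 R \<Longrightarrow> s y \<in> ?Fb y"
  "\<And>y y'. y \<in> cball 0 R \<Longrightarrow> y' \<in> cball 0 R \<Longrightarrow> dist y y' < e / 2 \<Longrightarrow> s y' = sec (s y) y'" by blast
 have "section_on (ball 0 R) s" unfolding section_on_def
 proof (intro conjI ballI)
  show "g (s x) = x" if "x \<in> ball 0 R" for x using s(2)[of x] that by auto
  show "continuous_map (top_of_set (ball 0 R)) S s" unfolding continuous_map_openin_preimage_eq
  proof (intro conjI allI impI)
   show "s \<in> topspace (top_of_set (ball 0 R)) \<rightarrow> topspace S" using s(2) by auto
   fix O1 assume O1: "openin S O1"
   show "openin (top_of_set (ball 0 R)) (topspace (top_of_set (ball 0 R)) \<inter> s -` O1)"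
   proof (subst openin_subopen, safe)
    fix x :: 'v assume x: "x \<in> topspace (top_of_set (ball 0 R))" "s x \<in> O1"
    have sx: "s x \<in> topspace S" "g (s x) = x" "x \<in> cball 0 R" using s(2)[of x] x by auto
    have se: "section_on (ball x (e/2)) (sec (s x))"
    proof -
     have "section_on (ball x e) (sec (s x))" using sec(1)[of "s x"] sx by simp
     moreover have "ball x (e/2) \<subseteq> ball x e" using e(1) by (intro subset_ball) simp
     ultimately show ?thesis by (rule section_on_subset)
    qed
    hence "openin (top_of_set (ball x (e/2))) {y \<in> ball x (e/2). sec (s x) y \<in> O1}"
     using openin_continuous_map_preimage[OF _ O1] by (force simp: section_on_def)
    hence o: "open {y \<in> ball x (e/2). sec (s x) y \<in> O1}" using openin_open_eq[OF open_ball] by blast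
    let ?V = "{y \<in> ball x (e/2). sec (s x) y \<in> O1} \<inter> ball 0 R"
    have "openin (top_of_set (ball 0 R)) ?V" using o by (auto simp: openin_open)
    moreover have "x \<in> ?V" using x sx e(1) sec(2)[of "s x"] by auto
    moreover have "?V \<subseteq> topspace (top_of_set (ball 0 R)) \<inter> s -` O1" using s(3)[OF sx(3)] by auto
    ultimately show "\<exists>V. openin (top_of_set (ball 0 R)) V \<and> x \<in> V \<and> V \<subseteq> topspace (top_of_set (ball 0 R)) \<inter> s -` O1" by blast
   qed
  qed
 qed
 thus ?thesis using s(1) by blast
qed

lemma bij_betw: "bij_betw g (topspace S) UNIV"
proof -
 obtain p where p: "p \<in> topspace S" using ne by blast
 have "\<exists>s. section_on (ball 0 R) s \<and> s (g p) = p" if "norm (g p) < R" for R using section_cball[OF p, of R] that by auto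
 then obtain \<sigma> where \<sigma>: "\<And>R. norm (g p) < R \<Longrightarrow> section_on (ball 0 R) (\<sigma> R)" "\<And>R. norm (g p) < R \<Longrightarrow> \<sigma> R (g p) = p" by metis
 define s where "s x = \<sigma> (norm (g p) + norm x + 1) x" for x
 have s\<sigma>: "s x = \<sigma> R x" if "norm (g p) < R" "norm x < R" for x R
 proof -
  let ?R = "norm (g p) + norm x + 1"
  have R: "norm (g p) < ?R" using norm_ge_zero[of x] by linarith
  have "section_on (ball 0 R \<inter> ball 0 ?R) (\<sigma> ?R)" "section_on (ball 0 R \<inter> ball 0 ?R) (\<sigma> R)"
   by (rule section_on_subset[OF \<sigma>(1)]; use R that in simp)+
  moreover have "connected (ball 0 R \<inter> ball 0 ?R :: 'v set)" by (simp add: convex_Int convex_connected)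
  ultimately have "\<sigma> ?R x = \<sigma> R x"
  proof (rule section_unique)
   show "g p \<in> ball 0 R \<inter> ball 0 ?R" using that R by simp
   show "\<sigma> ?R (g p) = \<sigma> R (g p)" using \<sigma>(2) R that by simp
   have "norm x < ?R" using norm_ge_zero[of "g p"] by linarith
   thus "x \<in> ball 0 R \<inter> ball 0 ?R" using that by simp
  qed
  thus ?thesis by (simp add: s_def)
 qed
 have gs: "g (s x) = x" "s x \<in> topspace S" for x
 proof -
  let ?R = "norm (g p) + norm x + 1"
  have R: "norm (g p) < ?R" "norm x < ?R" using norm_ge_zero[of x] norm_ge_zero[of "g p"] by linarith+
  show "g (s x) = x" "s x \<in> topspace S"
   using section_on_in[OF \<sigma>(1)[OF R(1)], of x] \<sigma>(1)[OF R(1)] R(2) by (auto simp: section_on_def s_def)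
 qed
 have sec: "section_on (ball 0 R) s" if "norm (g p) < R" for R unfolding section_on_def
 proof (intro conjI ballI gs(1))
  have "continuous_map (top_of_set (ball 0 R)) S (\<sigma> R)" using \<sigma>(1)[OF that] by (simp add: section_on_def)
  thus "continuous_map (top_of_set (ball 0 R)) S s" by (rule continuous_map_eq) (simp add: s\<sigma>[OF that])
 qed
 have conts: "continuous_map euclidean S s" unfolding continuous_map_openin_preimage_eq
 proof (intro conjI allI impI)
  show "s \<in> topspace euclidean \<rightarrow> topspace S" using gs by auto
  fix O1 assume O1: "openin S O1"
  have "open {y \<in> ball 0 R. s y \<in> O1}" if "norm (g p) < R" for R
  proof -
   have "openin (top_of_set (ball 0 R)) {y \<in> topspace (top_of_set (ball 0 R)). s y \<in> O1}"
    by (rule openin_continuous_map_preimage[OF _ O1]) (use sec[OF that] in \<open>simp add: section_on_def\<close>)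
   thus ?thesis by (simp add: openin_open_eq)
  qed
  hence "open (\<Union>R\<in>{norm (g p)<..}. {y \<in> ball 0 R. s y \<in> O1})" by (intro open_UN) auto
  moreover have "(\<Union>R\<in>{norm (g p)<..}. {y \<in> ball 0 R. s y \<in> O1}) = topspace euclidean \<inter> s -` O1"
  proof (intro subset_antisym subsetI)
   fix y assume "y \<in> topspace euclidean \<inter> s -` O1"
   moreover have "norm (g p) < norm (g p) + norm y + 1" "norm y < norm (g p) + norm y + 1"
    using norm_ge_zero[of y] norm_ge_zero[of "g p"] by linarith+
   ultimately show "y \<in> (\<Union>R\<in>{norm (g p)<..}. {y \<in> ball 0 R. s y \<in> O1})" by (intro UN_I[of "norm (g p) + norm y + 1"]) auto
  qed auto
  ultimately show "openin euclidean (topspace euclidean \<inter> s -` O1)" by simp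
 qed
 let ?E = "{q \<in> topspace S. s (g q) = q}"
 have "closedin S ?E"
  using closedin_continuous_maps_eq[OF hausdorff continuous_map_compose[OF cont conts, unfolded o_def] continuous_map_id[unfolded id_def]]
  by simp
 moreover have "openin S ?E"
 proof (subst openin_subopen, safe)
  fix q assume q: "q \<in> topspace S" "s (g q) = q"
  obtain Q W t where Q: "openin S Q" "q \<in> Q" "open W" "g ` Q \<subseteq> W"
   "\<forall>q'\<in>Q. t (g q') = q'" "\<forall>w\<in>W. g (t w) = w" "continuous_map (top_of_set W) S t" using locally[OF q(1)] by blast
  have "g q \<in> W" using Q(2,4) by blast
  then obtain r where r: "r > 0" "ball (g q) r \<subseteq> W" using Q(3) by (meson open_contains_ball)
  have "section_on W t" using Q(6,7) by (simp add: section_on_def)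
  hence t: "section_on (ball (g q) r) t" using r(2) by (rule section_on_subset)
  have s: "section_on (ball (g q) r) s" using conts gs by (simp add: section_on_def continuous_map_from_subtopology)
  let ?V = "Q \<inter> {q' \<in> topspace S. g q' \<in> ball (g q) r}"
  have "openin S ?V" by (intro openin_Int Q(1) openin_continuous_map_preimage[OF cont]) simp
  moreover have "q \<in> ?V" using q Q(2) r(1) by simp
  moreover have "?V \<subseteq> ?E"
  proof
   fix q' assume q': "q' \<in> ?V"
   have "s (g q') = t (g q')"
   proof (rule section_unique[OF s t connected_ball])
    show "g q \<in> ball (g q) r" using r(1) by simp
    show "s (g q) = t (g q)" using q(2) Q(2,5) by simp
    show "g q' \<in> ball (g q) r" using q' by blast
   qed
   thus "q' \<in> ?E" using q' Q(5) by auto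
  qed
  ultimately show "\<exists>V. openin S V \<and> q \<in> V \<and> V \<subseteq> ?E" by blast
 qed
 moreover have "p \<in> ?E" using p \<sigma>(2) s\<sigma>[of "norm (g p) + 1" "g p"] by simp
 ultimately have "?E = topspace S" using conn by (auto simp: connected_space_clopen_in)
 hence "s (g q) = q" if "q \<in> topspace S" for q using that by blast
 thus ?thesis using gs by (intro bij_betw_byWitness[of _ s]) auto
qed

end

context frame_surface
begin

text \<open>A surface inside a plane covers it, hence is embedded onto it because the plane is simply connected.\<close>

lemma surface_in_plane:
 assumes proper: "proper_map (pts S) T f" and a: "a \<in> carrier X" and \<delta>: "\<bar>\<delta>\<bar> < eps"
  and pl: "\<And>q. q \<in> SS \<Longrightarrow> \<exists>x. f q = Th a (pt x \<delta>)"
 shows "inj_on f SS" "f ` SS = Th a ` {y. y $ 3 = \<delta>}"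
proof -
 define g where "g q = hor (co a (f q))" for q
 let ?P = "\<lambda>x. Th a (pt x \<delta>)"
 have S: "pt x \<delta> \<in> Slab" for x using \<delta> by (simp add: Slab_def)
 have fq: "f q = ?P (g q)" if "q \<in> SS" for q
 proof -
  obtain x where "f q = ?P x" using pl[OF \<open>q \<in> SS\<close>] by blast
  thus ?thesis using a S by (simp add: g_def)
 qed
 have Pinj: "x = x'" if "?P x = ?P x'" for x x' using Th_eq_plane(2)[OF a that] by (metis hor_pt pt_nth(3))
 have Pcont: "continuous_map euclidean T ?P"
 proof -
  have "continuous_on UNIV (\<lambda>x. pt x \<delta>)"
   by (subst pt_add_axis) (intro continuous_intros linear_continuous_on bounded_linear_pt0)
  hence "continuous_map euclidean euclidean (\<lambda>x. pt x \<delta>)" by simp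
  from continuous_map_compose[OF this Th_continuous[OF a]] show ?thesis by (simp add: o_def)
 qed
 have "proper_local_homeo (pts S) g"
 proof
  show "Hausdorff_space (pts S)" using S_mfd by (simp add: smooth_manifold_def)
  show "connected_space (pts S)" "SS \<noteq> {}" by (rule S_connected S_nonempty)+
  have "f \<in> SS \<rightarrow> Th a ` Slab" using fq S by auto
  hence "continuous_map (pts S) (subtopology T (Th a ` Slab)) f"
   using f_continuous by (auto simp: continuous_map_in_subtopology)
  from continuous_map_compose[OF this co_continuous[OF a]]
  have "continuous_map (pts S) euclidean (\<lambda>q. co a (f q))" by (simp add: o_def)
  from continuous_map_compose[OF this, of euclidean hor]
  show "continuous_map (pts S) euclidean g" by (simp add: g_def[abs_def] o_def linear_continuous_on bounded_linear_hor)
  show "proper_map (pts S) euclidean g" unfolding proper_map_def closed_map_def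
  proof (intro conjI allI impI ballI)
   fix Z assume Z: "closedin (pts S) Z"
   hence "closedin T (f ` Z)" using proper by (simp add: proper_map_def closed_map_def)
   from closedin_continuous_map_preimage[OF Pcont this]
   have "closed {x. ?P x \<in> f ` Z}" by simp
   moreover have "{x. ?P x \<in> f ` Z} = g ` Z"
   proof (intro subset_antisym subsetI)
    fix x assume "x \<in> {x. ?P x \<in> f ` Z}"
    then obtain q where q: "q \<in> Z" "?P x = f q" by auto
    have "q \<in> SS" using q(1) closedin_subset[OF Z] by blast
    hence "x = g q" using q(2) fq Pinj by metis
    thus "x \<in> g ` Z" using q(1) by blast
   next
    fix x assume "x \<in> g ` Z"
    then obtain q where q: "q \<in> Z" "x = g q" by auto
    have "q \<in> SS" using q(1) closedin_subset[OF Z] by blast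
    hence "?P x = f q" using fq q(2) by simp
    thus "x \<in> {x. ?P x \<in> f ` Z}" using q(1) by blast
   qed
   ultimately show "closedin euclidean (g ` Z)" by simp
  next
   fix x :: "real ^ 2"
   have "?P x \<in> topspace T" using Pcont by (auto simp: continuous_map_def)
   hence "compactin (pts S) {q \<in> SS. f q = ?P x}" using proper by (simp add: proper_map_def)
   moreover have "{q \<in> SS. f q = ?P x} = {q \<in> SS. g q = x}" using fq Pinj by metis
   ultimately show "compactin (pts S) {q \<in> SS. g q = x}" by simp
  qed
  fix q assume q: "q \<in> SS"
  obtain cs d where cs: "cs \<in> charts S" "q \<in> fst cs" and d: "d \<in> C" "f q \<in> fst d" by (rule charts_at[OF q])
  define u where "u = snd cs q"
  have qu: "chart_inv cs u = q" using chart_inv_snd[OF S_mfd cs] by (simp add: u_def)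
  have uD: "u \<in> pdom a cs d" using cs d fq[OF q] S qu by (auto simp: pdom_def u_def)
  note inSS = param_in(3)[OF cs(1), of _ a d]
  have F0: "param a cs x = pt (g (chart_inv cs x)) \<delta>" if "x \<in> pdom a cs d" for x
   using fq[OF inSS[OF that]] a S by (simp add: param_def)
  have z: "fder (param a cs) u v $ 3 = 0" for v by (rule F0_flat[OF surface_adapted[OF a cs(1) d(1)] uD _ uD]) (simp add: F0)
  obtain U' W k where U': "open U'" "U' \<subseteq> pdom a cs d" "u \<in> U'" and W: "open W"
   and hk: "homeomorphism U' W (\<lambda>x. hor (param a cs x)) k"
  proof (rule height_derivative_injective[OF a cs(1) d(1) uD z open_dom[OF a cs(1) d(1)] uD])
  qed blast
  have kW: "k w \<in> U'" "g (chart_inv cs (k w)) = w" if "w \<in> W" for w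
  proof -
   show "k w \<in> U'" using hk that by (auto simp: homeomorphism_def)
   hence "hor (param a cs (k w)) = g (chart_inv cs (k w))" using F0[of "k w"] U'(2) by auto
   thus "g (chart_inv cs (k w)) = w" using hk that by (simp add: homeomorphism_def)
  qed
  have gU: "g (chart_inv cs x) \<in> W" "k (g (chart_inv cs x)) = x" if "x \<in> U'" for x
  proof -
   have e: "g (chart_inv cs x) = hor (param a cs x)" using F0[of x] U'(2) that by auto
   show "g (chart_inv cs x) \<in> W" "k (g (chart_inv cs x)) = x" unfolding e using hk that by (auto simp: homeomorphism_def)
  qed
  let ?Q = "{p \<in> fst cs. snd cs p \<in> U'}"
  let ?t = "\<lambda>w. chart_inv cs (k w)"
  have Uim: "U' \<subseteq> snd cs ` fst cs" using U'(2) by (auto simp: pdom_def)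
  have Qc: "snd cs p \<in> U'" "chart_inv cs (snd cs p) = p" if "p \<in> ?Q" for p using that chart_inv_snd[OF S_mfd cs(1)] by auto
  have 1: "openin (pts S) ?Q" by (rule chart_preimage_open[OF S_mfd cs(1) U'(1)])
  have 2: "q \<in> ?Q" using cs(2) U'(3) by (simp add: u_def)
  have 3: "g ` ?Q \<subseteq> W"
  proof (rule image_subsetI)
   fix p assume "p \<in> ?Q"
   from gU(1)[OF Qc(1)[OF this]] Qc(2)[OF this] show "g p \<in> W" by simp
  qed
  have 4: "?t (g p) = p" if "p \<in> ?Q" for p using gU(2)[OF Qc(1)[OF that]] Qc(2)[OF that] by simp
  have 5: "continuous_map (top_of_set W) (pts S) ?t"
  proof -
   have "continuous_on W k" "k ` W \<subseteq> snd cs ` fst cs" using hk Uim by (auto simp: homeomorphism_def)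
   hence "continuous_map (top_of_set W) (top_of_set (snd cs ` fst cs)) k" by auto
   from continuous_map_compose[OF this chart_inv_continuous[OF S_mfd cs(1)]] show ?thesis by (simp add: o_def)
  qed
  show "\<exists>Q W t. openin (pts S) Q \<and> q \<in> Q \<and> open W \<and> g ` Q \<subseteq> W \<and>
   (\<forall>q'\<in>Q. t (g q') = q') \<and> (\<forall>w\<in>W. g (t w) = w) \<and> continuous_map (top_of_set W) (pts S) t"
   by (rule exI[of _ ?Q], rule exI[of _ W], rule exI[of _ ?t]) (use 1 2 3 4 5 W kW(2) in blast)
 qed
 hence bij: "bij_betw g SS UNIV" by (rule proper_local_homeo.bij_betw)
 show "inj_on f SS"
 proof (rule inj_onI)
  fix q q' assume "q \<in> SS" "q' \<in> SS" "f q = f q'"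
  moreover hence "g q = g q'" by (simp add: g_def)
  ultimately show "q = q'" using bij by (auto simp: bij_betw_def inj_on_def)
 qed
 show "f ` SS = Th a ` {y. y $ 3 = \<delta>}"
 proof (intro subset_antisym subsetI)
  fix p assume "p \<in> f ` SS"
  then obtain q where "q \<in> SS" "p = f q" by blast
  hence "p = Th a (pt (g q) \<delta>)" using fq by simp
  thus "p \<in> Th a ` {y. y $ 3 = \<delta>}" by auto
 next
  fix p assume "p \<in> Th a ` {y. y $ 3 = \<delta>}"
  then obtain y where y: "p = Th a y" "y $ 3 = \<delta>" by blast
  obtain q where q: "q \<in> SS" "g q = hor y" using bij by (metis UNIV_I bij_betw_imp_surj_on imageE)
  have "p = f q" using fq[OF q(1)] q(2) y pt_hor[of y] by simp
  thus "p \<in> f ` SS" using q(1) by blast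
 qed
qed

end

section \<open>Separation by an embedded surface\<close>

lemma pathin_join:
 assumes "pathin X g1" "pathin X g2" "g2 0 = g1 1"
 shows "pathin X (\<lambda>x. if x \<le> 1/2 then g1 (2 * x) else g2 (2 * x - 1))"
proof -
 let ?T01 = "top_of_set {0..1::real}"
 have g: "continuous_map ?T01 X g1" "continuous_map ?T01 X g2" using assms by (auto simp: pathin_def)
 have "continuous_map ?T01 X (\<lambda>x. if x \<le> 1/2 then (g1 \<circ> (\<lambda>t. 2 * t)) x else (g2 \<circ> (\<lambda>t. 2 * t - 1)) x)"
 proof (intro continuous_map_cases_le continuous_map_compose, force, force)
  show "continuous_map (subtopology ?T01 {x \<in> topspace ?T01. x \<le> 1/2}) ?T01 ((*) 2)"
   by (auto simp: continuous_map_in_subtopology continuous_map_from_subtopology)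
  have "continuous_map (subtopology ?T01 {x. 0 \<le> x \<and> x \<le> 1 \<and> 1 \<le> x * 2}) euclideanreal (\<lambda>t. 2 * t - 1)"
   by (intro continuous_intros) (force intro: continuous_map_from_subtopology)
  thus "continuous_map (subtopology ?T01 {x \<in> topspace ?T01. 1/2 \<le> x}) ?T01 (\<lambda>t. 2 * t - 1)"
   by (force simp: continuous_map_in_subtopology)
  show "(g1 \<circ> (*) 2) x = (g2 \<circ> (\<lambda>t. 2 * t - 1)) x" if "x \<in> topspace ?T01" "x = 1/2" for x
   using that by (simp add: assms(3) mult.commute)
 qed (auto simp: g)
 thus ?thesis by (simp only: pathin_def o_def)
qed

definition locally_const :: "'v::metric_space set \<Rightarrow> ('v \<Rightarrow> int) \<Rightarrow> 'v \<Rightarrow> bool" where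
 "locally_const A u z \<longleftrightarrow> (\<exists>d>0. \<forall>y\<in>A. dist y z < d \<longrightarrow> u y = u z)"

lemma locally_const_subset: "locally_const A u z \<Longrightarrow> B \<subseteq> A \<Longrightarrow> locally_const B u z" unfolding locally_const_def by blast

lemma locally_const_isometry:
 assumes "locally_const A u (g z)" "g ` B \<subseteq> A" "\<And>y. dist (g y) (g z) = dist y z"
 shows "locally_const B (\<lambda>y. u (g y)) z" using assms unfolding locally_const_def by (metis image_subset_iff)

lemma locally_const_combine:
 assumes "locally_const A u z" "locally_const A v z" "\<And>y. y \<in> A \<Longrightarrow> u y = u z \<Longrightarrow> v y = v z \<Longrightarrow> w y = w z"
 shows "locally_const A w z"
proof -
 obtain d1 where d1: "d1 > 0" "\<And>y. y \<in> A \<Longrightarrow> dist y z < d1 \<Longrightarrow> u y = u z" using assms(1) unfolding locally_const_def by blast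
 obtain d2 where d2: "d2 > 0" "\<And>y. y \<in> A \<Longrightarrow> dist y z < d2 \<Longrightarrow> v y = v z" using assms(2) unfolding locally_const_def by blast
 show ?thesis unfolding locally_const_def by (rule exI[of _ "min d1 d2"]) (use d1 d2 assms(3) in auto)
qed

lemma locally_const_connected:
 assumes "connected A" "\<And>z. z \<in> A \<Longrightarrow> locally_const A u z" "x \<in> A" "y \<in> A"
 shows "u x = u y"
proof (rule connected_local_const[OF assms(1,3,4)], rule ballI)
 fix a assume "a \<in> A"
 then obtain d where "d > 0" "\<And>y. y \<in> A \<Longrightarrow> dist y a < d \<Longrightarrow> u y = u a" using assms(2) unfolding locally_const_def by blast
 thus "\<forall>\<^sub>F b in at a within A. u a = u b" unfolding eventually_at by metis
qed

lemma continuous_map_nbhd: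
 assumes h: "continuous_map (top_of_set A) T h" and z: "z \<in> A" "h z \<in> V" and V: "openin T V"
 shows "\<exists>d>0. \<forall>y\<in>A. dist y z < d \<longrightarrow> h y \<in> V"
proof -
 have "openin (top_of_set A) {y \<in> A. h y \<in> V}" using openin_continuous_map_preimage[OF h V] by simp
 hence "\<exists>d>0. \<forall>y\<in>A. dist y z < d \<longrightarrow> y \<in> {y \<in> A. h y \<in> V}" using z unfolding openin_euclidean_subtopology_iff by blast
 thus ?thesis by blast
qed

text \<open>A family of integer functions on the sets of an open cover which differ by locally constant functions
 is a principal bundle with discrete structure group; it has no monodromy around null-homotopic loops.\<close>

lemma monodromy_trivial:
 fixes \<W> :: "('a set \<times> ('a \<Rightarrow> int)) set" and s :: "real \<Rightarrow> int"
 assumes sc: "simply_connected_space T"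
  and opn: "\<And>W \<sigma>. (W, \<sigma>) \<in> \<W> \<Longrightarrow> openin T W"
  and cover: "\<And>x. x \<in> topspace T \<Longrightarrow> \<exists>W \<sigma>. (W, \<sigma>) \<in> \<W> \<and> x \<in> W"
  and coh: "\<And>W \<sigma> W' \<sigma>' x. (W, \<sigma>) \<in> \<W> \<Longrightarrow> (W', \<sigma>') \<in> \<W> \<Longrightarrow> x \<in> W \<Longrightarrow> x \<in> W' \<Longrightarrow>
    \<exists>V. openin T V \<and> x \<in> V \<and> (\<forall>y\<in>V. \<sigma> y - \<sigma>' y = \<sigma> x - \<sigma>' x)"
  and \<gamma>: "pathin T \<gamma>" "\<gamma> 1 = \<gamma> 0"
  and s: "\<And>t. t \<in> {0..1} \<Longrightarrow> \<exists>W \<sigma>. (W, \<sigma>) \<in> \<W> \<and> \<gamma> t \<in> W \<and> locally_const {0..1} (\<lambda>t. s t - \<sigma> (\<gamma> t)) t"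
 shows "s 1 = s 0"
proof -
 have \<gamma>0: "\<gamma> 0 \<in> topspace T" using \<gamma>(1) by (auto simp: pathin_def continuous_map_def)
 hence "pathin T (\<lambda>_. \<gamma> 0)" by simp
 hence "homotopic_with (\<lambda>r. r 1 = r 0) (top_of_set {0..1::real}) T \<gamma> (\<lambda>_. \<gamma> 0)"
  using sc \<gamma> unfolding simply_connected_space_def by blast
 then obtain h where h0: "continuous_map (prod_topology (top_of_set {0..1::real}) (top_of_set {0..1::real})) T h"
  and h: "\<And>x. h (0, x) = \<gamma> x" "\<And>x. h (1, x) = \<gamma> 0" "\<And>t. t \<in> {0..1} \<Longrightarrow> h (t, 1) = h (t, 0)"
  unfolding homotopic_with_def by blast
 define Q where "Q = {0..1::real} \<times> {0..1::real}"
 have hc: "continuous_map (top_of_set Q) T h"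
  using h0 by (simp add: Q_def prod_topology_subtopology subtopology_Times subtopology_subtopology Times_Int_Times flip: euclidean_product_topology)
 have hT: "h z \<in> topspace T" if "z \<in> Q" for z using hc that by (auto simp: continuous_map_def)
 have lcoh: "locally_const Q (\<lambda>y. \<sigma> (h y) - \<sigma>' (h y)) z"
  if "(W, \<sigma>) \<in> \<W>" "(W', \<sigma>') \<in> \<W>" "z \<in> Q" "h z \<in> W" "h z \<in> W'" for W \<sigma> W' \<sigma>' z
 proof -
  note * = that
  obtain V where V: "openin T V" "h z \<in> V" "\<forall>y\<in>V. \<sigma> y - \<sigma>' y = \<sigma> (h z) - \<sigma>' (h z)" using coh[OF *(1,2,4,5)] by blast
  obtain d where "d > 0" "\<And>y. y \<in> Q \<Longrightarrow> dist y z < d \<Longrightarrow> h y \<in> V" using continuous_map_nbhd[OF hc *(3) V(2,1)] by blast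
  thus ?thesis using V(3) unfolding locally_const_def by blast
 qed
 define ev where "ev U \<longleftrightarrow> open U \<and> (\<exists>W \<sigma>. (W, \<sigma>) \<in> \<W> \<and> (\<forall>y\<in>U \<inter> Q. h y \<in> W))" for U
 have cov: "Q \<subseteq> \<Union>{U. ev U}"
 proof
  fix z assume z: "z \<in> Q"
  obtain W \<sigma> where W: "(W, \<sigma>) \<in> \<W>" "h z \<in> W" using cover[OF hT[OF z]] by blast
  obtain d where "d > 0" "\<And>y. y \<in> Q \<Longrightarrow> dist y z < d \<Longrightarrow> h y \<in> W" using continuous_map_nbhd[OF hc z W(2) opn[OF W(1)]] by blast
  hence "ev (ball z d)" "z \<in> ball z d" using W(1) by (auto simp: ev_def dist_commute)
  thus "z \<in> \<Union>{U. ev U}" by blast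
 qed
 have op: "open U" if "U \<in> {U. ev U}" for U using that by (simp add: ev_def)
 have cQ: "compact Q" "convex Q" "bounded Q" by (auto simp: Q_def compact_Times convex_Times bounded_Times)
 obtain e where e: "e > 0" "\<And>x. x \<in> Q \<Longrightarrow> \<exists>U\<in>{U. ev U}. ball x e \<subseteq> U" using Heine_Borel_lemma[OF cQ(1) cov op] by blast
 have "\<exists>W \<sigma>. (W, \<sigma>) \<in> \<W> \<and> (\<forall>y\<in>ball x e \<inter> Q. h y \<in> W)" if "x \<in> Q" for x using e(2)[OF that] unfolding ev_def by blast
 then obtain W \<sigma> where W: "\<And>x. x \<in> Q \<Longrightarrow> (W x, \<sigma> x) \<in> \<W>" "\<And>x y. x \<in> Q \<Longrightarrow> y \<in> Q \<Longrightarrow> dist x y < e \<Longrightarrow> h y \<in> W x"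
  by (metis IntI mem_ball)
 define D where "D a b = \<sigma> a (h b) - \<sigma> a (h a)" for a b
 have coc: "D a b + D b c = D a c" if abc: "a \<in> Q" "b \<in> Q" "c \<in> Q" "dist a b < e" "dist b c < e" "dist a c < e" for a b c
 proof -
  let ?A = "ball a e \<inter> ball b e \<inter> Q"
  have "\<sigma> a (h b) - \<sigma> b (h b) = \<sigma> a (h c) - \<sigma> b (h c)"
  proof (rule locally_const_connected[of ?A])
   show "connected ?A" using cQ(2) by (intro convex_connected convex_Int) auto
   show "locally_const ?A (\<lambda>y. \<sigma> a (h y) - \<sigma> b (h y)) z" if "z \<in> ?A" for z
    by (rule locally_const_subset[OF lcoh[OF W(1)[OF abc(1)] W(1)[OF abc(2)]]]) (use that W(2) abc in auto)
  qed (use abc e(1) in auto)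
  thus ?thesis by (simp add: D_def)
 qed
 have "\<exists>\<Sigma>. \<Sigma> (0, 0) = 0 \<and> (\<forall>y\<in>Q. \<Sigma> y \<in> (UNIV :: int set)) \<and> (\<forall>y\<in>Q. \<forall>y'\<in>Q. dist y y' < e / 2 \<longrightarrow> \<Sigma> y' = \<Sigma> y + D y y')"
  by (rule transport_section[OF cQ(2,3) e(1), where Fb = "\<lambda>_. UNIV"]) (auto simp: Q_def D_def coc[unfolded D_def Q_def] add.assoc)
 then obtain \<Sigma> :: "real \<times> real \<Rightarrow> int" where \<Sigma>: "\<And>y y'. y \<in> Q \<Longrightarrow> y' \<in> Q \<Longrightarrow> dist y y' < e / 2 \<Longrightarrow> \<Sigma> y' = \<Sigma> y + D y y'" by blast
 have \<Sigma>L: "locally_const Q (\<lambda>y. \<Sigma> y - \<tau> (h y)) z" if "(V, \<tau>) \<in> \<W>" "z \<in> Q" "h z \<in> V" for V \<tau> z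
 proof -
  have hz: "h z \<in> W z" using W(2)[of z z] that e(1) by simp
  have "\<Sigma> y - \<sigma> z (h y) = \<Sigma> z - \<sigma> z (h z)" if "y \<in> Q" "dist y z < e / 2" for y
   using \<Sigma>[of z y] that \<open>z \<in> Q\<close> by (simp add: D_def dist_commute)
  hence "locally_const Q (\<lambda>y. \<Sigma> y - \<sigma> z (h y)) z" unfolding locally_const_def using e(1) by (intro exI[of _ "e/2"]) auto
  thus ?thesis by (rule locally_const_combine[OF _ lcoh[OF W(1)[OF that(2)] that(1,2) hz that(3)]]) linarith
 qed
 have slice: "locally_const {0..1} (\<lambda>t. u (t, x)) t" if "locally_const Q u (t, x)" "x \<in> {0..1}" for u and t x :: real
  using locally_const_isometry[of Q u "\<lambda>t. (t, x)" t "{0..1}"] that by (auto simp: Q_def dist_Pair_Pair image_subset_iff)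
 have slice': "locally_const {0..1} (\<lambda>x. u (t, x)) x" if "locally_const Q u (t, x)" "t \<in> {0..1}" for u and t x :: real
  using locally_const_isometry[of Q u "\<lambda>x. (t, x)" x "{0..1}"] that by (auto simp: Q_def dist_Pair_Pair image_subset_iff)
 have c01: "connected {0..1::real}" by simp
 have "\<Sigma> (0, 1) - \<Sigma> (0, 0) = \<Sigma> (1, 1) - \<Sigma> (1, 0)"
 proof (rule locally_const_connected[OF c01])
  fix t :: real assume t: "t \<in> {0..1}"
  hence z: "(t, 0) \<in> Q" "(t, 1) \<in> Q" by (auto simp: Q_def)
  obtain V \<tau> where V: "(V, \<tau>) \<in> \<W>" "h (t, 0) \<in> V" using cover[OF hT[OF z(1)]] by blast
  have "h (t, 1) \<in> V" using V(2) h(3)[OF t] by simp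
  show "locally_const {0..1} (\<lambda>t. \<Sigma> (t, 1) - \<Sigma> (t, 0)) t"
   by (rule locally_const_combine[OF slice[OF \<Sigma>L[OF V(1) z(1) V(2)]] slice[OF \<Sigma>L[OF V(1) z(2) \<open>h (t, 1) \<in> V\<close>]]])
    (use h(3) t in auto)
 qed auto
 moreover have "\<Sigma> (1, 1) = \<Sigma> (1, 0)"
 proof (rule locally_const_connected[OF c01])
  fix x :: real assume x: "x \<in> {0..1}"
  hence z: "(1, x) \<in> Q" by (auto simp: Q_def)
  obtain V \<tau> where V: "(V, \<tau>) \<in> \<W>" "h (1, x) \<in> V" using cover[OF hT[OF z]] by blast
  have l: "locally_const {0..1} (\<lambda>x. \<Sigma> (1, x) - \<tau> (h (1, x))) x" by (rule slice'[OF \<Sigma>L[OF V(1) z V(2)]]) simp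
  show "locally_const {0..1} (\<lambda>x. \<Sigma> (1, x)) x" by (rule locally_const_combine[OF l l]) (simp add: h(2))
 qed auto
 moreover have "s 1 - \<Sigma> (0, 1) = s 0 - \<Sigma> (0, 0)"
 proof (rule locally_const_connected[OF c01, of "\<lambda>x. s x - \<Sigma> (0, x)"])
  fix x :: real assume x: "x \<in> {0..1}"
  hence z: "(0, x) \<in> Q" by (auto simp: Q_def)
  obtain V \<tau> where V: "(V, \<tau>) \<in> \<W>" "\<gamma> x \<in> V" "locally_const {0..1} (\<lambda>t. s t - \<tau> (\<gamma> t)) x" using s[OF x] by blast
  have "h (0, x) \<in> V" using V(2) h(1) by simp
  hence l: "locally_const {0..1} (\<lambda>x. \<Sigma> (0, x) - \<tau> (h (0, x))) x" by (intro slice'[OF \<Sigma>L[OF V(1) z]]) auto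
  show "locally_const {0..1} (\<lambda>x. s x - \<Sigma> (0, x)) x" by (rule locally_const_combine[OF V(3) l]) (simp add: h(1))
 qed auto
 ultimately show ?thesis by simp
qed

lemma linear_vec2_zero:
 fixes D :: "real ^ 2 \<Rightarrow> 'b::real_vector"
 assumes "linear D" "D x = 0" "inj D" shows "x = 0" using assms linear_injective_0 by blast

context frame_surface
begin

lemma local_rep_derivative:
 assumes "cs \<in> charts S" "d \<in> C" "q \<in> fst cs" "f q \<in> fst d"
 shows "(local_rep cs d f has_derivative fder (local_rep cs d f) (snd cs q)) (at (snd cs q))"
  "linear (fder (local_rep cs d f) (snd cs q))" "inj (fder (local_rep cs d f) (snd cs q))"
proof -
 have "Ck_on (Suc 0) (snd cs ` {p \<in> fst cs. f p \<in> fst d}) (local_rep cs d f)"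
  using f_smooth assms unfolding smooth_map_def smooth_on_def by blast
 thus D: "(local_rep cs d f has_derivative fder (local_rep cs d f) (snd cs q)) (at (snd cs q))"
  by (rule Ck_on_SucD) (use assms in auto)
 thus "linear (fder (local_rep cs d f) (snd cs q))" by (rule has_derivative_linear)
 show "inj (fder (local_rep cs d f) (snd cs q))" using f_immersion assms unfolding immersion_def by blast
qed

lemma unit_normal_at_D:
 assumes ch: "cs \<in> charts S" "d \<in> C" "q \<in> fst cs" "f q \<in> fst d" and \<nu>: "unit_normal_at X f cs d q \<nu>"
 shows "fder (local_rep cs d f) (snd cs q) v \<bullet> (metric X d (snd d (f q)) *v \<nu>) = 0"
  "\<nu> \<bullet> (metric X d (snd d (f q)) *v \<nu>) = 1"
proof -
 have fq: "local_rep cs d f (snd cs q) = snd d (f q)" using chart_inv_snd[OF S_mfd ch(1,3)] by (simp add: local_rep_def)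
 thus "\<nu> \<bullet> (metric X d (snd d (f q)) *v \<nu>) = 1" using \<nu> by (simp add: unit_normal_at_def unit_normal_def)
 have ax: "fder (local_rep cs d f) (snd cs q) (axis a 1) \<bullet> (metric X d (snd d (f q)) *v \<nu>) = 0" for a
  using \<nu> fq by (simp add: unit_normal_at_def unit_normal_def pderiv_at_def)
 show "fder (local_rep cs d f) (snd cs q) v \<bullet> (metric X d (snd d (f q)) *v \<nu>) = 0"
  using linear_axis_expansion[OF local_rep_derivative(2)[OF ch], of v] ax by (simp add: inner_sum_left)
qed

end

locale oriented_surface = frame_surface X \<phi> c N S f
 for X :: "('a, 3) metric_group" (structure) and \<phi> c N and S :: "('s, 2) manifold" and f +
 fixes n :: "'s \<Rightarrow> ('a, 3) chart \<Rightarrow> real ^ 3"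
 assumes n: "unit_normal_field X S f n"
  and emb: "embedding_map (pts S) T f" and proper: "proper_map (pts S) T f"
begin

lemma f_inj: "inj_on f SS" using emb homeomorphic_imp_injective_map unfolding embedding_map_def by blast

lemma f_open:
 assumes "openin (pts S) Q" obtains O1 where "openin T O1" "\<And>q. q \<in> SS \<Longrightarrow> f q \<in> O1 \<longleftrightarrow> q \<in> Q"
proof -
 have "open_map (pts S) (subtopology T (f ` SS)) f" using emb homeomorphic_imp_open_map unfolding embedding_map_def by blast
 hence "openin (subtopology T (f ` SS)) (f ` Q)" using assms by (simp add: open_map_def)
 then obtain O1 where O1: "openin T O1" "f ` Q = O1 \<inter> f ` SS" by (auto simp: openin_subtopology)
 have "f q \<in> O1 \<longleftrightarrow> q \<in> Q" if "q \<in> SS" for q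
 proof
  assume "f q \<in> O1"
  hence "f q \<in> f ` Q" using O1(2) that by blast
  then obtain q' where "q' \<in> Q" "f q = f q'" by blast
  thus "q \<in> Q" using f_inj that openin_subset[OF assms] by (metis inj_onD subsetD)
 qed (use O1 in blast)
 thus thesis using that O1(1) by blast
qed

definition nray :: "('a, 3) chart \<Rightarrow> 's \<Rightarrow> real \<Rightarrow> 'a" where
 "nray d q \<tau> = chart_inv d (snd d (f q) + \<tau> *\<^sub>R n q d)"

text \<open>The curve \<open>\<omega>\<close> crosses the surface at \<open>f q\<close> to the side of the normal if \<open>\<sigma> > 0\<close>, and to the other side
 if \<open>\<sigma> < 0\<close>.\<close>

definition crosses :: "'s \<Rightarrow> (real \<Rightarrow> 'a) \<Rightarrow> real \<Rightarrow> bool" where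
 "crosses q \<omega> \<sigma> \<longleftrightarrow> \<omega> 0 = f q \<and> (\<forall>d\<in>C. f q \<in> fst d \<longrightarrow> (\<forall>\<^sub>F \<tau> in nhds 0. \<omega> \<tau> \<in> fst d) \<and>
   (\<exists>w. ((\<lambda>\<tau>. snd d (\<omega> \<tau>)) has_vector_derivative w) (at 0) \<and> 0 < \<sigma> * (w \<bullet> (metric X d (snd d (f q)) *v n q d))))"

text \<open>A flow box \<open>E\<close> straightens the surface to the plane \<open>y $ 3 = 0\<close>, with the normals pointing up.\<close>

definition flow_box :: "(real ^ 3) set \<Rightarrow> (real ^ 3 \<Rightarrow> 'a) \<Rightarrow> ('a \<Rightarrow> real ^ 3) \<Rightarrow> bool" where
 "flow_box B E K \<longleftrightarrow> open B \<and> continuous_map (top_of_set B) T E \<and> openin T (E ` B) \<and>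
   continuous_map (subtopology T (E ` B)) euclidean K \<and> (\<forall>y\<in>B. K (E y) = y) \<and>
   (\<forall>y\<in>B. E y \<in> f ` SS \<longleftrightarrow> y $ 3 = 0) \<and>
   (\<forall>q\<in>SS. f q \<in> E ` B \<longrightarrow> (\<forall>\<omega> \<sigma>. crosses q \<omega> \<sigma> \<longrightarrow>
    (\<forall>\<^sub>F \<tau> in at_right 0. \<omega> \<tau> \<in> E ` B \<and> 0 < \<sigma> * K (\<omega> \<tau>) $ 3)))"

lemma curve_eventually:
 assumes d: "d \<in> C" and \<omega>: "\<forall>\<^sub>F \<tau> in nhds 0. \<omega> \<tau> \<in> fst d" "isCont (\<lambda>\<tau>. snd d (\<omega> \<tau>)) (0 :: real)"
  and V: "openin T V" "\<omega> 0 \<in> V"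
 shows "\<forall>\<^sub>F \<tau> in nhds 0. \<omega> \<tau> \<in> V"
proof -
 let ?R = "{x \<in> snd d ` fst d. chart_inv d x \<in> V}"
 have \<omega>0: "\<omega> 0 \<in> fst d" using eventually_nhds_x_imp_x[OF \<omega>(1)] .
 have o: "open ?R" by (rule open_vimage[OF chart_open[OF mfd d] chart_inv_continuous[OF mfd d] V(1)])
 have i: "snd d (\<omega> 0) \<in> ?R" using V(2) \<omega>0 chart_inv_snd[OF mfd d] by simp
 have "((\<lambda>\<tau>. snd d (\<omega> \<tau>)) \<longlongrightarrow> snd d (\<omega> 0)) (nhds 0)"
  using \<omega>(2) tendsto_at_iff_tendsto_nhds[of "\<lambda>\<tau>. snd d (\<omega> \<tau>)" 0] by (simp add: isCont_def)
 from topological_tendstoD[OF this o i] have "\<forall>\<^sub>F \<tau> in nhds 0. snd d (\<omega> \<tau>) \<in> ?R" .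
 with \<omega>(1) show ?thesis by eventually_elim (use chart_inv_snd[OF mfd d] in auto)
qed

lemma crosses_eventually:
 assumes q: "q \<in> SS" and cr: "crosses q \<omega> \<sigma>" and V: "openin T V" "f q \<in> V"
 shows "\<forall>\<^sub>F \<tau> in at_right 0. \<omega> \<tau> \<in> V"
proof -
 obtain d where d: "d \<in> C" "f q \<in> fst d" by (rule charts_at[OF q])
 have \<omega>: "\<omega> 0 = f q" "\<forall>\<^sub>F \<tau> in nhds 0. \<omega> \<tau> \<in> fst d" using cr d unfolding crosses_def by blast+
 obtain w where "((\<lambda>\<tau>. snd d (\<omega> \<tau>)) has_vector_derivative w) (at 0)" using cr d unfolding crosses_def by blast
 hence "isCont (\<lambda>\<tau>. snd d (\<omega> \<tau>)) 0" using has_vector_derivative_continuous by blast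
 from curve_eventually[OF d(1) \<omega>(2) this V(1)] \<omega>(1) V(2) have "\<forall>\<^sub>F \<tau> in nhds 0. \<omega> \<tau> \<in> V" by simp
 thus ?thesis by (simp add: eventually_at_filter eventually_mono)
qed

lemma crossesI:
 assumes q: "q \<in> SS" and d: "d \<in> C" and \<omega>: "\<omega> 0 = f q" "\<forall>\<^sub>F \<tau> in nhds 0. \<omega> \<tau> \<in> fst d"
  "((\<lambda>\<tau>. snd d (\<omega> \<tau>)) has_vector_derivative w) (at 0)" "0 < \<sigma> * (w \<bullet> (metric X d (snd d (f q)) *v n q d))"
 shows "crosses q \<omega> \<sigma>" unfolding crosses_def
proof (intro conjI ballI impI)
 show "\<omega> 0 = f q" by fact
 have fq: "f q \<in> fst d" using eventually_nhds_x_imp_x[OF \<omega>(2)] \<omega>(1) by simp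
 fix e assume e: "e \<in> C" "f q \<in> fst e"
 have ct: "isCont (\<lambda>\<tau>. snd d (\<omega> \<tau>)) 0" using \<omega>(3) has_vector_derivative_continuous by blast
 show ev: "\<forall>\<^sub>F \<tau> in nhds 0. \<omega> \<tau> \<in> fst e"
  by (rule curve_eventually[OF d \<omega>(2) ct chart_openin[OF mfd e(1)]]) (simp add: \<omega>(1) e)
 let ?r = "local_rep d e id"
 define D where "D = fder ?r (snd d (f q))"
 have "smooth_on (snd d ` (fst d \<inter> fst e)) ?r" using mfd e(1) d unfolding smooth_manifold_def by blast
 hence "Ck_on (Suc 0) (snd d ` (fst d \<inter> fst e)) ?r" unfolding smooth_on_def by blast
 hence D: "(?r has_derivative D) (at (snd d (f q)))" unfolding D_def by (rule Ck_on_SucD) (use e(2) fq in blast)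
 have "((\<lambda>\<tau>. ?r (snd d (\<omega> \<tau>))) has_derivative (\<lambda>\<tau>. D (\<tau> *\<^sub>R w))) (at 0)"
  by (rule has_derivative_compose[OF \<omega>(3)[unfolded has_vector_derivative_def]]) (simp only: \<omega>(1) D)
 hence "((\<lambda>\<tau>. snd e (\<omega> \<tau>)) has_derivative (\<lambda>\<tau>. D (\<tau> *\<^sub>R w))) (at 0)"
 proof (rule has_derivative_transform_eventually)
  show "\<forall>\<^sub>F \<tau> in at 0. ?r (snd d (\<omega> \<tau>)) = snd e (\<omega> \<tau>)" using \<omega>(2) unfolding eventually_at_filter
   by eventually_elim (use chart_inv_snd[OF mfd d] in \<open>simp add: local_rep_def\<close>)
  show "?r (snd d (\<omega> 0)) = snd e (\<omega> 0)" using fq \<omega>(1) chart_inv_snd[OF mfd d] by (simp add: local_rep_def)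
 qed simp
 hence "((\<lambda>\<tau>. snd e (\<omega> \<tau>)) has_vector_derivative D w) (at 0)"
  by (simp add: has_vector_derivative_def linear_scale[OF has_derivative_linear[OF D]])
 moreover have "D w \<bullet> (metric X e (snd e (f q)) *v n q e) = w \<bullet> (metric X d (snd d (f q)) *v n q d)"
 proof -
  have "n q e = D (n q d)" using n e fq d q unfolding unit_normal_field_def D_def by blast
  thus ?thesis using riem d e fq unfolding riemannian_metric_def preserves_metric_def D_def by (simp add: Let_def)
 qed
 ultimately show "\<exists>w. ((\<lambda>\<tau>. snd e (\<omega> \<tau>)) has_vector_derivative w) (at 0) \<and> 0 < \<sigma> * (w \<bullet> (metric X e (snd e (f q)) *v n q e))"
  using \<omega>(4) by metis
qed

lemma normal_unit: "cs \<in> charts S \<Longrightarrow> d \<in> C \<Longrightarrow> q \<in> fst cs \<Longrightarrow> f q \<in> fst d \<Longrightarrow> unit_normal_at X f cs d q (n q d)"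
 using n unfolding unit_normal_field_def by blast

lemma
 assumes "cs \<in> charts S" "d \<in> C" "q \<in> fst cs" "f q \<in> fst d"
 shows normal_orthogonal: "fder (local_rep cs d f) (snd cs q) v \<bullet> (metric X d (snd d (f q)) *v n q d) = 0"
  and normal_norm: "n q d \<bullet> (metric X d (snd d (f q)) *v n q d) = 1"
 by (rule unit_normal_at_D[OF assms normal_unit[OF assms]])+

lemma nray_crosses:
 assumes q: "q \<in> SS" "d \<in> C" "f q \<in> fst d" and \<sigma>: "\<sigma> \<noteq> 0"
 shows "crosses q (\<lambda>\<tau>. nray d q (\<sigma> * \<tau>)) \<sigma>"
proof -
 obtain cs where cs: "cs \<in> charts S" "q \<in> fst cs" by (rule charts_at[OF q(1)])
 let ?l = "\<lambda>\<tau>. snd d (f q) + (\<sigma> * \<tau>) *\<^sub>R n q d"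
 have "open (?l -` (snd d ` fst d))"
  by (rule Topological_Spaces.open_vimage[OF chart_open[OF mfd q(2)]]) (intro continuous_intros)
 hence ev: "\<forall>\<^sub>F \<tau> in nhds 0. \<tau> \<in> ?l -` (snd d ` fst d)" using q(3) by (intro eventually_nhds_in_open) auto
 have dl: "(?l has_vector_derivative \<sigma> *\<^sub>R n q d) (at 0)"
  by (auto intro!: derivative_eq_intros simp: has_vector_derivative_def)
 show ?thesis
 proof (rule crossesI[OF q(1,2)])
  show "nray d q (\<sigma> * 0) = f q" using chart_inv_snd[OF mfd q(2,3)] by (simp add: nray_def)
  show "\<forall>\<^sub>F \<tau> in nhds 0. nray d q (\<sigma> * \<tau>) \<in> fst d" using ev by eventually_elim (auto simp: nray_def intro: chart_inv_in)
  show "((\<lambda>\<tau>. snd d (nray d q (\<sigma> * \<tau>))) has_vector_derivative \<sigma> *\<^sub>R n q d) (at 0)" unfolding has_vector_derivative_def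
  proof (rule has_derivative_transform_eventually[OF dl[unfolded has_vector_derivative_def]])
   show "\<forall>\<^sub>F \<tau> in at 0. ?l \<tau> = snd d (nray d q (\<sigma> * \<tau>))"
    using ev unfolding eventually_at_filter by eventually_elim (auto simp: nray_def snd_chart_inv)
   show "?l 0 = snd d (nray d q (\<sigma> * 0))" using q(3) by (simp add: nray_def snd_chart_inv)
  qed simp
  show "0 < \<sigma> * (\<sigma> *\<^sub>R n q d \<bullet> (metric X d (snd d (f q)) *v n q d))"
   using normal_norm[OF cs(1) q(2) cs(2) q(3)] \<sigma> not_sum_squares_lt_zero by (simp flip: power2_eq_square)
 qed
qed

lemma normal_product_continuous:
 assumes d: "d \<in> C" and R: "\<And>q. q \<in> R \<Longrightarrow> f q \<in> fst d"
  and v: "continuous_map (subtopology (pts S) R) euclidean v"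
 shows "continuous_map (subtopology (pts S) R) euclidean (\<lambda>q. v q \<bullet> (metric X d (snd d (f q)) *v n q d))"
proof -
 let ?Y = "subtopology (pts S) R"
 have "continuous_map (subtopology (pts S) {q. f q \<in> fst d}) euclidean (\<lambda>q. n q d)"
  using n d unfolding unit_normal_field_def by blast
 hence n1: "continuous_map ?Y euclidean (\<lambda>q. n q d)" by (rule continuous_map_from_subtopology_mono) (use R in blast)
 have "continuous_map ?Y (subtopology T (fst d)) f"
  using f_continuous R by (auto simp: continuous_map_in_subtopology continuous_map_from_subtopology)
 from continuous_map_compose[OF this chart_continuous[OF mfd d]]
 have "continuous_map ?Y euclidean (\<lambda>q. snd d (f q))" by (simp add: o_def)
 hence "continuous_map ?Y (top_of_set (snd d ` fst d)) (\<lambda>q. snd d (f q))"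
  using R by (auto simp: continuous_map_in_subtopology)
 moreover have "continuous_on (snd d ` fst d) (metric X d)"
  using riem d Ck_on_imp_continuous_on[of 0] unfolding riemannian_metric_def smooth_on_def by blast
 ultimately have m1: "continuous_map ?Y euclidean (\<lambda>q. metric X d (snd d (f q)))"
  using continuous_map_compose[of ?Y "top_of_set (snd d ` fst d)" "\<lambda>q. snd d (f q)" euclidean "metric X d"] by (simp add: o_def)
 have "continuous_map ?Y (prod_topology euclidean euclidean) (\<lambda>q. (metric X d (snd d (f q)), n q d))"
  using continuous_map_pairedI[OF m1 n1] .
 from continuous_map_pairedI[OF v this]
 have "continuous_map ?Y euclidean (\<lambda>q. (v q, metric X d (snd d (f q)), n q d))" by simp
 moreover have "continuous_map euclidean euclidean (\<lambda>(v, M :: real ^ 3 ^ 3, w). v \<bullet> (M *v w))"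
  unfolding matrix_vector_mult_def inner_vec_def split_def by (simp, intro continuous_intros)
 ultimately have "continuous_map ?Y euclidean ((\<lambda>(v, M, w). v \<bullet> (M *v w)) \<circ> (\<lambda>q. (v q, metric X d (snd d (f q)), n q d)))"
  by (rule continuous_map_compose)
 thus ?thesis by (simp add: o_def)
qed

lemma flow_box_exists:
 assumes p: "p \<in> SS" shows "\<exists>B E K. flow_box B E K \<and> f p \<in> E ` B"
proof -
 obtain cs d where cs: "cs \<in> charts S" "p \<in> fst cs" and d: "d \<in> C" "f p \<in> fst d" by (rule charts_at[OF p])
 let ?F = "local_rep cs d f" and ?G = "\<lambda>q. metric X d (snd d (f q))"
 define \<nu>0 where "\<nu>0 = n p d"
 define U where "U = {x \<in> snd cs ` fst cs. f (chart_inv cs x) \<in> fst d}"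
 have U: "open U" unfolding U_def
  by (rule open_vimage[OF chart_open[OF S_mfd cs(1)] f_chart_continuous[OF cs(1)] chart_openin[OF mfd d(1)]])
 have Uq: "chart_inv cs x \<in> fst cs" "f (chart_inv cs x) \<in> fst d" "snd cs (chart_inv cs x) = x" "chart_inv cs x \<in> SS" if "x \<in> U" for x
  using that chart_subset[OF S_mfd cs(1)] by (auto simp: U_def chart_inv_in snd_chart_inv)
 have qU: "snd cs q \<in> U" if "q \<in> fst cs" "f q \<in> fst d" for q using that chart_inv_snd[OF S_mfd cs(1)] by (simp add: U_def)
 have FU: "?F (snd cs q) = snd d (f q)" if "q \<in> fst cs" for q
  using chart_inv_snd[OF S_mfd cs(1) that] by (simp add: local_rep_def)
 have Uim: "U \<subseteq> snd cs ` {q \<in> fst cs. f q \<in> fst d}"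
 proof
  fix x assume "x \<in> U"
  thus "x \<in> snd cs ` {q \<in> fst cs. f q \<in> fst d}" using Uq[of x] by (intro image_eqI[of _ _ "chart_inv cs x"]) auto
 qed
 have "Ck_on 1 (snd cs ` {q \<in> fst cs. f q \<in> fst d}) ?F"
  using f_smooth cs(1) d(1) unfolding smooth_map_def smooth_on_def by blast
 hence FC: "Ck_on 1 U ?F" by (rule Ck_on_subset[OF _ Uim])
 define V where "V = {y :: real ^ 3. hor y \<in> U}"
 have V: "open V"
  unfolding V_def using Topological_Spaces.open_vimage[OF U linear_continuous_on[OF bounded_linear_hor]] by (simp add: vimage_def)
 define \<Psi> where "\<Psi> y = ?F (hor y) + y $ 3 *\<^sub>R \<nu>0" for y :: "real ^ 3"
 have \<Psi>C: "Ck_on 1 V \<Psi>" unfolding \<Psi>_def[abs_def]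
 proof (rule Ck_on_add[OF V])
  show "Ck_on 1 V (\<lambda>y. y $ 3 *\<^sub>R \<nu>0)"
   by (rule Ck_on_scaleR[OF V Ck_on_linear[OF V bounded_linear_vec_nth] Ck_on_const[OF V]])
  show "Ck_on 1 V (\<lambda>y. ?F (hor y))"
   by (rule Ck_on_compose[OF V U _ Ck_on_linear[OF V bounded_linear_hor] FC]) (auto simp: V_def)
 qed
 let ?DF = "\<lambda>q. fder ?F (snd cs q)"
 have D\<Psi>: "fder \<Psi> y = (\<lambda>v. ?DF q (hor v) + v $ 3 *\<^sub>R \<nu>0)"
  if "hor y = snd cs q" "q \<in> fst cs" "f q \<in> fst d" for y q
 proof (rule frechet_derivative_eqI)
  have "(?F has_derivative ?DF q) (at (hor y))" using local_rep_derivative(1)[OF cs(1) d(1) that(2,3)] that(1) by simp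
  from has_derivative_compose[OF bounded_linear_imp_has_derivative[OF bounded_linear_hor] this]
  show "(\<Psi> has_derivative (\<lambda>v. ?DF q (hor v) + v $ 3 *\<^sub>R \<nu>0)) (at y)" unfolding \<Psi>_def[abs_def]
   by (intro has_derivative_add has_derivative_scaleR_left bounded_linear_imp_has_derivative[OF bounded_linear_vec_nth])
 qed
 have third: "v $ 3 * (\<nu>0 \<bullet> (?G q *v n q d)) = fder \<Psi> y v \<bullet> (?G q *v n q d)"
  if "hor y = snd cs q" "q \<in> fst cs" "f q \<in> fst d" for y q v
  using normal_orthogonal[OF cs(1) d(1) that(2,3)] by (simp add: D\<Psi>[OF that] inner_add_left)
 define y0 where "y0 = pt (snd cs p) 0"
 have pos0: "\<nu>0 \<bullet> (?G p *v n p d) = 1" using normal_norm[OF cs(1) d(1) cs(2) d(2)] by (simp add: \<nu>0_def)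
 have hy0: "hor y0 = snd cs p" by (simp add: y0_def)
 note lr = local_rep_derivative[OF cs(1) d(1) cs(2) d(2)] and D0 = D\<Psi>[OF hy0 cs(2) d(2)]
 have "linear (fder \<Psi> y0)"
  unfolding D0 by (rule linearI) (auto simp: linear_add[OF lr(2)] linear_scale[OF lr(2)] algebra_simps)
 moreover have "v = 0" if v: "fder \<Psi> y0 v = 0" for v
 proof -
  have v3: "v $ 3 = 0" using third[OF hy0 cs(2) d(2), of v] v pos0 by simp
  hence "?DF p (hor v) = 0" using v by (simp add: D0)
  hence "hor v = 0" by (rule linear_vec2_zero[OF lr(2) _ lr(3)])
  hence "v = pt 0 0" using v3 pt_hor[of v] by simp
  thus "v = 0" by (simp add: vec_eq_iff forall_3)
 qed
 ultimately have inj: "inj (fder \<Psi> y0)" using linear_injective_0 by blast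
 obtain U1 W1 k G where U1: "open U1" "U1 \<subseteq> V" "y0 \<in> U1" and W1: "open W1" and hk: "homeomorphism U1 W1 \<Psi> k"
  and G0: "\<And>x. x \<in> W1 \<Longrightarrow> (k has_derivative G x) (at x)" "\<And>x v. x \<in> W1 \<Longrightarrow> fder \<Psi> (k x) (G x v) = v"
 proof (rule local_inverse[OF V \<Psi>C _ inj])
  show "y0 \<in> V" using qU[OF cs(2) d(2)] by (simp add: V_def y0_def)
 qed blast
 have \<Psi>1: "\<Psi> y \<in> W1" "k (\<Psi> y) = y" if "y \<in> U1" for y using hk that by (auto simp: homeomorphism_def)
 have k1: "k x \<in> U1" "\<Psi> (k x) = x" if "x \<in> W1" for x using hk that by (auto simp: homeomorphism_def)
 have \<Psi>cont: "continuous_on U1 \<Psi>" and kcont: "continuous_on W1 k" using hk by (auto simp: homeomorphism_def)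
 define Q1 where "Q1 = {q \<in> fst cs. snd cs q \<in> {x \<in> U. pt x 0 \<in> U1}} \<inter>
   {q \<in> SS. f q \<in> fst d \<and> 0 < \<nu>0 \<bullet> (?G q *v n q d)}"
 have Q1: "openin (pts S) Q1" unfolding Q1_def
 proof (rule openin_Int)
  have "open {x. pt x 0 \<in> U1}"
   using Topological_Spaces.open_vimage[OF U1(1) linear_continuous_on[OF bounded_linear_pt0]] by (simp add: vimage_def)
  hence "open {x \<in> U. pt x 0 \<in> U1}" using U by (simp add: Collect_conj_eq open_Int)
  thus "openin (pts S) {q \<in> fst cs. snd cs q \<in> {x \<in> U. pt x 0 \<in> U1}}" by (rule chart_preimage_open[OF S_mfd cs(1)])
  let ?O = "{q \<in> topspace (subtopology (pts S) {q. f q \<in> fst d}). \<nu>0 \<bullet> (?G q *v n q d) \<in> {0<..}}"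
  have "openin (subtopology (pts S) {q. f q \<in> fst d}) ?O"
   by (rule openin_continuous_map_preimage[OF normal_product_continuous[OF d(1)]]) auto
  moreover have "openin (pts S) {q \<in> SS. f q \<in> fst d}"
   by (rule openin_continuous_map_preimage[OF f_continuous chart_openin[OF mfd d(1)]])
  moreover have "subtopology (pts S) {q. f q \<in> fst d} = subtopology (pts S) {q \<in> SS. f q \<in> fst d}"
   by (simp add: subtopology_restrict[of _ "{q. f q \<in> fst d}"] Collect_conj_eq)
  ultimately have "openin (pts S) ?O" using openin_trans_full[of "pts S" "{q \<in> SS. f q \<in> fst d}" ?O] by simp
  moreover have "?O = {q \<in> SS. f q \<in> fst d \<and> 0 < \<nu>0 \<bullet> (?G q *v n q d)}" by simp
  ultimately show "openin (pts S) {q \<in> SS. f q \<in> fst d \<and> 0 < \<nu>0 \<bullet> (?G q *v n q d)}" by simp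
 qed
 have pQ1: "p \<in> Q1" using p cs(2) d(2) qU[OF cs(2) d(2)] U1(3) pos0 by (simp add: Q1_def y0_def)
 obtain O1 where O1: "openin T O1" "\<And>q. q \<in> SS \<Longrightarrow> f q \<in> O1 \<longleftrightarrow> q \<in> Q1" using f_open[OF Q1] by blast
 have Q1D: "q \<in> fst cs" "f q \<in> fst d" "snd cs q \<in> U" "pt (snd cs q) 0 \<in> U1" "0 < \<nu>0 \<bullet> (?G q *v n q d)"
  "\<Psi> (pt (snd cs q) 0) = snd d (f q)" if "q \<in> Q1" for q using that FU by (auto simp: Q1_def \<Psi>_def)
 define Z where "Z = {x \<in> snd d ` fst d. chart_inv d x \<in> O1}"
 have Z: "open Z" unfolding Z_def by (rule open_vimage[OF chart_open[OF mfd d(1)] chart_inv_continuous[OF mfd d(1)] O1(1)])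
 define W2 where "W2 = W1 \<inter> Z"
 have W2: "open W2" using W1 Z by (auto simp: W2_def)
 define B where "B = {y \<in> U1. \<Psi> y \<in> W2}"
 define E where "E y = chart_inv d (\<Psi> y)" for y
 define K where "K x = k (snd d x)" for x
 have B: "open B"
 proof -
  have "continuous_map (top_of_set U1) euclidean \<Psi>" using \<Psi>cont by simp
  thus ?thesis unfolding B_def by (rule open_vimage[OF U1(1)]) (simp add: W2)
 qed
 have W2d: "x \<in> snd d ` fst d" "chart_inv d x \<in> fst d" "snd d (chart_inv d x) = x" "chart_inv d x \<in> O1" if "x \<in> W2" for x
  using that by (auto simp: W2_def Z_def chart_inv_in snd_chart_inv)
 have EB: "E ` B = {x \<in> fst d. snd d x \<in> W2}"
 proof (intro subset_antisym subsetI)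
  fix x assume "x \<in> E ` B"
  then obtain y where "y \<in> B" "x = E y" by blast
  thus "x \<in> {x \<in> fst d. snd d x \<in> W2}" using W2d[of "\<Psi> y"] by (simp add: E_def B_def)
 next
  fix x assume x: "x \<in> {x \<in> fst d. snd d x \<in> W2}"
  hence w: "snd d x \<in> W1" by (simp add: W2_def)
  have "k (snd d x) \<in> B" using x k1[OF w] by (simp add: B_def)
  moreover have "x = E (k (snd d x))" using x k1[OF w] chart_inv_snd[OF mfd d(1)] by (simp add: E_def)
  ultimately show "x \<in> E ` B" by blast
 qed
 have KE: "K (E y) = y" if "y \<in> B" for y using that W2d[of "\<Psi> y"] \<Psi>1 by (simp add: K_def E_def B_def)
 have onS: "q \<in> Q1" "y = pt (snd cs q) 0" if "q \<in> SS" "f q = E y" "y \<in> B" for q y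
 proof -
  have "\<Psi> y \<in> W2" using that(3) by (simp add: B_def)
  thus q: "q \<in> Q1" using O1(2)[OF that(1)] W2d(4)[of "\<Psi> y"] that(2) by (simp add: E_def)
  have "\<Psi> (pt (snd cs q) 0) = \<Psi> y" using Q1D(6)[OF q] that(2) W2d(3)[OF \<open>\<Psi> y \<in> W2\<close>] by (simp add: E_def)
  thus "y = pt (snd cs q) 0" using \<Psi>1(2)[OF Q1D(4)[OF q]] \<Psi>1(2)[of y] that(3) by (simp add: B_def)
 qed
 have "flow_box B E K" unfolding flow_box_def
 proof (intro conjI ballI impI allI)
  show "open B" by (rule B)
  show "openin T (E ` B)" unfolding EB by (rule chart_preimage_open[OF mfd d(1) W2])
  show "continuous_map (top_of_set B) T E"
  proof -
   have "continuous_on B \<Psi>" by (rule continuous_on_subset[OF \<Psi>cont]) (simp add: B_def)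
   moreover have "\<Psi> ` B \<subseteq> snd d ` fst d" using W2d(1) by (auto simp: B_def)
   ultimately have "continuous_map (top_of_set B) (top_of_set (snd d ` fst d)) \<Psi>" by auto
   from continuous_map_compose[OF this chart_inv_continuous[OF mfd d(1)]] show ?thesis by (simp add: E_def[abs_def] o_def)
  qed
  show "continuous_map (subtopology T (E ` B)) euclidean K"
  proof -
   have "E ` B \<subseteq> fst d" "snd d ` E ` B \<subseteq> W1" unfolding EB by (auto simp: W2_def)
   hence "continuous_map (subtopology T (E ` B)) (top_of_set W1) (snd d)"
    using continuous_map_from_subtopology_mono[OF chart_continuous[OF mfd d(1)], of "E ` B"]
    by (auto simp: continuous_map_in_subtopology)
   from continuous_map_compose[OF this, of euclidean k] kcont show ?thesis by (simp add: K_def[abs_def] o_def)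
  qed
  show "K (E y) = y" if "y \<in> B" for y using KE[OF that] .
  show "E y \<in> f ` SS \<longleftrightarrow> y $ 3 = 0" if y: "y \<in> B" for y
  proof
   assume "E y \<in> f ` SS"
   then obtain q where "q \<in> SS" "f q = E y" by auto
   from onS(2)[OF this y] show "y $ 3 = 0" by (metis pt_nth(3))
  next
   assume y3: "y $ 3 = 0"
   have "hor y \<in> U" using y U1(2) by (auto simp: B_def V_def)
   note q = Uq[OF this]
   have "\<Psi> y = snd d (f (chart_inv cs (hor y)))" by (simp add: \<Psi>_def y3 local_rep_def)
   hence "E y = f (chart_inv cs (hor y))" using chart_inv_snd[OF mfd d(1) q(2)] by (simp add: E_def)
   thus "E y \<in> f ` SS" using q(4) by blast
  qed
  fix q \<omega> \<sigma> assume q: "q \<in> SS" "f q \<in> E ` B" and cr: "crosses q \<omega> \<sigma>"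
  obtain y where y: "y \<in> B" "f q = E y" using q(2) by blast
  have qQ: "q \<in> Q1" and y_eq: "y = pt (snd cs q) 0" using onS[OF q(1) y(2,1)] by auto
  note qd = Q1D[OF qQ]
  have hy: "hor y = snd cs q" by (simp add: y_eq)
  have ky: "k (snd d (f q)) = y" using KE[OF y(1)] y(2) by (simp add: K_def)
  have \<Psi>y: "\<Psi> y = snd d (f q)" using qd(6) y_eq by simp
  have yW: "snd d (f q) \<in> W1" using \<Psi>1(1)[of y] y(1) \<Psi>y by (simp add: B_def)
  define H where "H = G (snd d (f q))"
  have G: "(k has_derivative H) (at (snd d (f q)))" "\<And>v. fder \<Psi> y (H v) = v" using G0[OF yW] by (simp_all add: H_def ky)
  obtain w where w: "((\<lambda>\<tau>. snd d (\<omega> \<tau>)) has_vector_derivative w) (at 0)" "0 < \<sigma> * (w \<bullet> (?G q *v n q d))"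
   using cr d(1) qd(2) unfolding crosses_def by blast
  have \<omega>0: "\<omega> 0 = f q" using cr unfolding crosses_def by blast
  have "H w $ 3 * (\<nu>0 \<bullet> (?G q *v n q d)) = w \<bullet> (?G q *v n q d)" using third[OF hy qd(1,2), of "H w"] G(2)[of w] by simp
  hence "0 < (\<sigma> * H w $ 3) * (\<nu>0 \<bullet> (?G q *v n q d))" using w(2) by (metis mult.assoc)
  hence pos: "0 < \<sigma> * H w $ 3" using qd(5) zero_less_mult_pos2 by blast
  define \<rho> where "\<rho> \<tau> = \<sigma> * K (\<omega> \<tau>) $ 3" for \<tau>
  have "(\<rho> has_derivative (\<lambda>\<tau>. \<sigma> * H (\<tau> *\<^sub>R w) $ 3)) (at 0)"
  proof -
   have "((\<lambda>\<tau>. k (snd d (\<omega> \<tau>))) has_derivative (\<lambda>\<tau>. H (\<tau> *\<^sub>R w))) (at 0)"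
    by (rule has_derivative_compose[OF w(1)[unfolded has_vector_derivative_def]]) (use G(1) \<omega>0 in simp)
   from bounded_linear.has_derivative[OF bounded_linear_mult_right[of \<sigma>] bounded_linear.has_derivative[OF bounded_linear_vec_nth[of 3] this]]
   show ?thesis unfolding \<rho>_def[abs_def] K_def .
  qed
  moreover have "(\<lambda>\<tau>. \<sigma> * H (\<tau> *\<^sub>R w) $ 3) = (*) (\<sigma> * H w $ 3)"
   by (rule ext) (simp add: linear_scale[OF has_derivative_linear[OF G(1)]])
  ultimately have D3: "(\<rho> has_real_derivative (\<sigma> * H w $ 3)) (at 0)" by (simp only: has_field_derivative_def)
  have "\<rho> 0 = 0" using ky y_eq by (simp add: \<rho>_def K_def \<omega>0)
  then obtain \<delta> where \<delta>: "\<delta> > 0" "\<And>h. 0 < h \<Longrightarrow> h < \<delta> \<Longrightarrow> 0 < \<rho> h" using DERIV_pos_inc_right[OF D3 pos] by auto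
  hence "\<forall>\<^sub>F \<tau> in at_right 0. 0 < \<rho> \<tau>" unfolding eventually_at_right_field by blast
  moreover have "\<forall>\<^sub>F \<tau> in at_right 0. \<omega> \<tau> \<in> E ` B"
   by (rule crosses_eventually[OF q(1) cr _ q(2)]) (unfold EB, rule chart_preimage_open[OF mfd d(1) W2])
  ultimately show "\<forall>\<^sub>F \<tau> in at_right 0. \<omega> \<tau> \<in> E ` B \<and> 0 < \<sigma> * K (\<omega> \<tau>) $ 3" by eventually_elim (simp add: \<rho>_def)
 qed
 moreover have "f p \<in> E ` B"
 proof -
  have "snd d (f p) \<in> W1" using \<Psi>1(1)[OF U1(3)] FU[OF cs(2)] by (simp add: \<Psi>_def y0_def)
  moreover have "snd d (f p) \<in> Z" using d(2) O1(2)[OF p] pQ1 chart_inv_snd[OF mfd d] by (simp add: Z_def)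
  ultimately show ?thesis unfolding EB using d(2) by (simp add: W2_def)
 qed
 ultimately show ?thesis by blast
qed

end

lemma (in lie_frame) locally_path_connected_T: "locally_path_connected_space T" unfolding locally_path_connected_space
proof (intro allI impI)
 fix V x assume V: "openin T V \<and> x \<in> V"
 hence x: "x \<in> carrier X" using openin_subset[of T V] topspace_T by auto
 have "Th x 0 = x" using x by (simp add: Th_def \<phi>_0 c_0 linear_0[OF linear_hor])
 moreover have "open {y \<in> UNIV. Th x y \<in> V}" by (rule open_vimage[OF open_UNIV, of T]) (use Th_continuous[OF x] V in auto)
 ultimately obtain r where r: "r > 0" "ball 0 r \<subseteq> {y \<in> UNIV. Th x y \<in> V}"
  using V by (metis (no_types, lifting) UNIV_I mem_Collect_eq open_contains_ball)
 have "path_connectedin T (Th x ` ball 0 r)" by (rule path_connectedin_continuous_map_image[OF Th_continuous[OF x]])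
   (simp add: convex_imp_path_connected)
 moreover have "openin T (Th x ` ball 0 r)" by (rule Th_open_map[OF x open_ball])
 moreover have "x \<in> Th x ` ball 0 r" using \<open>Th x 0 = x\<close> r(1) by (intro image_eqI[of _ _ 0]) auto
 moreover have "Th x ` ball 0 r \<subseteq> V" using r(2) by blast
 ultimately show "\<exists>U. openin T U \<and> path_connectedin T U \<and> x \<in> U \<and> U \<subseteq> V" by blast
qed

context oriented_surface
begin

lemma flow_boxD:
 assumes "flow_box B E K"
 shows "open B" "continuous_map (top_of_set B) T E" "openin T (E ` B)" "continuous_map (subtopology T (E ` B)) euclidean K"
  "y \<in> B \<Longrightarrow> K (E y) = y" "y \<in> B \<Longrightarrow> E y \<in> f ` SS \<longleftrightarrow> y $ 3 = 0"
  "q \<in> SS \<Longrightarrow> f q \<in> E ` B \<Longrightarrow> crosses q \<omega> \<sigma> \<Longrightarrow> \<forall>\<^sub>F \<tau> in at_right 0. \<omega> \<tau> \<in> E ` B \<and> 0 < \<sigma> * K (\<omega> \<tau>) $ 3"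
 using assms unfolding flow_box_def by blast+

lemma flow_box_coordinates:
 assumes "flow_box B E K" "x \<in> E ` B"
 shows "K x \<in> B" "E (K x) = x" "x \<in> f ` SS \<longleftrightarrow> K x $ 3 = 0"
proof -
 obtain y where "y \<in> B" "x = E y" using assms(2) by blast
 thus "K x \<in> B" "E (K x) = x" "x \<in> f ` SS \<longleftrightarrow> K x $ 3 = 0" using flow_boxD(5,6)[OF assms(1)] by simp_all
qed

lemma flow_box_open:
 assumes "flow_box B E K" "open W" shows "openin T {x \<in> E ` B. K x \<in> W}"
proof -
 note b = flow_boxD[OF assms(1)]
 have "openin (subtopology T (E ` B)) {x \<in> topspace (subtopology T (E ` B)). K x \<in> W}"
  by (rule openin_continuous_map_preimage[OF b(4)]) (simp add: assms(2))
 moreover have "topspace (subtopology T (E ` B)) = E ` B" using openin_subset[OF b(3)] by auto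
 ultimately show ?thesis using openin_trans_full[OF _ b(3)] by (simp only:)
qed

definition side :: "('a \<Rightarrow> real ^ 3) \<Rightarrow> 'a \<Rightarrow> int" where
 "side K x = (if 0 \<le> K x $ 3 then 1 else 0)"

lemma side_locally_constant:
 assumes b: "flow_box B E K" and x: "x \<in> E ` B" "x \<notin> f ` SS"
 shows "\<exists>V. openin T V \<and> x \<in> V \<and> (\<forall>y\<in>V. side K y = side K x)"
proof -
 have nz: "K x $ 3 \<noteq> 0" using flow_box_coordinates(3)[OF b x(1)] x(2) by simp
 have o: "open {y :: real ^ 3. 0 < y $ 3}" "open {y :: real ^ 3. y $ 3 < 0}" by (intro open_Collect_less continuous_intros)+
 show ?thesis
 proof (cases "0 < K x $ 3")
  case True
  thus ?thesis using flow_box_open[OF b o(1)] x by (intro exI[of _ "{x \<in> E ` B. K x \<in> {y. 0 < y $ 3}}"]) (simp add: side_def)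
 next
  case False
  thus ?thesis using flow_box_open[OF b o(2)] x nz
   by (intro exI[of _ "{x \<in> E ` B. K x \<in> {y. y $ 3 < 0}}"]) (simp add: side_def)
 qed
qed

lemma openin_diff_constant:
 assumes "\<exists>V. openin Y V \<and> x \<in> V \<and> (\<forall>y\<in>V. u y = u x)" "\<exists>V. openin Y V \<and> x \<in> V \<and> (\<forall>y\<in>V. v y = v x)"
 shows "\<exists>V. openin Y V \<and> x \<in> V \<and> (\<forall>y\<in>V. u y - v y = u x - (v x :: int))"
proof -
 obtain V where V: "openin Y V" "x \<in> V" "\<forall>y\<in>V. u y = u x" using assms(1) by blast
 obtain V' where V': "openin Y V'" "x \<in> V'" "\<forall>y\<in>V'. v y = v x" using assms(2) by blast
 show ?thesis
 proof (intro exI[of _ "V \<inter> V'"] conjI ballI)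
  show "u y - v y = u x - v x" if "y \<in> V \<inter> V'" for y
  proof -
   have "u y = u x" "v y = v x" using that V(3) V'(3) by blast+
   thus ?thesis by (simp only:)
  qed
 qed (use V V' in blast)+
qed

lemma same_side_connected:
 assumes b: "flow_box B E K" and P: "connectedin T P" "P \<subseteq> E ` B" "P \<inter> f ` SS = {}" and yz: "y \<in> P" "z \<in> P"
 shows "0 < K y $ 3 \<Longrightarrow> 0 < K z $ 3"
proof (rule ccontr)
 assume y: "0 < K y $ 3" and z: "\<not> 0 < K z $ 3"
 have "connectedin (subtopology T (E ` B)) P" using P by (simp add: connectedin_subtopology)
 from connectedin_continuous_map_image[OF flow_boxD(4)[OF b] this]
 have "connected (K ` P)" by simp
 hence "connected ((\<lambda>y. y $ 3) ` K ` P)" by (intro connected_continuous_image continuous_intros)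
 from connected_contains_Icc[OF this, of "K z $ 3" "K y $ 3"] yz
 have "{K z $ 3..K y $ 3} \<subseteq> (\<lambda>y. y $ 3) ` K ` P" by blast
 moreover have "0 \<in> {K z $ 3..K y $ 3}" using y z by auto
 ultimately obtain x where x: "x \<in> P" "K x $ 3 = 0" by auto
 hence "x \<in> f ` SS" using flow_box_coordinates(3)[OF b] P(2) by blast
 thus False using x(1) P(3) by blast
qed

lemma flow_box_half_connected:
 assumes b: "flow_box B E K" and r: "ball y r \<subseteq> B"
 shows "connectedin T (E ` (ball y r \<inter> {y. 0 < \<sigma> * y $ 3}))" "E ` (ball y r \<inter> {y. 0 < \<sigma> * y $ 3}) \<inter> f ` SS = {}"
proof -
 let ?H = "{y :: real ^ 3. 0 < \<sigma> * y $ 3}"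
 have "convex ?H" using convex_halfspace_gt[of 0 "\<sigma> *\<^sub>R axis 3 1 :: real ^ 3"] by (simp add: inner_axis')
 hence "connectedin (top_of_set B) (ball y r \<inter> ?H)"
  using r by (auto simp: connectedin_subtopology convex_Int convex_connected)
 thus "connectedin T (E ` (ball y r \<inter> ?H))" by (rule connectedin_continuous_map_image[OF flow_boxD(2)[OF b]])
 have "E x \<notin> f ` SS" if "x \<in> ball y r \<inter> ?H" for x
 proof -
  have "x \<in> B" "x $ 3 \<noteq> 0" using that r by auto
  thus ?thesis using flow_boxD(6)[OF b] by blast
 qed
 thus "E ` (ball y r \<inter> ?H) \<inter> f ` SS = {}" by fastforce
qed

lemma crossing_curves_meet:
 assumes q: "q \<in> SS" and cr: "crosses q \<omega> \<sigma>" "crosses q \<omega>' \<sigma>'" and \<sigma>: "0 < \<sigma> * \<sigma>'"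
  and Co: "Co \<in> connected_components_of (subtopology T (topspace T - f ` SS))"
  and ev: "\<forall>\<^sub>F \<tau> in at_right 0. \<omega> \<tau> \<in> Co"
 shows "\<forall>\<^sub>F \<tau> in at_right 0. \<omega>' \<tau> \<in> Co"
proof -
 obtain B E K where b: "flow_box B E K" "f q \<in> E ` B" using flow_box_exists[OF q] by blast
 obtain r where r: "r > 0" "ball (K (f q)) r \<subseteq> B"
  using flow_boxD(1)[OF b(1)] flow_box_coordinates(1)[OF b] open_contains_ball by blast
 let ?V = "{y \<in> E ` B. K y \<in> ball (K (f q)) r}"
 have V: "openin T ?V" "f q \<in> ?V" using flow_box_open[OF b(1) open_ball] b(2) r(1) by auto
 let ?P = "E ` (ball (K (f q)) r \<inter> {y. 0 < \<sigma> * y $ 3})"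
 note P = flow_box_half_connected[OF b(1) r(2), of \<sigma>]
 have inP: "y \<in> ?P" if "y \<in> ?V" "0 < \<sigma> * K y $ 3" for y
  using that flow_box_coordinates(2)[OF b(1), of y] by (intro image_eqI[of _ _ "K y"]) auto
 obtain \<tau> where "\<omega> \<tau> \<in> ?V" "0 < \<sigma> * K (\<omega> \<tau>) $ 3" "\<omega> \<tau> \<in> Co"
  using eventually_happens'[OF _ eventually_conj[OF crosses_eventually[OF q cr(1) V]
    eventually_conj[OF flow_boxD(7)[OF b(1) q(1) b(2) cr(1)] ev]]] trivial_limit_at_right_real by blast
 hence "?P \<inter> Co \<noteq> {}" using inP by blast
 moreover have "connectedin (subtopology T (topspace T - f ` SS)) ?P"
  using P connectedin_subset_topspace[OF P(1)] by (auto simp: connectedin_subtopology)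
 ultimately have PC: "?P \<subseteq> Co" using connected_components_of_maximal[OF Co] by (auto simp: disjnt_def)
 have sg: "0 < \<sigma> * x" if "0 < \<sigma>' * x" for x :: real using that \<sigma> by (auto simp: zero_less_mult_iff)
 show ?thesis using crosses_eventually[OF q cr(2) V] flow_boxD(7)[OF b(1) q(1) b(2) cr(2)]
  by eventually_elim (use inP sg PC in blast)
qed

lemma flow_box_coherent:
 assumes b: "flow_box B E K" and b': "flow_box B' E' K'" and x: "x \<in> E ` B" "x \<in> E' ` B'"
 shows "\<exists>V. openin T V \<and> x \<in> V \<and> (\<forall>y\<in>V. side K y - side K' y = side K x - side K' x)"
proof (cases "x \<in> f ` SS")
 case False
 show ?thesis
  by (rule openin_diff_constant[OF side_locally_constant[OF b x(1) False] side_locally_constant[OF b' x(2) False]])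
next
 case True
 then obtain q where q: "q \<in> SS" "x = f q" by blast
 obtain d where d: "d \<in> C" "f q \<in> fst d" by (rule charts_at[OF q(1)])
 have "open {y \<in> B. E y \<in> E' ` B'}" by (rule open_vimage[OF flow_boxD(1,2)[OF b] flow_boxD(3)[OF b']])
 moreover have "K x \<in> {y \<in> B. E y \<in> E' ` B'}" using flow_box_coordinates[OF b x(1)] x(2) by simp
 ultimately obtain r where r: "r > 0" "ball (K x) r \<subseteq> {y \<in> B. E y \<in> E' ` B'}" using open_contains_ball by blast
 let ?V = "{y \<in> E ` B. K y \<in> ball (K x) r}"
 have V: "openin T ?V" by (rule flow_box_open[OF b open_ball])
 have xV: "x \<in> ?V" using x r(1) by simp
 have V': "y \<in> E' ` B'" if "y \<in> ?V" for y
 proof -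
  have "K y \<in> {y \<in> B. E y \<in> E' ` B'}" using that r(2) by blast
  thus ?thesis using flow_box_coordinates(2)[OF b, of y] that by simp
 qed
 have rB: "ball (K x) r \<subseteq> B" using r(2) by auto
 let ?P = "\<lambda>\<sigma>. E ` (ball (K x) r \<inter> {y. 0 < \<sigma> * y $ 3})"
 have P: "connectedin T (?P \<sigma>)" "?P \<sigma> \<subseteq> E' ` B'" "?P \<sigma> \<inter> f ` SS = {}" for \<sigma>
  using flow_box_half_connected[OF b rB, of \<sigma>] r(2) by auto
 have inP: "y \<in> ?P \<sigma>" if "y \<in> ?V" "0 < \<sigma> * K y $ 3" for y \<sigma>
  using that flow_box_coordinates(2)[OF b, of y] by (intro image_eqI[of _ _ "K y"]) auto
 have fqV: "f q \<in> ?V" and fqx: "f q \<in> E ` B" "f q \<in> E' ` B'" using xV x q(2) by auto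
 have ex: "\<exists>z. z \<in> ?V \<and> 0 < \<sigma> * K z $ 3 \<and> 0 < \<sigma> * K' z $ 3" if "\<sigma> \<noteq> 0" for \<sigma>
 proof -
  note cr = nray_crosses[OF q(1) d that]
  show ?thesis using eventually_happens'[OF _ eventually_conj[OF crosses_eventually[OF q(1) cr V fqV]
    eventually_conj[OF flow_boxD(7)[OF b q(1) fqx(1) cr] flow_boxD(7)[OF b' q(1) fqx(2) cr]]]] trivial_limit_at_right_real by blast
 qed
 obtain z1 where t1: "z1 \<in> ?V" "0 < K z1 $ 3" "0 < K' z1 $ 3" using ex[of 1] by auto
 obtain z2 where t2: "z2 \<in> ?V" "K z2 $ 3 < 0" "K' z2 $ 3 < 0" using ex[of "- 1"] by auto
 have "side K y = side K' y" if y: "y \<in> ?V" for y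
 proof -
  have y': "y \<in> E ` B" "y \<in> E' ` B'" using y V'[OF y] by auto
  consider "0 < K y $ 3" | "K y $ 3 = 0" | "K y $ 3 < 0" by linarith
  thus ?thesis
  proof cases
   case 1
   have "0 < K' y $ 3" by (rule same_side_connected[OF b' P[of 1] inP inP t1(3)]) (use t1 y 1 in auto)
   thus ?thesis using 1 by (simp add: side_def)
  next
   case 2
   hence "K' y $ 3 = 0" using flow_box_coordinates(3)[OF b y'(1)] flow_box_coordinates(3)[OF b' y'(2)] by simp
   thus ?thesis using 2 by (simp add: side_def)
  next
   case 3
   have "\<not> 0 < K' y $ 3" using same_side_connected[OF b' P[of "-1"] inP inP, of y z2] t2 y 3 by auto
   moreover have "K' y $ 3 \<noteq> 0" using 3 flow_box_coordinates(3)[OF b y'(1)] flow_box_coordinates(3)[OF b' y'(2)] by simp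
   ultimately show ?thesis using 3 by (simp add: side_def)
  qed
 qed
 thus ?thesis using V xV by (intro exI[of _ ?V]) auto
qed

lemma closedin_image: "closedin T (f ` SS)" using proper by (simp add: proper_map_def closed_map_def)

theorem component_on_one_side:
 assumes sc: "simply_connected_space T"
  and Co: "Co \<in> connected_components_of (subtopology T (topspace T - f ` SS))"
  and q: "q \<in> SS" and up: "crosses q \<omega> 1" "\<forall>\<^sub>F \<tau> in at_right 0. \<omega> \<tau> \<in> Co"
  and down: "crosses q \<omega>' (- 1)" "\<forall>\<^sub>F \<tau> in at_right 0. \<omega>' \<tau> \<in> Co"
 shows False
proof -
 let ?W0 = "topspace T - f ` SS"
 have W0: "openin T ?W0" using closedin_image by (simp add: openin_diff)
 obtain B E K where b: "flow_box B E K" "f q \<in> E ` B" using flow_box_exists[OF q] by blast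
 obtain r where r: "r > 0" "ball (K (f q)) r \<subseteq> B"
  using flow_boxD(1)[OF b(1)] flow_box_coordinates(1)[OF b] open_contains_ball by blast
 let ?V = "{y \<in> E ` B. K y \<in> ball (K (f q)) r}"
 have V: "openin T ?V" "f q \<in> ?V" using flow_box_open[OF b(1) open_ball] b(2) r(1) by auto
 have ex: "\<exists>x. x \<in> ?V \<and> 0 < \<sigma> * K x $ 3 \<and> x \<in> Co" if cr: "crosses q \<zeta> \<sigma>" "\<forall>\<^sub>F \<tau> in at_right 0. \<zeta> \<tau> \<in> Co" for \<zeta> \<sigma>
  using eventually_happens'[OF _ eventually_conj[OF crosses_eventually[OF q cr(1) V]
    eventually_conj[OF flow_boxD(7)[OF b(1) q(1) b(2) cr(1)] cr(2)]]] trivial_limit_at_right_real by blast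
 obtain xp where t1: "xp \<in> ?V" "0 < K xp $ 3" "xp \<in> Co" using ex[OF up] by auto
 obtain xm where t2: "xm \<in> ?V" "K xm $ 3 < 0" "xm \<in> Co" using ex[OF down] by auto
 have xV: "xp \<in> ?V" "xm \<in> ?V" and xK: "0 < K xp $ 3" "K xm $ 3 < 0" and xC: "xp \<in> Co" "xm \<in> Co" using t1 t2 by simp_all
 have "locally_path_connected_space (subtopology T ?W0)"
  by (rule locally_path_connected_space_open_subset[OF locally_path_connected_T W0])
 hence "Co \<in> path_components_of (subtopology T ?W0)" using Co path_components_eq_connected_components_of by blast
 hence "path_connectedin (subtopology T ?W0) Co" by (rule path_connectedin_path_components_of)
 hence CoW: "Co \<subseteq> ?W0" and "path_connectedin T Co" by (auto simp: path_connectedin_subtopology)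
 then obtain g2 where g2: "pathin T g2" "g2 ` {0..1} \<subseteq> Co" "g2 0 = xp" "g2 1 = xm"
  using xC unfolding path_connectedin by (metis image_subset_iff_funcset)
 let ?l = "linepath (K xm) (K xp)"
 have lB: "?l t \<in> ball (K (f q)) r" if "t \<in> {0..1}" for t
 proof -
  have "?l t \<in> closed_segment (K xm) (K xp)" using that by (metis linepath_in_path)
  moreover have "closed_segment (K xm) (K xp) \<subseteq> ball (K (f q)) r" using xV by (intro closed_segment_subset convex_ball) auto
  ultimately show ?thesis by blast
 qed
 define g1 where "g1 t = E (?l t)" for t
 have g1: "pathin T g1"
 proof -
  have "continuous_on {0..1} ?l" by (intro continuous_on_linepath)
  moreover have "?l \<in> {0..1} \<rightarrow> B" using lB r(2) by blast
  ultimately have "continuous_map (top_of_set {0..1}) (top_of_set B) ?l" by auto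
  from continuous_map_compose[OF this flow_boxD(2)[OF b(1)]] show ?thesis by (simp add: pathin_def g1_def[abs_def] o_def)
 qed
 have g1B: "g1 t \<in> E ` B" "K (g1 t) = ?l t" if "t \<in> {0..1}" for t
  using lB[OF that] r(2) flow_boxD(5)[OF b(1)] by (auto simp: g1_def)
 have g1e: "g1 0 = xm" "g1 1 = xp" using xV flow_box_coordinates(2)[OF b(1)] by (auto simp: g1_def linepath_0' linepath_1')
 define \<gamma> where "\<gamma> t = (if t \<le> 1/2 then g1 (2 * t) else g2 (2 * t - 1))" for t
 have \<gamma>: "pathin T \<gamma>" unfolding \<gamma>_def[abs_def] by (rule pathin_join[OF g1 g2(1)]) (simp add: g2 g1e)
 define s where "s t = (if t \<le> 1/2 then side K (\<gamma> t) else 1)" for t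
 have sp: "side K xp = 1" "side K xm = 0" using xK by (simp_all add: side_def)
 define \<W> where "\<W> = insert (?W0, \<lambda>_. 0) {(E ` B, side K) | B E K. flow_box B E K}"
 have box_in: "(E ` B, side K) \<in> \<W>" if "flow_box B E K" for B E K
  unfolding \<W>_def by (intro insertI2 CollectI, rule exI[of _ B], rule exI[of _ E], rule exI[of _ K], simp add: that)
 have "s 1 = s 0"
 proof (rule monodromy_trivial[OF sc, of \<W> \<gamma>])
  show "openin T W" if "(W, \<sigma>) \<in> \<W>" for W \<sigma> using that W0 flow_boxD(3) by (auto simp: \<W>_def)
  show "\<exists>W \<sigma>. (W, \<sigma>) \<in> \<W> \<and> x \<in> W" if "x \<in> topspace T" for x
  proof (cases "x \<in> f ` SS")
   case True
   then obtain p where "p \<in> SS" "x = f p" by blast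
   then obtain B E K where "flow_box B E K" "x \<in> E ` B" using flow_box_exists by blast
   from box_in[OF this(1)] this(2) show ?thesis by (intro exI conjI)
  next
   case False thus ?thesis using that unfolding \<W>_def by blast
  qed
  show "\<exists>V. openin T V \<and> x \<in> V \<and> (\<forall>y\<in>V. \<sigma> y - \<sigma>' y = \<sigma> x - \<sigma>' x)"
   if W: "(W, \<sigma>) \<in> \<W>" "(W', \<sigma>') \<in> \<W>" "x \<in> W" "x \<in> W'" for W \<sigma> W' \<sigma>' x
  proof -
   have alt: "(U = ?W0 \<and> \<tau> = (\<lambda>_. 0)) \<or> (\<exists>B E K. flow_box B E K \<and> U = E ` B \<and> \<tau> = side K)"
    if "(U, \<tau>) \<in> \<W>" for U \<tau> using that unfolding \<W>_def by blast
   have lc: "\<exists>V. openin T V \<and> x \<in> V \<and> (\<forall>y\<in>V. \<tau> y = \<tau> x)" if U: "(U, \<tau>) \<in> \<W>" "x \<in> U" "x \<in> ?W0" for U \<tau> using alt[OF U(1)]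
   proof (elim disjE exE conjE)
    assume "U = ?W0" "\<tau> = (\<lambda>_. 0)"
    thus ?thesis using W0 U(2) by (intro exI[of _ ?W0]) auto
   next
    fix B E K assume "flow_box B E K" "U = E ` B" "\<tau> = side K"
    thus ?thesis using side_locally_constant[of B E K x] U(2,3) by blast
   qed
   show ?thesis
   proof (cases "x \<in> ?W0")
    case True
    show ?thesis by (rule openin_diff_constant[OF lc[OF W(1,3) True] lc[OF W(2,4) True]])
   next
    case False
    obtain B E K where 1: "flow_box B E K" "W = E ` B" "\<sigma> = side K" using alt[OF W(1)] False W(3) by blast
    obtain B' E' K' where 2: "flow_box B' E' K'" "W' = E' ` B'" "\<sigma>' = side K'" using alt[OF W(2)] False W(4) by blast
    show ?thesis using flow_box_coherent[OF 1(1) 2(1)] W(3,4) unfolding 1(2,3) 2(2,3) by blast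
   qed
  qed
  show "pathin T \<gamma>" by (rule \<gamma>)
  show "\<gamma> 1 = \<gamma> 0" by (simp add: \<gamma>_def g1e g2)
  show "\<exists>W \<sigma>. (W, \<sigma>) \<in> \<W> \<and> \<gamma> t \<in> W \<and> locally_const {0..1} (\<lambda>t. s t - \<sigma> (\<gamma> t)) t" if t: "t \<in> {0..1}" for t
  proof -
   consider "t < 1/2" | "t = 1/2" | "1/2 < t" by linarith
   thus ?thesis
   proof cases
    case 1
    have "\<gamma> t \<in> E ` B" using g1B(1)[of "2 * t"] 1 t by (simp add: \<gamma>_def)
    moreover have "locally_const {0..1} (\<lambda>t. s t - side K (\<gamma> t)) t" unfolding locally_const_def
     by (rule exI[of _ "1/2 - t"]) (use 1 in \<open>auto simp: s_def dist_real_def\<close>)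
    ultimately show ?thesis using box_in[OF b(1)] by (intro exI conjI)
   next
    case 2
    have gt: "\<gamma> t = xp" unfolding \<gamma>_def 2 by (simp add: g1e)
    hence gW: "\<gamma> t \<in> ?W0" using xC(1) CoW by blast
    obtain V where V: "openin T V" "xp \<in> V" "\<forall>y\<in>V. side K y = side K xp"
     using side_locally_constant[OF b(1), of xp] xV(1) gW gt by blast
    obtain e where e: "e > 0" "\<forall>t'\<in>{0..1}. dist t' t < e \<longrightarrow> \<gamma> t' \<in> V"
     using continuous_map_nbhd[of "{0..1}" T \<gamma> t V] \<gamma> t V gt by (auto simp: pathin_def)
    have "locally_const {0..1} (\<lambda>t. s t - 0) t" unfolding locally_const_def
    proof (rule exI[of _ e], intro conjI ballI impI e(1))
     fix t' :: real assume "t' \<in> {0..1}" "dist t' t < e"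
     hence "side K (\<gamma> t') = 1" using e(2) V(3) sp(1) by simp
     thus "s t' - 0 = s t - 0" using gt sp(1) by (simp add: s_def)
    qed
    moreover have "(?W0, \<lambda>_. 0) \<in> \<W>" by (simp add: \<W>_def)
    ultimately show ?thesis using gW by (intro exI conjI)
   next
    case 3
    have "\<gamma> t \<in> Co" using g2(2) 3 t by (auto simp: \<gamma>_def)
    hence gW: "\<gamma> t \<in> ?W0" using CoW by blast
    have "locally_const {0..1} (\<lambda>t. s t - 0) t" unfolding locally_const_def
     by (rule exI[of _ "t - 1/2"]) (use 3 in \<open>auto simp: s_def dist_real_def abs_if split: if_splits\<close>)
    moreover have "(?W0, \<lambda>_. 0) \<in> \<W>" by (simp add: \<W>_def)
    ultimately show ?thesis using gW by (intro exI conjI)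
   qed
  qed
 qed
 moreover have "s 1 = 1" "s 0 = 0" using sp by (simp_all add: s_def \<gamma>_def g1e)
 ultimately show False by simp
qed

end

lemma unit_normal_unique:
 fixes D :: "real ^ 2 \<Rightarrow> real ^ 3" and G :: "real ^ 3 ^ 3"
 assumes D: "linear D" "inj D" and G: "transpose G = G" "\<And>v. v \<noteq> 0 \<Longrightarrow> 0 < v \<bullet> (G *v v)"
  and \<nu>: "\<And>x. D x \<bullet> (G *v \<nu>) = 0" "\<nu> \<bullet> (G *v \<nu>) = 1"
  and \<nu>': "\<And>x. D x \<bullet> (G *v \<nu>') = 0" "\<nu>' \<bullet> (G *v \<nu>') = 1"
 shows "\<nu>' = \<nu> \<or> \<nu>' = - \<nu>"
proof -
 define P where "P v = D (hor v) + v $ 3 *\<^sub>R \<nu>" for v :: "real ^ 3"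
 have linP: "linear P" by (rule linearI) (auto simp: P_def linear_add[OF D(1)] linear_scale[OF D(1)] algebra_simps)
 have "v = 0" if v: "P v = 0" for v
 proof -
  have "P v \<bullet> (G *v \<nu>) = v $ 3" using \<nu> by (simp add: P_def inner_add_left)
  hence v3: "v $ 3 = 0" using v by simp
  hence "D (hor v) = 0" using v by (simp add: P_def)
  hence "hor v = 0" by (rule linear_vec2_zero[OF D(1) _ D(2)])
  hence "v = pt 0 0" using v3 pt_hor[of v] by simp
  thus "v = 0" by (simp add: vec_eq_iff forall_3)
 qed
 hence "surj P" using linear_injective_0[OF linP] linear_injective_imp_surjective[OF linP] by blast
 then obtain v where v: "\<nu>' = P v" by (metis surjD)
 define x where "x = hor v"
 define s where "s = v $ 3"
 have eq: "\<nu>' = D x + s *\<^sub>R \<nu>" by (simp add: v P_def x_def s_def)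
 have sym: "\<nu> \<bullet> (G *v \<nu>') = \<nu>' \<bullet> (G *v \<nu>)" by (metis inner_symmetric_matrix[OF G(1)] inner_commute)
 have s1: "\<nu>' \<bullet> (G *v \<nu>) = s" using \<nu> by (subst eq) (simp add: inner_add_left)
 have "\<nu>' \<bullet> (G *v \<nu>') = D x \<bullet> (G *v \<nu>') + s * (\<nu> \<bullet> (G *v \<nu>'))" by (subst (1) eq) (simp add: inner_add_left)
 hence "s * s = 1" using \<nu>' sym s1 by simp
 hence s: "s = 1 \<or> s = -1" by (simp add: square_eq_1_iff)
 have "D x = \<nu>' - s *\<^sub>R \<nu>" using eq by simp
 hence "G *v D x = G *v \<nu>' - s *\<^sub>R (G *v \<nu>)" by (simp add: matrix_vector_mult_diff_distrib matrix_vector_mult_scaleR)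
 hence "D x \<bullet> (G *v D x) = 0" using \<nu>(1) \<nu>'(1) by (simp add: inner_diff_right)
 hence "D x = 0" using G(2) by (metis less_irrefl)
 thus ?thesis using s eq by auto
qed

section \<open>Marching from plane to plane\<close>

lemma simply_connected_imp_connected:
 assumes "simply_connected_space Y" shows "connected_space Y"
proof (rule path_connected_imp_connected_space)
 show "path_connected_space Y" unfolding path_connected_space_def
 proof (intro ballI)
  fix x y assume xy: "x \<in> topspace Y" "y \<in> topspace Y"
  hence "homotopic_with (\<lambda>r. r 1 = r 0) (top_of_set {0..1::real}) Y (\<lambda>_. x) (\<lambda>_. y)"
   using assms unfolding simply_connected_space_def by simp
  then obtain h where h: "continuous_map (prod_topology (top_of_set {0..1::real}) (top_of_set {0..1::real})) Y h"
   "\<And>t. h (0, t) = x" "\<And>t. h (1, t) = y" unfolding homotopic_with_def by blast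
  have "continuous_map (top_of_set {0..1}) (prod_topology (top_of_set {0..1::real}) (top_of_set {0..1::real})) (\<lambda>t. (t, 0))"
   by (auto simp: continuous_map_paired continuous_map_in_subtopology continuous_map_from_subtopology intro!: continuous_intros)
  from continuous_map_compose[OF this h(1)] h(2,3)
  show "\<exists>g. pathin Y g \<and> g 0 = x \<and> g 1 = y" by (intro exI[of _ "\<lambda>t. h (t, 0)"]) (simp add: pathin_def o_def)
 qed
qed

context lie_frame
begin

lemma plane_image: "a \<in> carrier X \<Longrightarrow> Th a ` {y. y $ 3 = \<delta>} = (a \<otimes> c \<delta>) <# N"
proof -
 assume a: "a \<in> carrier X"
 have "Th a ` {y. y $ 3 = \<delta>} = Th (a \<otimes> c \<delta>) ` {y. y $ 3 = 0}"
 proof (intro subset_antisym subsetI)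
  fix p assume "p \<in> Th a ` {y. y $ 3 = \<delta>}"
  then obtain y where y: "p = Th a y" "y $ 3 = \<delta>" by blast
  have "p = Th (a \<otimes> c \<delta>) (pt (L \<delta> (hor y)) 0)" using Th_rebase_inverse[OF a, of y \<delta>] y by simp
  thus "p \<in> Th (a \<otimes> c \<delta>) ` {y. y $ 3 = 0}" by auto
 next
  fix p assume "p \<in> Th (a \<otimes> c \<delta>) ` {y. y $ 3 = 0}"
  then obtain y where y: "p = Th (a \<otimes> c \<delta>) y" "y $ 3 = 0" by blast
  have "y = pt (hor y) 0" using y(2) pt_hor[of y] by simp
  hence "p = Th a (pt (L (- \<delta>) (hor y)) \<delta>)" using Th_rebase[OF a, of \<delta> "hor y" 0] y(1) by simp
  thus "p \<in> Th a ` {y. y $ 3 = \<delta>}" by auto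
 qed
 thus ?thesis using plane_eq[of "a \<otimes> c \<delta>"] a by simp
qed

lemma coset_absorb: "b \<in> carrier X \<Longrightarrow> h \<in> N \<Longrightarrow> (b \<otimes> h) <# N = b <# N"
proof -
 assume b: "b \<in> carrier X" "h \<in> N"
 have sub: "subgroup N X" using normal_N by (rule normal_imp_subgroup)
 have "(b \<otimes> h) <# N = b <# (h <# N)" using b subgroup.mem_carrier[OF sub] subgroup.subset[OF sub] by (intro lcos_m_assoc[symmetric]) auto
 also have "h <# N = N" using coset_join3[OF _ sub b(2)] subgroup.mem_carrier[OF sub b(2)] by simp
 finally show ?thesis .
qed

lemma open_thick_plane: "b \<in> carrier X \<Longrightarrow> openin T (Th b ` {y. \<bar>y $ 3\<bar> < e})"
 by (rule Th_open_map, assumption) (intro open_Collect_less continuous_intros)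

lemma foliation_induct:
 assumes conn: "connected_space T" and e: "e > 0"
  and E: "a \<in> carrier X" "E a" and inv: "\<And>b h. b \<in> carrier X \<Longrightarrow> E b \<Longrightarrow> h \<in> N \<Longrightarrow> E (b \<otimes> h)"
  and step: "\<And>b t. b \<in> carrier X \<Longrightarrow> E b \<Longrightarrow> \<bar>t\<bar> < e \<Longrightarrow> E (b \<otimes> c t)"
  and b: "b \<in> carrier X"
 shows "E b"
proof -
 let ?B = "\<lambda>b. Th b ` {y. \<bar>y $ 3\<bar> < e}"
 have self: "b \<in> ?B b" if "b \<in> carrier X" for b using e that by (intro image_eqI[of _ _ 0]) auto
 have sub: "?B b \<subseteq> carrier X" if "b \<in> carrier X" for b using that by auto
 have 1: "E b'" if "b \<in> carrier X" "E b" "b' \<in> ?B b" for b b'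
 proof -
  note bb = that
  obtain y where y: "b' = Th b y" "\<bar>y $ 3\<bar> < e" using bb(3) by blast
  have "b' = b \<otimes> \<phi> (hor y) \<otimes> c (y $ 3)" using that(1) by (simp add: y Th_def m_assoc)
  thus ?thesis using step[OF _ inv[OF that(1,2) \<phi>_in] y(2)] that(1) by simp
 qed
 have 2: "E b" if "b \<in> carrier X" "E b'" "b' \<in> ?B b" for b b'
 proof -
  note bb = that
  obtain y where y: "b' = Th b y" "\<bar>y $ 3\<bar> < e" using bb(3) by blast
  have "b = b' \<otimes> c (- y $ 3) \<otimes> \<phi> (- hor y)" using that(1) by (simp add: y Th_def c_uminus \<phi>_uminus m_assoc)
  moreover have "b' \<in> carrier X" using y that(1) by simp
  ultimately show ?thesis using inv[OF _ step[OF _ that(2)] \<phi>_in] y(2) by (metis abs_minus_cancel c_carrier m_closed)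
 qed
 let ?U = "{b \<in> carrier X. E b}"
 have "openin T ?U"
 proof (subst openin_subopen, rule ballI)
  fix b assume b: "b \<in> ?U"
  hence "?B b \<subseteq> ?U" using 1[of b] sub[of b] by blast
  thus "\<exists>V. openin T V \<and> b \<in> V \<and> V \<subseteq> ?U" using b self[of b] open_thick_plane[of b e] by blast
 qed
 moreover have "openin T (topspace T - ?U)"
 proof (subst openin_subopen, rule ballI)
  fix b assume "b \<in> topspace T - ?U"
  hence b: "b \<in> carrier X" "\<not> E b" using topspace_T by auto
  hence "?B b \<subseteq> topspace T - ?U" using 2[OF b(1)] sub[OF b(1)] topspace_T by blast
  thus "\<exists>V. openin T V \<and> b \<in> V \<and> V \<subseteq> topspace T - ?U" using self[OF b(1)] open_thick_plane[OF b(1), of e] by blast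
 qed
 ultimately have "?U = {} \<or> ?U = topspace T" using conn topspace_T by (auto simp: connected_space_clopen_in closedin_def)
 thus ?thesis using E b topspace_T by auto
qed

lemma upward_induct:
 assumes E: "a \<in> carrier X" "E a" and step: "\<And>b t. b \<in> carrier X \<Longrightarrow> E b \<Longrightarrow> 0 \<le> t \<Longrightarrow> t < e \<Longrightarrow> E (b \<otimes> c t)"
  and e: "e > 0" and t: "0 \<le> t"
 shows "E (a \<otimes> c t)"
proof -
 obtain n :: nat where n: "t / e < real n" using reals_Archimedean2 by blast
 have n0: "0 < real n" using n t e by (meson divide_nonneg_pos le_less_trans)
 have s: "0 \<le> t / n" "t / n < e" using n n0 t e by (simp_all add: field_simps)
 have "E (a \<otimes> c (real k * (t / n)))" for k
 proof (induction k)
  case (Suc k)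
  have "a \<otimes> c (real (Suc k) * (t / n)) = a \<otimes> c (real k * (t / n)) \<otimes> c (t / n)"
  proof -
   have "real (Suc k) * (t / n) = real k * (t / n) + t / n" by (simp add: distrib_right add_divide_distrib)
   thus ?thesis using E(1) by (simp only: c_add) (simp add: m_assoc)
  qed
  thus ?case using step[OF _ Suc s] E(1) by simp
 qed (use E in simp)
 from this[of n] show ?thesis using n0 by simp
qed

lemma reversed_trA:
 assumes "lie_frame X \<phi> (\<lambda>t. c (- t)) N"
 shows "flow_frame.trA (lie_frame.A X \<phi> (\<lambda>t. c (- t))) = - trA"
proof -
 interpret rev: lie_frame X \<phi> "\<lambda>t. c (- t)" N by fact
 have L: "rev.L z x = L (- z) x" for z x by (simp add: rev.L_def L_def)
 have "rev.A x = - A x" for x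
 proof -
  have "((\<lambda>z. L z x) has_vector_derivative A x) (at 0)" using L_has_vector_derivative[of x 0] by (simp add: L_0)
  moreover have "((\<lambda>z. - z) has_vector_derivative (- 1)) (at (0 :: real))" by (auto intro!: derivative_eq_intros)
  ultimately have "((\<lambda>z. L (- z) x) has_vector_derivative - A x) (at 0)"
   using vector_diff_chain_at[of uminus "- 1" 0 "\<lambda>z. L z x" "A x"] by (simp add: o_def)
  thus ?thesis unfolding rev.A_def L by (rule vector_derivative_at)
 qed
 thus ?thesis by (simp add: rev.trA_def trA_def)
qed

lemma vertical_line_derivative:
 assumes p: "p \<in> carrier X" and d: "d \<in> C" "p \<in> fst d"
 shows "((\<lambda>\<tau>. snd d (p \<otimes> c (\<sigma> * \<tau>))) has_vector_derivative \<sigma> *\<^sub>R Lam d p (J0 (axis 3 1))) (at 0)"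
  "\<forall>\<^sub>F \<tau> in nhds 0. p \<otimes> c (\<sigma> * \<tau>) \<in> fst d"
proof -
 let ?l = "\<lambda>\<tau>. (\<sigma> * \<tau>) *\<^sub>R axis 3 1 :: real ^ 3"
 have Th: "Th p (?l \<tau>) = p \<otimes> c (\<sigma> * \<tau>)" for \<tau>
 proof -
  have "hor (?l \<tau>) = 0" "?l \<tau> $ 3 = \<sigma> * \<tau>" by (simp_all add: vec_eq_iff forall_2 axis_def)
  thus ?thesis using p by (simp only: Th_def) simp
 qed
 have "(?l has_derivative (\<lambda>\<tau>. (\<sigma> * \<tau>) *\<^sub>R axis 3 1)) (at 0)" by (auto intro!: derivative_eq_intros)
 moreover have "((\<lambda>y. snd d (Th p y)) has_derivative (\<lambda>v. Lam d p (J0 (frm 0 v)))) (at (?l 0))"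
  using Th_has_derivative[OF p d(1), of 0] p d(2) by simp
 ultimately have "((\<lambda>\<tau>. snd d (Th p (?l \<tau>))) has_derivative (\<lambda>\<tau>. Lam d p (J0 (frm 0 ((\<sigma> * \<tau>) *\<^sub>R axis 3 1))))) (at 0)"
  by (rule has_derivative_compose)
 moreover have "Lam d p (J0 (frm 0 ((\<sigma> * \<tau>) *\<^sub>R axis 3 1))) = \<tau> *\<^sub>R (\<sigma> *\<^sub>R Lam d p (J0 (axis 3 1)))" for \<tau>
  using linear_scale[OF linear_frm] linear_scale[OF linear_Lam[OF d]]
   linear_scale[OF has_derivative_linear[OF Th_one_has_derivative]] by (simp add: frm_axis_3 mult.commute)
 ultimately show "((\<lambda>\<tau>. snd d (p \<otimes> c (\<sigma> * \<tau>))) has_vector_derivative \<sigma> *\<^sub>R Lam d p (J0 (axis 3 1))) (at 0)"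
  unfolding Th by (simp add: has_vector_derivative_def)
 have "open (?l -` {y \<in> UNIV. Th p y \<in> fst d})"
  by (rule Topological_Spaces.open_vimage[OF smooth_into_open[OF mfd Th_smooth[OF p] d(1)]]) (intro continuous_intros)
 hence "\<forall>\<^sub>F \<tau> in nhds 0. \<tau> \<in> ?l -` {y \<in> UNIV. Th p y \<in> fst d}" using p d(2) by (intro eventually_nhds_in_open) auto
 thus "\<forall>\<^sub>F \<tau> in nhds 0. p \<otimes> c (\<sigma> * \<tau>) \<in> fst d" by eventually_elim (use Th in auto)
qed

lemma Lam_J0_isometry:
 "d \<in> C \<Longrightarrow> p \<in> fst d \<Longrightarrow> Lam d p (J0 v) \<bullet> (metric X d (snd d p) *v Lam d p (J0 w)) = v \<bullet> w" by (simp add: Lam_isometry orth')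

end

context frame_surface
begin

lemma unit_normal_at_unique:
 assumes "cs \<in> charts S" "d \<in> C" "q \<in> fst cs" "f q \<in> fst d" "unit_normal_at X f cs d q \<nu>" "unit_normal_at X f cs d q \<nu>'"
 shows "\<nu>' = \<nu> \<or> \<nu>' = - \<nu>"
 by (rule unit_normal_unique[OF local_rep_derivative(2,3)[OF assms(1-4)] metric_symmetric[OF assms(2,4)] metric_pos[OF assms(2,4)]
   unit_normal_at_D[OF assms(1-5)] unit_normal_at_D[OF assms(1-4,6)]])

lemma H_surface_curvature:
 assumes H: "H_surface X S f H" and ch: "cs \<in> charts S" "d \<in> C" "q \<in> fst cs" "f q \<in> fst d" and \<nu>: "unit_normal_at X f cs d q \<nu>"
 shows "mean_curvature_at X f cs d q \<nu> = H \<or> mean_curvature_at X f cs d q \<nu> = - H"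
proof -
 consider "H = 0" "minimal_surface X S f" |
  n where "unit_normal_field X S f n"
   "\<forall>c\<in>charts S. \<forall>d\<in>charts (mfd X). \<forall>p\<in>fst c. f p \<in> fst d \<longrightarrow> mean_curvature_at X f c d p (n p d) = H"
  using H unfolding H_surface_def by blast
 thus ?thesis
 proof cases
  case 1 thus ?thesis using ch \<nu> unfolding minimal_surface_def by auto
 next
  case 2
  have "unit_normal_at X f cs d q (n q d)" using 2(1) ch unfolding unit_normal_field_def by blast
  from unit_normal_at_unique[OF ch this \<nu>] 2(2) ch
  show ?thesis by (auto simp: mean_curvature_at_def mean_curvature_uminus)
 qed
qed

lemma good_if_mean_curvature_le:
 assumes H: "H_surface X S f H" and le: "2 * H \<le> - trA" and H0: "0 \<le> H" shows "good q" unfolding good_def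
proof (intro ballI impI allI, elim conjE)
 fix cs d e assume "cs \<in> charts S" "d \<in> C" "q \<in> fst cs" "f q \<in> fst d" "unit_normal_at X f cs d q (Lam d (f q) (J0 e))"
 from H_surface_curvature[OF H this] le H0
 show "2 * mean_curvature_at X f cs d q (Lam d (f q) (J0 e)) \<le> - trA" by auto
qed

lemma plane_curvature:
 assumes a: "a \<in> carrier X" and \<delta>: "\<bar>\<delta>\<bar> < eps" and pl: "\<And>q. q \<in> SS \<Longrightarrow> \<exists>x. f q = Th a (pt x \<delta>)"
  and ch: "cs \<in> charts S" "d \<in> C" "q \<in> fst cs" "f q \<in> fst d"
 shows "unit_normal_at X f cs d q (vert d (f q))"
  "2 * mean_curvature_at X f cs d q (vert d (f q)) = - trA"
proof -
 have S: "pt x \<delta> \<in> Slab" for x using \<delta> by (simp add: Slab_def)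
 have "q \<in> SS" using ch(3) chart_subset[OF S_mfd ch(1)] by blast
 then obtain x where x: "f q = Th a (pt x \<delta>)" using pl by blast
 note uD = param_at(1)[OF a ch(1,3,4) x S] and pq = param_at(2)[OF a ch(1,3,4) x S]
 have F0: "param a cs v $ 3 = \<delta>" if v: "v \<in> pdom a cs d" for v
 proof -
  obtain x where "f (chart_inv cs v) = Th a (pt x \<delta>)" using pl[OF param_in(3)[OF ch(1) v]] by blast
  thus ?thesis using a S by (simp add: param_def)
 qed
 have z: "fder (param a cs) (snd cs q) v $ 3 = 0" for v by (rule F0_flat[OF surface_adapted[OF a ch(1,2)] uD F0 uD])
 show un: "unit_normal_at X f cs d q (vert d (f q))" by (rule vertical_unit_normal[OF a ch x S z])
 have eq: "fder (Thc a d) (param a cs (snd cs q)) (axis 3 1) = vert d (f q)"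
  using frechet_Th[OF a ch(2), of "pt x \<delta>" "axis 3 1"] x ch(4) by (simp add: pq frm_axis_3)
 have "2 * mean_curvature (metric X d) (local_rep cs d f) (snd cs q)
   (fder (Thc a d) (param a cs (snd cs q)) (axis 3 1)) = - (axis 3 1 :: real ^ 3) $ 3 * trA"
  by (rule mean_curvature_plane(1)[OF surface_adapted[OF a ch(1,2)] uD F0])
   (use un in \<open>simp_all add: eq unit_normal_at_def\<close>)
 thus "2 * mean_curvature_at X f cs d q (vert d (f q)) = - trA" by (simp add: eq mean_curvature_at_def)
qed

lemma plane_mean_curvature:
 assumes H: "H_surface X S f H" "0 \<le> H" and a: "a \<in> carrier X" and \<delta>: "\<bar>\<delta>\<bar> < eps" and pl: "\<And>q. q \<in> SS \<Longrightarrow> \<exists>x. f q = Th a (pt x \<delta>)"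
 shows "2 * H = \<bar>trA\<bar>"
proof -
 obtain q where "q \<in> SS" using S_nonempty by blast
 then obtain cs d where ch: "cs \<in> charts S" "q \<in> fst cs" "d \<in> C" "f q \<in> fst d" by (rule charts_at)
 note ch = ch(1,3,2,4)
 note p = plane_curvature[OF a \<delta> pl ch]
 show ?thesis using H_surface_curvature[OF H(1) ch p(1)] p(2) H(2) by auto
qed

lemma slab_step:
 assumes H: "H_surface X S f H" "0 \<le> H" and proper: "proper_map (pts S) T f" and a: "a \<in> carrier X"
  and disj: "f ` SS \<inter> (a <# N) = {}"
  and sgn: "\<And>q y. q \<in> SS \<Longrightarrow> f q = Th a y \<Longrightarrow> y \<in> Slab \<Longrightarrow> 0 < y $ 3 \<Longrightarrow>
    (\<And>t. 0 \<le> t \<Longrightarrow> t < y $ 3 \<Longrightarrow> Th a (pt (hor y) t) \<notin> f ` SS) \<Longrightarrow> good q"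
  and sgn_near: "\<And>q y. q \<in> SS \<Longrightarrow> f q = Th a y \<Longrightarrow> y \<in> Slab \<Longrightarrow> 0 < y $ 3 \<Longrightarrow>
    (\<And>t. 0 \<le> t \<Longrightarrow> t < y $ 3 \<Longrightarrow> Th a (pt (hor y) t) \<notin> f ` SS) \<Longrightarrow>
    (\<And>cs d. cs \<in> charts S \<Longrightarrow> d \<in> C \<Longrightarrow> q \<in> fst cs \<Longrightarrow> f q \<in> fst d \<Longrightarrow>
      unit_normal_at X f cs d q (vert d (f q))) \<Longrightarrow>
    \<exists>Q. openin (pts S) Q \<and> q \<in> Q \<and> (\<forall>q'\<in>Q. good q')"
  and not_leaf: "\<not> (inj_on f SS \<and> (\<exists>b\<in>carrier X. f ` SS = b <# N) \<and> 2 * H = \<bar>trA\<bar>)"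
  and y: "0 \<le> y $ 3" "y $ 3 < eps"
 shows "Th a y \<notin> f ` SS"
proof
 assume "Th a y \<in> f ` SS"
 then obtain p1 where p1: "p1 \<in> SS" "f p1 = Th a y" by auto
 have dj: "f q \<noteq> Th a (pt x 0)" if "q \<in> SS" for q x
 proof
  assume "f q = Th a (pt x 0)"
  hence "f q \<in> a <# N" unfolding plane_eq[OF a] by auto
  thus False using disj that by blast
 qed
 have y0: "0 < y $ 3" using y(1) p1 dj[OF p1(1), of "hor y"] pt_hor[of y] by (cases "y $ 3 = 0") auto
 obtain \<delta> where \<delta>: "0 < \<delta>" "\<delta> < eps" "\<And>q. q \<in> SS \<Longrightarrow> \<exists>x. f q = Th a (pt x \<delta>)"
 proof (rule halfspace[OF proper a _ p1 y0 y(2)])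
  show "f q \<noteq> Th a (pt x 0)" if "q \<in> SS" for q x by (rule dj[OF that])
  show "good q" if "q \<in> SS" "f q = Th a y" "y \<in> Slab" "0 < y $ 3"
   "\<And>t. 0 \<le> t \<Longrightarrow> t < y $ 3 \<Longrightarrow> Th a (pt (hor y) t) \<notin> f ` SS" for q y by (rule sgn[OF that])
  show "\<exists>Q. openin (pts S) Q \<and> q \<in> Q \<and> (\<forall>q'\<in>Q. good q')" if "q \<in> SS" "f q = Th a y" "y \<in> Slab" "0 < y $ 3"
   "\<And>t. 0 \<le> t \<Longrightarrow> t < y $ 3 \<Longrightarrow> Th a (pt (hor y) t) \<notin> f ` SS"
   "\<And>cs d. cs \<in> charts S \<Longrightarrow> d \<in> C \<Longrightarrow> q \<in> fst cs \<Longrightarrow> f q \<in> fst d \<Longrightarrow>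
      unit_normal_at X f cs d q (vert d (f q))" for q y by (rule sgn_near[OF that])
 qed (rule that)
 have ab: "\<bar>\<delta>\<bar> < eps" using \<delta> by simp
 have "f ` SS = (a \<otimes> c \<delta>) <# N" using surface_in_plane(2)[OF proper a ab \<delta>(3)] plane_image[OF a] by simp
 moreover have "a \<otimes> c \<delta> \<in> carrier X" using a by simp
 ultimately show False using not_leaf surface_in_plane(1)[OF proper a ab \<delta>(3)] plane_mean_curvature[OF H a ab \<delta>(3)] by blast
qed

end

context oriented_surface
begin

lemma vertical_crosses:
 assumes q: "q \<in> SS" and d: "d \<in> C" "f q \<in> fst d"
  and pos: "0 < \<sigma> * (\<tau> * (vert d (f q) \<bullet> (metric X d (snd d (f q)) *v n q d)))"
 shows "crosses q (\<lambda>t. f q \<otimes> c (\<tau> * t)) \<sigma>"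
proof (rule crossesI[OF q d(1)])
 have fq: "f q \<in> carrier X" by (rule f_carrier[OF q])
 show "f q \<otimes> c (\<tau> * 0) = f q" using fq by simp
 show "\<forall>\<^sub>F t in nhds 0. f q \<otimes> c (\<tau> * t) \<in> fst d" by (rule vertical_line_derivative(2)[OF fq d])
 show "((\<lambda>t. snd d (f q \<otimes> c (\<tau> * t))) has_vector_derivative \<tau> *\<^sub>R vert d (f q)) (at 0)"
  by (rule vertical_line_derivative(1)[OF fq d])
qed (use pos in simp)

lemma vertical_sign_chart_independent:
 assumes q: "q \<in> SS" and d: "d \<in> C" "f q \<in> fst d" "d' \<in> C" "f q \<in> fst d'"
  and neg: "vert d (f q) \<bullet> (metric X d (snd d (f q)) *v n q d) < 0"
 shows "Lam d' (f q) (J0 (axis 3 1)) \<bullet> (metric X d' (snd d' (f q)) *v n q d') < 0"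
proof -
 have "crosses q (\<lambda>t. f q \<otimes> c (1 * t)) (- 1)" by (rule vertical_crosses[OF q d(1,2)]) (use neg in simp)
 then obtain w where w: "((\<lambda>t. snd d' (f q \<otimes> c (1 * t))) has_vector_derivative w) (at 0)"
  "0 < - 1 * (w \<bullet> (metric X d' (snd d' (f q)) *v n q d'))" using d(3,4) unfolding crosses_def by blast
 have "w = 1 *\<^sub>R Lam d' (f q) (J0 (axis 3 1))"
  by (rule vector_derivative_unique_at[OF w(1) vertical_line_derivative(1)[OF f_carrier[OF q] d(3,4)]])
 thus ?thesis using w(2) by simp
qed

lemma mean_convex_upward:
 assumes mc: "mean_convex_side X S f Co" and H: "0 < H"
  and nH: "\<And>cs d p. cs \<in> charts S \<Longrightarrow> d \<in> C \<Longrightarrow> p \<in> fst cs \<Longrightarrow> f p \<in> fst d \<Longrightarrow> mean_curvature_at X f cs d p (n p d) = H"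
  and q: "q \<in> SS" and cr: "crosses q \<omega> \<sigma>" "0 < \<sigma>"
 shows "\<forall>\<^sub>F \<tau> in at_right 0. \<omega> \<tau> \<in> Co"
proof -
 obtain cs d where cs: "cs \<in> charts S" "q \<in> fst cs" and d: "d \<in> C" "f q \<in> fst d" by (rule charts_at[OF q])
 have "\<forall>\<^sub>F t in at_right 0. chart_inv d (snd d (f q) + (t * mean_curvature_at X f cs d q (n q d)) *\<^sub>R n q d) \<in> Co"
  using mc cs d normal_unit[OF cs(1) d(1) cs(2) d(2)] unfolding mean_convex_side_def by blast
 hence "\<forall>\<^sub>F t in at_right 0. nray d q (H * t) \<in> Co" using nH[OF cs(1) d(1) cs(2) d(2)] by (simp add: nray_def mult.commute)
 moreover have "crosses q (\<lambda>t. nray d q (H * t)) H" using nray_crosses[OF q d] H by simp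
 ultimately show ?thesis
  using crossing_curves_meet[OF q _ cr(1), of _ H Co] mc H cr(2) unfolding mean_convex_side_def by simp
qed

lemma component_absorbs:
 assumes Co: "Co \<in> connected_components_of (subtopology T (topspace T - f ` SS))"
  and Z: "connectedin T Z" "Z \<inter> f ` SS = {}" "Z \<inter> Co \<noteq> {}"
 shows "Z \<subseteq> Co"
proof -
 have "connectedin (subtopology T (topspace T - f ` SS)) Z"
  using Z connectedin_subset_topspace[OF Z(1)] by (auto simp: connectedin_subtopology)
 thus ?thesis using connected_components_of_maximal[OF Co] Z(3) by (auto simp: disjnt_def)
qed

lemma connectedin_Th: "a \<in> carrier X \<Longrightarrow> convex W \<Longrightarrow> connectedin T (Th a ` W)"
 by (rule connectedin_continuous_map_image[OF Th_continuous]) (simp_all add: convex_connected)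

text \<open>At a point where the surface is seen from a plane in the component, the mean curvature vector points downwards,
 since otherwise the component would lie on both sides of the surface.\<close>

lemma component_step:
 assumes sc: "simply_connected_space T" and HS: "H_surface X S f H" and H: "0 < H"
  and nH: "\<And>cs d p. cs \<in> charts S \<Longrightarrow> d \<in> C \<Longrightarrow> p \<in> fst cs \<Longrightarrow> f p \<in> fst d \<Longrightarrow> mean_curvature_at X f cs d p (n p d) = H"
  and tr: "\<bar>trA\<bar> \<le> 2 * H" and mc: "mean_convex_side X S f Co" and a: "a \<in> carrier X" and pl: "a <# N \<subseteq> Co"
  and not_leaf: "\<not> (inj_on f SS \<and> (\<exists>b\<in>carrier X. f ` SS = b <# N) \<and> 2 * H = \<bar>trA\<bar>)"
  and t: "0 \<le> t" "t < eps"
 shows "(a \<otimes> c t) <# N \<subseteq> Co"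
proof -
 have Co: "Co \<in> connected_components_of (subtopology T (topspace T - f ` SS))"
  using mc unfolding mean_convex_side_def by blast
 have CoD: "Co \<inter> f ` SS = {}" using connected_components_of_subset[OF Co] by auto
 define \<beta> where "\<beta> q d = vert d (f q) \<bullet> (metric X d (snd d (f q)) *v n q d)" for q d
 have below: "\<beta> q d \<le> 0" if q: "q \<in> SS" "f q = Th a y" "0 < y $ 3"
  "\<And>t. 0 \<le> t \<Longrightarrow> t < y $ 3 \<Longrightarrow> Th a (pt (hor y) t) \<notin> f ` SS" and d: "d \<in> C" "f q \<in> fst d" for q y d
 proof (rule ccontr)
  assume "\<not> \<beta> q d \<le> 0"
  hence cr: "crosses q (\<lambda>t. f q \<otimes> c (- 1 * t)) (- 1)" "crosses q (\<lambda>t. f q \<otimes> c (1 * t)) 1"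
   unfolding \<beta>_def by (intro vertical_crosses[OF q(1) d]; simp)+
  let ?Z = "Th a ` (\<lambda>t. pt (hor y) t) ` {0..<y $ 3}"
  have "convex ((\<lambda>t. pt (hor y) t) ` {0..<y $ 3})"
  proof -
   have e: "(\<lambda>t. pt (hor y) t) ` {0..<y $ 3} = (\<lambda>t. pt (hor y) 0 + t *\<^sub>R pt 0 1) ` {0..<y $ 3}"
    by (rule image_cong[OF refl pt_add_axis])
   have "convex ((\<lambda>x. pt (hor y) 0 + x) ` (\<lambda>t. t *\<^sub>R pt 0 1 :: real ^ 3) ` {0..<y $ 3})"
    by (intro convex_translation convex_linear_image) (auto intro!: linearI simp: algebra_simps)
   thus ?thesis unfolding e by (simp only: image_image)
  qed
  from connectedin_Th[OF a this] have "connectedin T ?Z" .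
  moreover have "?Z \<inter> f ` SS = {}"
  proof -
   have "p \<notin> f ` SS" if p: "p \<in> ?Z" for p
   proof -
    obtain t where t: "p = Th a (pt (hor y) t)" "t \<in> {0..<y $ 3}" using p unfolding image_image by (rule imageE)
    have "0 \<le> t" "t < y $ 3" using t(2) by simp_all
    from q(4)[OF this] show ?thesis unfolding t(1) .
   qed
   thus ?thesis by blast
  qed
  moreover have "?Z \<inter> Co \<noteq> {}"
  proof -
   have "Th a (pt (hor y) 0) \<in> a <# N" unfolding plane_eq[OF a] by auto
   moreover have "Th a (pt (hor y) 0) \<in> ?Z" using q(3) by auto
   ultimately show ?thesis using pl by blast
  qed
  ultimately have ZC: "?Z \<subseteq> Co" by (rule component_absorbs[OF Co])
  have "f q \<otimes> c (- 1 * t) \<in> Co" if "0 < t" "t < y $ 3" for t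
  proof -
   have "f q \<otimes> c (- 1 * t) = Th a (pt (hor y) (y $ 3 - t))" using a by (simp add: q(2) Th_def m_assoc flip: c_add)
   thus ?thesis using ZC that by auto
  qed
  hence "\<forall>\<^sub>F t in at_right 0. f q \<otimes> c (- 1 * t) \<in> Co" unfolding eventually_at_right_field using q(3) by blast
  from component_on_one_side[OF sc Co q(1) cr(2) mean_convex_upward[OF mc H nH q(1) cr(2)] cr(1) this]
  show False by simp
 qed
 have good: "good q" if \<beta>: "\<And>d. d \<in> C \<Longrightarrow> f q \<in> fst d \<Longrightarrow> \<beta> q d \<le> 0" for q unfolding good_def
 proof (intro ballI impI allI, elim conjE)
  fix cs d e assume ch: "cs \<in> charts S" "d \<in> C" "q \<in> fst cs" "f q \<in> fst d"
   and e: "unit_normal_at X f cs d q (Lam d (f q) (J0 e))" "e $ 3 > 0"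
  have "Lam d (f q) (J0 e) \<noteq> n q d"
  proof
   assume "Lam d (f q) (J0 e) = n q d"
   hence "\<beta> q d = axis 3 1 \<bullet> e" unfolding \<beta>_def using Lam_J0_isometry[OF ch(2,4), of "axis 3 1" e] by simp
   thus False using \<beta>[OF ch(2,4)] e(2) by (simp add: inner_axis')
  qed
  hence "Lam d (f q) (J0 e) = - n q d" using unit_normal_at_unique[OF ch normal_unit[OF ch] e(1)] by blast
  hence "mean_curvature_at X f cs d q (Lam d (f q) (J0 e)) = - H"
   using nH[OF ch] by (simp add: mean_curvature_at_def mean_curvature_uminus)
  thus "2 * mean_curvature_at X f cs d q (Lam d (f q) (J0 e)) \<le> - trA" using tr by simp
 qed
 have miss: "Th a y \<notin> f ` SS" if y: "0 \<le> y $ 3" "y $ 3 < eps" for y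
 proof (rule slab_step[OF HS _ proper a _ _ _ not_leaf y])
  show "0 \<le> H" using H by simp
  show "f ` SS \<inter> (a <# N) = {}" using pl CoD by blast
  show "good q" if "q \<in> SS" "f q = Th a y" "y \<in> Slab" "0 < y $ 3"
   "\<And>t. 0 \<le> t \<Longrightarrow> t < y $ 3 \<Longrightarrow> Th a (pt (hor y) t) \<notin> f ` SS" for q y by (rule good, rule below[OF that(1,2,4,5)])
  fix q y assume q: "q \<in> SS" "f q = Th a y" "y \<in> Slab" "0 < y $ 3"
   and seg: "\<And>t. 0 \<le> t \<Longrightarrow> t < y $ 3 \<Longrightarrow> Th a (pt (hor y) t) \<notin> f ` SS"
   and vert: "\<And>cs d. cs \<in> charts S \<Longrightarrow> d \<in> C \<Longrightarrow> q \<in> fst cs \<Longrightarrow> f q \<in> fst d \<Longrightarrow>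
      unit_normal_at X f cs d q (vert d (f q))"
  obtain cs d where cs: "cs \<in> charts S" "q \<in> fst cs" and d: "d \<in> C" "f q \<in> fst d" by (rule charts_at[OF q(1)])
  note ch = cs(1) d(1) cs(2) d(2)
  have "\<beta> q d = 1 \<or> \<beta> q d = - 1" using unit_normal_at_unique[OF ch normal_unit[OF ch] vert[OF ch]] normal_norm[OF ch]
   unfolding \<beta>_def by auto
  hence neg: "\<beta> q d < 0" using below[OF q(1,2,4) seg d] by auto
  let ?R = "{q' \<in> SS. f q' \<in> fst d \<inter> Th a ` Slab}"
  have oR: "openin (pts S) ?R"
   by (rule openin_continuous_map_preimage[OF f_continuous]) (intro openin_Int chart_openin[OF mfd d(1)] openin_slab[OF a])
  let ?\<theta> = "Thc a d" and ?V = "{y \<in> UNIV. Th a y \<in> fst d}"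
  define v where "v q' = fder ?\<theta> (co a (f q')) (axis 3 1)" for q'
  have v: "v q' = Lam d (f q') (J0 (axis 3 1))" if "q' \<in> ?R" for q'
   using frechet_Th[OF a d(1), of "co a (f q')" "axis 3 1"] Th_co[of "f q'" a] that by (simp add: v_def frm_axis_3)
  have "continuous_map (subtopology (pts S) ?R) euclidean v"
  proof -
   have "continuous_map (subtopology (pts S) ?R) (subtopology T (Th a ` Slab)) f"
    using f_continuous by (auto simp: continuous_map_in_subtopology continuous_map_from_subtopology)
   from continuous_map_compose[OF this co_continuous[OF a]]
   have "continuous_map (subtopology (pts S) ?R) euclidean (\<lambda>q'. co a (f q'))" by (simp add: o_def)
   hence 1: "continuous_map (subtopology (pts S) ?R) (top_of_set ?V) (\<lambda>q'. co a (f q'))"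
    using Th_co by (auto simp: continuous_map_in_subtopology)
   have "Ck_on (Suc 0) ?V ?\<theta>" using smooth_intoD(4)[OF Th_smooth[OF a] d(1)] by blast
   hence "continuous_on ?V (\<lambda>y. fder ?\<theta> y (axis 3 1))" by simp
   hence "continuous_map (top_of_set ?V) euclidean (\<lambda>y. fder ?\<theta> y (axis 3 1))" by simp
   from continuous_map_compose[OF 1 this] show ?thesis by (simp add: v_def[abs_def] o_def)
  qed
  hence ct: "continuous_map (subtopology (pts S) ?R) euclidean (\<lambda>q'. v q' \<bullet> (metric X d (snd d (f q')) *v n q' d))"
   by (intro normal_product_continuous[OF d(1)]) auto
  let ?Q = "{q' \<in> topspace (subtopology (pts S) ?R). v q' \<bullet> (metric X d (snd d (f q')) *v n q' d) \<in> {..<0}}"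
  have "openin (subtopology (pts S) ?R) ?Q" by (rule openin_continuous_map_preimage[OF ct]) simp
  hence "openin (pts S) ?Q" by (rule openin_trans_full[OF _ oR])
  moreover have "q \<in> ?Q"
  proof -
   have "q \<in> ?R" using q d(2) by auto
   thus ?thesis using neg v[of q] by (simp add: \<beta>_def)
  qed
  moreover have "good q'" if q': "q' \<in> ?Q" for q'
  proof (rule good)
   fix d' assume d': "d' \<in> C" "f q' \<in> fst d'"
   have R: "q' \<in> ?R" "v q' \<bullet> (metric X d (snd d (f q')) *v n q' d) < 0" using q' by auto
   have "\<beta> q' d' < 0" unfolding \<beta>_def by (rule vertical_sign_chart_independent[OF _ d(1) _ d']) (use R v[OF R(1)] in auto)
   thus "\<beta> q' d' \<le> 0" by simp
  qed
  ultimately show "\<exists>Q. openin (pts S) Q \<and> q \<in> Q \<and> (\<forall>q'\<in>Q. good q')" by blast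
 qed
 let ?W = "{y :: real ^ 3. 0 \<le> y $ 3} \<inter> {y. y $ 3 < eps}"
 have "convex ?W" using convex_halfspace_ge[of 0 "axis 3 1 :: real ^ 3"] convex_halfspace_lt[of "axis 3 1 :: real ^ 3" eps]
  by (intro convex_Int) (simp_all add: inner_axis')
 from connectedin_Th[OF a this] have "connectedin T (Th a ` ?W)" .
 moreover have "Th a ` ?W \<inter> f ` SS = {}" using miss by auto
 moreover have "Th a ` ?W \<inter> Co \<noteq> {}"
 proof -
  have "Th a 0 \<in> a <# N" unfolding plane_eq[OF a] by (rule imageI) simp
  moreover have "Th a 0 \<in> Th a ` ?W" using eps(1) by (intro imageI) simp
  ultimately show ?thesis using pl by blast
 qed
 ultimately have "Th a ` ?W \<subseteq> Co" by (rule component_absorbs[OF Co])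
 thus ?thesis using t unfolding plane_image[OF a, symmetric] by auto
qed

lemma component_above_plane:
 assumes mc: "mean_convex_side X S f Co" and H: "0 < H"
  and nH: "\<And>cs d p. cs \<in> charts S \<Longrightarrow> d \<in> C \<Longrightarrow> p \<in> fst cs \<Longrightarrow> f p \<in> fst d \<Longrightarrow> mean_curvature_at X f cs d p (n p d) = H"
  and a: "a \<in> carrier X" and pl: "f ` SS = a <# N" and tr: "trA = - 2 * H"
 shows "Co \<subseteq> Th a ` {y. 0 < y $ 3}"
proof -
 let ?V = "Th a ` {y. 0 < y $ 3}"
 have Co: "Co \<in> connected_components_of (subtopology T (topspace T - f ` SS))"
  using mc unfolding mean_convex_side_def by blast
 have CoD: "Co \<subseteq> topspace T" "Co \<inter> (a <# N) = {}" using connected_components_of_subset[OF Co] pl by auto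
 have P: "\<exists>x. f q = Th a (pt x 0)" if "q \<in> SS" for q
 proof -
  have "f q \<in> Th a ` {y. y $ 3 = 0}" using that pl plane_eq[OF a] by blast
  then obtain y where "f q = Th a y" "y $ 3 = 0" by blast
  thus ?thesis using pt_hor[of y] by metis
 qed
 have e0: "\<bar>0\<bar> < eps" using eps(1) by simp
 obtain q where q: "q \<in> SS" using S_nonempty by blast
 then obtain cs d where ch: "cs \<in> charts S" "q \<in> fst cs" "d \<in> C" "f q \<in> fst d" by (rule charts_at)
 note ch = ch(1,3,2,4)
 note pc = plane_curvature[OF a e0 P ch]
 have "vert d (f q) \<noteq> - n q d"
 proof
  assume "vert d (f q) = - n q d"
  thus False using pc(2) nH[OF ch] tr H by (simp add: mean_curvature_at_def mean_curvature_uminus)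
 qed
 hence "vert d (f q) = n q d" using unit_normal_at_unique[OF ch normal_unit[OF ch] pc(1)] by blast
 hence "vert d (f q) \<bullet> (metric X d (snd d (f q)) *v n q d) = 1" using normal_norm[OF ch] by simp
 hence cr: "crosses q (\<lambda>t. f q \<otimes> c (1 * t)) 1" by (intro vertical_crosses[OF q ch(2,4)]) simp
 have "\<forall>\<^sub>F t in at_right (0::real). 0 < t" by (simp add: eventually_at_right_less)
 from eventually_happens'[OF _ eventually_conj[OF this mean_convex_upward[OF mc H nH q cr]]]
 obtain t where t: "0 < t" "f q \<otimes> c t \<in> Co" using trivial_limit_at_right_real by auto
 obtain x where x: "f q = Th a (pt x 0)" using P[OF q] by blast
 have "f q \<otimes> c t = Th a (pt x t)" using a by (simp add: x Th_def m_assoc)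
 moreover have "Th a (pt x t) \<in> ?V" using t(1) by (intro imageI) simp
 ultimately have meets: "?V \<inter> Co \<noteq> {}" using t(2) by (metis IntI empty_iff)
 have oV: "openin T ?V" by (rule Th_open_map[OF a]) (intro open_Collect_less continuous_intros)
 define Ou where "Ou = \<Union>{W. openin T W \<and> W \<inter> ?V = {}}"
 have oO: "openin T Ou" unfolding Ou_def by (rule openin_Union) blast
 have "x \<in> ?V \<union> Ou" if "x \<in> Co" for x
 proof (rule ccontr)
  assume "x \<notin> ?V \<union> Ou"
  hence xV: "x \<notin> ?V" and near: "\<And>W. openin T W \<Longrightarrow> x \<in> W \<Longrightarrow> W \<inter> ?V \<noteq> {}" unfolding Ou_def by blast+
  have xc: "x \<in> carrier X" using that CoD topspace_T by blast
  have xF: "x \<notin> a <# N" using that CoD by blast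
  have level: "\<exists>y. x = Th a y \<and> \<bar>y $ 3\<bar> < \<eta> \<and> y $ 3 < 0 \<and> (\<exists>s. \<bar>s\<bar> < \<eta> \<and> 0 < y $ 3 + s)" if "\<eta> > 0" for \<eta>
  proof -
   have "x \<in> Th x ` {y. \<bar>y $ 3\<bar> < \<eta>}" using xc that by (intro image_eqI[of _ _ 0]) auto
   from near[OF open_thick_plane[OF xc] this] obtain u y where u: "\<bar>u $ 3\<bar> < \<eta>" "0 < y $ 3" "Th x u = Th a y" by auto
   have "x = Th x u \<otimes> c (- u $ 3) \<otimes> \<phi> (- hor u)" using xc by (simp add: Th_def c_uminus \<phi>_uminus m_assoc)
   also have "\<dots> = Th a y \<otimes> c (- u $ 3) \<otimes> \<phi> (- hor u)" by (simp only: u(3))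
   also have "\<dots> = a \<otimes> \<phi> (hor y) \<otimes> c (y $ 3 - u $ 3) \<otimes> \<phi> (- hor u)"
    using a by (simp add: Th_def m_assoc diff_conv_add_uminus c_add del: add_uminus_conv_diff)
   finally have "x \<in> Th (a \<otimes> c (y $ 3 - u $ 3)) ` {y. y $ 3 = 0}"
   proof -
    assume *: "x = a \<otimes> \<phi> (hor y) \<otimes> c (y $ 3 - u $ 3) \<otimes> \<phi> (- hor u)"
    let ?\<delta> = "y $ 3 - u $ 3"
    have "a \<otimes> \<phi> (hor y) \<otimes> c ?\<delta> = a \<otimes> c ?\<delta> \<otimes> \<phi> (L ?\<delta> (hor y))"
     using a by (simp add: \<phi>_L m_assoc) (metis c_carrier \<phi>_carrier inv_closed l_one m_assoc m_closed r_inv)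
    moreover have "\<phi> (L ?\<delta> (hor y) - hor u) = \<phi> (L ?\<delta> (hor y)) \<otimes> \<phi> (- hor u)"
     using \<phi>_add[of "L ?\<delta> (hor y)" "- hor u"] by simp
    ultimately have "x = Th (a \<otimes> c ?\<delta>) (pt (L ?\<delta> (hor y) - hor u) 0)" using a * by (simp add: Th_def m_assoc)
    thus ?thesis by auto
   qed
   hence "x \<in> Th a ` {w. w $ 3 = y $ 3 - u $ 3}" using plane_image[OF a] plane_eq[of "a \<otimes> c (y $ 3 - u $ 3)"] a by simp
   then obtain w where w: "x = Th a w" "w $ 3 = y $ 3 - u $ 3" by blast
   have "w $ 3 \<noteq> 0" using xF w(1) unfolding plane_eq[OF a] by blast
   moreover have "\<not> 0 < w $ 3" using xV w(1) by blast
   ultimately show ?thesis using w u by (intro exI[of _ w] conjI exI[of _ "u $ 3"]) auto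
  qed
  obtain y where y: "x = Th a y" "\<bar>y $ 3\<bar> < eps" "y $ 3 < 0" using level[OF eps(1)] by blast
  obtain y' s where y': "x = Th a y'" "\<bar>y' $ 3\<bar> < \<bar>y $ 3\<bar>" "y' $ 3 < 0" using level[of "\<bar>y $ 3\<bar>"] y(3) by auto
  have "y' $ 3 - y $ 3 = 0" by (rule eps(2)) (use Th_eq_plane(1)[OF a, of y y'] y y' in auto)
  thus False using y'(2) by simp
 qed
 hence sub: "Co \<subseteq> ?V \<union> Ou" by (rule subsetI)
 have cT: "connectedin T Co" using connectedin_connected_components_of[OF Co] by (simp add: connectedin_subtopology)
 have dj: "?V \<inter> Ou \<inter> Co = {}" unfolding Ou_def by blast
 from connectedinD[OF cT oV oO sub dj meets] have "Ou \<inter> Co = {}" by blast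
 thus ?thesis using sub by blast
qed

end

lemma H_surfaceD:
 assumes "H_surface X S f H" shows "connected_immersed_surface X S f" "0 \<le> H"
 using assms by (auto simp: H_surface_def minimal_surface_def)

context lie_frame
begin

definition leaf :: "('s, 2) manifold \<Rightarrow> ('s \<Rightarrow> 'a) \<Rightarrow> real \<Rightarrow> bool" where
 "leaf S f H \<longleftrightarrow> inj_on f (topspace (pts S)) \<and> (\<exists>b\<in>carrier X. f ` topspace (pts S) = b <# N) \<and> 2 * H = \<bar>trA\<bar>"

lemma frame_surfaceI: "connected_immersed_surface X S f \<Longrightarrow> frame_surface X \<phi> c N S f"
 by (intro frame_surface.intro frame_surface_axioms.intro) unfold_locales

lemma leaf_translate:
 assumes a: "a \<in> carrier X" and l: "leaf S f H" shows "is_left_translate_of X S f (a <# N)"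
proof -
 obtain b where b: "b \<in> carrier X" "f ` topspace (pts S) = b <# N" using l by (auto simp: leaf_def)
 have "(b \<otimes> inv a) <# (a <# N) = (b \<otimes> inv a \<otimes> a) <# N"
  using a b normal_imp_subgroup[OF normal_N] by (intro lcos_m_assoc) (auto dest: subgroup.subset)
 also have "b \<otimes> inv a \<otimes> a = b" using a b by (simp add: m_assoc)
 finally have "f ` topspace (pts S) = (b \<otimes> inv a) <# (a <# N)" using b by simp
 moreover have "b \<otimes> inv a \<in> carrier X" using a b by simp
 ultimately show ?thesis using l by (auto simp: is_left_translate_of_def leaf_def)
qed

lemma plane_trA:
 assumes H: "H_surface X S f H" and a: "a \<in> carrier X" and im: "f ` topspace (pts S) = a <# N"
 shows "2 * H = \<bar>trA\<bar>"
proof -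
 interpret frame_surface X \<phi> c N S f by (rule frame_surfaceI[OF H_surfaceD(1)[OF H]])
 show ?thesis
 proof (rule plane_mean_curvature[OF H H_surfaceD(2)[OF H] a])
  show "\<bar>0\<bar> < eps" using eps(1) by simp
  fix q assume "q \<in> SS"
  hence "f q \<in> Th a ` {y. y $ 3 = 0}" using im plane_eq[OF a] by blast
  then obtain y where "f q = Th a y" "y $ 3 = 0" by blast
  thus "\<exists>x. f q = Th a (pt x 0)" using pt_hor[of y] by metis
 qed
qed

lemma disjoint_step:
 assumes H: "H_surface X S f H" and tr: "2 * H \<le> - trA" and pi: "properly_immersed X S f" and nl: "\<not> leaf S f H"
  and b: "b \<in> carrier X" and dj: "f ` topspace (pts S) \<inter> (b <# N) = {}" and t: "0 \<le> t" "t < eps"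
 shows "f ` topspace (pts S) \<inter> ((b \<otimes> c t) <# N) = {}"
proof -
 interpret frame_surface X \<phi> c N S f by (rule frame_surfaceI[OF H_surfaceD(1)[OF H]])
 have proper: "proper_map (pts S) T f" using pi by (simp add: properly_immersed_def)
 have good: "good q" for q by (rule good_if_mean_curvature_le[OF H tr H_surfaceD(2)[OF H]])
 have miss: "Th b y \<notin> f ` SS" if "0 \<le> y $ 3" "y $ 3 < eps" for y
  by (rule slab_step[OF H H_surfaceD(2)[OF H] proper b dj good _ nl[unfolded leaf_def] that])
   (use good in \<open>auto intro!: exI[of _ SS]\<close>)
 have "p \<notin> f ` SS" if p: "p \<in> Th b ` {y. y $ 3 = t}" for p
 proof -
  obtain y where y: "p = Th b y" "y \<in> {y. y $ 3 = t}" using p by (rule imageE)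
  show ?thesis unfolding y(1) by (rule miss) (use y(2) t in simp_all)
 qed
 thus ?thesis unfolding plane_image[OF b, symmetric] by blast
qed

lemma own_plane: "p \<in> carrier X \<Longrightarrow> p \<in> p <# N"
proof -
 assume p: "p \<in> carrier X"
 have "Th p 0 \<in> Th p ` {y. y $ 3 = 0}" by (rule imageI) simp
 thus ?thesis using p plane_eq[OF p] by simp
qed

lemma spread:
 assumes rev: "lie_frame X \<phi> (\<lambda>t. c (- t)) N" and conn: "connected_space T"
  and a: "a \<in> carrier X" "E (a <# N)"
  and up: "\<And>b t. b \<in> carrier X \<Longrightarrow> E (b <# N) \<Longrightarrow> 0 \<le> t \<Longrightarrow> t < eps \<Longrightarrow> E ((b \<otimes> c t) <# N)"
  and down: "\<And>b t. b \<in> carrier X \<Longrightarrow> E (b <# N) \<Longrightarrow> 0 \<le> t \<Longrightarrow> t < lie_frame.eps X \<phi> (\<lambda>t. c (- t)) N \<Longrightarrow> E ((b \<otimes> c (- t)) <# N)"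
  and b: "b \<in> carrier X"
 shows "E (b <# N)"
proof (rule foliation_induct[OF conn _ a(1), where E = "\<lambda>b. E (b <# N)" and e = "min eps (lie_frame.eps X \<phi> (\<lambda>t. c (- t)) N)"])
 show "0 < min eps (lie_frame.eps X \<phi> (\<lambda>t. c (- t)) N)" using eps(1) lie_frame.eps(1)[OF rev] by simp
 show "E ((b \<otimes> h) <# N)" if "b \<in> carrier X" "E (b <# N)" "h \<in> N" for b h using that by (simp add: coset_absorb)
 show "E ((b \<otimes> c t) <# N)" if "b \<in> carrier X" "E (b <# N)" "\<bar>t\<bar> < min eps (lie_frame.eps X \<phi> (\<lambda>t. c (- t)) N)" for b t
  using up[OF that(1,2), of t] down[OF that(1,2), of "- t"] that(3) by (cases "0 \<le> t") auto
qed (use a b in auto)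

lemma minimal_case:
 assumes rev: "lie_frame X \<phi> (\<lambda>t. c (- t)) N" and conn: "connected_space T"
  and tr: "trA = 0" and a: "a \<in> carrier X"
  and S: "minimal_surface X S f" "properly_immersed X S f" "f ` topspace (pts S) \<inter> (a <# N) = {}"
 shows "leaf S f 0"
proof (rule ccontr)
 assume nl: "\<not> leaf S f 0"
 interpret rev: lie_frame X \<phi> "\<lambda>t. c (- t)" N by (rule rev)
 have H: "H_surface X S f 0" using S(1) by (simp add: H_surface_def)
 interpret frame_surface X \<phi> c N S f by (rule frame_surfaceI[OF H_surfaceD(1)[OF H]])
 have tr': "rev.trA = 0" using reversed_trA[OF rev] tr by simp
 have nl': "\<not> rev.leaf S f 0" using nl tr tr' by (simp add: leaf_def rev.leaf_def)
 obtain q where q: "q \<in> SS" using S_nonempty by blast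
 have "f ` SS \<inter> (f q <# N) = {}"
 proof (rule spread[OF rev conn a, where E = "\<lambda>P. f ` SS \<inter> P = {}"])
  show "f ` SS \<inter> ((b \<otimes> c t) <# N) = {}" if "b \<in> carrier X" "f ` SS \<inter> (b <# N) = {}" "0 \<le> t" "t < eps" for b t
   using disjoint_step[OF H _ S(2) nl that] tr by simp
  show "f ` SS \<inter> ((b \<otimes> c (- t)) <# N) = {}" if "b \<in> carrier X" "f ` SS \<inter> (b <# N) = {}" "0 \<le> t" "t < rev.eps" for b t
   using rev.disjoint_step[OF H _ S(2) nl' that] tr' by simp
 qed (use S(3) f_carrier[OF q] in auto)
 thus False using own_plane[OF f_carrier[OF q]] q by blast
qed

lemma mean_convex_side_case:
 assumes tr: "trA = - 2 * h" and h: "0 < h" and a: "a \<in> carrier X"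
  and M: "H_surface X M \<iota> h" "properly_embedded X M \<iota>" "\<iota> ` topspace (pts M) = a <# N"
  and S: "H_surface X S f H" "H \<le> h" "properly_immersed X S f"
  and Co: "mean_convex_side X M \<iota> Co" "f ` topspace (pts S) \<subseteq> Co"
 shows "leaf S f H"
proof (rule ccontr)
 assume nl: "\<not> leaf S f H"
 obtain n where n: "unit_normal_field X M \<iota> n"
  "\<And>cs d p. cs \<in> charts M \<Longrightarrow> d \<in> C \<Longrightarrow> p \<in> fst cs \<Longrightarrow> \<iota> p \<in> fst d \<Longrightarrow> mean_curvature_at X \<iota> cs d p (n p d) = h"
  using M(1) h unfolding H_surface_def by auto
 interpret M: oriented_surface X \<phi> c N M \<iota> n using frame_surfaceI[OF H_surfaceD(1)[OF M(1)]] n(1) M(2)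
  by (intro oriented_surface.intro oriented_surface_axioms.intro) (auto simp: properly_embedded_def properly_immersed_def)
 interpret frame_surface X \<phi> c N S f by (rule frame_surfaceI[OF H_surfaceD(1)[OF S(1)]])
 have above: "Co \<subseteq> Th a ` {y. 0 < y $ 3}" by (rule M.component_above_plane[OF Co(1) h n(2) a M(3) tr])
 have "Co \<inter> (a <# N) = {}" using Co(1) connected_components_of_subset unfolding mean_convex_side_def M(3) by fastforce
 hence dj: "f ` SS \<inter> (a <# N) = {}" using Co(2) by blast
 obtain q where q: "q \<in> SS" using S_nonempty by blast
 hence "f q \<in> Th a ` {y. 0 < y $ 3}" using above Co(2) by blast
 then obtain y where y: "f q = Th a y" "0 < y $ 3" by blast
 have "f ` SS \<inter> ((a \<otimes> c (y $ 3)) <# N) = {}"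
 proof (rule upward_induct[OF a, where E = "\<lambda>b. f ` SS \<inter> (b <# N) = {}" and e = eps])
  show "f ` SS \<inter> ((b \<otimes> c t) <# N) = {}" if "b \<in> carrier X" "f ` SS \<inter> (b <# N) = {}" "0 \<le> t" "t < eps" for b t
   by (rule disjoint_step[OF S(1) _ S(3) nl that]) (use tr S(2) in simp)
 qed (use dj eps(1) y in auto)
 moreover have "f q \<in> (a \<otimes> c (y $ 3)) <# N" unfolding plane_image[OF a, symmetric] using y by blast
 ultimately show False using q by blast
qed

lemma convex_hull_side_case:
 assumes rev: "lie_frame X \<phi> (\<lambda>t. c (- t)) N" and sc: "simply_connected_space T"
  and tr: "\<bar>trA\<bar> \<le> 2 * H" and H: "0 < H" and a: "a \<in> carrier X"
  and S: "H_surface X S f H" "properly_embedded X S f" and Co: "mean_convex_side X S f Co" "a <# N \<subseteq> Co"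
 shows "leaf S f H"
proof (rule ccontr)
 assume nl: "\<not> leaf S f H"
 interpret rev: lie_frame X \<phi> "\<lambda>t. c (- t)" N by (rule rev)
 have tr': "\<bar>rev.trA\<bar> = \<bar>trA\<bar>" using reversed_trA[OF rev] by simp
 have nl': "\<not> rev.leaf S f H" using nl tr' by (simp add: leaf_def rev.leaf_def)
 have tr2: "\<bar>rev.trA\<bar> \<le> 2 * H" using tr tr' by simp
 obtain n where nH: "unit_normal_field X S f n"
  "\<And>cs d p. cs \<in> charts S \<Longrightarrow> d \<in> C \<Longrightarrow> p \<in> fst cs \<Longrightarrow> f p \<in> fst d \<Longrightarrow> mean_curvature_at X f cs d p (n p d) = H"
  using S(1) H unfolding H_surface_def by auto
 interpret oriented_surface X \<phi> c N S f n using frame_surfaceI[OF H_surfaceD(1)[OF S(1)]] nH(1) S(2)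
  by (intro oriented_surface.intro oriented_surface_axioms.intro) (auto simp: properly_embedded_def properly_immersed_def)
 interpret r: oriented_surface X \<phi> "\<lambda>t. c (- t)" N S f n using rev.frame_surfaceI[OF H_surfaceD(1)[OF S(1)]] nH(1) S(2)
  by (intro oriented_surface.intro oriented_surface_axioms.intro) (auto simp: properly_embedded_def properly_immersed_def)
 obtain q where q: "q \<in> SS" using S_nonempty by blast
 have "f q <# N \<subseteq> Co"
 proof (rule spread[OF rev simply_connected_imp_connected[OF sc] a, where E = "\<lambda>P. P \<subseteq> Co"])
  show "(b \<otimes> c t) <# N \<subseteq> Co" if "b \<in> carrier X" "b <# N \<subseteq> Co" "0 \<le> t" "t < eps" for b t
   by (rule component_step[OF sc S(1) H nH(2) tr Co(1) that(1,2) nl[unfolded leaf_def] that(3,4)])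
  show "(b \<otimes> c (- t)) <# N \<subseteq> Co" if "b \<in> carrier X" "b <# N \<subseteq> Co" "0 \<le> t" "t < rev.eps" for b t
   by (rule r.component_step[OF sc S(1) H nH(2) tr2 Co(1) that(1,2) nl'[unfolded rev.leaf_def] that(3,4)])
 qed (use Co(2) f_carrier[OF q] in auto)
 hence "f q \<in> Co" using own_plane[OF f_carrier[OF q]] by blast
 thus False using Co(1) connected_components_of_subset q unfolding mean_convex_side_def by fastforce
qed

end

theorem theorem1p1:
  fixes X :: "('a, 3) metric_group"
    and F :: "'a set"
    and M :: "('m, 2) manifold" and \<iota> :: "'m \<Rightarrow> 'a"
  assumes X: "metric_lie_group X" "simply_connected_space (pts (mfd X))"
    and F_translate: "\<exists>N a. normal_R2_subgroup X N \<and> a \<in> carrier X \<and> F = a <#\<^bsub>X\<^esub> N"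
    and F_surface: "properly_embedded X M \<iota>" "\<iota> ` topspace (pts M) = F"
    and F_mean_curvature: "H_surface X M \<iota> (critical_value X)"
  shows
    "(critical_value X = 0 \<longrightarrow>
        (\<forall>(S :: ('s, 2) manifold) f.
           minimal_surface X S f \<and> properly_immersed X S f \<and> f ` topspace (pts S) \<inter> F = {} \<longrightarrow>
           is_left_translate_of X S f F)) \<and>
     (critical_value X > 0 \<longrightarrow>
        (\<forall>H \<in> {0..critical_value X}. \<forall>(S :: ('s, 2) manifold) f C.
           H_surface X S f H \<and> properly_immersed X S f \<and>
           mean_convex_side X M \<iota> C \<and> f ` topspace (pts S) \<subseteq> C \<longrightarrow>
           is_left_translate_of X S f F \<and> H = critical_value X)) \<and>
     (critical_value X > 0 \<longrightarrow>
        (\<forall>H \<in> {critical_value X..}. \<forall>(S :: ('s, 2) manifold) f C.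
           H_surface X S f H \<and> properly_embedded X S f \<and>
           mean_convex_side X S f C \<and> F \<subseteq> C \<longrightarrow>
           is_left_translate_of X S f F \<and> H = critical_value X))"
proof -
 obtain N a where N: "normal_R2_subgroup X N" and a: "a \<in> carrier X" and F: "F = a <#\<^bsub>X\<^esub> N" using F_translate by blast
 interpret metric_lie X by (rule metric_lie.intro[OF X(1)])
 obtain \<phi> c where "lie_frame X \<phi> c N" "lie_frame X \<phi> (\<lambda>t. c (- t)) N" using exists_lie_frame[OF N] by blast
 then interpret fr: lie_frame X \<phi> c N + rev: lie_frame X \<phi> "\<lambda>t. c (- t)" N by auto
 note rev = rev.lie_frame_axioms
 have im: "\<iota> ` topspace (pts M) = a <#\<^bsub>X\<^esub> N" using F_surface(2) F by simp
 have tr: "2 * critical_value X = \<bar>fr.trA\<bar>" by (rule fr.plane_trA[OF F_mean_curvature a im])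
 have rtr: "rev.trA = - fr.trA" by (rule fr.reversed_trA[OF rev])
 have res: "is_left_translate_of X S f F \<and> H = critical_value X" if "fr.leaf S f H" for S :: "('s, 2) manifold" and f H
  using fr.leaf_translate[OF a that] that tr F by (simp add: fr.leaf_def)
 have "is_left_translate_of X S f F"
  if "critical_value X = 0" "minimal_surface X S f" "properly_immersed X S f" "f ` topspace (pts S) \<inter> F = {}"
  for S :: "('s, 2) manifold" and f
  using res[OF fr.minimal_case[OF rev simply_connected_imp_connected[OF X(2)] _ a that(2,3)]] that(1,4) tr F by simp
 moreover have "is_left_translate_of X S f F \<and> H = critical_value X"
  if h: "0 < critical_value X" "H \<le> critical_value X" and S: "H_surface X S f H" "properly_immersed X S f"
   "mean_convex_side X M \<iota> Co" "f ` topspace (pts S) \<subseteq> Co"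
  for S :: "('s, 2) manifold" and f H Co
 proof (rule res, cases "fr.trA \<le> 0")
  case True
  show "fr.leaf S f H"
   by (rule fr.mean_convex_side_case[OF _ h(1) a F_mean_curvature F_surface(1) im S(1) h(2) S(2-4)]) (use tr True in simp)
 next
  case False
  have "rev.leaf S f H"
   by (rule rev.mean_convex_side_case[OF _ h(1) a F_mean_curvature F_surface(1) im S(1) h(2) S(2-4)]) (use tr rtr False in simp)
  thus "fr.leaf S f H" using rtr by (simp add: fr.leaf_def rev.leaf_def)
 qed
 moreover have "is_left_translate_of X S f F \<and> H = critical_value X"
  if h: "0 < critical_value X" "critical_value X \<le> H" and S: "H_surface X S f H" "properly_embedded X S f"
   "mean_convex_side X S f Co" "F \<subseteq> Co"
  for S :: "('s, 2) manifold" and f H Co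
  by (rule res[OF fr.convex_hull_side_case[OF rev X(2) _ _ a S(1-3)]]) (use h tr S(4) F in auto)
 ultimately show ?thesis by (auto simp: Ball_def)
qed

end
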